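(* Let $(Y^i,Z^i,K^i)\in S^{2,n}\times H^{2,n}\times A^{2,1}$, $i=1,2$, be two solutions of the mean-field reflected BSDE (MF) with data $(f^i,\xi^i)$ and constraint functional $H$. Assume that for $(f^i,\xi^i)_{i=1,2}$ and $H$ the following three hypotheses hold: Assumption (A), Assumption (SDE), and Condition (U). Put $\mu^i_s=[Y^i_s]$, $\nu^i_s=[(Y^i_s,Z^i_s)]$, $\Delta Y=Y^1-Y^2$, $\Delta Z=Z^1-Z^2$, $\Delta\xi=\xi^1-\xi^2$, $\delta f=f^1-f^2$, $\Delta R=R^1-R^2$, where $$R^i_t=\int_0^t\partial_yH(Y^i_s,\mu^i_s)\,dK^i_s+\widetilde{\mathbb E}\Big[\int_0^t\partial_\mu H(\widetilde Y^i_s,\mu^i_s)(Y^i_s)\,d\widetilde K^i_s\Big],\quad i=1,2,$$ and $$I_\delta=\Big(\mathbb E\Big[|\Delta\xi|^2+\int_0^T|\delta f(s,Y^1_s,Z^1_s,\nu^1_s)|^2ds\Big]\Big)^{1/2}.$$ Then there exists a constant $C>0$ depending on $T$ and $L$ such that $$\sup_{0\le t\le T}\mathbb E|\Delta Y_t|^2+\mathbb E\int_0^T|\Delta Z_s|^2ds\le C\,I_\delta^2\qquad\text{and}\qquad\sup_{0\le t\le T}\mathbb E|\Delta R_t|\le C\,I_\delta.$$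
   Context: Notation. Fix $T>0$ and integers $n,d,l\ge1$. $(\Omega,\mathcal F,\mathbb P)$ is the classical Wiener space with a $d$-dimensional standard Brownian motion $B=(B_t)_{0\le t\le T}$ and the filtration $(\mathcal F_t)_{0\le t\le T}$ generated by $B$. $S^{2,n}$ is the set of $\mathbb R^n$-valued continuous adapted processes $Y$ with $\mathbb E[\sup_{t\le T}|Y_t|^2]<\infty$; $H^{2,n}$ is the set of $\mathbb R^{n\times d}$-valued predictable processes $Z$ with $\mathbb E\int_0^T|Z_t|^2dt<\infty$; $A^{2,1}$ is the set of non-decreasing elements of $S^{2,1}$ starting from $0$. $\mathcal P_2(E)$ is the space of probability measures on $E$ with finite second moment, with the 2-Wasserstein distance $W_2$; $[\xi]$ is the law of $\xi$; $\delta_x$ is the Dirac mass at $x$. $\partial_\mu$ denotes the Lions derivative: $h:\mathcal P_2(\mathbb R^n)\to\mathbb R$ is L-differentiable if its lift $X\mapsto h([X])$ to $L^2$ is Fréchet differentiable, with gradient $\partial_\mu h([X])(X)$ at $X$. Mean-field reflected BSDE (MF) with data $(f,\xi)$. A solution is a triple of progressively measurable processes $(Y,Z,K)$ with values in $\mathbb R^n\times\mathbb R^{n\times d}\times\mathbb R$, $K$ continuous non-decreasing with $K_0=0$, such that for all $t\in[0,T]$ $$Y_t=\xi+\int_t^Tf(s,Y_s,Z_s,\nu_s)ds-\int_t^TZ_sdB_s+\int_t^T\partial_yH(Y_s,\mu_s)dK_s+\widetilde{\mathbb E}\Big[\int_t^T\partial_\mu H(\widetilde Y_s,\mu_s)(Y_s)d\widetilde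 K_s\Big],$$ $$H(Y_t,\mu_t)\ge0,\qquad\int_0^TH(Y_s,\mu_s)dK_s=0,$$ where $\mu_s=[Y_s]$, $\nu_s=[(Y_s,Z_s)]$, and $(\widetilde Y,\widetilde K)$ is an independent copy of $(Y,K)$, $\widetilde{\mathbb E}$ being the expectation over the copy only. Assumption (A) on $(f,H,\xi)$, with constants $L\ge0$ and $0<\beta<M<\infty$. (1) $f:\Omega\times[0,T]\times\mathbb R^n\times\mathbb R^{n\times d}\times\mathcal P_2(\mathbb R^n\times\mathbb R^{n\times d})\to\mathbb R^n$; the process $(f(t,0,0,\delta_0))_{0\le t\le T}$ is progressively measurable with $\mathbb E\int_0^T|f(t,0,0,\delta_0)|^4dt<\infty$; and $|f(t,y_1,z_1,\nu_1)-f(t,y_2,z_2,\nu_2)|\le L(|y_1-y_2|+|z_1-z_2|+W_2(\nu_1,\nu_2))$ for all arguments. (2) $H:\mathbb R^n\times\mathcal P_2(\mathbb R^n)\to\mathbb R$ satisfies: (a) $y\mapsto H(y,\mu)$ is twice continuously differentiable for every $\mu$, and $\partial_yH,\partial^2_{yy}H$ are jointly continuous in $(y,\mu)$; (b) $\mu\mapsto H(y,\mu)$ is continuously L-differentiable for every $y$, with a version of $v\mapsto\partial_\mu H(y,\mu)(v)$ such that $\partial_\mu H$ is jointly continuous in $(y,\mu,v)$; (c) for this version, $v\mapsto\partial_\mu H(y,\mu)(v)$ is continuously differentiable, with derivative $\partial_v\partial_\mu H(y,\mu)(v)\in\mathbb R^{n\times n}$ jointly continuous in $(y,\mu,v)$;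 (d) for all $(y,\mu,v)$: $|\partial_yH(y,\mu)|\ge\beta$ and $|\partial_yH(y,\mu)|+|\partial^2_{yy}H(y,\mu)|+|\partial_\mu H(y,\mu)(v)|+|\partial_v\partial_\mu H(y,\mu)(v)|\le M$; (e) for all $y\in\mathbb R^n$, $\mu_1,\mu_2\in\mathcal P_2(\mathbb R^n)$, $Y_1,Y_2\in L^2(\Omega,\mathbb R^n)$: $|\partial_yH(y,\mu_1)-\partial_yH(y,\mu_2)|\le L\,W_2(\mu_1,\mu_2)$ and $\mathbb E|\partial_\mu H(y,[Y_1])(Y_1)-\partial_\mu H(y,[Y_2])(Y_2)|^2\le L\,\mathbb E|Y_1-Y_2|^2$; (f) for all $y_1,y_2,v\in\mathbb R^n$ and $\mu_1,\mu_2\in\mathcal P_2(\mathbb R^n)$: $\partial_yH(v,\mu_1)\cdot\partial_\mu H(y_2,\mu_2)(v)\ge0$ and $\partial_\mu H(y_1,\mu_1)(v)\cdot\partial_\mu H(y_2,\mu_2)(v)\ge0$; (g) $H$ is concave: $H(y_2,\mu_2)-H(y_1,\mu_1)\le\partial_yH(y_1,\mu_1)\cdot(y_2-y_1)+\mathbb E[\partial_\mu H(y_1,\mu_1)(Y_1)\cdot(Y_2-Y_1)]$ for all $(y_i,\mu_i)$ and all square-integrable $Y_1,Y_2$ with laws $\mu_1,\mu_2$. (3) $\xi$ is $\mathcal F_T$-measurable, $\mathbb E|\xi|^4<\infty$ and $H(\xi,[\xi])\ge0$. Assumption (SDE) on the data. The data are of Markovian type (with scalar $Y$, i.e. $n=1$):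 the terminal value is $\xi=g(X_T,[X_T])$ and the driver, at time $s$, is $f(s,X_s,y,[X_s],\mu)$, where $\mu$ is the law of the $Y$ variable (the first marginal of $\nu$), with no dependence on $z$; here $X$ is the solution of a forward SDE $dX_s=b(s,X_s)ds+\sigma(s,X_s)dB_s$ from a given initial condition. The coefficients satisfy: (i) $b:\Omega\times[0,T]\times\mathbb R^l\to\mathbb R^l$ and $\sigma:\Omega\times[0,T]\times\mathbb R^l\to\mathbb R^{l\times d}$ are progressively measurable, and for all $s\in[0,T]$, $x_1,x_2\in\mathbb R^l$: $|b(s,x_1)-b(s,x_2)|+|\sigma(s,x_1)-\sigma(s,x_2)|\le L|x_1-x_2|$ and $|b(s,0)|+|\sigma(s,0)|\le L$; (ii) $f:[0,T]\times\mathbb R^l\times\mathbb R\times\mathcal P_2(\mathbb R^l)\times\mathcal P_2(\mathbb R)\to\mathbb R$ satisfies, for some $L>0$ and all arguments, $|f(t,x,0,\lambda,\delta_0)|\le L(1+|x|+W_2(\lambda,\delta_0))$ and $|f(t,x_1,y_1,\lambda_1,\mu_1)-f(t,x_2,y_2,\lambda_2,\mu_2)|\le L(|x_1-x_2|+|y_1-y_2|+W_2(\lambda_1,\lambda_2)+W_2(\mu_1,\mu_2))$; (iii) $g:\mathbb R^l\times\mathcal P_2(\mathbb R^l)\to\mathbb R$ satisfies $|g(x_1,\lambda_1)-g(x_2,\lambda_2)|\le L(|x_1-x_2|+W_2(\lambda_1,\lambda_2))$ for all $x_1,x_2\in\mathbb R^l$, $\lambda_1,\lambda_2\in\mathcal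 P_2(\mathbb R^l)$. Condition (U) on $H$. There is a constant $\epsilon_0>0$ such that $\left|\mathbb E_{X\sim\mu}[\partial_\mu H(y,\mu)(X)]\right|\le(1-\epsilon_0)\,|\partial_yH(y,\mu)|$ for all $(y,\mu)\in\mathbb R^n\times\mathcal P_2(\mathbb R^n)$. *)

theory Defs
  imports "HOL-Probability.Probability"
begin

text \<open>
  Conventions. A process is a function \<open>X t \<omega>\<close> of time and scenario, relevant only for
  \<open>0 \<le> t \<le> T\<close>. The state space \<open>\<real>\<^sup>n\<close> is an arbitrary Euclidean space \<open>'y\<close>
  (\<open>n = 1\<close> is \<open>'y = real\<close>). An \<open>n \<times> d\<close> matrix is an element of \<open>'y ^ 'd\<close>, i.e. the
  family of its \<open>d\<close> columns; its norm is the Frobenius norm.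
  Path properties (continuity, monotonicity, the equations) are required almost surely.
\<close>


section \<open>Measures with finite second moment, Wasserstein distance, Lions derivative\<close>

abbreviation law :: "'w measure \<Rightarrow> ('w \<Rightarrow> 'a::topological_space) \<Rightarrow> 'a measure" where
  "law P X \<equiv> distr P borel X"

abbreviation dirac :: "'a::topological_space \<Rightarrow> 'a measure" where
  "dirac x \<equiv> return borel x"

definition P2 :: "'a::euclidean_space measure set" where
  "P2 = {\<mu>. prob_space \<mu> \<and> sets \<mu> = sets borel \<and> (\<integral>\<^sup>+x. ennreal ((norm x)\<^sup>2) \<partial>\<mu>) < \<infinity>}"

definition couplings ::
  "'a::euclidean_space measure \<Rightarrow> 'a measure \<Rightarrow> ('a \<times> 'a) measure set" where
  "couplings \<mu> \<nu> = {\<pi>. prob_space \<pi> \<and> sets \<pi> = sets borel \<and>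
     distr \<pi> borel fst = \<mu> \<and> distr \<pi> borel snd = \<nu>}"

text \<open>The infimum is finite whenever both measures are in \<open>P2\<close>.\<close>

definition W2 :: "'a::euclidean_space measure \<Rightarrow> 'a measure \<Rightarrow> real" where
  "W2 \<mu> \<nu> =
     sqrt (enn2real (INF \<pi>\<in>couplings \<mu> \<nu>. \<integral>\<^sup>+p. ennreal ((norm (fst p - snd p))\<^sup>2) \<partial>\<pi>))"

text \<open>Continuity in a vector argument and a measure in \<open>P2\<close> jointly, the latter metrised by \<open>W2\<close>.\<close>

definition jointly_continuous ::
  "('a::metric_space \<Rightarrow> 'b::euclidean_space measure \<Rightarrow> 'c::metric_space) \<Rightarrow> bool" where
  "jointly_continuous G \<longleftrightarrow>
     (\<forall>x. \<forall>\<mu>\<in>P2. \<forall>e>0. \<exists>\<delta>>0. \<forall>x'. \<forall>\<mu>'\<in>P2.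
        dist x' x < \<delta> \<and> W2 \<mu>' \<mu> < \<delta> \<longrightarrow> dist (G x' \<mu>') (G x \<mu>) < e)"

definition L2 :: "'w measure \<Rightarrow> ('w \<Rightarrow> 'a::euclidean_space) set" where
  "L2 P = {X. X \<in> borel_measurable P \<and> integrable P (\<lambda>\<omega>. (norm (X \<omega>))\<^sup>2)}"

definition l2norm :: "'w measure \<Rightarrow> ('w \<Rightarrow> 'a::euclidean_space) \<Rightarrow> real" where
  "l2norm P X = sqrt (\<integral>\<omega>. (norm (X \<omega>))\<^sup>2 \<partial>P)"

text \<open>The lift \<open>X \<mapsto> h (law P X)\<close> to \<open>L2 P\<close> is Frechet differentiable at every \<open>X\<close>, with gradient
  \<open>Dh (law P X) \<circ> X\<close>. Thus \<open>Dh\<close> is one version of the Lions derivative: \<open>Dh \<mu>\<close> is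
  determined by this \<open>\<mu>\<close>-almost everywhere.\<close>

definition lions_derivative ::
  "'w measure \<Rightarrow> ('a::euclidean_space measure \<Rightarrow> real) \<Rightarrow> ('a measure \<Rightarrow> 'a \<Rightarrow> 'a) \<Rightarrow> bool" where
  "lions_derivative P h Dh \<longleftrightarrow>
     (\<forall>X\<in>L2 P. (\<lambda>\<omega>. Dh (law P X) (X \<omega>)) \<in> L2 P \<and>
       (\<forall>e>0. \<exists>\<delta>>0. \<forall>V\<in>L2 P. l2norm P V < \<delta> \<longrightarrow>
          \<bar>h (law P (\<lambda>\<omega>. X \<omega> + V \<omega>)) - h (law P X) - (\<integral>\<omega>. Dh (law P X) (X \<omega>) \<bullet> V \<omega> \<partial>P)\<bar>
            \<le> e * l2norm P V))"

definition continuously_lions_differentiable ::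
  "'w measure \<Rightarrow> ('a::euclidean_space measure \<Rightarrow> real) \<Rightarrow> ('a measure \<Rightarrow> 'a \<Rightarrow> 'a) \<Rightarrow> bool" where
  "continuously_lions_differentiable P h Dh \<longleftrightarrow>
     lions_derivative P h Dh \<and>
     (\<forall>X\<in>L2 P. \<forall>e>0. \<exists>\<delta>>0. \<forall>X'\<in>L2 P. l2norm P (\<lambda>\<omega>. X' \<omega> - X \<omega>) < \<delta> \<longrightarrow>
        l2norm P (\<lambda>\<omega>. Dh (law P X') (X' \<omega>) - Dh (law P X) (X \<omega>)) < e)"


section \<open>Classical Wiener space\<close>

definition brownian_motion ::
  "'w measure \<Rightarrow> real \<Rightarrow> (real \<Rightarrow> 'w \<Rightarrow> real ^ 'd::finite) \<Rightarrow> bool" where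
  "brownian_motion P T B \<longleftrightarrow>
     (\<forall>t\<in>{0..T}. B t \<in> borel_measurable P) \<and>
     (\<forall>\<omega>\<in>space P. B 0 \<omega> = 0 \<and> continuous_on {0..T} (\<lambda>t. B t \<omega>)) \<and>
     (\<forall>s t. 0 \<le> s \<and> s < t \<and> t \<le> T \<longrightarrow>
        distributed P lborel (\<lambda>\<omega>. B t \<omega> - B s \<omega>)
          (\<lambda>x. ennreal (\<Prod>j\<in>UNIV. normal_density 0 (sqrt (t - s)) (x $ j)))) \<and>
     (\<forall>m (\<tau> :: nat \<Rightarrow> real). mono_on {..m} \<tau> \<and> \<tau> ` {..m} \<subseteq> {0..T} \<longrightarrow>
        prob_space.indep_vars P (\<lambda>_. borel) (\<lambda>i \<omega>. B (\<tau> (Suc i)) \<omega> - B (\<tau> i) \<omega>) {..<m})"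

definition wiener_paths :: "real \<Rightarrow> (real \<Rightarrow> real ^ 'd::finite) set" where
  "wiener_paths T = {w \<in> extensional {0..T}. continuous_on {0..T} w \<and> w 0 = 0}"

definition coordinate :: "real \<Rightarrow> (real \<Rightarrow> 'b) \<Rightarrow> 'b" where
  "coordinate t w = w t"

text \<open>The sigma-algebra generated by the coordinates is the Borel one of the uniform topology; the
  conditions determine the measure.\<close>

definition wiener_measure :: "real \<Rightarrow> (real \<Rightarrow> real ^ 'd::finite) measure \<Rightarrow> bool" where
  "wiener_measure T W \<longleftrightarrow>
     prob_space W \<and> space W = wiener_paths T \<and>
     sets W = sigma_sets (wiener_paths T)
       {{w \<in> wiener_paths T. w t \<in> A} | t A. t \<in> {0..T} \<and> A \<in> sets borel} \<and>
     brownian_motion W T coordinate"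

text \<open>The natural filtration, augmented by the null sets of \<open>P\<close>.\<close>

definition brownian_filtration ::
  "'w measure \<Rightarrow> (real \<Rightarrow> 'w \<Rightarrow> real ^ 'd::finite) \<Rightarrow> real \<Rightarrow> 'w measure" where
  "brownian_filtration P B t =
     sigma (space P)
       ({B s -` A \<inter> space P | s A. s \<in> {0..t} \<and> A \<in> sets borel} \<union> null_sets P)"


section \<open>Processes\<close>

definition adapted ::
  "real \<Rightarrow> (real \<Rightarrow> 'w measure) \<Rightarrow> (real \<Rightarrow> 'w \<Rightarrow> 'a::topological_space) \<Rightarrow> bool" where
  "adapted T Fil X \<longleftrightarrow> (\<forall>t\<in>{0..T}. X t \<in> borel_measurable (Fil t))"

definition progressive ::
  "real \<Rightarrow> (real \<Rightarrow> 'w measure) \<Rightarrow> (real \<Rightarrow> 'w \<Rightarrow> 'a::topological_space) \<Rightarrow> bool" where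
  "progressive T Fil X \<longleftrightarrow>
     (\<forall>t\<in>{0..T}. (\<lambda>(s, \<omega>). X s \<omega>) \<in> borel_measurable (restrict_space borel {0..t} \<Otimes>\<^sub>M Fil t))"

definition predictable ::
  "real \<Rightarrow> (real \<Rightarrow> 'w measure) \<Rightarrow> (real \<Rightarrow> 'w \<Rightarrow> 'a::topological_space) \<Rightarrow> bool" where
  "predictable T Fil X \<longleftrightarrow>
     (\<lambda>(s, \<omega>). X s \<omega>) \<in> borel_measurable
       (sigma ({0..T} \<times> space (Fil 0))
         ({{0} \<times> A | A. A \<in> sets (Fil 0)} \<union>
          {{s<..t} \<times> A | s t A. 0 \<le> s \<and> s < t \<and> t \<le> T \<and> A \<in> sets (Fil s)}))"

definition S2 ::
  "'w measure \<Rightarrow> real \<Rightarrow> (real \<Rightarrow> 'w measure) \<Rightarrow> (real \<Rightarrow> 'w \<Rightarrow> 'a::euclidean_space) set" where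
  "S2 P T Fil = {Y. adapted T Fil Y \<and> (AE \<omega> in P. continuous_on {0..T} (\<lambda>t. Y t \<omega>)) \<and>
     (\<integral>\<^sup>+\<omega>. (SUP t\<in>{0..T}. ennreal ((norm (Y t \<omega>))\<^sup>2)) \<partial>P) < \<infinity>}"

text \<open>\<open>E \<integral>\<^sub>0\<^sup>T |Z\<^sub>s|\<^sup>p ds\<close>.\<close>

definition time_moment ::
  "'w measure \<Rightarrow> real \<Rightarrow> nat \<Rightarrow> (real \<Rightarrow> 'w \<Rightarrow> 'a::real_normed_vector) \<Rightarrow> ennreal" where
  "time_moment P T p Z = (\<integral>\<^sup>+\<omega>. (\<integral>\<^sup>+s\<in>{0..T}. ennreal ((norm (Z s \<omega>)) ^ p) \<partial>lborel) \<partial>P)"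

definition H2 ::
  "'w measure \<Rightarrow> real \<Rightarrow> (real \<Rightarrow> 'w measure) \<Rightarrow> (real \<Rightarrow> 'w \<Rightarrow> 'a::euclidean_space) set" where
  "H2 P T Fil = {Z. predictable T Fil Z \<and> time_moment P T 2 Z < \<infinity>}"

definition A2 ::
  "'w measure \<Rightarrow> real \<Rightarrow> (real \<Rightarrow> 'w measure) \<Rightarrow> (real \<Rightarrow> 'w \<Rightarrow> real) set" where
  "A2 P T Fil = {K \<in> S2 P T Fil. AE \<omega> in P. mono_on {0..T} (\<lambda>t. K t \<omega>) \<and> K 0 \<omega> = 0}"


section \<open>Ito integral\<close>

definition columns_times :: "'y::real_vector ^ 'd \<Rightarrow> real ^ 'd \<Rightarrow> 'y" where
  "columns_times z b = (\<Sum>j\<in>UNIV. (b $ j) *\<^sub>R (z $ j))"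

text \<open>The triple \<open>(m, \<tau>, \<zeta>)\<close> stands for the process
  \<open>\<Sum>i<m. indicator {\<tau> i<..\<tau> (i + 1)} s *\<^sub>R \<zeta> i \<omega>\<close>.\<close>

definition simple_integrand ::
  "real \<Rightarrow> (real \<Rightarrow> 'w measure) \<Rightarrow> nat \<Rightarrow> (nat \<Rightarrow> real) \<Rightarrow>
     (nat \<Rightarrow> 'w \<Rightarrow> 'b::real_normed_vector) \<Rightarrow> bool" where
  "simple_integrand T Fil m \<tau> \<zeta> \<longleftrightarrow>
     mono_on {..m} \<tau> \<and> \<tau> ` {..m} \<subseteq> {0..T} \<and>
     (\<forall>i<m. \<zeta> i \<in> borel_measurable (Fil (\<tau> i)) \<and> bounded (\<zeta> i ` space (Fil (\<tau> i))))"

definition simple_process ::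
  "nat \<Rightarrow> (nat \<Rightarrow> real) \<Rightarrow> (nat \<Rightarrow> 'w \<Rightarrow> 'b::real_vector) \<Rightarrow> real \<Rightarrow> 'w \<Rightarrow> 'b" where
  "simple_process m \<tau> \<zeta> s \<omega> = (\<Sum>i<m. indicator {\<tau> i<..\<tau> (Suc i)} s *\<^sub>R \<zeta> i \<omega>)"

definition simple_ito_integral ::
  "(real \<Rightarrow> 'w \<Rightarrow> real ^ 'd) \<Rightarrow> nat \<Rightarrow> (nat \<Rightarrow> real) \<Rightarrow>
     (nat \<Rightarrow> 'w \<Rightarrow> 'y::real_vector ^ 'd) \<Rightarrow> real \<Rightarrow> 'w \<Rightarrow> 'y" where
  "simple_ito_integral B m \<tau> \<zeta> t \<omega> =
     (\<Sum>i<m. columns_times (\<zeta> i \<omega>) (B (min (\<tau> (Suc i)) t) \<omega> - B (min (\<tau> i) t) \<omega>))"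

text \<open>\<open>N\<close> is a continuous version of \<open>t \<mapsto> \<integral>\<^sub>0\<^sup>t Z\<^sub>s dB\<^sub>s\<close>, for a square-integrable progressive
  integrand \<open>Z\<close>: the \<open>L\<^sup>2\<close>-limit of integrals of simple processes converging to \<open>Z\<close> in
  \<open>L\<^sup>2(dt \<otimes> P)\<close>. It is unique up to indistinguishability.\<close>

definition ito_integral ::
  "'w measure \<Rightarrow> real \<Rightarrow> (real \<Rightarrow> 'w measure) \<Rightarrow> (real \<Rightarrow> 'w \<Rightarrow> real ^ 'd::finite) \<Rightarrow>
     (real \<Rightarrow> 'w \<Rightarrow> 'y::euclidean_space ^ 'd) \<Rightarrow> (real \<Rightarrow> 'w \<Rightarrow> 'y) \<Rightarrow> bool" where
  "ito_integral P T Fil B Z N \<longleftrightarrow>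
     progressive T Fil Z \<and> adapted T Fil N \<and>
     (AE \<omega> in P. continuous_on {0..T} (\<lambda>t. N t \<omega>)) \<and>
     (\<exists>m \<tau> \<zeta>. (\<forall>k. simple_integrand T Fil (m k) (\<tau> k) (\<zeta> k)) \<and>
        (\<lambda>k. time_moment P T 2 (\<lambda>s \<omega>. simple_process (m k) (\<tau> k) (\<zeta> k) s \<omega> - Z s \<omega>))
           \<longlonglongrightarrow> 0 \<and>
        (\<forall>t\<in>{0..T}.
           (\<lambda>k. \<integral>\<^sup>+\<omega>. ennreal
              ((norm (simple_ito_integral B (m k) (\<tau> k) (\<zeta> k) t \<omega> - N t \<omega>))\<^sup>2) \<partial>P)
           \<longlonglongrightarrow> 0))"


section \<open>The mean-field reflected BSDE\<close>

text \<open>The Stieltjes measure \<open>dk\<close> of a continuous non-decreasing \<open>k\<close> on \<open>[0, T]\<close>, extended by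
  constants outside.\<close>

definition stieltjes :: "real \<Rightarrow> (real \<Rightarrow> real) \<Rightarrow> real measure" where
  "stieltjes T k = interval_measure (\<lambda>s. k (max 0 (min T s)))"

text \<open>\<open>\<integral>\<^sub>a\<^sup>b \<partial>\<^sub>yH(Y\<^sub>s, \<mu>\<^sub>s) dK\<^sub>s + E' \<integral>\<^sub>a\<^sup>b \<partial>\<^sub>\<mu>H(Y'\<^sub>s, \<mu>\<^sub>s)(Y\<^sub>s) dK'\<^sub>s\<close> with \<open>\<mu>\<^sub>s\<close> the law of \<open>Y\<^sub>s\<close>. The
  independent copy \<open>(Y', K')\<close> is realised as \<open>(Y, K)\<close> read on a second coordinate \<open>\<omega>'\<close>.\<close>

definition reflection ::
  "'w measure \<Rightarrow> real \<Rightarrow> ('y::euclidean_space \<Rightarrow> 'y measure \<Rightarrow> 'y) \<Rightarrow>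
     ('y \<Rightarrow> 'y measure \<Rightarrow> 'y \<Rightarrow> 'y) \<Rightarrow> (real \<Rightarrow> 'w \<Rightarrow> 'y) \<Rightarrow> (real \<Rightarrow> 'w \<Rightarrow> real) \<Rightarrow>
     real \<Rightarrow> real \<Rightarrow> 'w \<Rightarrow> 'y" where
  "reflection P T Hy Hmu Y K a b \<omega> =
     (LINT s:{a..b}|stieltjes T (\<lambda>t. K t \<omega>). Hy (Y s \<omega>) (law P (Y s))) +
     (\<integral>\<omega>'. (LINT s:{a..b}|stieltjes T (\<lambda>t. K t \<omega>').
               Hmu (Y s \<omega>') (law P (Y s)) (Y s \<omega>)) \<partial>P)"

text \<open>\<open>f(s, Y\<^sub>s, Z\<^sub>s, \<nu>\<^sub>s)\<close> with \<open>\<nu>\<^sub>s\<close> the law of \<open>(Y\<^sub>s, Z\<^sub>s)\<close>. For a square-integrable \<open>Z\<close>, \<open>\<nu>\<^sub>s\<close> is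
  in \<open>P2\<close> for almost every \<open>s\<close> only; at the remaining times \<open>f\<close> has no meaningful value.\<close>

definition driver_along ::
  "'w measure \<Rightarrow>
     (real \<Rightarrow> 'w \<Rightarrow> 'y::euclidean_space \<Rightarrow> 'y ^ 'd \<Rightarrow> ('y \<times> ('y ^ 'd::finite)) measure \<Rightarrow> 'y) \<Rightarrow>
     (real \<Rightarrow> 'w \<Rightarrow> 'y) \<Rightarrow> (real \<Rightarrow> 'w \<Rightarrow> 'y ^ 'd) \<Rightarrow> real \<Rightarrow> 'w \<Rightarrow> 'y" where
  "driver_along P f Y Z s \<omega> =
     (let \<nu> = law P (\<lambda>\<omega>. (Y s \<omega>, Z s \<omega>)) in if \<nu> \<in> P2 then f s \<omega> (Y s \<omega>) (Z s \<omega>) \<nu> else 0)"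

text \<open>The two conditions on \<open>driver_along\<close> say that the Lebesgue integral in the equation makes
  sense; measurability of \<open>f\<close> is otherwise only assumed for \<open>f(t, 0, 0, \<delta>\<^sub>0)\<close>.\<close>

definition mf_rbsde_solution ::
  "'w measure \<Rightarrow> real \<Rightarrow> (real \<Rightarrow> 'w measure) \<Rightarrow> (real \<Rightarrow> 'w \<Rightarrow> real ^ 'd::finite) \<Rightarrow>
     ('y::euclidean_space \<Rightarrow> 'y measure \<Rightarrow> real) \<Rightarrow> ('y \<Rightarrow> 'y measure \<Rightarrow> 'y) \<Rightarrow>
     ('y \<Rightarrow> 'y measure \<Rightarrow> 'y \<Rightarrow> 'y) \<Rightarrow>
     (real \<Rightarrow> 'w \<Rightarrow> 'y \<Rightarrow> 'y ^ 'd \<Rightarrow> ('y \<times> ('y ^ 'd)) measure \<Rightarrow> 'y) \<Rightarrow> ('w \<Rightarrow> 'y) \<Rightarrow>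
     (real \<Rightarrow> 'w \<Rightarrow> 'y) \<Rightarrow> (real \<Rightarrow> 'w \<Rightarrow> 'y ^ 'd) \<Rightarrow> (real \<Rightarrow> 'w \<Rightarrow> real) \<Rightarrow> bool" where
  "mf_rbsde_solution P T Fil B H Hy Hmu f \<xi> Y Z K \<longleftrightarrow>
     progressive T Fil Y \<and> progressive T Fil Z \<and> progressive T Fil K \<and>
     (AE \<omega> in P. continuous_on {0..T} (\<lambda>t. K t \<omega>) \<and> mono_on {0..T} (\<lambda>t. K t \<omega>) \<and> K 0 \<omega> = 0) \<and>
     progressive T Fil (driver_along P f Y Z) \<and>
     (AE \<omega> in P. set_integrable lborel {0..T} (\<lambda>s. driver_along P f Y Z s \<omega>)) \<and>
     (\<exists>N. ito_integral P T Fil B Z N \<and>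
        (AE \<omega> in P. \<forall>t\<in>{0..T}.
           Y t \<omega> = \<xi> \<omega> + (LINT s:{t..T}|lborel. driver_along P f Y Z s \<omega>)
                   - (N T \<omega> - N t \<omega>) + reflection P T Hy Hmu Y K t T \<omega>)) \<and>
     (AE \<omega> in P. (\<forall>t\<in>{0..T}. 0 \<le> H (Y t \<omega>) (law P (Y t))) \<and>
        (\<integral>\<^sup>+s\<in>{0..T}. ennreal (H (Y s \<omega>) (law P (Y s))) \<partial>stieltjes T (\<lambda>t. K t \<omega>)) = 0)"


section \<open>Standing assumptions\<close>

definition driver_assumption ::
  "'w measure \<Rightarrow> real \<Rightarrow> (real \<Rightarrow> 'w measure) \<Rightarrow> real \<Rightarrow>
     (real \<Rightarrow> 'w \<Rightarrow> 'y::euclidean_space \<Rightarrow> 'y ^ 'd \<Rightarrow> ('y \<times> ('y ^ 'd::finite)) measure \<Rightarrow> 'y) \<Rightarrow>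
     bool" where
  "driver_assumption P T Fil L f \<longleftrightarrow>
     progressive T Fil (\<lambda>t \<omega>. f t \<omega> 0 0 (dirac 0)) \<and>
     time_moment P T 4 (\<lambda>t \<omega>. f t \<omega> 0 0 (dirac 0)) < \<infinity> \<and>
     (\<forall>t\<in>{0..T}. \<forall>\<omega>\<in>space P. \<forall>y1 y2 z1 z2. \<forall>\<nu>1\<in>P2. \<forall>\<nu>2\<in>P2.
        norm (f t \<omega> y1 z1 \<nu>1 - f t \<omega> y2 z2 \<nu>2)
          \<le> L * (norm (y1 - y2) + norm (z1 - z2) + W2 \<nu>1 \<nu>2))"

text \<open>\<open>Hy\<close> and \<open>Hmu\<close> are \<open>\<partial>\<^sub>yH\<close> and the version of \<open>\<partial>\<^sub>\<mu>H\<close>; \<open>Hyy\<close> and \<open>Hvmu\<close> are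
  \<open>\<partial>\<^sup>2\<^sub>y\<^sub>yH\<close> and \<open>\<partial>\<^sub>v\<partial>\<^sub>\<mu>H\<close> as linear maps.\<close>

definition constraint_assumption ::
  "'w measure \<Rightarrow> real \<Rightarrow> real \<Rightarrow> real \<Rightarrow> ('y::euclidean_space \<Rightarrow> 'y measure \<Rightarrow> real) \<Rightarrow>
     ('y \<Rightarrow> 'y measure \<Rightarrow> 'y) \<Rightarrow> ('y \<Rightarrow> 'y measure \<Rightarrow> 'y \<Rightarrow> 'y) \<Rightarrow> bool" where
  "constraint_assumption P L \<beta> M H Hy Hmu \<longleftrightarrow>
     (\<exists>(Hyy :: 'y \<Rightarrow> 'y measure \<Rightarrow> 'y \<Rightarrow>\<^sub>L 'y) (Hvmu :: 'y \<Rightarrow> 'y measure \<Rightarrow> 'y \<Rightarrow> 'y \<Rightarrow>\<^sub>L 'y).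
       (\<forall>y. \<forall>\<mu>\<in>P2. GDERIV (\<lambda>y. H y \<mu>) y :> Hy y \<mu>) \<and>
       (\<forall>y. \<forall>\<mu>\<in>P2. ((\<lambda>y. Hy y \<mu>) has_derivative blinfun_apply (Hyy y \<mu>)) (at y)) \<and>
       jointly_continuous Hy \<and> jointly_continuous Hyy \<and>
       (\<forall>y. continuously_lions_differentiable P (H y) (Hmu y)) \<and>
       jointly_continuous (\<lambda>(y, v) \<mu>. Hmu y \<mu> v) \<and>
       (\<forall>y v. \<forall>\<mu>\<in>P2. (Hmu y \<mu> has_derivative blinfun_apply (Hvmu y \<mu> v)) (at v)) \<and>
       jointly_continuous (\<lambda>(y, v) \<mu>. Hvmu y \<mu> v) \<and>
       (\<forall>y v. \<forall>\<mu>\<in>P2. \<beta> \<le> norm (Hy y \<mu>) \<and>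
          norm (Hy y \<mu>) + norm (Hyy y \<mu>) + norm (Hmu y \<mu> v) + norm (Hvmu y \<mu> v) \<le> M)) \<and>
     (\<forall>y. \<forall>\<mu>1\<in>P2. \<forall>\<mu>2\<in>P2. norm (Hy y \<mu>1 - Hy y \<mu>2) \<le> L * W2 \<mu>1 \<mu>2) \<and>
     (\<forall>y. \<forall>Y1\<in>L2 P. \<forall>Y2\<in>L2 P.
        (\<integral>\<omega>. (norm (Hmu y (law P Y1) (Y1 \<omega>) - Hmu y (law P Y2) (Y2 \<omega>)))\<^sup>2 \<partial>P)
          \<le> L * (\<integral>\<omega>. (norm (Y1 \<omega> - Y2 \<omega>))\<^sup>2 \<partial>P)) \<and>
     (\<forall>y1 y2 v. \<forall>\<mu>1\<in>P2. \<forall>\<mu>2\<in>P2.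
        0 \<le> Hy v \<mu>1 \<bullet> Hmu y2 \<mu>2 v \<and> 0 \<le> Hmu y1 \<mu>1 v \<bullet> Hmu y2 \<mu>2 v) \<and>
     (\<forall>y1 y2. \<forall>Y1\<in>L2 P. \<forall>Y2\<in>L2 P.
        H y2 (law P Y2) - H y1 (law P Y1)
          \<le> Hy y1 (law P Y1) \<bullet> (y2 - y1)
             + (\<integral>\<omega>. Hmu y1 (law P Y1) (Y1 \<omega>) \<bullet> (Y2 \<omega> - Y1 \<omega>) \<partial>P))"

definition terminal_assumption ::
  "'w measure \<Rightarrow> real \<Rightarrow> (real \<Rightarrow> 'w measure) \<Rightarrow> ('y::euclidean_space \<Rightarrow> 'y measure \<Rightarrow> real) \<Rightarrow>
     ('w \<Rightarrow> 'y) \<Rightarrow> bool" where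
  "terminal_assumption P T Fil H \<xi> \<longleftrightarrow>
     \<xi> \<in> borel_measurable (Fil T) \<and> (\<integral>\<^sup>+\<omega>. ennreal ((norm (\<xi> \<omega>)) ^ 4) \<partial>P) < \<infinity> \<and>
     (AE \<omega> in P. 0 \<le> H (\<xi> \<omega>) (law P \<xi>))"

definition assumption_A ::
  "'w measure \<Rightarrow> real \<Rightarrow> (real \<Rightarrow> 'w measure) \<Rightarrow> real \<Rightarrow> real \<Rightarrow> real \<Rightarrow>
     ('y::euclidean_space \<Rightarrow> 'y measure \<Rightarrow> real) \<Rightarrow>
     ('y \<Rightarrow> 'y measure \<Rightarrow> 'y) \<Rightarrow> ('y \<Rightarrow> 'y measure \<Rightarrow> 'y \<Rightarrow> 'y) \<Rightarrow>
     (real \<Rightarrow> 'w \<Rightarrow> 'y \<Rightarrow> 'y ^ 'd \<Rightarrow> ('y \<times> ('y ^ 'd::finite)) measure \<Rightarrow> 'y) \<Rightarrow> ('w \<Rightarrow> 'y) \<Rightarrow> bool"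
  where
  "assumption_A P T Fil L \<beta> M H Hy Hmu f \<xi> \<longleftrightarrow>
     0 \<le> L \<and> 0 < \<beta> \<and> \<beta> < M \<and>
     driver_assumption P T Fil L f \<and>
     constraint_assumption P L \<beta> M H Hy Hmu \<and>
     terminal_assumption P T Fil H \<xi>"

definition condition_U ::
  "('y::euclidean_space \<Rightarrow> 'y measure \<Rightarrow> 'y) \<Rightarrow> ('y \<Rightarrow> 'y measure \<Rightarrow> 'y \<Rightarrow> 'y) \<Rightarrow> bool" where
  "condition_U Hy Hmu \<longleftrightarrow>
     (\<exists>\<epsilon>0>0. \<forall>y. \<forall>\<mu>\<in>P2. norm (\<integral>x. Hmu y \<mu> x \<partial>\<mu>) \<le> (1 - \<epsilon>0) * norm (Hy y \<mu>))"

definition sde_solution ::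
  "'w measure \<Rightarrow> real \<Rightarrow> (real \<Rightarrow> 'w measure) \<Rightarrow> (real \<Rightarrow> 'w \<Rightarrow> real ^ 'd::finite) \<Rightarrow>
     (real \<Rightarrow> 'w \<Rightarrow> 'x::euclidean_space \<Rightarrow> 'x) \<Rightarrow> (real \<Rightarrow> 'w \<Rightarrow> 'x \<Rightarrow> 'x ^ 'd) \<Rightarrow> 'x \<Rightarrow>
     (real \<Rightarrow> 'w \<Rightarrow> 'x) \<Rightarrow> bool" where
  "sde_solution P T Fil B b \<sigma> x0 X \<longleftrightarrow>
     X \<in> S2 P T Fil \<and>
     (\<exists>N. ito_integral P T Fil B (\<lambda>s \<omega>. \<sigma> s \<omega> (X s \<omega>)) N \<and>
        (AE \<omega> in P. \<forall>t\<in>{0..T}.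
           X t \<omega> = x0 + (LINT s:{0..t}|lborel. b s \<omega> (X s \<omega>)) + N t \<omega>))"

text \<open>The driver \<open>F\<close> and terminal value \<open>\<xi>\<close> of the BSDE are of Markovian type, with scalar \<open>Y\<close>.\<close>

definition assumption_SDE ::
  "'w measure \<Rightarrow> real \<Rightarrow> (real \<Rightarrow> 'w measure) \<Rightarrow> (real \<Rightarrow> 'w \<Rightarrow> real ^ 'd::finite) \<Rightarrow> real \<Rightarrow>
     (real \<Rightarrow> 'w \<Rightarrow> real ^ 'l \<Rightarrow> real ^ 'l) \<Rightarrow> (real \<Rightarrow> 'w \<Rightarrow> real ^ 'l \<Rightarrow> (real ^ 'l) ^ 'd) \<Rightarrow>
     real ^ 'l::finite \<Rightarrow> (real \<Rightarrow> 'w \<Rightarrow> real ^ 'l) \<Rightarrow>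
     (real \<Rightarrow> real ^ 'l \<Rightarrow> real \<Rightarrow> (real ^ 'l) measure \<Rightarrow> real measure \<Rightarrow> real) \<Rightarrow>
     (real ^ 'l \<Rightarrow> (real ^ 'l) measure \<Rightarrow> real) \<Rightarrow>
     (real \<Rightarrow> 'w \<Rightarrow> real \<Rightarrow> real ^ 'd \<Rightarrow> (real \<times> (real ^ 'd)) measure \<Rightarrow> real) \<Rightarrow> ('w \<Rightarrow> real) \<Rightarrow>
     bool" where
  "assumption_SDE P T Fil B L b \<sigma> x0 X f g F \<xi> \<longleftrightarrow>
     0 < L \<and>
     sde_solution P T Fil B b \<sigma> x0 X \<and>
     (AE \<omega> in P. (\<forall>t\<in>{0..T}. \<forall>y z. \<forall>\<nu>\<in>P2.
        F t \<omega> y z \<nu> = f t (X t \<omega>) y (law P (X t)) (distr \<nu> borel fst))) \<and>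
     (AE \<omega> in P. \<xi> \<omega> = g (X T \<omega>) (law P (X T))) \<and>
     (\<forall>x. progressive T Fil (\<lambda>s \<omega>. b s \<omega> x) \<and> progressive T Fil (\<lambda>s \<omega>. \<sigma> s \<omega> x)) \<and>
     (\<forall>s\<in>{0..T}. \<forall>\<omega>\<in>space P.
        (\<forall>x1 x2. norm (b s \<omega> x1 - b s \<omega> x2) + norm (\<sigma> s \<omega> x1 - \<sigma> s \<omega> x2) \<le> L * norm (x1 - x2)) \<and>
        norm (b s \<omega> 0) + norm (\<sigma> s \<omega> 0) \<le> L) \<and>
     (\<forall>t\<in>{0..T}. \<forall>x. \<forall>\<rho>\<in>P2. \<bar>f t x 0 \<rho> (dirac 0)\<bar> \<le> L * (1 + norm x + W2 \<rho> (dirac 0))) \<and>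
     (\<forall>t\<in>{0..T}. \<forall>x1 x2 y1 y2. \<forall>\<rho>1\<in>P2. \<forall>\<rho>2\<in>P2. \<forall>\<mu>1\<in>P2. \<forall>\<mu>2\<in>P2.
        \<bar>f t x1 y1 \<rho>1 \<mu>1 - f t x2 y2 \<rho>2 \<mu>2\<bar>
          \<le> L * (norm (x1 - x2) + \<bar>y1 - y2\<bar> + W2 \<rho>1 \<rho>2 + W2 \<mu>1 \<mu>2)) \<and>
     (\<forall>x1 x2. \<forall>\<rho>1\<in>P2. \<forall>\<rho>2\<in>P2.
        \<bar>g x1 \<rho>1 - g x2 \<rho>2\<bar> \<le> L * (norm (x1 - x2) + W2 \<rho>1 \<rho>2))"


section \<open>The size of the perturbation\<close>

definition ennreal_sqrt :: "ennreal \<Rightarrow> ennreal" where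
  "ennreal_sqrt x = (if x = \<infinity> then \<infinity> else ennreal (sqrt (enn2real x)))"

definition I_delta ::
  "'w measure \<Rightarrow> real \<Rightarrow>
     (real \<Rightarrow> 'w \<Rightarrow> 'y::euclidean_space \<Rightarrow> 'y ^ 'd \<Rightarrow> ('y \<times> ('y ^ 'd::finite)) measure \<Rightarrow> 'y) \<Rightarrow>
     (real \<Rightarrow> 'w \<Rightarrow> 'y \<Rightarrow> 'y ^ 'd \<Rightarrow> ('y \<times> ('y ^ 'd)) measure \<Rightarrow> 'y) \<Rightarrow>
     ('w \<Rightarrow> 'y) \<Rightarrow> ('w \<Rightarrow> 'y) \<Rightarrow> (real \<Rightarrow> 'w \<Rightarrow> 'y) \<Rightarrow> (real \<Rightarrow> 'w \<Rightarrow> 'y ^ 'd) \<Rightarrow> ennreal" where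
  "I_delta P T f1 f2 \<xi>1 \<xi>2 Y1 Z1 =
     ennreal_sqrt (\<integral>\<^sup>+\<omega>. (ennreal ((norm (\<xi>1 \<omega> - \<xi>2 \<omega>))\<^sup>2) +
       (\<integral>\<^sup>+s\<in>{0..T}. ennreal
          ((norm (driver_along P f1 Y1 Z1 s \<omega> - driver_along P f2 Y1 Z1 s \<omega>))\<^sup>2) \<partial>lborel)) \<partial>P)"

end

theory Submission
  imports Defs
begin

text \<open>
  The two solutions are compared by the energy method. Let \<open>U = Y1 - Y2\<close>, let \<open>f\<close> be the difference
  of the two drivers, each taken along its own solution, \<open>N\<close> the difference of the two stochastic
  integrals and \<open>R1\<close>, \<open>R2\<close> the reflection terms. In expectation, Ito's formula for \<open>U\<^sup>2\<close> says that
  \<open>E U\<^sub>t\<^sup>2 + E \<integral>\<^sub>t\<^sup>T |Z1 - Z2|\<^sup>2 ds = E |\<xi>1 - \<xi>2|\<^sup>2 + 2 E \<integral>\<^sub>t\<^sup>T U f ds + 2 E \<integral>\<^sub>t\<^sup>T U d(R1 - R2)\<close>.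

  The reflection terms have a sign (\<open>reflection_energy\<close>). Exchanging the scenario with its
  independent copy in the mean-field part turns \<open>E \<integral> U dR1\<close> into the expectation of
  \<open>\<integral> {Hy(Y1, \<mu>1) (Y1 - Y2) + E' [Hmu(Y1, \<mu>1)(Y1') (Y1' - Y2')]} dK1\<close>. By concavity the bracket is at
  most \<open>H(Y1, \<mu>1) - H(Y2, \<mu>2)\<close>. The first term vanishes \<open>dK1\<close>-almost everywhere, because \<open>K1\<close> grows
  only where the constraint is active, and the second one is nonnegative, because \<open>Y2\<close> satisfies the
  constraint. Hence \<open>E \<integral> U dR1 \<le> 0\<close> and, by symmetry, \<open>- E \<integral> U dR2 \<le> 0\<close>.

  For the driver, the Markovian form gives \<open>|f| \<le> |\<delta>f| + L (|U| + ||U||)\<close>, where \<open>\<delta>f\<close> is the difference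
  of the two drivers along the first solution and \<open>||U||\<close> is the norm in \<open>L\<^sup>2(P)\<close>. Therefore
  \<open>E U\<^sub>t\<^sup>2 \<le> I\<^sup>2 + (1 + 4 L) \<integral>\<^sub>t\<^sup>T E U\<^sub>s\<^sup>2 ds\<close> with the size \<open>I\<close> of the perturbation, and Gronwall's
  inequality bounds \<open>U\<close>, then \<open>N\<close> and \<open>Z1 - Z2\<close>. The equation expresses \<open>R1 - R2\<close> by \<open>U\<close>, \<open>\<integral> f ds\<close> and
  \<open>N\<close>, all of which are now controlled; this is the second claim.

  Ito's formula is used in a discrete form. On a grid, with martingale increments \<open>n\<^sub>i\<close> and increments
  \<open>a\<^sub>i\<close> of the continuous finite-variation part, \<open>U\<^sub>i - U\<^sub>i\<^sub>+\<^sub>1 = a\<^sub>i - n\<^sub>i\<close> and \<open>E U\<^sub>i n\<^sub>i = 0\<close> yield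
  \<open>E U\<^sub>i\<^sup>2 + E (a\<^sub>i - n\<^sub>i)\<^sup>2 = E U\<^sub>i\<^sub>+\<^sub>1\<^sup>2 + 2 E U\<^sub>i a\<^sub>i\<close> (\<open>energy_identity\<close>). As the grid is refined, the sums of
  \<open>U\<^sub>i a\<^sub>i\<close> are bounded as above (\<open>cross_terms\<close>) and \<open>\<Sum> E a\<^sub>i\<^sup>2\<close> tends to \<open>0\<close>. The orthogonality
  \<open>E U\<^sub>i n\<^sub>i = 0\<close> comes from the independence of Brownian increments from the augmented filtration
  (\<open>F_indep_increment\<close>), and \<open>Z1 - Z2\<close> is bounded by \<open>N\<close> through the isometry for simple integrands
  (\<open>ito_isometry_diff\<close>). Since the constant is free, factors are lost wherever this shortens an
  argument.

  Two points of measure theory shape the proof. The driver of the second equation along the first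
  solution may fail to be measurable, so that \<open>\<delta>f\<close> is replaced by the measurable lower bound
  \<open>max 0 (|f| - L (|U| + ||U||))\<close> of \<open>|\<delta>f|\<close>. And paths are regular almost surely only, so that the
  processes are first replaced by versions that vanish outside an event of full probability.
\<close>

section \<open>Grids and Stieltjes integrals\<close>

definition grid :: "real \<Rightarrow> real \<Rightarrow> nat \<Rightarrow> nat \<Rightarrow> real" where
  "grid a b m i = a + (b - a) * real i / real m"

lemma grid_0 [simp]: "grid a b m 0 = a"
  by (simp add: grid_def)

lemma grid_end [simp]: "m > 0 \<Longrightarrow> grid a b m m = b"
  by (simp add: grid_def)

lemma grid_mono: "a \<le> b \<Longrightarrow> i \<le> j \<Longrightarrow> grid a b m i \<le> grid a b m j"
  unfolding grid_def by (intro add_left_mono divide_right_mono mult_left_mono) auto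

lemma grid_Suc_mono: "a \<le> b \<Longrightarrow> grid a b m i \<le> grid a b m (Suc i)"
  by (rule grid_mono) auto

lemma grid_mem: "a \<le> b \<Longrightarrow> i \<le> m \<Longrightarrow> m > 0 \<Longrightarrow> grid a b m i \<in> {a..b}"
  using grid_mono[of a b 0 i m] grid_mono[of a b i m m] by auto

lemma grid_step: "m > 0 \<Longrightarrow> grid a b m (Suc i) - grid a b m i = (b - a) / real m"
  by (simp add: grid_def field_simps)

lemma eventually_grid_fine:
  assumes "d > 0"
  shows "\<forall>\<^sub>F m in sequentially. m > 0 \<and> (\<forall>i. grid a b m (Suc i) - grid a b m i < d)"
proof -
  have "(\<lambda>m. (b - a) / real m) \<longlonglongrightarrow> 0"
    by (rule lim_const_over_n)
  then have "\<forall>\<^sub>F m in sequentially. (b - a) / real m < d"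
    using assms by (auto dest: order_tendstoD)
  then show ?thesis
    using eventually_gt_at_top[of 0] by eventually_elim (simp add: grid_step)
qed

text \<open>Uniform continuity on a compact interval: on fine grids a continuous path is nearly constant on every cell.\<close>

lemma eventually_grid_uniform:
  fixes h :: "real \<Rightarrow> 'a::metric_space"
  assumes h: "continuous_on {a..b} h" and "a \<le> b" "e > 0"
  shows "\<forall>\<^sub>F m in sequentially. m > 0 \<and> (\<forall>i<m. \<forall>s\<in>{grid a b m i..grid a b m (Suc i)}.
           dist (h s) (h (grid a b m i)) < e)"
proof -
  have "uniformly_continuous_on {a..b} h"
    by (intro compact_uniformly_continuous h compact_Icc)
  then obtain d where d: "d > 0"
    "\<And>s s'. s \<in> {a..b} \<Longrightarrow> s' \<in> {a..b} \<Longrightarrow> dist s' s < d \<Longrightarrow> dist (h s') (h s) < e"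
    using \<open>e > 0\<close> unfolding uniformly_continuous_on_def by metis
  show ?thesis
    using eventually_grid_fine[OF d(1), of a b]
  proof eventually_elim
    case (elim m)
    have "dist (h s) (h (grid a b m i)) < e"
      if i: "i < m" and s: "s \<in> {grid a b m i..grid a b m (Suc i)}" for i s
    proof (rule d(2))
      show "grid a b m i \<in> {a..b}" using grid_mem[of a b i m] elim i \<open>a \<le> b\<close> by simp
      have "grid a b m (Suc i) \<in> {a..b}" using grid_mem[of a b "Suc i" m] elim i \<open>a \<le> b\<close> by simp
      then show "s \<in> {a..b}" using s \<open>grid a b m i \<in> {a..b}\<close> by auto
      have "grid a b m (Suc i) - grid a b m i < d" using elim by blast
      then show "dist s (grid a b m i) < d" using s by (auto simp: dist_real_def)
    qed
    then show ?case using elim by auto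
  qed
qed

lemma sum_increments_grid:
  fixes g :: "real \<Rightarrow> real"
  assumes "m > 0"
  shows "(\<Sum>i<m. g (grid a b m (Suc i)) - g (grid a b m i)) = g b - g a"
  using sum_lessThan_telescope[of "\<lambda>i. g (grid a b m i)" m] assms by simp

lemma sum_squares_increments_le:
  fixes g :: "real \<Rightarrow> real"
  assumes "mono_on {a..b} g" "a \<le> b" "m > 0"
  shows "(\<Sum>i<m. (g (grid a b m (Suc i)) - g (grid a b m i))\<^sup>2) \<le> (g b - g a)\<^sup>2"
proof -
  let ?d = "\<lambda>i. g (grid a b m (Suc i)) - g (grid a b m i)"
  have nn: "0 \<le> ?d i" if "i < m" for i
    using assms that mono_onD[OF assms(1), of "grid a b m i" "grid a b m (Suc i)"]
      grid_mem[of a b i m] grid_mem[of a b "Suc i" m] grid_Suc_mono[of a b m i] by simp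
  have tot: "(\<Sum>i<m. ?d i) = g b - g a"
    by (rule sum_increments_grid[OF assms(3)])
  have "(\<Sum>i<m. (?d i)\<^sup>2) \<le> (\<Sum>i<m. ?d i * (\<Sum>j<m. ?d j))"
    unfolding power2_eq_square
    by (intro sum_mono mult_left_mono member_le_sum) (use nn in auto)
  also have "\<dots> = (g b - g a)\<^sup>2"
    unfolding sum_distrib_right[symmetric] tot power2_eq_square ..
  finally show ?thesis .
qed

text \<open>A continuous monotone path has no quadratic variation: one factor of each square is uniformly
  small, and the other factors add up to the total increase.\<close>

lemma sum_squares_increments_tendsto_0:
  fixes g :: "real \<Rightarrow> real"
  assumes mono: "mono_on {a..b} g" and cont: "continuous_on {a..b} g" and "a \<le> b"
  shows "(\<lambda>m. \<Sum>i<m. (g (grid a b m (Suc i)) - g (grid a b m i))\<^sup>2) \<longlonglongrightarrow> 0"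
proof (rule LIMSEQ_I)
  fix r :: real assume "r > 0"
  define e where "e = r / 2 / (1 + (g b - g a))"
  have gab: "g b - g a \<ge> 0" using mono_onD[OF mono, of a b] \<open>a \<le> b\<close> by simp
  then have "e > 0" using \<open>r > 0\<close> by (simp add: e_def)
  have "\<forall>\<^sub>F m in sequentially.
      norm ((\<Sum>i<m. (g (grid a b m (Suc i)) - g (grid a b m i))\<^sup>2) - 0) < r"
    using eventually_grid_uniform[OF cont \<open>a \<le> b\<close> \<open>e > 0\<close>]
  proof eventually_elim
    case (elim m)
    then have m: "m > 0" by simp
    let ?d = "\<lambda>i. g (grid a b m (Suc i)) - g (grid a b m i)"
    have d: "0 \<le> ?d i" "?d i \<le> e" if i: "i < m" for i
    proof -
      show "0 \<le> ?d i"
        using mono_onD[OF mono, of "grid a b m i" "grid a b m (Suc i)"] i m \<open>a \<le> b\<close>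
          grid_mem[of a b i m] grid_mem[of a b "Suc i" m] grid_Suc_mono[of a b m i] by simp
      show "?d i \<le> e"
        using elim i grid_Suc_mono[OF \<open>a \<le> b\<close>, of m i] by (force simp: dist_real_def)
    qed
    have "(\<Sum>i<m. (?d i)\<^sup>2) \<le> (\<Sum>i<m. e * ?d i)"
      unfolding power2_eq_square by (intro sum_mono mult_right_mono) (use d in auto)
    also have "\<dots> = e * (g b - g a)"
      unfolding sum_distrib_left[symmetric] sum_increments_grid[OF m] ..
    also have "\<dots> \<le> e * (1 + (g b - g a))" using \<open>e > 0\<close> by (intro mult_left_mono) auto
    also have "\<dots> = r / 2"
      by (subst nonzero_eq_divide_eq[symmetric]) (use gab e_def in auto)
    also have "\<dots> < r" using \<open>r > 0\<close> by simp
    finally show ?case using sum_nonneg[of "{..<m}" "\<lambda>i. (?d i)\<^sup>2"] by simp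
  qed
  then show "\<exists>no. \<forall>n\<ge>no. norm ((\<Sum>i<n. (g (grid a b n (Suc i)) - g (grid a b n i))\<^sup>2) - 0) < r"
    by (simp add: eventually_sequentially)
qed

definition increasing_path :: "real \<Rightarrow> (real \<Rightarrow> real) \<Rightarrow> bool" where
  "increasing_path T k \<longleftrightarrow> continuous_on {0..T} k \<and> mono_on {0..T} k"

context
  fixes T :: real and k :: "real \<Rightarrow> real"
  assumes T: "T > 0" and k: "increasing_path T k"
begin

lemma clamped_mono: "x \<le> y \<Longrightarrow> k (max 0 (min T x)) \<le> k (max 0 (min T y))"
  using k T unfolding increasing_path_def by (auto intro!: mono_onD[where f=k and A="{0..T}"])

lemma clamped_continuous: "continuous (at x) (\<lambda>s. k (max 0 (min T s)))"
proof -
  have "continuous_on UNIV (\<lambda>s. k (max 0 (min T s)))"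
    by (rule continuous_on_compose2[of "{0..T}" k])
      (use k T in \<open>auto simp: increasing_path_def intro!: continuous_intros\<close>)
  then show ?thesis by (simp add: continuous_on_eq_continuous_at)
qed

text \<open>By continuity of the path its Stieltjes measure has no atoms, so that closed intervals carry
  the increment.\<close>

lemma emeasure_stieltjes_Icc:
  assumes "a \<le> b" "{a..b} \<subseteq> {0..T}"
  shows "emeasure (stieltjes T k) {a..b} = ennreal (k b - k a)"
  unfolding stieltjes_def
  by (subst emeasure_interval_measure_Icc)
    (use assms in \<open>auto intro!: clamped_mono clamped_continuous continuous_at_imp_continuous_on\<close>)

lemma sets_stieltjes [simp, measurable_cong]: "sets (stieltjes T k) = sets borel"
  by (simp add: stieltjes_def)

lemma space_stieltjes [simp]: "space (stieltjes T k) = UNIV"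
  by (simp add: stieltjes_def)

lemma increment_nonneg: "a \<le> b \<Longrightarrow> {a..b} \<subseteq> {0..T} \<Longrightarrow> 0 \<le> k b - k a"
  using k by (auto simp: increasing_path_def dest: mono_onD[of _ _ a b])

lemma set_integrable_stieltjes:
  fixes h :: "real \<Rightarrow> real"
  assumes "a \<le> b" "{a..b} \<subseteq> {0..T}" "continuous_on {0..T} h"
  shows "set_integrable (stieltjes T k) {a..b} h"
proof -
  have "continuous_on {a..b} h" by (rule continuous_on_subset) fact+
  then have m: "set_borel_measurable (stieltjes T k) {a..b} h"
    using borel_measurable_continuous_on_indicator[of "{a..b}" h]
    unfolding set_borel_measurable_def by (simp add: measurable_cong_sets[OF sets_stieltjes refl])
  have "compact (h ` {a..b})"
    by (intro compact_continuous_image \<open>continuous_on {a..b} h\<close> compact_Icc)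
  then obtain B where B: "\<And>x. x \<in> {a..b} \<Longrightarrow> norm (h x) \<le> B"
    by (meson bounded_iff compact_imp_bounded imageI)
  show ?thesis unfolding set_integrable_def
  proof (rule integrableI_bounded_set[where A = "{a..b}" and B = B])
    show "(\<lambda>x. indicat_real {a..b} x *\<^sub>R h x) \<in> borel_measurable (stieltjes T k)"
      using m by (simp add: set_borel_measurable_def)
    show "emeasure (stieltjes T k) {a..b} < \<infinity>"
      using assms by (simp add: emeasure_stieltjes_Icc)
  qed (use B in \<open>auto simp: indicator_def\<close>)
qed

lemma stieltjes_integral_const:
  assumes "a \<le> b" "{a..b} \<subseteq> {0..T}"
  shows "(LINT s:{a..b}|stieltjes T k. c) = c * (k b - k a)"
proof -
  have "measure (stieltjes T k) {a..b} = k b - k a"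
    using emeasure_stieltjes_Icc[OF assms] increment_nonneg[OF assms] by (simp add: measure_def)
  then show ?thesis by (simp add: set_lebesgue_integral_def)
qed

text \<open>All estimates of Riemann-Stieltjes sums reduce to this comparison with a constant on one cell.\<close>

lemma stieltjes_integral_near_const:
  assumes ab: "a \<le> b" "{a..b} \<subseteq> {0..T}" and h: "continuous_on {0..T} h"
    and e: "\<And>s. s \<in> {a..b} \<Longrightarrow> \<bar>h s - c\<bar> \<le> e"
  shows "\<bar>(LINT s:{a..b}|stieltjes T k. h s) - c * (k b - k a)\<bar> \<le> e * (k b - k a)"
proof -
  have i: "set_integrable (stieltjes T k) {a..b} (\<lambda>s. h s - c)"
    by (intro set_integrable_stieltjes ab continuous_intros h)
  have "(LINT s:{a..b}|stieltjes T k. h s) - c * (k b - k a) = (LINT s:{a..b}|stieltjes T k. h s - c)"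
    by (subst set_integral_diff(2))
      (auto intro!: set_integrable_stieltjes ab h simp: stieltjes_integral_const[OF ab])
  also have "\<bar>\<dots>\<bar> \<le> (LINT s:{a..b}|stieltjes T k. \<bar>h s - c\<bar>)"
    using set_integral_norm_bound[OF i] by simp
  also have "\<dots> \<le> (LINT s:{a..b}|stieltjes T k. e)"
    by (rule set_integral_mono) (use e in \<open>auto intro!: set_integrable_stieltjes ab continuous_intros h\<close>)
  also have "\<dots> = e * (k b - k a)" by (rule stieltjes_integral_const[OF ab])
  finally show ?thesis .
qed

lemma stieltjes_integral_bound:
  assumes "a \<le> b" "{a..b} \<subseteq> {0..T}" "continuous_on {0..T} h"
    "\<And>s. s \<in> {a..b} \<Longrightarrow> \<bar>h s\<bar> \<le> M"
  shows "\<bar>LINT s:{a..b}|stieltjes T k. h s\<bar> \<le> M * (k b - k a)"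
  using stieltjes_integral_near_const[OF assms(1-3), of 0 M] assms(4) by simp

lemma stieltjes_integral_combine:
  fixes h :: "real \<Rightarrow> real"
  assumes "a \<le> b" "b \<le> c" "{a..c} \<subseteq> {0..T}" "continuous_on {0..T} h"
  shows "(LINT s:{a..c}|stieltjes T k. h s)
    = (LINT s:{a..b}|stieltjes T k. h s) + (LINT s:{b..c}|stieltjes T k. h s)"
proof -
  have "{a..c} = {a..b} \<union> {b..c}" using assms by auto
  then have "(LINT s:{a..c}|stieltjes T k. h s) = (LINT s:{a..b} \<union> {b..c}|stieltjes T k. h s)"
    by simp
  also have "\<dots> = (LINT s:{a..b}|stieltjes T k. h s) + (LINT s:{b..c}|stieltjes T k. h s)"
  proof (rule set_integral_Un_AE)
    have "emeasure (stieltjes T k) {b..b} = 0"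
      using emeasure_stieltjes_Icc[of b b] assms by auto
    then have "AE s in stieltjes T k. s \<notin> {b}"
      by (intro AE_not_in) (auto simp: null_sets_def)
    then show "AE x in stieltjes T k. \<not> (x \<in> {a..b} \<and> x \<in> {b..c})"
      by eventually_elim auto
  qed (use assms in \<open>auto intro!: set_integrable_stieltjes\<close>)
  finally show ?thesis .
qed

text \<open>On each cell the integral of \<open>h\<close> differs from its left-point value by a small multiple of the
  increment of \<open>k\<close>, whatever bounded weight multiplies it. In the application \<open>u\<close> is a process
  sampled at the left endpoints, and \<open>\<integral> h dk\<close> over a cell is a piece of the reflection term.\<close>

lemma riemann_stieltjes_error:
  assumes ab: "a \<le> b" "{a..b} \<subseteq> {0..T}" and h: "continuous_on {0..T} h"
    and u: "\<And>s. s \<in> {a..b} \<Longrightarrow> \<bar>u s\<bar> \<le> S"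
  shows "(\<lambda>m. \<Sum>i<m. u (grid a b m i) *
      ((LINT s:{grid a b m i..grid a b m (Suc i)}|stieltjes T k. h s)
        - h (grid a b m i) * (k (grid a b m (Suc i)) - k (grid a b m i)))) \<longlonglongrightarrow> 0"
    (is "?E \<longlonglongrightarrow> 0")
proof (rule LIMSEQ_I)
  fix r :: real assume "r > 0"
  define Q where "Q = S * (k b - k a)"
  have S: "S \<ge> 0" using u[of a] ab by auto
  have kab: "k b - k a \<ge> 0" by (rule increment_nonneg[OF ab])
  have Q: "Q \<ge> 0" using S kab by (simp add: Q_def)
  define e where "e = r / 2 / (1 + Q)"
  have e: "e > 0" using Q \<open>r > 0\<close> by (simp add: e_def)
  have "continuous_on {a..b} h" by (rule continuous_on_subset) fact+
  from eventually_grid_uniform[OF this ab(1) e]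
  have "\<forall>\<^sub>F m in sequentially. norm (?E m - 0) < r"
  proof eventually_elim
    case (elim m)
    then have m: "m > 0" by simp
    have le: "grid a b m i \<le> grid a b m (Suc i)" for i by (rule grid_Suc_mono[OF ab(1)])
    have mem: "grid a b m i \<in> {a..b}" if "i \<le> m" for i by (rule grid_mem[OF ab(1) that m])
    have sub: "{grid a b m i..grid a b m (Suc i)} \<subseteq> {0..T}" if "i < m" for i
      using mem[of i] mem[of "Suc i"] that ab by auto
    let ?d = "\<lambda>i. k (grid a b m (Suc i)) - k (grid a b m i)"
    have "norm (?E m) \<le> (\<Sum>i<m. S * (e * ?d i))"
    proof (rule sum_norm_le)
      fix i assume "i \<in> {..<m}"
      then have i: "i < m" by simp
      have "\<bar>(LINT s:{grid a b m i..grid a b m (Suc i)}|stieltjes T k. h s) - h (grid a b m i) * ?d i\<bar>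
          \<le> e * ?d i"
        by (rule stieltjes_integral_near_const[OF le sub[OF i] h])
          (use elim i in \<open>auto simp: dist_real_def less_imp_le\<close>)
      then show "norm (u (grid a b m i) *
        ((LINT s:{grid a b m i..grid a b m (Suc i)}|stieltjes T k. h s) - h (grid a b m i) * ?d i))
        \<le> S * (e * ?d i)"
        unfolding real_norm_def abs_mult by (intro mult_mono u mem) (use i S in auto)
    qed
    also have "\<dots> = S * (e * (k b - k a))"
      unfolding sum_distrib_left[symmetric] sum_increments_grid[OF m] ..
    also have "\<dots> = e * Q" by (simp add: Q_def)
    also have "\<dots> \<le> e * (1 + Q)" using e by simp
    also have "\<dots> = r / 2"
      by (subst nonzero_eq_divide_eq[symmetric]) (use Q e_def in auto)
    also have "\<dots> < r" using \<open>r > 0\<close> by simp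
    finally show ?case by simp
  qed
  then show "\<exists>no. \<forall>n\<ge>no. norm (?E n - 0) < r"
    by (simp add: eventually_sequentially)
qed

end

lemma grid_mem_time:
  assumes "0 \<le> a" "a \<le> b" "b \<le> T" "i < m"
  shows "grid a b m i \<in> {0..T}" "grid a b m (Suc i) \<in> {0..T}"
  using grid_mem[OF assms(2), of i m] grid_mem[OF assms(2), of "Suc i" m] assms by auto

context
  fixes T :: real and k :: "real \<Rightarrow> real"
  assumes T: "T > 0" and k: "increasing_path T k"
begin

lemma stieltjes_integral_grid:
  fixes h :: "real \<Rightarrow> real"
  assumes ab: "a \<le> b" "{a..b} \<subseteq> {0..T}" and h: "continuous_on {0..T} h" and m: "m > 0"
  shows "(\<Sum>i<m. LINT s:{grid a b m i..grid a b m (Suc i)}|stieltjes T k. h s) = (LINT s:{a..b}|stieltjes T k. h s)"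
proof -
  have "(\<Sum>i<j. LINT s:{grid a b m i..grid a b m (Suc i)}|stieltjes T k. h s)
      = (LINT s:{a..grid a b m j}|stieltjes T k. h s)" if "j \<le> m" for j
    using that
  proof (induction j)
    case 0
    have "{a..a} \<subseteq> {0..T}" using ab by auto
    then have "\<bar>LINT s:{a..a}|stieltjes T k. h s\<bar> \<le> \<bar>h a\<bar> * (k a - k a)"
      by (intro stieltjes_integral_bound[OF T k _ _ h]) auto
    then show ?case by simp
  next
    case (Suc j)
    have g: "grid a b m j \<in> {a..b}" "grid a b m (Suc j) \<in> {a..b}"
      using Suc.prems m by (auto intro!: grid_mem[OF ab(1), unfolded atLeastAtMost_iff, THEN conjunct1]
        grid_mem[OF ab(1), unfolded atLeastAtMost_iff, THEN conjunct2])
    have "(LINT s:{a..grid a b m (Suc j)}|stieltjes T k. h s) =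
      (LINT s:{a..grid a b m j}|stieltjes T k. h s) + (LINT s:{grid a b m j..grid a b m (Suc j)}|stieltjes T k. h s)"
      by (rule stieltjes_integral_combine[OF T k]) (use g ab h grid_Suc_mono[OF ab(1)] in auto)
    then show ?case using Suc by simp
  qed
  from this[of m] show ?thesis using m by simp
qed

text \<open>This exhibits the integral as a limit of expressions in finitely many path values, which is how
  its measurability in the scenario is obtained.\<close>

lemma riemann_stieltjes_tendsto:
  fixes h :: "real \<Rightarrow> real"
  assumes ab: "a \<le> b" "{a..b} \<subseteq> {0..T}" and h: "continuous_on {0..T} h"
  shows "(\<lambda>m. \<Sum>i<m. h (grid a b m i) * (k (grid a b m (Suc i)) - k (grid a b m i)))
      \<longlonglongrightarrow> (LINT s:{a..b}|stieltjes T k. h s)"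
proof -
  have "(\<lambda>m. (\<Sum>i<m. LINT s:{grid a b m i..grid a b m (Suc i)}|stieltjes T k. h s)
      - (\<Sum>i<m. h (grid a b m i) * (k (grid a b m (Suc i)) - k (grid a b m i)))) \<longlonglongrightarrow> 0"
    using riemann_stieltjes_error[OF T k ab h, of "\<lambda>_. 1" 1] by (simp add: sum_subtractf)
  then have "(\<lambda>m. (LINT s:{a..b}|stieltjes T k. h s)
      - (\<Sum>i<m. h (grid a b m i) * (k (grid a b m (Suc i)) - k (grid a b m i)))) \<longlonglongrightarrow> 0"
    by (rule Lim_transform_eventually)
      (use eventually_gt_at_top[of 0] in eventually_elim, simp add: stieltjes_integral_grid[OF ab h])
  from tendsto_diff[OF tendsto_const[of "LINT s:{a..b}|stieltjes T k. h s"] this] show ?thesis by simp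
qed

text \<open>The flatness condition on \<open>K\<close>, localised to a cell.\<close>

lemma stieltjes_integral_eq_0:
  assumes ab: "a \<le> b" "{a..b} \<subseteq> {0..T}" and h: "continuous_on {0..T} h"
    and nonneg: "\<And>s. s \<in> {0..T} \<Longrightarrow> 0 \<le> h s"
    and null: "(\<integral>\<^sup>+s\<in>{0..T}. ennreal (h s) \<partial>stieltjes T k) = 0"
  shows "(LINT s:{a..b}|stieltjes T k. h s) = 0"
proof -
  have i: "set_integrable (stieltjes T k) {0..T} h"
    using T by (intro set_integrable_stieltjes[OF T k] h) auto
  then have m: "(\<lambda>s. indicator {0..T} s * h s) \<in> borel_measurable (stieltjes T k)"
    using borel_measurable_integrable by (auto simp: set_integrable_def)
  have eq: "ennreal (h s) * indicator {0..T} s = ennreal (indicator {0..T} s * h s)" for s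
    by (auto simp: indicator_def)
  have "AE s in stieltjes T k. ennreal (indicator {0..T} s * h s) = 0"
    using null m unfolding eq by (subst (asm) nn_integral_0_iff_AE) auto
  then have "AE s in stieltjes T k. indicator {a..b} s *\<^sub>R h s = 0"
  proof eventually_elim
    case (elim s)
    then show ?case using nonneg[of s] ab by (auto simp: indicator_def ennreal_eq_0_iff split: if_splits)
  qed
  then show ?thesis unfolding set_lebesgue_integral_def
    by (subst integral_cong_AE[where g = "\<lambda>_. 0"])
      (use set_integrable_stieltjes[OF T k ab h] in \<open>auto simp: set_integrable_def\<close>)
qed

end

section \<open>Square-integrable random variables and their laws\<close>

lemma law_in_P2:
  assumes "prob_space P" "X \<in> L2 P"
  shows "law P X \<in> P2"
proof -
  interpret prob_space P by fact
  have [measurable]: "X \<in> borel_measurable P" and i: "integrable P (\<lambda>\<omega>. (norm (X \<omega>))\<^sup>2)"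
    using assms(2) by (auto simp: L2_def)
  have "(\<integral>\<^sup>+x. ennreal ((norm x)\<^sup>2) \<partial>law P X) = (\<integral>\<^sup>+\<omega>. ennreal ((norm (X \<omega>))\<^sup>2) \<partial>P)"
    by (subst nn_integral_distr) auto
  also have "\<dots> < \<infinity>" using i by (simp add: integrable_iff_bounded)
  finally show ?thesis by (auto simp: P2_def intro!: prob_space_distr)
qed

lemma L2_diff:
  assumes "X \<in> L2 P" "Y \<in> L2 P"
  shows "(\<lambda>\<omega>. X \<omega> - Y \<omega>) \<in> L2 P"
proof -
  have [measurable]: "X \<in> borel_measurable P" "Y \<in> borel_measurable P"
    using assms by (auto simp: L2_def)
  have "integrable P (\<lambda>\<omega>. (norm (X \<omega> - Y \<omega>))\<^sup>2)"
  proof (rule Bochner_Integration.integrable_bound)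
    show "integrable P (\<lambda>\<omega>. 2 * (norm (X \<omega>))\<^sup>2 + 2 * (norm (Y \<omega>))\<^sup>2)"
      using assms by (auto simp: L2_def)
    have "(norm (x - y))\<^sup>2 \<le> 2 * (norm x)\<^sup>2 + 2 * (norm y)\<^sup>2" for x y :: 'b
    proof -
      have "(norm (x - y))\<^sup>2 \<le> (norm x + norm y)\<^sup>2"
        by (intro power_mono norm_triangle_ineq4) auto
      also have "\<dots> \<le> 2 * (norm x)\<^sup>2 + 2 * (norm y)\<^sup>2"
        using sum_squares_bound[of "norm x" "norm y"] by (simp add: power2_sum)
      finally show ?thesis .
    qed
    then show "AE \<omega> in P. norm ((norm (X \<omega> - Y \<omega>))\<^sup>2) \<le> norm (2 * (norm (X \<omega>))\<^sup>2 + 2 * (norm (Y \<omega>))\<^sup>2)"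
      by auto
  qed measurable
  then show ?thesis by (simp add: L2_def)
qed

text \<open>The joint law of two variables on one space is a coupling of their laws.\<close>

lemma W2_law_le_l2norm:
  assumes "prob_space P" "X \<in> L2 P" "Y \<in> L2 P"
  shows "W2 (law P X) (law P Y) \<le> l2norm P (\<lambda>\<omega>. X \<omega> - Y \<omega>)"
proof -
  interpret prob_space P by fact
  have [measurable]: "X \<in> borel_measurable P" "Y \<in> borel_measurable P"
    using assms by (auto simp: L2_def)
  define \<pi> where "\<pi> = distr P borel (\<lambda>\<omega>. (X \<omega>, Y \<omega>))"
  have [measurable]: "fst \<in> borel_measurable (borel :: ('b \<times> 'b) measure)"
    "snd \<in> borel_measurable (borel :: ('b \<times> 'b) measure)"
    by (auto intro!: borel_measurable_continuous_onI continuous_intros)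
  have "\<pi> \<in> couplings (law P X) (law P Y)"
    by (auto simp: couplings_def \<pi>_def distr_distr comp_def intro!: prob_space_distr)
  then have "(INF \<pi>\<in>couplings (law P X) (law P Y). \<integral>\<^sup>+p. ennreal ((norm (fst p - snd p))\<^sup>2) \<partial>\<pi>)
      \<le> (\<integral>\<^sup>+p. ennreal ((norm (fst p - snd p))\<^sup>2) \<partial>\<pi>)"
    by (rule INF_lower)
  also have "\<dots> = (\<integral>\<^sup>+\<omega>. ennreal ((norm (X \<omega> - Y \<omega>))\<^sup>2) \<partial>P)"
    unfolding \<pi>_def by (subst nn_integral_distr) (auto simp: borel_prod[symmetric])
  also have "\<dots> = ennreal (\<integral>\<omega>. (norm (X \<omega> - Y \<omega>))\<^sup>2 \<partial>P)"
    using L2_diff[OF assms(2,3)] by (intro nn_integral_eq_integral) (auto simp: L2_def)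
  finally show ?thesis
    unfolding W2_def l2norm_def by (intro real_sqrt_le_mono) (simp add: enn2real_leI)
qed

lemma jointly_continuousD:
  assumes "jointly_continuous G" "x \<longlonglongrightarrow> x0" "\<And>n. \<mu> n \<in> P2" "\<mu>0 \<in> P2"
    "(\<lambda>n. W2 (\<mu> n) \<mu>0) \<longlonglongrightarrow> 0"
  shows "(\<lambda>n. G (x n) (\<mu> n)) \<longlonglongrightarrow> G x0 \<mu>0"
proof (rule tendstoI)
  fix e :: real assume "e > 0"
  then obtain d where d: "d > 0"
    "\<And>x' \<mu>'. \<mu>' \<in> P2 \<Longrightarrow> dist x' x0 < d \<Longrightarrow> W2 \<mu>' \<mu>0 < d \<Longrightarrow> dist (G x' \<mu>') (G x0 \<mu>0) < e"
    using assms(1,4) unfolding jointly_continuous_def by metis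
  have "\<forall>\<^sub>F n in sequentially. dist (x n) x0 < d" using assms(2) d(1) by (rule tendstoD)
  moreover have "\<forall>\<^sub>F n in sequentially. W2 (\<mu> n) \<mu>0 < d"
    using assms(5) d(1) by (rule order_tendstoD)
  ultimately show "\<forall>\<^sub>F n in sequentially. dist (G (x n) (\<mu> n)) (G x0 \<mu>0) < e"
    by eventually_elim (use d(2) assms(3) in auto)
qed

lemma W2_law_self:
  assumes "prob_space P" "X \<in> L2 P"
  shows "W2 (law P X) (law P X) = 0"
proof -
  have "W2 (law P X) (law P X) \<le> 0"
    using W2_law_le_l2norm[OF assms assms(2)] by (simp add: l2norm_def)
  moreover have "W2 (law P X) (law P X) \<ge> 0" by (simp add: W2_def)
  ultimately show ?thesis by simp
qed

lemma jointly_continuous_borel_measurable: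
  fixes G :: "'a::euclidean_space \<Rightarrow> real measure \<Rightarrow> real"
  assumes "jointly_continuous G" "prob_space P" "X \<in> L2 P"
  shows "(\<lambda>x. G x (law P X)) \<in> borel_measurable borel"
proof (rule borel_measurable_continuous_onI)
  show "continuous_on UNIV (\<lambda>x. G x (law P X))"
    unfolding continuous_on_sequentially comp_def
    by (intro ballI allI impI jointly_continuousD[OF assms(1)])
      (use law_in_P2[OF assms(2,3)] W2_law_self[OF assms(2,3)] in auto)
qed

text \<open>Dominated convergence.\<close>

lemma l2norm_continuous_paths:
  fixes X :: "real \<Rightarrow> 'w \<Rightarrow> 'a::euclidean_space"
  assumes m: "\<And>t. t \<in> {0..T} \<Longrightarrow> X t \<in> borel_measurable P"
    and cont: "\<And>\<omega>. \<omega> \<in> space P \<Longrightarrow> continuous_on {0..T} (\<lambda>t. X t \<omega>)"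
    and bnd: "\<And>t \<omega>. t \<in> {0..T} \<Longrightarrow> \<omega> \<in> space P \<Longrightarrow> norm (X t \<omega>) \<le> S \<omega>"
    and S: "integrable P (\<lambda>\<omega>. (S \<omega>)\<^sup>2)"
    and r: "\<And>n. r n \<in> {0..T}" "t \<in> {0..T}" "r \<longlonglongrightarrow> t"
  shows "(\<lambda>n. l2norm P (\<lambda>\<omega>. X (r n) \<omega> - X t \<omega>)) \<longlonglongrightarrow> 0"
proof -
  have "(\<lambda>n. \<integral>\<omega>. (norm (X (r n) \<omega> - X t \<omega>))\<^sup>2 \<partial>P) \<longlonglongrightarrow> (\<integral>\<omega>. 0 \<partial>P)"
  proof (rule integral_dominated_convergence[where w = "\<lambda>\<omega>. 4 * (S \<omega>)\<^sup>2"])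
    show "(\<lambda>\<omega>. (norm (X (r n) \<omega> - X t \<omega>))\<^sup>2) \<in> borel_measurable P" for n
      using m[OF r(1)] m[OF r(2)] by measurable
    show "AE \<omega> in P. (\<lambda>n. (norm (X (r n) \<omega> - X t \<omega>))\<^sup>2) \<longlonglongrightarrow> 0"
    proof (rule AE_I2)
      fix \<omega> assume "\<omega> \<in> space P"
      then have "(\<lambda>n. X (r n) \<omega>) \<longlonglongrightarrow> X t \<omega>"
        using cont r unfolding continuous_on_sequentially comp_def by blast
      then have "(\<lambda>n. (norm (X (r n) \<omega> - X t \<omega>))\<^sup>2) \<longlonglongrightarrow> (norm (X t \<omega> - X t \<omega>))\<^sup>2"
        by (intro tendsto_intros)
      then show "(\<lambda>n. (norm (X (r n) \<omega> - X t \<omega>))\<^sup>2) \<longlonglongrightarrow> 0" by simp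
    qed
    show "AE \<omega> in P. norm ((norm (X (r n) \<omega> - X t \<omega>))\<^sup>2) \<le> 4 * (S \<omega>)\<^sup>2" for n
    proof (rule AE_I2)
      fix \<omega> assume w: "\<omega> \<in> space P"
      have "norm (X (r n) \<omega> - X t \<omega>) \<le> 2 * S \<omega>"
        using norm_triangle_ineq4[of "X (r n) \<omega>" "X t \<omega>"] bnd[OF r(1) w, of n] bnd[OF r(2) w] by simp
      then have "(norm (X (r n) \<omega> - X t \<omega>))\<^sup>2 \<le> (2 * S \<omega>)\<^sup>2" by (intro power_mono) auto
      then show "norm ((norm (X (r n) \<omega> - X t \<omega>))\<^sup>2) \<le> 4 * (S \<omega>)\<^sup>2" by (simp add: power_mult_distrib)
    qed
  qed (use S in auto)
  then have "(\<lambda>n. \<integral>\<omega>. (norm (X (r n) \<omega> - X t \<omega>))\<^sup>2 \<partial>P) \<longlonglongrightarrow> 0" by simp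
  from tendsto_real_sqrt[OF this] show ?thesis by (simp add: l2norm_def)
qed

lemma L2_real_iff: "X \<in> L2 P \<longleftrightarrow> X \<in> borel_measurable P \<and> integrable P (\<lambda>\<omega>. (X \<omega>)\<^sup>2)" for X :: "'w \<Rightarrow> real"
  by (simp add: L2_def)

lemma L2_measurable: "X \<in> L2 P \<Longrightarrow> X \<in> borel_measurable P"
  by (simp add: L2_def)

lemma L2_mult_integrable:
  fixes X Y :: "'w \<Rightarrow> real"
  assumes "X \<in> L2 P" "Y \<in> L2 P"
  shows "integrable P (\<lambda>\<omega>. X \<omega> * Y \<omega>)"
proof (rule Bochner_Integration.integrable_bound)
  show "integrable P (\<lambda>\<omega>. (X \<omega>)\<^sup>2 + (Y \<omega>)\<^sup>2)" using assms by (auto simp: L2_real_iff)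
  show "(\<lambda>\<omega>. X \<omega> * Y \<omega>) \<in> borel_measurable P" using assms by (auto simp: L2_real_iff)
  have "\<bar>x * y\<bar> \<le> x\<^sup>2 + y\<^sup>2" for x y :: real
  proof -
    have "2 * \<bar>x\<bar> * \<bar>y\<bar> \<le> x\<^sup>2 + y\<^sup>2" using sum_squares_bound[of "\<bar>x\<bar>" "\<bar>y\<bar>"] by simp
    moreover have "0 \<le> \<bar>x\<bar> * \<bar>y\<bar>" by simp
    ultimately show ?thesis unfolding abs_mult by linarith
  qed
  then show "AE \<omega> in P. norm (X \<omega> * Y \<omega>) \<le> norm ((X \<omega>)\<^sup>2 + (Y \<omega>)\<^sup>2)" by auto
qed

lemma L2_add:
  fixes X Y :: "'w \<Rightarrow> real"
  assumes "X \<in> L2 P" "Y \<in> L2 P"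
  shows "(\<lambda>\<omega>. X \<omega> + Y \<omega>) \<in> L2 P"
  using assms L2_mult_integrable[OF assms] by (auto simp: L2_real_iff power2_sum mult.assoc)

lemma L2_cmult: "X \<in> L2 P \<Longrightarrow> (\<lambda>\<omega>. c * X \<omega>) \<in> L2 P" for X :: "'w \<Rightarrow> real"
  by (auto simp: L2_real_iff power_mult_distrib)

lemma L2_sum:
  fixes X :: "'i \<Rightarrow> 'w \<Rightarrow> real"
  shows "(\<And>i. i \<in> I \<Longrightarrow> X i \<in> L2 P) \<Longrightarrow> (\<lambda>\<omega>. \<Sum>i\<in>I. X i \<omega>) \<in> L2 P"
proof (induction I rule: infinite_finite_induct)
  case (insert x F)
  then show ?case using L2_add[of "X x" P "\<lambda>\<omega>. \<Sum>i\<in>F. X i \<omega>"] by auto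
qed (auto simp: L2_real_iff)

lemma L2_dominated:
  fixes X :: "'w \<Rightarrow> real"
  assumes "X \<in> borel_measurable P" "Y \<in> L2 P" "AE \<omega> in P. \<bar>X \<omega>\<bar> \<le> \<bar>Y \<omega>\<bar>"
  shows "X \<in> L2 P"
proof -
  have "integrable P (\<lambda>\<omega>. (X \<omega>)\<^sup>2)"
  proof (rule Bochner_Integration.integrable_bound)
    show "integrable P (\<lambda>\<omega>. (Y \<omega>)\<^sup>2)" using assms(2) by (simp add: L2_real_iff)
    show "AE \<omega> in P. norm ((X \<omega>)\<^sup>2) \<le> norm ((Y \<omega>)\<^sup>2)"
      using assms(3) by eventually_elim (simp add: abs_le_square_iff)
  qed (use assms(1) in measurable)
  then show ?thesis using assms(1) by (simp add: L2_real_iff)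
qed

lemma l2norm_power2: "(l2norm P X)\<^sup>2 = (\<integral>\<omega>. (norm (X \<omega>))\<^sup>2 \<partial>P)"
  by (simp add: l2norm_def)

lemma l2norm_nonneg [simp]: "0 \<le> l2norm P X"
  by (simp add: l2norm_def)

lemma L2_nn_integral:
  fixes X :: "'w \<Rightarrow> real"
  assumes "X \<in> L2 P"
  shows "(\<integral>\<^sup>+\<omega>. ennreal ((X \<omega>)\<^sup>2) \<partial>P) = ennreal ((l2norm P X)\<^sup>2)"
  unfolding l2norm_power2 using assms by (subst nn_integral_eq_integral) (auto simp: L2_real_iff)

lemma L2_Cauchy_Schwarz_abs:
  fixes X Y :: "'w \<Rightarrow> real"
  assumes "X \<in> L2 P" "Y \<in> L2 P"
  shows "(\<integral>\<omega>. \<bar>X \<omega> * Y \<omega>\<bar> \<partial>P) \<le> l2norm P X * l2norm P Y"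
proof -
  have [measurable]: "X \<in> borel_measurable P" "Y \<in> borel_measurable P"
    using assms by (auto simp: L2_real_iff)
  have "ennreal ((\<integral>\<omega>. \<bar>X \<omega> * Y \<omega>\<bar> \<partial>P)\<^sup>2) = (\<integral>\<^sup>+\<omega>. ennreal \<bar>X \<omega>\<bar> * ennreal \<bar>Y \<omega>\<bar> \<partial>P)\<^sup>2"
    using integrable_abs[OF L2_mult_integrable[OF assms]]
    by (subst ennreal_power[symmetric], simp, subst nn_integral_eq_integral[symmetric])
      (auto simp: ennreal_mult abs_mult)
  also have "\<dots> \<le> (\<integral>\<^sup>+\<omega>. (ennreal \<bar>X \<omega>\<bar>)\<^sup>2 \<partial>P) * (\<integral>\<^sup>+\<omega>. (ennreal \<bar>Y \<omega>\<bar>)\<^sup>2 \<partial>P)"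
    by (rule Cauchy_Schwarz_nn_integral) measurable
  also have "\<dots> = ennreal ((l2norm P X)\<^sup>2) * ennreal ((l2norm P Y)\<^sup>2)"
    using L2_nn_integral[OF assms(1)] L2_nn_integral[OF assms(2)] by (simp add: ennreal_power)
  also have "\<dots> = ennreal ((l2norm P X * l2norm P Y)\<^sup>2)"
    by (simp add: ennreal_mult power_mult_distrib)
  finally have "(\<integral>\<omega>. \<bar>X \<omega> * Y \<omega>\<bar> \<partial>P)\<^sup>2 \<le> (l2norm P X * l2norm P Y)\<^sup>2"
    by (simp add: ennreal_le_iff)
  then show ?thesis by (rule power2_le_imp_le) simp
qed

lemma L2_Cauchy_Schwarz:
  fixes X Y :: "'w \<Rightarrow> real"
  assumes "X \<in> L2 P" "Y \<in> L2 P"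
  shows "\<bar>\<integral>\<omega>. X \<omega> * Y \<omega> \<partial>P\<bar> \<le> l2norm P X * l2norm P Y"
  using integral_abs_bound[of P "\<lambda>\<omega>. X \<omega> * Y \<omega>"] L2_Cauchy_Schwarz_abs[OF assms] by linarith

lemma L2_of_nn_integral_finite:
  fixes X :: "'w \<Rightarrow> real"
  assumes "X \<in> borel_measurable P" "(\<integral>\<^sup>+\<omega>. ennreal ((X \<omega>)\<^sup>2) \<partial>P) < \<infinity>"
  shows "X \<in> L2 P"
  using assms by (auto simp: L2_real_iff intro!: integrableI_nonneg)

context prob_space
begin

lemma L2_const: "(\<lambda>\<omega>. c :: real) \<in> L2 M"
  by (simp add: L2_real_iff)

lemma L2_integrable: "X \<in> L2 M \<Longrightarrow> integrable M X" for X :: "'a \<Rightarrow> real"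
  using L2_mult_integrable[OF _ L2_const[of 1], of X] by simp

lemma expectation_abs_le_l2norm: "X \<in> L2 M \<Longrightarrow> expectation (\<lambda>\<omega>. \<bar>X \<omega>\<bar>) \<le> l2norm M X" for X :: "'a \<Rightarrow> real"
  using L2_Cauchy_Schwarz_abs[OF _ L2_const[of 1], of X] by (simp add: l2norm_def prob_space)

end

lemma (in prob_space) integrable_pair_mult:
  fixes f g :: "'a \<Rightarrow> real"
  assumes "integrable M f" "integrable M g"
  shows "integrable (M \<Otimes>\<^sub>M M) (\<lambda>p. f (fst p) * g (snd p))"
proof -
  interpret PP: pair_prob_space M M ..
  have [measurable]: "f \<in> borel_measurable M" "g \<in> borel_measurable M" using assms by auto
  show ?thesis
  proof (rule PP.Fubini_integrable)
    show "integrable M (\<lambda>x. \<integral>y. norm (f (fst (x, y)) * g (snd (x, y))) \<partial>M)"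
      using assms by (simp add: abs_mult)
  qed (use assms in auto)
qed

section \<open>Brownian increments and the augmented filtration\<close>

text \<open>Lebesgue measure on \<open>real ^ 'd\<close> is the image of the product measure over the basis.\<close>

lemma
  fixes f :: "'d::finite \<Rightarrow> real \<Rightarrow> real"
  assumes f: "\<And>i. integrable lborel (f i)"
  shows integrable_vec_prod: "integrable lborel (\<lambda>x::real^'d. \<Prod>i\<in>UNIV. f i (x $ i))"
    and integral_vec_prod: "(\<integral>x. (\<Prod>i\<in>UNIV. f i ((x::real^'d) $ i)) \<partial>lborel) = (\<Prod>i\<in>UNIV. integral\<^sup>L lborel (f i))"
proof -
  interpret product_sigma_finite "\<lambda>_::real^'d. lborel::real measure" ..
  define e where "e = (\<lambda>i::'d. axis i (1::real))"
  have inj: "inj e" by (auto simp: e_def inj_def axis_eq_axis)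
  have Basis: "Basis = e ` UNIV" by (auto simp: Basis_vec_def e_def)
  have coord: "(\<Sum>b\<in>Basis. g b *\<^sub>R b) $ i = g (e i)" for g and i :: 'd
  proof -
    have "(\<Sum>b\<in>Basis. g b *\<^sub>R b) $ i = (\<Sum>b\<in>Basis. g b * b $ i)"
      by (simp add: sum_component)
    also have "\<dots> = (\<Sum>j\<in>UNIV. g (e j) * e j $ i)"
      unfolding Basis using inj by (subst sum.reindex) auto
    also have "\<dots> = (\<Sum>j\<in>UNIV. if j = i then g (e j) else 0)"
      by (intro sum.cong) (auto simp: e_def axis_def)
    finally show ?thesis by simp
  qed
  have idx: "axis_index (e i) = i" for i by (simp add: e_def)
  have prod: "(\<Prod>i\<in>UNIV. f i (g (e i))) = (\<Prod>b\<in>Basis. f (axis_index b) (g b))" for g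
    unfolding Basis using inj by (subst prod.reindex) (auto simp: idx)
  have [measurable]: "f i \<in> borel_measurable borel" for i
    using borel_measurable_integrable[OF f[of i]] by simp
  have m: "(\<lambda>f. \<Sum>b\<in>Basis. f b *\<^sub>R b) \<in> measurable (\<Pi>\<^sub>M b\<in>(Basis :: (real^'d) set). lborel) borel"
    by measurable
  have m2: "(\<lambda>x::real^'d. \<Prod>i\<in>UNIV. f i (x $ i)) \<in> borel_measurable borel"
    by measurable
  show "integrable lborel (\<lambda>x::real^'d. \<Prod>i\<in>UNIV. f i (x $ i))"
    by (subst lborel_eq, subst integrable_distr_eq[OF m m2], unfold coord prod)
      (intro product_integrable_prod f finite_Basis)
  have "(\<integral>x. (\<Prod>i\<in>UNIV. f i ((x::real^'d) $ i)) \<partial>lborel)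
     = (\<Prod>b\<in>(Basis :: (real^'d) set). integral\<^sup>L lborel (f (axis_index b)))"
    by (subst lborel_eq, subst integral_distr[OF m m2], unfold coord prod)
      (intro product_integral_prod f finite_Basis)
  also have "\<dots> = (\<Prod>i\<in>UNIV. integral\<^sup>L lborel (f i))"
    unfolding Basis using inj by (subst prod.reindex) (auto simp: idx)
  finally show "(\<integral>x. (\<Prod>i\<in>UNIV. f i ((x::real^'d) $ i)) \<partial>lborel) = (\<Prod>i\<in>UNIV. integral\<^sup>L lborel (f i))" .
qed

lemma
  fixes \<sigma> :: real and j k :: "'d::finite"
  assumes "\<sigma> > 0"
  shows integrable_gaussian_mixed: "integrable lborel
      (\<lambda>x::real^'d. (\<Prod>i\<in>UNIV. normal_density 0 \<sigma> (x $ i)) * (x $ j * x $ k))" (is ?A)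
    and integral_gaussian_mixed: "(\<integral>x. (\<Prod>i\<in>UNIV. normal_density 0 \<sigma> ((x::real^'d) $ i)) * (x $ j * x $ k) \<partial>lborel)
      = (if j = k then \<sigma>\<^sup>2 else 0)" (is ?B)
    and integrable_gaussian_first: "integrable lborel
      (\<lambda>x::real^'d. (\<Prod>i\<in>UNIV. normal_density 0 \<sigma> (x $ i)) * x $ j)" (is ?C)
    and integral_gaussian_first: "(\<integral>x. (\<Prod>i\<in>UNIV. normal_density 0 \<sigma> ((x::real^'d) $ i)) * x $ j \<partial>lborel) = 0" (is ?D)
proof -
  let ?n = "normal_density 0 \<sigma>"
  \<comment> \<open>Exponents that write \<open>x\<^sub>j x\<^sub>k\<close> and \<open>x\<^sub>j\<close> as products over all coordinates.\<close>
  let ?p = "\<lambda>i. (if i = j then 1 else 0) + (if i = k then 1 else 0 :: nat)"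
  let ?q = "\<lambda>i. if i = j then 1 else 0 :: nat"
  have int: "integrable lborel (\<lambda>x. ?n x * x ^ p)" for p
    using integrable_normal_moment[OF assms, of 0 p] by simp
  have 1: "(\<integral>x. ?n x * x ^ 1 \<partial>lborel) = 0"
    using integral_normal_moment_nz_1[OF assms, of 0] by simp
  have 2: "(\<integral>x. ?n x * x ^ 2 \<partial>lborel) = \<sigma>\<^sup>2"
    using integral_normal_moment_even[OF assms, of 0 1] by (simp add: fact_numeral)
  have 0: "(\<integral>x. ?n x * x ^ 0 \<partial>lborel) = 1"
    using integral_normal_density[OF assms, of 0] by simp
  have pw: "(\<Prod>i\<in>UNIV. (x::real^'d) $ i ^ (if i = j then 1 else 0)) = x $ j" for x j
  proof -
    have "(\<Prod>i\<in>UNIV. (x::real^'d) $ i ^ (if i = j then 1 else 0)) = (\<Prod>i\<in>UNIV. if i = j then x $ i else 1)"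
      by (intro prod.cong) auto
    then show ?thesis by simp
  qed
  have P: "(\<Prod>i\<in>UNIV. ?n (x $ i) * (x $ i) ^ ?p i) = (\<Prod>i\<in>UNIV. ?n (x $ i)) * (x $ j * x $ k)" for x :: "real^'d"
    by (simp only: prod.distrib power_add pw)
  have Q: "(\<Prod>i\<in>UNIV. ?n (x $ i) * (x $ i) ^ ?q i) = (\<Prod>i\<in>UNIV. ?n (x $ i)) * x $ j" for x :: "real^'d"
    by (simp only: prod.distrib pw)
  show ?A using integrable_vec_prod[of "\<lambda>i x. ?n x * x ^ ?p i", OF int] unfolding P .
  show ?C using integrable_vec_prod[of "\<lambda>i x. ?n x * x ^ ?q i", OF int] unfolding Q .
  have "(\<Prod>i\<in>UNIV. (\<integral>x. ?n x * x ^ ?p i \<partial>lborel)) = (if j = k then \<sigma>\<^sup>2 else 0)"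
  proof (cases "j = k")
    case True
    have "(\<Prod>i\<in>UNIV. (\<integral>x. ?n x * x ^ ?p i \<partial>lborel)) = (\<Prod>i\<in>UNIV. if i = j then \<sigma>\<^sup>2 else 1)"
    proof (intro prod.cong refl)
      fix i show "(\<integral>x. ?n x * x ^ ?p i \<partial>lborel) = (if i = j then \<sigma>\<^sup>2 else 1)"
        using True 2 0 by (cases "i = j") (simp_all add: numeral_2_eq_2)
    qed
    then show ?thesis using True by simp
  next
    case False
    then have "(\<integral>x. ?n x * x ^ ?p j \<partial>lborel) = 0" using 1 by simp
    then have "(\<Prod>i\<in>UNIV. (\<integral>x. ?n x * x ^ ?p i \<partial>lborel)) = 0"
      by (rule prod_zero[OF finite bexI[OF _ UNIV_I]])
    then show ?thesis using False by simp
  qed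
  then show ?B using integral_vec_prod[of "\<lambda>i x. ?n x * x ^ ?p i", OF int] unfolding P by simp
  have "(\<integral>x. ?n x * x ^ ?q j \<partial>lborel) = 0" using 1 by simp
  then have "(\<Prod>i\<in>UNIV. (\<integral>x. ?n x * x ^ ?q i \<partial>lborel)) = 0"
    by (rule prod_zero[OF finite bexI[OF _ UNIV_I]])
  then show ?D using integral_vec_prod[of "\<lambda>i x. ?n x * x ^ ?q i", OF int] unfolding Q by simp
qed

locale brownian =
  fixes W :: "'w measure" and T :: real and B :: "real \<Rightarrow> 'w \<Rightarrow> real ^ 'd::finite"
    and P :: "'w measure" and F :: "real \<Rightarrow> 'w measure"
  assumes prob_W: "prob_space W" and brownian: "brownian_motion W T B" and T_pos: "T > 0"
    and P_def: "P = completion W" and F_def: "F = brownian_filtration P B"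
begin

sublocale prob_space P
  unfolding P_def using prob_W by (intro prob_spaceI) (simp add: prob_space.emeasure_space_1)

lemma space_P: "space P = space W"
  by (simp add: P_def)

lemma B_measurable_W: "t \<in> {0..T} \<Longrightarrow> B t \<in> borel_measurable W"
  using brownian by (auto simp: brownian_motion_def)

lemma B_measurable [measurable]: "t \<in> {0..T} \<Longrightarrow> B t \<in> borel_measurable P"
  unfolding P_def by (intro measurable_completion B_measurable_W)

lemma B_0: "\<omega> \<in> space P \<Longrightarrow> B 0 \<omega> = 0"
  using brownian by (auto simp: brownian_motion_def space_P)

lemma gen_subset: "t \<le> T \<Longrightarrow> {B s -` A \<inter> space P | s A. s \<in> {0..t} \<and> A \<in> sets borel} \<union> null_sets P \<subseteq> sets P"
  by (auto intro!: measurable_sets B_measurable)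

lemma gen_Pow: "{B s -` A \<inter> space P | s A. s \<in> {0..t} \<and> A \<in> sets borel} \<union> null_sets P \<subseteq> Pow (space P)"
  by (auto dest: sets.sets_into_space)

lemma space_F [simp]: "space (F t) = space P"
  by (simp add: F_def brownian_filtration_def space_measure_of_conv)

lemma sets_F: "sets (F t) = sigma_sets (space P)
    ({B s -` A \<inter> space P | s A. s \<in> {0..t} \<and> A \<in> sets borel} \<union> null_sets P)"
  unfolding F_def brownian_filtration_def by (intro sets_measure_of gen_Pow)

lemma sets_F_le: "t \<le> T \<Longrightarrow> sets (F t) \<subseteq> sets P"
  unfolding sets_F using gen_subset by (intro sets.sigma_sets_subset)

lemma sets_F_mono: "s \<le> t \<Longrightarrow> sets (F s) \<subseteq> sets (F t)"
  unfolding sets_F by (intro sigma_sets_mono' Un_mono subset_refl) fastforce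

lemma F_measurable_mono: "f \<in> measurable (F s) N \<Longrightarrow> s \<le> t \<Longrightarrow> f \<in> measurable (F t) N"
  using sets_F_mono[of s t] by (auto simp: measurable_def)

lemma F_measurable_P: "f \<in> measurable (F s) N \<Longrightarrow> s \<le> T \<Longrightarrow> f \<in> measurable P N"
  using sets_F_le[of s] by (auto simp: measurable_def)

lemma null_in_F: "A \<in> null_sets P \<Longrightarrow> A \<in> sets (F t)"
  unfolding sets_F by auto

lemma B_F_measurable: "0 \<le> s \<Longrightarrow> s \<le> t \<Longrightarrow> B s \<in> borel_measurable (F t)"
proof (rule measurableI)
  fix A :: "(real^'d) set" assume "A \<in> sets borel" "0 \<le> s" "s \<le> t"
  then have "B s -` A \<inter> space P \<in> sets (F t)" unfolding sets_F by (intro sigma_sets.Basic) auto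
  then show "B s -` A \<inter> space (F t) \<in> sets (F t)" by simp
qed simp

lemma increment_measurable: "a \<in> {0..T} \<Longrightarrow> b \<in> {0..T} \<Longrightarrow> (\<lambda>\<omega>. B b \<omega> - B a \<omega>) \<in> borel_measurable P"
  using B_measurable[of a] B_measurable[of b] by measurable

lemma
  assumes "0 \<le> a" "a \<le> b" "b \<le> T"
  shows integrable_increment: "integrable P (\<lambda>\<omega>. (B b \<omega> - B a \<omega>) $ j)" (is ?A)
    and expectation_increment: "expectation (\<lambda>\<omega>. (B b \<omega> - B a \<omega>) $ j) = 0" (is ?B)
    and integrable_increment_mult: "integrable P (\<lambda>\<omega>. (B b \<omega> - B a \<omega>) $ j * (B b \<omega> - B a \<omega>) $ k)" (is ?C)
    and expectation_increment_mult:
      "expectation (\<lambda>\<omega>. (B b \<omega> - B a \<omega>) $ j * (B b \<omega> - B a \<omega>) $ k) = (if j = k then b - a else 0)" (is ?D)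
proof -
  have "?A \<and> ?B \<and> ?C \<and> ?D"
  proof (cases "a = b")
    case True then show ?thesis by simp
  next
    case False
    define \<sigma> where "\<sigma> = sqrt (b - a)"
    have s: "\<sigma> > 0" and s2: "\<sigma>\<^sup>2 = b - a" using assms False by (auto simp: \<sigma>_def)
    let ?X = "\<lambda>\<omega>. B b \<omega> - B a \<omega>"
    let ?g = "\<lambda>x::real^'d. \<Prod>j\<in>UNIV. normal_density 0 \<sigma> (x $ j)"
    have D: "distributed W lborel ?X (\<lambda>x. ennreal (?g x))"
      using brownian assms False unfolding brownian_motion_def \<sigma>_def by auto
    have g: "?g x \<ge> 0" for x by (intro prod_nonneg) auto
    have X: "?X \<in> borel_measurable W"
      by (intro borel_measurable_diff B_measurable_W) (use assms in auto)
    have mm: "(\<lambda>\<omega>. ?X \<omega> $ j) \<in> borel_measurable W" "(\<lambda>\<omega>. ?X \<omega> $ j * ?X \<omega> $ k) \<in> borel_measurable W"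
      using measurable_compose[OF X, of "\<lambda>x. x $ j"] measurable_compose[OF X, of "\<lambda>x. x $ j * x $ k"]
      by simp_all
    have l: "(\<lambda>x::real^'d. x $ j) \<in> borel_measurable lborel" "(\<lambda>x::real^'d. x $ j * x $ k) \<in> borel_measurable lborel"
      by measurable
    show ?thesis
      unfolding P_def integrable_completion[OF mm(1)] integrable_completion[OF mm(2)]
        integral_completion[OF mm(1)] integral_completion[OF mm(2)]
      using distributed_integrable[OF D l(1)] distributed_integrable[OF D l(2)]
        distributed_integral[OF D l(1)] distributed_integral[OF D l(2)] g
        integrable_gaussian_mixed[OF s, of j k] integral_gaussian_mixed[OF s, of j k]
        integrable_gaussian_first[OF s, of j] integral_gaussian_first[OF s, of j] s2
      by (cases "j = k") simp_all
  qed
  then show ?A ?B ?C ?D by auto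
qed

text \<open>The values of \<open>B\<close> at finitely many times up to \<open>a\<close> are functions of increments that precede the
  increment from \<open>a\<close> to \<open>b\<close>, and increments over successive intervals are independent.\<close>

lemma cylinder_indep_increment:
  assumes S: "finite S" "S \<subseteq> {0..a}" and C: "\<And>s. s \<in> S \<Longrightarrow> C s \<in> sets borel"
    and ab: "0 \<le> a" "a \<le> b" "b \<le> T" and A: "A \<in> sets borel"
  shows "prob ({\<omega>\<in>space P. \<forall>s\<in>S. B s \<omega> \<in> C s} \<inter> ((\<lambda>\<omega>. B b \<omega> - B a \<omega>) -` A \<inter> space P))
    = prob {\<omega>\<in>space P. \<forall>s\<in>S. B s \<omega> \<in> C s} * prob ((\<lambda>\<omega>. B b \<omega> - B a \<omega>) -` A \<inter> space P)"
proof -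
  interpret W: prob_space W by (rule prob_W)
  \<comment> \<open>The times of the cylinder, with \<open>0\<close> and \<open>a\<close> added; followed by \<open>b\<close> they make the
    increment from \<open>a\<close> to \<open>b\<close> the last one.\<close>
  define xs where "xs = sorted_list_of_set (insert 0 (insert a S))"
  define n where "n = length xs"
  have set_xs: "set xs = insert 0 (insert a S)" and sorted: "sorted xs"
    using S(1) unfolding xs_def by (simp_all del: sorted_list_of_set_insert_remove)
  have n: "n > 0" using set_xs by (auto simp: n_def)
  have xs_range: "xs ! i \<in> {0..a}" if "i < n" for i
    using that S ab set_xs nth_mem[of i xs] by (auto simp: n_def)
  have xs_0: "xs ! 0 = 0"
  proof -
    obtain i where "i < n" "xs ! i = 0" using set_xs by (metis in_set_conv_nth insertI1 n_def)
    then show ?thesis using sorted_nth_mono[OF sorted, of 0 i] xs_range[of 0] n by (auto simp: n_def)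
  qed
  have xs_last: "xs ! (n - 1) = a"
  proof -
    obtain i where i: "i < n" "xs ! i = a" using set_xs by (metis in_set_conv_nth insert_iff n_def)
    then show ?thesis using sorted_nth_mono[OF sorted, of i "n - 1"] xs_range[of "n - 1"] n by (auto simp: n_def)
  qed
  define \<tau> where "\<tau> i = (if i < n then xs ! i else b)" for i
  have mono: "mono_on {..n} \<tau>"
  proof (rule mono_onI)
    fix r s assume "r \<in> {..n}" "s \<in> {..n}" "r \<le> s"
    then show "\<tau> r \<le> \<tau> s"
      using sorted_nth_mono[OF sorted, of r s] xs_range[of r] ab by (auto simp: \<tau>_def n_def)
  qed
  have range: "\<tau> ` {..n} \<subseteq> {0..T}"
    using xs_range ab by (fastforce simp: \<tau>_def)
  define D where "D i \<omega> = B (\<tau> (Suc i)) \<omega> - B (\<tau> i) \<omega>" for i \<omega>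
  have indep: "W.indep_vars (\<lambda>_. borel) D {..<n}"
    using brownian mono range unfolding brownian_motion_def D_def by blast
  let ?M = "\<lambda>I. PiM I (\<lambda>_. borel :: (real^'d) measure)"
  let ?J = "{..<n - 1}"
  have iv: "W.indep_var (?M ?J) (\<lambda>\<omega>. restrict (\<lambda>i. D i \<omega>) ?J) (?M {n - 1}) (\<lambda>\<omega>. restrict (\<lambda>i. D i \<omega>) {n - 1})"
    by (rule W.indep_var_restrict[OF indep]) (use n in auto)
  have "\<forall>s\<in>S. \<exists>i. i < n \<and> xs ! i = s"
    using set_xs by (metis in_set_conv_nth insert_iff n_def)
  then obtain idx where idx: "\<And>s. s \<in> S \<Longrightarrow> idx s < n \<and> xs ! idx s = s"
    by metis
  \<comment> \<open>Since \<open>B\<close> starts at \<open>0\<close>, the cylinder is a condition on the preceding increments.\<close>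
  define XE where "XE = {f\<in>space (?M ?J). \<forall>s\<in>S. (\<Sum>i<idx s. f i) \<in> C s}"
  define XA where "XA = {f\<in>space (?M {n - 1}). f (n - 1) \<in> A}"
  have XE: "XE \<in> sets (?M ?J)"
    unfolding XE_def
  proof (rule sets.sets_Collect_finite_All[OF _ S(1)])
    fix s assume s: "s \<in> S"
    have "(\<lambda>f. \<Sum>i<idx s. f i) \<in> borel_measurable (?M ?J)"
      using idx[OF s] by (intro borel_measurable_sum measurable_component_singleton) auto
    from measurable_sets[OF this C[OF s]]
    show "{f \<in> space (?M ?J). (\<Sum>i<idx s. f i) \<in> C s} \<in> sets (?M ?J)"
      by (simp add: vimage_def Int_def conj_commute)
  qed
  have XA: "XA \<in> sets (?M {n - 1})"
    unfolding XA_def using A by measurable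
  have sumD: "(\<Sum>i<j. D i \<omega>) = B (\<tau> j) \<omega>" if "\<omega> \<in> space W" for \<omega> j
    using sum_lessThan_telescope[of "\<lambda>i. B (\<tau> i) \<omega>" j] B_0[of \<omega>] that n xs_0
    by (simp add: D_def \<tau>_def space_P)
  have Bs: "(\<Sum>i<idx s. restrict (\<lambda>i. D i \<omega>) ?J i) = B s \<omega>" if "s \<in> S" "\<omega> \<in> space W" for s \<omega>
  proof -
    have "(\<Sum>i<idx s. restrict (\<lambda>i. D i \<omega>) ?J i) = (\<Sum>i<idx s. D i \<omega>)"
      using idx[OF that(1)] by (intro sum.cong) auto
    then show ?thesis using sumD[OF that(2), of "idx s"] idx[OF that(1)] by (simp add: \<tau>_def)
  qed
  have Xinc: "D (n - 1) \<omega> = B b \<omega> - B a \<omega>" for \<omega>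
    using n xs_last by (simp add: D_def \<tau>_def)
  have E: "(\<lambda>\<omega>. restrict (\<lambda>i. D i \<omega>) ?J) -` XE \<inter> space W = {\<omega>\<in>space P. \<forall>s\<in>S. B s \<omega> \<in> C s}"
    using Bs by (auto simp: XE_def space_P space_PiM simp del: restrict_apply)
  have X: "(\<lambda>\<omega>. restrict (\<lambda>i. D i \<omega>) {n - 1}) -` XA \<inter> space W = (\<lambda>\<omega>. B b \<omega> - B a \<omega>) -` A \<inter> space P"
    using Xinc by (auto simp: XA_def space_P space_PiM)
  have vimage_pair: "(\<lambda>x. (f x, g x)) -` (U \<times> V) \<inter> Z = (f -` U \<inter> Z) \<inter> (g -` V \<inter> Z)"
    for f :: "'w \<Rightarrow> 'u" and g :: "'w \<Rightarrow> 'v" and U V Z by auto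
  have mE: "{\<omega>\<in>space P. \<forall>s\<in>S. B s \<omega> \<in> C s} \<in> sets W"
    unfolding E[symmetric] using W.indep_var_rv1[OF iv] XE by (rule measurable_sets)
  have mX: "(\<lambda>\<omega>. B b \<omega> - B a \<omega>) -` A \<inter> space P \<in> sets W"
    unfolding X[symmetric] using W.indep_var_rv2[OF iv] XA by (rule measurable_sets)
  have mc: "prob A = W.prob A" if "A \<in> sets W" for A
    unfolding P_def by (rule measure_completion[OF that])
  have "W.prob ({\<omega>\<in>space P. \<forall>s\<in>S. B s \<omega> \<in> C s} \<inter> ((\<lambda>\<omega>. B b \<omega> - B a \<omega>) -` A \<inter> space P))
    = W.prob {\<omega>\<in>space P. \<forall>s\<in>S. B s \<omega> \<in> C s} * W.prob ((\<lambda>\<omega>. B b \<omega> - B a \<omega>) -` A \<inter> space P)"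
    by (rule W.indep_varD[OF iv XE XA, unfolded vimage_pair E X])
  then show ?thesis
    by (simp only: mc[OF mE] mc[OF mX] mc[OF sets.Int[OF mE mX]])
qed

text \<open>Cylinder events together with the null sets form a \<open>\<pi>\<close>-system that generates \<open>F a\<close>; independence
  of the increment extends from it to \<open>F a\<close>.\<close>

lemma F_indep_increment:
  fixes V :: "'w \<Rightarrow> real" and g :: "real ^ 'd \<Rightarrow> real"
  assumes ab: "0 \<le> a" "a \<le> b" "b \<le> T" and V: "V \<in> borel_measurable (F a)"
    and g: "g \<in> borel_measurable borel"
  shows "indep_var borel V borel (\<lambda>\<omega>. g (B b \<omega> - B a \<omega>))"
proof -
  let ?X = "\<lambda>\<omega>. B b \<omega> - B a \<omega>"
  have X: "?X \<in> borel_measurable P" using ab by (intro increment_measurable) auto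
  define cyl where "cyl = (\<lambda>(S, C). {\<omega>\<in>space P. \<forall>s\<in>S. B s \<omega> \<in> C s})"
  define GC where "GC = {(S, C). finite S \<and> S \<subseteq> {0..a} \<and> (\<forall>s\<in>S. C s \<in> sets (borel :: (real^'d) measure))}"
  define G where "G = cyl ` GC \<union> null_sets P"
  define HX where "HX = {?X -` A \<inter> space P | A. A \<in> sets borel}"
  have cyl: "cyl c \<in> events" if "c \<in> GC" for c
  proof -
    obtain S C where c: "c = (S, C)" by (metis surj_pair)
    then have S: "finite S" "S \<subseteq> {0..a}" "\<And>s. s \<in> S \<Longrightarrow> C s \<in> sets borel"
      using that by (auto simp: GC_def)
    have "{\<omega>\<in>space P. \<forall>s\<in>S. B s \<omega> \<in> C s} \<in> events"
    proof (rule sets.sets_Collect_finite_All[OF _ S(1)])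
      fix s assume s: "s \<in> S"
      then have "B s \<in> borel_measurable P" using S(2) ab by (intro B_measurable) auto
      from measurable_sets[OF this S(3)[OF s]] show "{\<omega>\<in>space P. B s \<omega> \<in> C s} \<in> events"
        by (simp add: vimage_def Int_def conj_commute)
    qed
    then show ?thesis by (simp add: cyl_def c)
  qed
  have cylInt: "cyl c \<inter> cyl c' \<in> cyl ` GC" if "c \<in> GC" "c' \<in> GC" for c c'
  proof -
    obtain S C S' C' where c: "c = (S, C)" "c' = (S', C')" by (metis surj_pair)
    define C'' where "C'' s = (if s \<in> S then C s else UNIV) \<inter> (if s \<in> S' then C' s else UNIV)" for s
    have "cyl c \<inter> cyl c' = cyl (S \<union> S', C'')"
      by (auto simp: cyl_def c C''_def)
    moreover have "(S \<union> S', C'') \<in> GC" using that by (auto simp: GC_def c C''_def)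
    ultimately show ?thesis by auto
  qed
  have nullInt: "N \<inter> A \<in> null_sets P" if "N \<in> null_sets P" "A \<in> events" for N A
    using that by (intro null_sets_subset[of N P "N \<inter> A"]) auto
  have "indep_set G HX"
  proof (rule indep_setI)
    show "G \<subseteq> events" using cyl by (auto simp: G_def)
    show "HX \<subseteq> events" using X by (auto simp: HX_def)
    fix E Q assume E: "E \<in> G" and Q: "Q \<in> HX"
    then have Qev: "Q \<in> events" using \<open>HX \<subseteq> events\<close> by auto
    show "prob (E \<inter> Q) = prob E * prob Q"
    proof (cases "E \<in> null_sets P")
      case True
      then have "prob E = 0" "prob (E \<inter> Q) = 0" using nullInt[OF True Qev]
        by (auto simp: null_sets_def measure_def)
      then show ?thesis by simp
    next
      case False
      then obtain S C where "E = cyl (S, C)" "(S, C) \<in> GC" using E by (auto simp: G_def)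
      then show ?thesis using Q cylinder_indep_increment[of S a C b] ab
        by (auto simp: GC_def cyl_def HX_def)
    qed
  qed
  moreover have "Int_stable G"
  proof (rule Int_stableI)
    fix E E' assume "E \<in> G" "E' \<in> G"
    then show "E \<inter> E' \<in> G"
      unfolding G_def using cylInt nullInt cyl by (auto simp: Int_commute)
  qed
  moreover have "Int_stable HX"
  proof (rule Int_stableI)
    fix E E' assume "E \<in> HX" "E' \<in> HX"
    then obtain A A' where "E = ?X -` A \<inter> space P" "E' = ?X -` A' \<inter> space P" "A \<in> sets borel" "A' \<in> sets borel"
      by (auto simp: HX_def)
    then have "E \<inter> E' = ?X -` (A \<inter> A') \<inter> space P \<and> A \<inter> A' \<in> sets borel" by auto
    then show "E \<inter> E' \<in> HX" unfolding HX_def by blast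
  qed
  ultimately have ind: "indep_set (sigma_sets (space P) G) (sigma_sets (space P) HX)"
    by (rule indep_set_sigma_sets)
  have FG: "sets (F a) \<subseteq> sigma_sets (space P) G"
    unfolding sets_F
  proof (rule sigma_sets_mono')
    have "B s -` A \<inter> space P \<in> cyl ` GC" if "s \<in> {0..a}" "A \<in> sets borel" for s A
    proof -
      have "B s -` A \<inter> space P = cyl ({s}, \<lambda>_. A)" "({s}, \<lambda>_. A) \<in> GC"
        using that by (auto simp: cyl_def GC_def)
      then show ?thesis by blast
    qed
    then show "{B s -` A \<inter> space P |s A. s \<in> {0..a} \<and> A \<in> sets borel} \<union> null_sets P \<subseteq> G"
      by (auto simp: G_def)
  qed
  have gX: "(\<lambda>\<omega>. g (?X \<omega>)) \<in> borel_measurable P" by (rule measurable_compose[OF X g])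
  let ?SV = "sigma_sets (space P) {V -` A \<inter> space P | A. A \<in> sets borel}"
  let ?SX = "sigma_sets (space P) {(\<lambda>\<omega>. g (?X \<omega>)) -` A \<inter> space P | A. A \<in> sets borel}"
  have subV: "?SV \<subseteq> sets (F a)"
  proof -
    have "{V -` A \<inter> space P | A. A \<in> sets borel} \<subseteq> sets (F a)"
      using measurable_sets[OF V] by auto
    from sets.sigma_sets_subset[OF this] show ?thesis by simp
  qed
  have subX: "?SX \<subseteq> sigma_sets (space P) HX"
  proof (rule sigma_sets_mono')
    have "(\<lambda>\<omega>. g (?X \<omega>)) -` A \<inter> space P = ?X -` (g -` A) \<inter> space P \<and> g -` A \<in> sets borel"
      if "A \<in> sets borel" for A using measurable_sets[OF g that] by auto
    then show "{(\<lambda>\<omega>. g (?X \<omega>)) -` A \<inter> space P | A. A \<in> sets borel} \<subseteq> HX"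
      unfolding HX_def by blast
  qed
  have "indep_set ?SV ?SX"
  proof (rule indep_setI)
    show "?SV \<subseteq> events" using subV sets_F_le[of a] ab by auto
    show "?SX \<subseteq> events" using indep_setD_ev2[OF ind] subX by auto
    show "prob (x \<inter> y) = prob x * prob y" if "x \<in> ?SV" "y \<in> ?SX" for x y
      using that subV subX FG by (intro indep_setD[OF ind]) auto
  qed
  then show ?thesis
    unfolding indep_var_eq using gX F_measurable_P[OF V] ab by auto
qed

text \<open>Conditional mean and covariance of an increment, in the form in which they are used: tested
  against a variable known at its start.\<close>

lemma F_orthogonal_increment:
  fixes V :: "'w \<Rightarrow> real"
  assumes ab: "0 \<le> a" "a \<le> b" "b \<le> T" and V: "V \<in> borel_measurable (F a)" "integrable P V"
  shows "integrable P (\<lambda>\<omega>. V \<omega> * (B b \<omega> - B a \<omega>) $ j)"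
    and "expectation (\<lambda>\<omega>. V \<omega> * (B b \<omega> - B a \<omega>) $ j) = 0"
    and "integrable P (\<lambda>\<omega>. V \<omega> * ((B b \<omega> - B a \<omega>) $ j * (B b \<omega> - B a \<omega>) $ k))"
    and "expectation (\<lambda>\<omega>. V \<omega> * ((B b \<omega> - B a \<omega>) $ j * (B b \<omega> - B a \<omega>) $ k))
      = expectation V * (if j = k then b - a else 0)"
proof -
  have 1: "indep_var borel V borel (\<lambda>\<omega>. (B b \<omega> - B a \<omega>) $ j)"
    by (rule F_indep_increment[OF ab V(1), of "\<lambda>x. x $ j"]) measurable
  have 2: "indep_var borel V borel (\<lambda>\<omega>. (B b \<omega> - B a \<omega>) $ j * (B b \<omega> - B a \<omega>) $ k)"
    by (rule F_indep_increment[OF ab V(1), of "\<lambda>x. x $ j * x $ k"]) measurable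
  note i1 = integrable_increment[OF ab, of j] and i2 = integrable_increment_mult[OF ab, of j k]
  show "integrable P (\<lambda>\<omega>. V \<omega> * (B b \<omega> - B a \<omega>) $ j)"
    using indep_var_integrable[OF 1 V(2) i1] .
  show "expectation (\<lambda>\<omega>. V \<omega> * (B b \<omega> - B a \<omega>) $ j) = 0"
    using indep_var_lebesgue_integral[OF 1 V(2) i1] expectation_increment[OF ab, of j] by simp
  show "integrable P (\<lambda>\<omega>. V \<omega> * ((B b \<omega> - B a \<omega>) $ j * (B b \<omega> - B a \<omega>) $ k))"
    using indep_var_integrable[OF 2 V(2) i2] .
  show "expectation (\<lambda>\<omega>. V \<omega> * ((B b \<omega> - B a \<omega>) $ j * (B b \<omega> - B a \<omega>) $ k))
      = expectation V * (if j = k then b - a else 0)"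
    using indep_var_lebesgue_integral[OF 2 V(2) i2] expectation_increment_mult[OF ab, of j k] by simp
qed

end

section \<open>Isometry and martingale property of the Ito integral\<close>

lemma columns_times_real: "columns_times z b = z \<bullet> b" for z :: "real ^ 'd::finite"
  by (simp add: columns_times_def inner_vec_def mult.commute)

context brownian
begin

text \<open>The coefficients \<open>\<zeta>\<close> of a block \<open>\<zeta> 1\<^bsub>(a, b]\<^esub>\<close> of a simple integrand.\<close>

definition bounded_at :: "real \<Rightarrow> ('w \<Rightarrow> real ^ 'd) \<Rightarrow> bool" where
  "bounded_at a \<zeta> \<longleftrightarrow> \<zeta> \<in> borel_measurable (F a) \<and> (\<exists>C. \<forall>\<omega>\<in>space P. norm (\<zeta> \<omega>) \<le> C)"

lemma bounded_at_mono: "bounded_at a \<zeta> \<Longrightarrow> a \<le> b \<Longrightarrow> bounded_at b \<zeta>"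
  unfolding bounded_at_def using F_measurable_mono by blast

lemma bounded_at_component:
  assumes "bounded_at a \<zeta>" "a \<le> T"
  shows "(\<lambda>\<omega>. \<zeta> \<omega> $ j) \<in> borel_measurable (F a)" "(\<lambda>\<omega>. \<zeta> \<omega> $ j) \<in> borel_measurable P"
    "\<exists>C. \<forall>\<omega>\<in>space P. \<bar>\<zeta> \<omega> $ j\<bar> \<le> C"
proof -
  show m: "(\<lambda>\<omega>. \<zeta> \<omega> $ j) \<in> borel_measurable (F a)"
    using assms unfolding bounded_at_def by (intro measurable_compose[of \<zeta> _ borel "\<lambda>x. x $ j"]) auto
  then show "(\<lambda>\<omega>. \<zeta> \<omega> $ j) \<in> borel_measurable P" using assms F_measurable_P by blast
  show "\<exists>C. \<forall>\<omega>\<in>space P. \<bar>\<zeta> \<omega> $ j\<bar> \<le> C"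
    using assms component_le_norm_cart order_trans unfolding bounded_at_def by metis
qed

lemma integrable_bounded_mult:
  fixes f g :: "'w \<Rightarrow> real"
  assumes "f \<in> borel_measurable P" "\<exists>C. \<forall>\<omega>\<in>space P. \<bar>f \<omega>\<bar> \<le> C" "integrable P g"
  shows "integrable P (\<lambda>\<omega>. f \<omega> * g \<omega>)"
proof -
  obtain C where "\<forall>\<omega>\<in>space P. \<bar>f \<omega>\<bar> \<le> C" using assms(2) by blast
  then have "AE \<omega> in P. norm (f \<omega> * g \<omega>) \<le> norm (C * g \<omega>)"
    unfolding real_norm_def abs_mult by (intro AE_I2 mult_right_mono) (auto intro: order_trans[OF _ abs_ge_self])
  then show ?thesis
    by (rule Bochner_Integration.integrable_bound[rotated 2])
      (use assms borel_measurable_integrable[OF assms(3)] in auto)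
qed

lemma block_common_start:
  assumes \<zeta>: "bounded_at c \<zeta>" and \<eta>: "bounded_at c \<eta>" and bd: "0 \<le> c" "c \<le> b" "b \<le> T"
  shows "integrable P (\<lambda>\<omega>. (\<zeta> \<omega> \<bullet> (B b \<omega> - B c \<omega>)) * (\<eta> \<omega> \<bullet> (B b \<omega> - B c \<omega>)))"
    and "expectation (\<lambda>\<omega>. (\<zeta> \<omega> \<bullet> (B b \<omega> - B c \<omega>)) * (\<eta> \<omega> \<bullet> (B b \<omega> - B c \<omega>)))
      = expectation (\<lambda>\<omega>. \<zeta> \<omega> \<bullet> \<eta> \<omega>) * (b - c)"
proof -
  have cT: "c \<le> T" using bd by simp
  let ?V = "\<lambda>j k \<omega>. \<zeta> \<omega> $ j * \<eta> \<omega> $ k"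
  let ?X = "\<lambda>\<omega>. B b \<omega> - B c \<omega>"
  have V: "?V j k \<in> borel_measurable (F c)" for j k
    using bounded_at_component(1)[OF \<zeta> cT, of j] bounded_at_component(1)[OF \<eta> cT, of k] by measurable
  have "integrable P (\<lambda>\<omega>. \<zeta> \<omega> $ j * (\<eta> \<omega> $ k * 1))" for j k
    by (intro integrable_bounded_mult bounded_at_component(2,3)[OF \<zeta> cT] bounded_at_component(2,3)[OF \<eta> cT]) simp
  then have Vi: "integrable P (?V j k)" for j k by simp
  have expand: "(\<zeta> \<omega> \<bullet> ?X \<omega>) * (\<eta> \<omega> \<bullet> ?X \<omega>) = (\<Sum>j\<in>UNIV. \<Sum>k\<in>UNIV. ?V j k \<omega> * (?X \<omega> $ j * ?X \<omega> $ k))" for \<omega>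
    unfolding inner_vec_def sum_product by (intro sum.cong refl) (simp add: mult_ac)
  note O = F_orthogonal_increment(3,4)[OF bd V Vi]
  show "integrable P (\<lambda>\<omega>. (\<zeta> \<omega> \<bullet> ?X \<omega>) * (\<eta> \<omega> \<bullet> ?X \<omega>))"
    unfolding expand by (intro Bochner_Integration.integrable_sum O(1))
  have "expectation (\<lambda>\<omega>. (\<zeta> \<omega> \<bullet> ?X \<omega>) * (\<eta> \<omega> \<bullet> ?X \<omega>))
     = (\<Sum>j\<in>UNIV. \<Sum>k\<in>UNIV. expectation (?V j k) * (if j = k then b - c else 0))"
    unfolding expand
    by (simp only: Bochner_Integration.integral_sum Bochner_Integration.integrable_sum O(1) O(2))
  also have "\<dots> = (\<Sum>j\<in>UNIV. expectation (?V j j) * (b - c))"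
    by (intro sum.cong refl) (simp add: if_distrib cong: if_cong)
  also have "\<dots> = expectation (\<lambda>\<omega>. \<Sum>j\<in>UNIV. ?V j j \<omega>) * (b - c)"
    unfolding sum_distrib_right[symmetric] by (subst Bochner_Integration.integral_sum) (auto intro: Vi)
  finally show "expectation (\<lambda>\<omega>. (\<zeta> \<omega> \<bullet> ?X \<omega>) * (\<eta> \<omega> \<bullet> ?X \<omega>)) = expectation (\<lambda>\<omega>. \<zeta> \<omega> \<bullet> \<eta> \<omega>) * (b - c)"
    by (simp add: inner_vec_def)
qed

lemma block_F_measurable:
  assumes \<zeta>: "bounded_at a \<zeta>" and ab: "0 \<le> a" "a \<le> b"
  shows "(\<lambda>\<omega>. \<zeta> \<omega> \<bullet> (B b \<omega> - B a \<omega>)) \<in> borel_measurable (F b)"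
proof -
  have "\<zeta> \<in> borel_measurable (F b)"
    using \<zeta> ab F_measurable_mono unfolding bounded_at_def by blast
  moreover have "B b \<in> borel_measurable (F b)" "B a \<in> borel_measurable (F b)"
    using ab by (auto intro: B_F_measurable)
  ultimately show ?thesis by measurable
qed

lemma block_L2:
  assumes \<zeta>: "bounded_at a \<zeta>" and ab: "0 \<le> a" "a \<le> b" "b \<le> T"
  shows "(\<lambda>\<omega>. \<zeta> \<omega> \<bullet> (B b \<omega> - B a \<omega>)) \<in> L2 P"
  using block_common_start(1)[OF \<zeta> \<zeta> ab] F_measurable_P[OF block_F_measurable[OF \<zeta> ab(1,2)] ab(3)]
  by (simp add: L2_real_iff power2_eq_square)

lemma block_orthogonal:
  assumes V: "V \<in> borel_measurable (F c)" "V \<in> L2 P" and \<eta>: "bounded_at c \<eta>" and cd: "0 \<le> c" "c \<le> d" "d \<le> T"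
  shows "expectation (\<lambda>\<omega>. V \<omega> * (\<eta> \<omega> \<bullet> (B d \<omega> - B c \<omega>))) = 0"
proof -
  have cT: "c \<le> T" using cd by simp
  let ?V = "\<lambda>j \<omega>. \<eta> \<omega> $ j * V \<omega>"
  have Vm: "?V j \<in> borel_measurable (F c)" for j
    using bounded_at_component(1)[OF \<eta> cT, of j] V by measurable
  have Vi: "integrable P (?V j)" for j
    by (intro integrable_bounded_mult bounded_at_component(2,3)[OF \<eta> cT] L2_integrable V)
  note O = F_orthogonal_increment(1,2)[OF cd Vm Vi]
  have "expectation (\<lambda>\<omega>. V \<omega> * (\<eta> \<omega> \<bullet> (B d \<omega> - B c \<omega>)))
    = expectation (\<lambda>\<omega>. \<Sum>j\<in>UNIV. ?V j \<omega> * (B d \<omega> - B c \<omega>) $ j)"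
    by (intro Bochner_Integration.integral_cong refl)
      (auto simp: inner_vec_def sum_distrib_left mult_ac intro!: sum.cong)
  also have "\<dots> = 0"
    by (simp only: Bochner_Integration.integral_sum O(1) O(2)) simp
  finally show ?thesis .
qed

text \<open>The longer increment is cut at \<open>b\<close>; its second part is orthogonal to everything known at \<open>b\<close>.\<close>

lemma block_common_start_le:
  assumes \<zeta>: "bounded_at c \<zeta>" and \<eta>: "bounded_at c \<eta>" and bd: "0 \<le> c" "c \<le> b" "b \<le> d" "d \<le> T"
  shows "expectation (\<lambda>\<omega>. (\<zeta> \<omega> \<bullet> (B b \<omega> - B c \<omega>)) * (\<eta> \<omega> \<bullet> (B d \<omega> - B c \<omega>)))
      = expectation (\<lambda>\<omega>. \<zeta> \<omega> \<bullet> \<eta> \<omega>) * (b - c)"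
proof -
  have bT: "b \<le> T" and b0: "0 \<le> b" using bd by auto
  let ?V = "\<lambda>\<omega>. \<zeta> \<omega> \<bullet> (B b \<omega> - B c \<omega>)"
  have V: "?V \<in> L2 P" by (rule block_L2[OF \<zeta> bd(1,2) bT])
  have \<eta>b: "bounded_at b \<eta>" by (rule bounded_at_mono[OF \<eta> bd(2)])
  have W: "(\<lambda>\<omega>. \<eta> \<omega> \<bullet> (B d \<omega> - B b \<omega>)) \<in> L2 P" by (rule block_L2[OF \<eta>b b0 bd(3,4)])
  have "expectation (\<lambda>\<omega>. ?V \<omega> * (\<eta> \<omega> \<bullet> (B d \<omega> - B c \<omega>)))
      = expectation (\<lambda>\<omega>. ?V \<omega> * (\<eta> \<omega> \<bullet> (B b \<omega> - B c \<omega>)) + ?V \<omega> * (\<eta> \<omega> \<bullet> (B d \<omega> - B b \<omega>)))"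
    by (intro Bochner_Integration.integral_cong refl) (simp add: inner_diff_right algebra_simps)
  also have "\<dots> = expectation (\<lambda>\<omega>. ?V \<omega> * (\<eta> \<omega> \<bullet> (B b \<omega> - B c \<omega>))) + expectation (\<lambda>\<omega>. ?V \<omega> * (\<eta> \<omega> \<bullet> (B d \<omega> - B b \<omega>)))"
    by (intro Bochner_Integration.integral_add block_common_start(1)[OF \<zeta> \<eta> bd(1,2) bT] L2_mult_integrable V W)
  also have "\<dots> = expectation (\<lambda>\<omega>. \<zeta> \<omega> \<bullet> \<eta> \<omega>) * (b - c)"
    using block_common_start(2)[OF \<zeta> \<eta> bd(1,2) bT]
      block_orthogonal[OF block_F_measurable[OF \<zeta> bd(1,2)] V \<eta>b b0 bd(3,4)] by simp
  finally show ?thesis .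
qed

lemma block_product_ordered:
  assumes \<zeta>: "bounded_at a \<zeta>" and \<eta>: "bounded_at c \<eta>"
    and ab: "0 \<le> a" "a \<le> b" "b \<le> T" and cd: "c \<le> d" "d \<le> T" and ac: "a \<le> c"
  shows "expectation (\<lambda>\<omega>. (\<zeta> \<omega> \<bullet> (B b \<omega> - B a \<omega>)) * (\<eta> \<omega> \<bullet> (B d \<omega> - B c \<omega>)))
      = expectation (\<lambda>\<omega>. \<zeta> \<omega> \<bullet> \<eta> \<omega>) * max 0 (min b d - c)"
proof (cases "b \<le> c")
  case True
  have "(\<lambda>\<omega>. \<zeta> \<omega> \<bullet> (B b \<omega> - B a \<omega>)) \<in> borel_measurable (F c)"
    using block_F_measurable[OF \<zeta> ab(1,2)] True by (rule F_measurable_mono)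
  from block_orthogonal[OF this block_L2[OF \<zeta> ab] \<eta>] show ?thesis using True ab cd ac by simp
next
  case False
  then have cb: "c \<le> b" and c0: "0 \<le> c" and cT: "c \<le> T" using ab cd ac by auto
  have \<zeta>c: "bounded_at c \<zeta>" by (rule bounded_at_mono[OF \<zeta> ac])
  let ?Y = "\<lambda>\<omega>. \<eta> \<omega> \<bullet> (B d \<omega> - B c \<omega>)"
  have Y: "?Y \<in> L2 P" by (rule block_L2[OF \<eta> c0 cd])
  \<comment> \<open>The block over \<open>(a, b]\<close> is cut at \<open>c\<close>; its first part is known at \<open>c\<close> and so orthogonal to the
    other block.\<close>
  have X1: "(\<lambda>\<omega>. \<zeta> \<omega> \<bullet> (B c \<omega> - B a \<omega>)) \<in> L2 P" by (rule block_L2[OF \<zeta> ab(1) ac cT])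
  have X2: "(\<lambda>\<omega>. \<zeta> \<omega> \<bullet> (B b \<omega> - B c \<omega>)) \<in> L2 P" by (rule block_L2[OF \<zeta>c c0 cb ab(3)])
  have "expectation (\<lambda>\<omega>. (\<zeta> \<omega> \<bullet> (B b \<omega> - B a \<omega>)) * ?Y \<omega>)
     = expectation (\<lambda>\<omega>. (\<zeta> \<omega> \<bullet> (B c \<omega> - B a \<omega>)) * ?Y \<omega> + (\<zeta> \<omega> \<bullet> (B b \<omega> - B c \<omega>)) * ?Y \<omega>)"
    by (intro Bochner_Integration.integral_cong refl) (simp add: inner_diff_right algebra_simps)
  also have "\<dots> = expectation (\<lambda>\<omega>. (\<zeta> \<omega> \<bullet> (B c \<omega> - B a \<omega>)) * ?Y \<omega>) + expectation (\<lambda>\<omega>. (\<zeta> \<omega> \<bullet> (B b \<omega> - B c \<omega>)) * ?Y \<omega>)"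
    by (intro Bochner_Integration.integral_add L2_mult_integrable X1 X2 Y)
  also have "expectation (\<lambda>\<omega>. (\<zeta> \<omega> \<bullet> (B c \<omega> - B a \<omega>)) * ?Y \<omega>) = 0"
    by (rule block_orthogonal[OF block_F_measurable[OF \<zeta> ab(1) ac] X1 \<eta> c0 cd])
  also have "expectation (\<lambda>\<omega>. (\<zeta> \<omega> \<bullet> (B b \<omega> - B c \<omega>)) * ?Y \<omega>) = expectation (\<lambda>\<omega>. \<zeta> \<omega> \<bullet> \<eta> \<omega>) * (min b d - c)"
  proof (cases "b \<le> d")
    case True
    then show ?thesis using block_common_start_le[OF \<zeta>c \<eta> c0 cb True cd(2)] by simp
  next
    case False
    then show ?thesis using block_common_start_le[OF \<eta> \<zeta>c c0 cd(1) _ ab(3)]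
      by (simp add: mult.commute inner_commute)
  qed
  finally show ?thesis using cb cd by simp
qed

text \<open>The isometry in polarised form; the factor is the length of the intersection of \<open>(a, b]\<close> and
  \<open>(c, d]\<close>. Stating it for two arbitrary intervals makes it applicable to differences of simple
  processes on unrelated grids.\<close>

lemma block_product:
  assumes \<zeta>: "bounded_at a \<zeta>" and \<eta>: "bounded_at c \<eta>"
    and ab: "0 \<le> a" "a \<le> b" "b \<le> T" and cd: "0 \<le> c" "c \<le> d" "d \<le> T"
  shows "expectation (\<lambda>\<omega>. (\<zeta> \<omega> \<bullet> (B b \<omega> - B a \<omega>)) * (\<eta> \<omega> \<bullet> (B d \<omega> - B c \<omega>)))
      = expectation (\<lambda>\<omega>. \<zeta> \<omega> \<bullet> \<eta> \<omega>) * max 0 (min b d - max a c)"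
proof (cases "a \<le> c")
  case True
  then show ?thesis using block_product_ordered[OF \<zeta> \<eta> ab cd(2,3) True] by simp
next
  case False
  then have "c \<le> a" by simp
  from block_product_ordered[OF \<eta> \<zeta> cd ab(2,3) this] show ?thesis
    using False by (simp add: mult.commute inner_commute min.commute)
qed

text \<open>Both sides are quadratic in the family of blocks, so that the polarised isometry gives them
  term by term. The blocks may overlap.\<close>

lemma block_isometry:
  assumes I: "finite I" and \<zeta>: "\<And>i. i \<in> I \<Longrightarrow> bounded_at (a i) (\<zeta> i)"
    and ab: "\<And>i. i \<in> I \<Longrightarrow> 0 \<le> a i \<and> a i \<le> b i \<and> b i \<le> T"
  shows "time_moment P T 2 (\<lambda>s \<omega>. \<Sum>i\<in>I. indicator {a i<..b i} s *\<^sub>R \<zeta> i \<omega>)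
    = (\<integral>\<^sup>+\<omega>. ennreal ((\<Sum>i\<in>I. \<zeta> i \<omega> \<bullet> (B (b i) \<omega> - B (a i) \<omega>))\<^sup>2) \<partial>P)"
proof -
  let ?\<Phi> = "\<lambda>s \<omega>. \<Sum>i\<in>I. indicator {a i<..b i} s *\<^sub>R \<zeta> i \<omega>"
  let ?X = "\<lambda>i \<omega>. \<zeta> i \<omega> \<bullet> (B (b i) \<omega> - B (a i) \<omega>)"
  define l where "l i j = max 0 (min (b i) (b j) - max (a i) (a j))" for i j
  define Q where "Q \<omega> = (\<Sum>i\<in>I. \<Sum>j\<in>I. (\<zeta> i \<omega> \<bullet> \<zeta> j \<omega>) * l i j)" for \<omega>
  have ind: "integrable lborel (\<lambda>s. indicat_real ({a i<..b i} \<inter> {a j<..b j}) s)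
      \<and> (LBINT s. indicat_real ({a i<..b i} \<inter> {a j<..b j}) s) = l i j" for i j
  proof -
    have eq: "{a i<..b i} \<inter> {a j<..b j} = {max (a i) (a j)<..min (b i) (b j)}" by auto
    show ?thesis unfolding eq l_def by (auto simp: max_def)
  qed
  have sq: "(norm (?\<Phi> s \<omega>))\<^sup>2 = (\<Sum>i\<in>I. \<Sum>j\<in>I. (\<zeta> i \<omega> \<bullet> \<zeta> j \<omega>) * indicat_real ({a i<..b i} \<inter> {a j<..b j}) s)" for s \<omega>
    unfolding power2_norm_eq_inner inner_sum_left inner_sum_right
    by (intro sum.cong refl) (simp add: indicator_inter_arith mult_ac inner_commute del: Int_greaterThanAtMost)
  have sqi: "integrable lborel (\<lambda>s. (norm (?\<Phi> s \<omega>))\<^sup>2)" and sqv: "(LBINT s. (norm (?\<Phi> s \<omega>))\<^sup>2) = Q \<omega>" for \<omega>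
    unfolding sq Q_def using ind by (simp_all add: Bochner_Integration.integral_sum)
  have Q_nonneg: "0 \<le> Q \<omega>" for \<omega> unfolding sqv[symmetric] by (intro Bochner_Integration.integral_nonneg) auto
  have inner: "(\<integral>\<^sup>+s\<in>{0..T}. ennreal ((norm (?\<Phi> s \<omega>))\<^sup>2) \<partial>lborel) = ennreal (Q \<omega>)" for \<omega>
  proof -
    have "?\<Phi> s \<omega> = 0" if "s \<notin> {0..T}" for s
      using that ab by (intro sum.neutral ballI) (force simp: indicator_def)
    then have "(\<integral>\<^sup>+s\<in>{0..T}. ennreal ((norm (?\<Phi> s \<omega>))\<^sup>2) \<partial>lborel) = (\<integral>\<^sup>+s. ennreal ((norm (?\<Phi> s \<omega>))\<^sup>2) \<partial>lborel)"
      by (intro nn_integral_cong) (auto simp: indicator_def)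
    also have "\<dots> = ennreal (Q \<omega>)"
      unfolding sqv[symmetric] by (rule nn_integral_eq_integral[OF sqi]) simp
    finally show ?thesis .
  qed
  have XL2: "?X i \<in> L2 P" if "i \<in> I" for i using block_L2[OF \<zeta>[OF that]] ab[OF that] by blast
  have zz: "integrable P (\<lambda>\<omega>. \<zeta> i \<omega> \<bullet> \<zeta> j \<omega>)" if ij: "i \<in> I" "j \<in> I" for i j
  proof -
    have aT: "a i \<le> T" "a j \<le> T" using ab ij by force+
    have "integrable P (\<lambda>\<omega>. \<zeta> i \<omega> $ k * (\<zeta> j \<omega> $ k * 1))" for k
      by (intro integrable_bounded_mult bounded_at_component(2,3)[OF \<zeta>[OF ij(1)] aT(1)]
          bounded_at_component(2,3)[OF \<zeta>[OF ij(2)] aT(2)]) simp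
    then show ?thesis by (auto simp: inner_vec_def)
  qed
  have Qi: "integrable P Q" unfolding Q_def using zz by (intro Bochner_Integration.integrable_sum) auto
  have S: "(\<lambda>\<omega>. \<Sum>i\<in>I. ?X i \<omega>) \<in> L2 P" by (intro L2_sum XL2)
  have prod: "integrable P (\<lambda>\<omega>. ?X i \<omega> * ?X j \<omega>)" if "i \<in> I" "j \<in> I" for i j
    using that by (intro L2_mult_integrable XL2)
  have "expectation (\<lambda>\<omega>. (\<Sum>i\<in>I. ?X i \<omega>)\<^sup>2) = expectation (\<lambda>\<omega>. \<Sum>i\<in>I. \<Sum>j\<in>I. ?X i \<omega> * ?X j \<omega>)"
    unfolding power2_eq_square sum_product ..
  also have "\<dots> = (\<Sum>i\<in>I. \<Sum>j\<in>I. expectation (\<lambda>\<omega>. ?X i \<omega> * ?X j \<omega>))"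
    using prod by (simp add: Bochner_Integration.integral_sum)
  also have "\<dots> = (\<Sum>i\<in>I. \<Sum>j\<in>I. expectation (\<lambda>\<omega>. \<zeta> i \<omega> \<bullet> \<zeta> j \<omega>) * l i j)"
    unfolding l_def by (intro sum.cong refl block_product \<zeta>) (use ab in auto)
  also have "\<dots> = expectation Q"
    unfolding Q_def using zz by (simp add: Bochner_Integration.integral_sum)
  finally have E: "expectation (\<lambda>\<omega>. (\<Sum>i\<in>I. ?X i \<omega>)\<^sup>2) = expectation Q" .
  have "time_moment P T 2 ?\<Phi> = (\<integral>\<^sup>+\<omega>. ennreal (Q \<omega>) \<partial>P)"
    unfolding time_moment_def inner ..
  also have "\<dots> = ennreal (expectation Q)" by (rule nn_integral_eq_integral[OF Qi]) (simp add: Q_nonneg)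
  also have "\<dots> = (\<integral>\<^sup>+\<omega>. ennreal ((\<Sum>i\<in>I. ?X i \<omega>)\<^sup>2) \<partial>P)"
    unfolding E[symmetric] using S by (intro nn_integral_eq_integral[symmetric]) (auto simp: L2_real_iff)
  finally show ?thesis .
qed

lemma simple_integrand_bounded_at:
  assumes "simple_integrand T F m \<tau> \<zeta>" "i < m"
  shows "bounded_at (\<tau> i) (\<zeta> i)"
  using assms unfolding simple_integrand_def bounded_at_def bounded_iff by auto

lemma simple_integrand_times:
  assumes "simple_integrand T F m \<tau> \<zeta>" "i < m"
  shows "0 \<le> \<tau> i" "\<tau> i \<le> \<tau> (Suc i)" "\<tau> (Suc i) \<le> T"
proof -
  have m: "mono_on {..m} \<tau>" and r: "\<tau> ` {..m} \<subseteq> {0..T}"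
    using assms(1) by (auto simp: simple_integrand_def)
  show "\<tau> i \<le> \<tau> (Suc i)" using mono_onD[OF m, of i "Suc i"] assms(2) by simp
  have "\<tau> i \<in> {0..T}" "\<tau> (Suc i) \<in> {0..T}" using r assms(2) by (auto simp: image_subset_iff)
  then show "0 \<le> \<tau> i" "\<tau> (Suc i) \<le> T" by auto
qed

text \<open>An increment of the integral over \<open>[a, b]\<close> is again a sum over blocks, with the grid clipped to
  \<open>[a, b]\<close>.\<close>

lemma simple_ito_increment:
  fixes \<zeta> :: "nat \<Rightarrow> 'w \<Rightarrow> real ^ 'd"
  assumes "a \<le> b"
  shows "simple_ito_integral B m \<tau> \<zeta> b \<omega> - simple_ito_integral B m \<tau> \<zeta> a \<omega>
    = (\<Sum>i<m. \<zeta> i \<omega> \<bullet> (B (max a (min b (\<tau> (Suc i)))) \<omega> - B (max a (min b (\<tau> i))) \<omega>))"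
proof -
  have clip: "B (max a (min b x)) \<omega> = B (min x b) \<omega> - B (min x a) \<omega> + B a \<omega>" for x
    using assms by (auto simp: min_def max_def)
  show ?thesis
    unfolding simple_ito_integral_def columns_times_real sum_subtractf[symmetric] inner_diff_right[symmetric]
    by (intro sum.cong refl arg_cong2[of _ _ _ _ "(\<bullet>)"]) (simp add: clip)
qed

text \<open>A block that begins after \<open>b\<close> is clipped to the empty block. The clipped start of any other block
  is no earlier than \<open>a\<close> and than its original start, so that its coefficient and \<open>V\<close> are both known there.\<close>

lemma simple_ito_increment_orthogonal:
  fixes \<zeta> :: "nat \<Rightarrow> 'w \<Rightarrow> real ^ 'd"
  assumes s: "simple_integrand T F m \<tau> \<zeta>" and ab: "0 \<le> a" "a \<le> b" "b \<le> T"
  defines "J \<equiv> \<lambda>t \<omega>. simple_ito_integral B m \<tau> \<zeta> t \<omega>"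
  shows "(\<lambda>\<omega>. J b \<omega> - J a \<omega>) \<in> L2 P"
    and "V \<in> borel_measurable (F a) \<Longrightarrow> V \<in> L2 P \<Longrightarrow> expectation (\<lambda>\<omega>. V \<omega> * (J b \<omega> - J a \<omega>)) = 0"
proof -
  define \<alpha> where "\<alpha> i = max a (min b (\<tau> i))" for i
  define X where "X i \<omega> = \<zeta> i \<omega> \<bullet> (B (\<alpha> (Suc i)) \<omega> - B (\<alpha> i) \<omega>)" for i \<omega>
  have J: "J b \<omega> - J a \<omega> = (\<Sum>i<m. X i \<omega>)" for \<omega>
    unfolding J_def X_def \<alpha>_def by (rule simple_ito_increment[OF ab(2)])
  have \<alpha>: "0 \<le> \<alpha> i" "\<alpha> i \<le> \<alpha> (Suc i)" "\<alpha> (Suc i) \<le> T" "a \<le> \<alpha> i" if "i < m" for i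
    using ab simple_integrand_times[OF s that] by (auto simp: \<alpha>_def)
  have X: "X i \<in> L2 P \<and> (V \<in> borel_measurable (F a) \<longrightarrow> V \<in> L2 P \<longrightarrow> expectation (\<lambda>\<omega>. V \<omega> * X i \<omega>) = 0)"
    if i: "i < m" for i V
  proof (cases "\<tau> i \<le> b")
    case True
    then have "\<tau> i \<le> \<alpha> i" by (auto simp: \<alpha>_def)
    then have b: "bounded_at (\<alpha> i) (\<zeta> i)"
      by (rule bounded_at_mono[OF simple_integrand_bounded_at[OF s i]])
    show ?thesis
      unfolding X_def
      using block_L2[OF b \<alpha>(1-3)[OF i]]
        block_orthogonal[OF F_measurable_mono[OF _ \<alpha>(4)[OF i]] _ b \<alpha>(1-3)[OF i], of V] by blast
  next
    case False
    then have "\<alpha> (Suc i) = \<alpha> i" using simple_integrand_times(2)[OF s i] ab by (auto simp: \<alpha>_def)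
    then have "X i = (\<lambda>_. 0)" by (simp add: X_def fun_eq_iff)
    then show ?thesis by (simp add: L2_const)
  qed
  show "(\<lambda>\<omega>. J b \<omega> - J a \<omega>) \<in> L2 P" unfolding J using X by (intro L2_sum) auto
  assume V: "V \<in> borel_measurable (F a)" "V \<in> L2 P"
  have "expectation (\<lambda>\<omega>. V \<omega> * (J b \<omega> - J a \<omega>)) = (\<Sum>i<m. expectation (\<lambda>\<omega>. V \<omega> * X i \<omega>))"
    unfolding J sum_distrib_left
    by (rule Bochner_Integration.integral_sum) (use X V in \<open>auto intro!: L2_mult_integrable\<close>)
  also have "\<dots> = 0" using X V by (intro sum.neutral) auto
  finally show "expectation (\<lambda>\<omega>. V \<omega> * (J b \<omega> - J a \<omega>)) = 0" .
qed

lemma simple_ito_integral_0: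
  assumes s: "simple_integrand T F m \<tau> \<zeta>"
  shows "simple_ito_integral B m \<tau> \<zeta> 0 \<omega> = 0"
  unfolding simple_ito_integral_def
proof (intro sum.neutral ballI)
  fix i assume "i \<in> {..<m}"
  then have "min (\<tau> i) 0 = 0" "min (\<tau> (Suc i)) 0 = 0"
    using simple_integrand_times[OF s, of i] by auto
  then show "columns_times (\<zeta> i \<omega>) (B (min (\<tau> (Suc i)) 0) \<omega> - B (min (\<tau> i) 0) \<omega>) = 0"
    by (simp add: columns_times_def)
qed

lemma simple_ito_L2:
  fixes \<zeta> :: "nat \<Rightarrow> 'w \<Rightarrow> real ^ 'd"
  assumes s: "simple_integrand T F m \<tau> \<zeta>" and t: "t \<in> {0..T}"
  shows "(\<lambda>\<omega>. simple_ito_integral B m \<tau> \<zeta> t \<omega>) \<in> L2 P"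
  using simple_ito_increment_orthogonal(1)[OF s, of 0 t] t simple_ito_integral_0[OF s] by simp

lemma L2_limit:
  fixes X :: "nat \<Rightarrow> 'w \<Rightarrow> real"
  assumes X: "\<And>k. X k \<in> L2 P" and N: "N \<in> borel_measurable P"
    and lim: "(\<lambda>k. \<integral>\<^sup>+\<omega>. ennreal ((norm (X k \<omega> - N \<omega>))\<^sup>2) \<partial>P) \<longlonglongrightarrow> 0"
  shows "N \<in> L2 P" and "V \<in> L2 P \<Longrightarrow> (\<lambda>k. expectation (\<lambda>\<omega>. V \<omega> * X k \<omega>)) \<longlonglongrightarrow> expectation (\<lambda>\<omega>. V \<omega> * N \<omega>)"
proof -
  have "\<forall>\<^sub>F k in sequentially. (\<integral>\<^sup>+\<omega>. ennreal ((norm (X k \<omega> - N \<omega>))\<^sup>2) \<partial>P) < 1"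
    using lim by (rule order_tendstoD) simp
  then obtain k where k: "(\<integral>\<^sup>+\<omega>. ennreal ((norm (X k \<omega> - N \<omega>))\<^sup>2) \<partial>P) < 1"
    by (meson eventually_sequentially order_refl)
  have "(\<integral>\<^sup>+\<omega>. ennreal ((X k \<omega> - N \<omega>)\<^sup>2) \<partial>P) < \<infinity>"
    using k less_trans[OF k, of \<infinity>] by simp
  then have "(\<lambda>\<omega>. X k \<omega> - N \<omega>) \<in> L2 P"
    using L2_measurable[OF X] N by (intro L2_of_nn_integral_finite) auto
  from L2_diff[OF X this, of k] show NL: "N \<in> L2 P" by simp
  have D: "(\<lambda>\<omega>. X k \<omega> - N \<omega>) \<in> L2 P" for k by (rule L2_diff[OF X NL])
  have "(\<lambda>k. ennreal ((l2norm P (\<lambda>\<omega>. X k \<omega> - N \<omega>))\<^sup>2)) \<longlonglongrightarrow> ennreal 0"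
    using lim L2_nn_integral[OF D] by simp
  then have "(\<lambda>k. (l2norm P (\<lambda>\<omega>. X k \<omega> - N \<omega>))\<^sup>2) \<longlonglongrightarrow> 0"
    by (subst (asm) tendsto_ennreal_iff) auto
  from tendsto_real_sqrt[OF this] have l: "(\<lambda>k. l2norm P (\<lambda>\<omega>. X k \<omega> - N \<omega>)) \<longlonglongrightarrow> 0" by simp
  assume V: "V \<in> L2 P"
  have eq: "expectation (\<lambda>\<omega>. V \<omega> * X k \<omega>) - expectation (\<lambda>\<omega>. V \<omega> * N \<omega>)
     = expectation (\<lambda>\<omega>. V \<omega> * (X k \<omega> - N \<omega>))" for k
    by (subst Bochner_Integration.integral_diff[symmetric])
      (auto intro!: L2_mult_integrable V X NL simp: algebra_simps)
  have "(\<lambda>k. expectation (\<lambda>\<omega>. V \<omega> * X k \<omega>) - expectation (\<lambda>\<omega>. V \<omega> * N \<omega>)) \<longlonglongrightarrow> 0"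
  proof (rule Lim_null_comparison)
    show "\<forall>\<^sub>F k in sequentially. norm (expectation (\<lambda>\<omega>. V \<omega> * X k \<omega>) - expectation (\<lambda>\<omega>. V \<omega> * N \<omega>))
        \<le> l2norm P V * l2norm P (\<lambda>\<omega>. X k \<omega> - N \<omega>)"
      unfolding eq using L2_Cauchy_Schwarz[OF V D] by simp
    show "(\<lambda>k. l2norm P V * l2norm P (\<lambda>\<omega>. X k \<omega> - N \<omega>)) \<longlonglongrightarrow> 0"
      using tendsto_mult_right_zero[OF l] .
  qed
  then show "(\<lambda>k. expectation (\<lambda>\<omega>. V \<omega> * X k \<omega>)) \<longlonglongrightarrow> expectation (\<lambda>\<omega>. V \<omega> * N \<omega>)"
    by (simp add: LIM_zero_iff)
qed

text \<open>All three properties hold for simple integrands and pass to the limit in \<open>L\<^sup>2\<close>.\<close>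

lemma ito_integral_martingale:
  fixes N :: "real \<Rightarrow> 'w \<Rightarrow> real"
  assumes ito: "ito_integral P T F B Z N"
  shows "t \<in> {0..T} \<Longrightarrow> N t \<in> L2 P"
    and "AE \<omega> in P. N 0 \<omega> = 0"
    and "0 \<le> a \<Longrightarrow> a \<le> b \<Longrightarrow> b \<le> T \<Longrightarrow> V \<in> borel_measurable (F a) \<Longrightarrow> V \<in> L2 P \<Longrightarrow>
      expectation (\<lambda>\<omega>. V \<omega> * (N b \<omega> - N a \<omega>)) = 0"
proof -
  obtain m \<tau> \<zeta> where s: "\<And>k. simple_integrand T F (m k) (\<tau> k) (\<zeta> k)"
    and lim: "\<And>t. t \<in> {0..T} \<Longrightarrow> (\<lambda>k. \<integral>\<^sup>+\<omega>. ennreal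
              ((norm (simple_ito_integral B (m k) (\<tau> k) (\<zeta> k) t \<omega> - N t \<omega>))\<^sup>2) \<partial>P) \<longlonglongrightarrow> 0"
    using ito unfolding ito_integral_def by blast
  let ?J = "\<lambda>k t \<omega>. simple_ito_integral B (m k) (\<tau> k) (\<zeta> k) t \<omega>"
  have N: "N t \<in> borel_measurable P" if "t \<in> {0..T}" for t
    using ito that F_measurable_P[of "N t" t borel] by (auto simp: ito_integral_def adapted_def)
  note L = L2_limit[OF simple_ito_L2[OF s] N lim]
  show "N t \<in> L2 P" if "t \<in> {0..T}" for t using L(1)[of t] that by blast
  have 0: "0 \<in> {0..T}" using T_pos by simp
  have "(\<integral>\<^sup>+\<omega>. ennreal ((N 0 \<omega>)\<^sup>2) \<partial>P) = 0"
    using lim[OF 0] unfolding simple_ito_integral_0[OF s] by (simp add: LIMSEQ_const_iff)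
  then have "AE \<omega> in P. ennreal ((N 0 \<omega>)\<^sup>2) = 0"
    using N[OF 0] by (subst (asm) nn_integral_0_iff_AE) auto
  then show "AE \<omega> in P. N 0 \<omega> = 0" by eventually_elim (simp add: ennreal_eq_0_iff)
  assume ab: "0 \<le> a" "a \<le> b" "b \<le> T" and V: "V \<in> borel_measurable (F a)" "V \<in> L2 P"
  have a: "a \<in> {0..T}" and b: "b \<in> {0..T}" using ab by auto
  have i: "integrable P (\<lambda>\<omega>. V \<omega> * ?J k t \<omega>)" if "t \<in> {0..T}" for k t
    by (intro L2_mult_integrable V simple_ito_L2[OF s that])
  have "expectation (\<lambda>\<omega>. V \<omega> * ?J k b \<omega>) - expectation (\<lambda>\<omega>. V \<omega> * ?J k a \<omega>) = 0" for k
    using simple_ito_increment_orthogonal(2)[OF s ab V, of k] i[OF a, of k] i[OF b, of k]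
    by (simp add: right_diff_distrib)
  moreover have "(\<lambda>k. expectation (\<lambda>\<omega>. V \<omega> * ?J k b \<omega>) - expectation (\<lambda>\<omega>. V \<omega> * ?J k a \<omega>))
     \<longlonglongrightarrow> expectation (\<lambda>\<omega>. V \<omega> * N b \<omega>) - expectation (\<lambda>\<omega>. V \<omega> * N a \<omega>)"
    by (intro tendsto_diff L(2) a b V)
  ultimately have "expectation (\<lambda>\<omega>. V \<omega> * N b \<omega>) - expectation (\<lambda>\<omega>. V \<omega> * N a \<omega>) = 0"
    by (simp add: LIMSEQ_const_iff)
  moreover have "integrable P (\<lambda>\<omega>. V \<omega> * N b \<omega>)" "integrable P (\<lambda>\<omega>. V \<omega> * N a \<omega>)"
    by (intro L2_mult_integrable V L(1) a b)+
  ultimately show "expectation (\<lambda>\<omega>. V \<omega> * (N b \<omega> - N a \<omega>)) = 0"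
    by (simp add: right_diff_distrib)
qed

text \<open>The indicator discards the times outside the horizon, about which progressive measurability says
  nothing.\<close>

definition jointly_measurable :: "(real \<Rightarrow> 'w \<Rightarrow> 'b::euclidean_space) \<Rightarrow> bool" where
  "jointly_measurable X \<longleftrightarrow> (\<lambda>(\<omega>, s). indicator {0..T} s *\<^sub>R X s \<omega>) \<in> borel_measurable (P \<Otimes>\<^sub>M lborel)"

lemma progressive_jointly_measurable:
  fixes X :: "real \<Rightarrow> 'w \<Rightarrow> 'b::euclidean_space"
  assumes "progressive T F X"
  shows "jointly_measurable X"
proof -
  have X: "(\<lambda>(s, \<omega>). X s \<omega>) \<in> borel_measurable (restrict_space borel {0..T} \<Otimes>\<^sub>M F T)"
    using assms T_pos by (auto simp: progressive_def)
  have 1: "(\<lambda>p. max 0 (min T (snd p))) \<in> measurable (P \<Otimes>\<^sub>M lborel) (restrict_space borel {0..T})"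
    by (rule measurable_restrict_space2) (use T_pos in auto)
  have "id \<in> measurable P (F T)"
    using sets_F_le[of T] by (intro measurableI) (auto dest: sets.sets_into_space)
  then have 2: "fst \<in> measurable (P \<Otimes>\<^sub>M lborel) (F T)"
    using measurable_compose[OF measurable_fst, of id P "F T"] by simp
  have "(\<lambda>p. X (max 0 (min T (snd p))) (fst p)) \<in> borel_measurable (P \<Otimes>\<^sub>M lborel)"
    using measurable_compose[OF measurable_Pair[OF 1 2] X] by simp
  then have "(\<lambda>p. indicator {0..T} (snd p) *\<^sub>R X (max 0 (min T (snd p))) (fst p)) \<in> borel_measurable (P \<Otimes>\<^sub>M lborel)"
    by measurable
  also have "(\<lambda>p. indicator {0..T} (snd p) *\<^sub>R X (max 0 (min T (snd p))) (fst p))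
      = (\<lambda>(\<omega>, s). indicator {0..T} s *\<^sub>R X s \<omega>)"
    by (auto simp: fun_eq_iff indicator_def)
  finally show ?thesis by (simp add: jointly_measurable_def)
qed

lemma simple_jointly_measurable:
  fixes \<zeta> :: "nat \<Rightarrow> 'w \<Rightarrow> real ^ 'd"
  assumes s: "simple_integrand T F m \<tau> \<zeta>"
  shows "jointly_measurable (simple_process m \<tau> \<zeta>)"
proof -
  have z: "\<zeta> i \<in> borel_measurable P" if "i < m" for i
  proof (rule F_measurable_P)
    show "\<zeta> i \<in> borel_measurable (F (\<tau> i))"
      using simple_integrand_bounded_at[OF s that] by (simp add: bounded_at_def)
    show "\<tau> i \<le> T" using simple_integrand_times[OF s that] by linarith
  qed
  have "(\<lambda>p. indicator {0..T} (snd p) *\<^sub>R (\<Sum>i<m. indicator {\<tau> i<..\<tau> (Suc i)} (snd p) *\<^sub>R \<zeta> i (fst p)))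
     \<in> borel_measurable (P \<Otimes>\<^sub>M lborel)"
  proof (intro borel_measurable_scaleR borel_measurable_sum)
    show "(\<lambda>p. \<zeta> i (fst p)) \<in> borel_measurable (P \<Otimes>\<^sub>M lborel)" if "i \<in> {..<m}" for i
      using z that by (intro measurable_compose[OF measurable_fst]) auto
  qed measurable
  then show ?thesis by (simp add: jointly_measurable_def simple_process_def case_prod_beta)
qed

lemma jointly_measurable_diff:
  assumes "jointly_measurable X" "jointly_measurable Y"
  shows "jointly_measurable (\<lambda>s \<omega>. X s \<omega> - Y s \<omega>)"
  using borel_measurable_diff[OF assms[unfolded jointly_measurable_def]]
  by (simp add: jointly_measurable_def case_prod_beta scaleR_diff_right)

lemma time_moment_le3:
  fixes X Y1 Y2 Y3 :: "real \<Rightarrow> 'w \<Rightarrow> 'b::euclidean_space"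
  assumes m: "jointly_measurable Y1" "jointly_measurable Y2" "jointly_measurable Y3"
    and le: "\<And>s \<omega>. (norm (X s \<omega>))\<^sup>2 \<le> 2 * (norm (Y1 s \<omega>))\<^sup>2 + 4 * (norm (Y2 s \<omega>))\<^sup>2 + 4 * (norm (Y3 s \<omega>))\<^sup>2"
  shows "time_moment P T 2 X \<le> 2 * time_moment P T 2 Y1 + 4 * time_moment P T 2 Y2 + 4 * time_moment P T 2 Y3"
proof -
  define f where "f Y = (\<lambda>(\<omega>, s). ennreal ((norm (indicator {0..T} s *\<^sub>R Y s \<omega> :: 'b))\<^sup>2))" for Y :: "real \<Rightarrow> 'w \<Rightarrow> 'b"
  have tm: "time_moment P T 2 Y = (\<integral>\<^sup>+\<omega>. (\<integral>\<^sup>+s. f Y (\<omega>, s) \<partial>lborel) \<partial>P)" for Y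
    unfolding time_moment_def f_def by (intro nn_integral_cong) (auto simp: indicator_def)
  have [measurable]: "f Y1 \<in> borel_measurable (P \<Otimes>\<^sub>M lborel)" "f Y2 \<in> borel_measurable (P \<Otimes>\<^sub>M lborel)"
    "f Y3 \<in> borel_measurable (P \<Otimes>\<^sub>M lborel)"
    using m unfolding jointly_measurable_def f_def case_prod_beta by measurable
  have 4: "ennreal (4 * x) = 4 * ennreal x" "ennreal (2 * x) = 2 * ennreal x" if "x \<ge> 0" for x
    using that by (simp_all add: ennreal_mult)
  have le': "f X (\<omega>, s) \<le> 2 * f Y1 (\<omega>, s) + 4 * f Y2 (\<omega>, s) + 4 * f Y3 (\<omega>, s)" for \<omega> s
  proof (cases "s \<in> {0..T}")
    case True
    then have "f X (\<omega>, s) = ennreal ((norm (X s \<omega>))\<^sup>2)" by (simp add: f_def)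
    also have "\<dots> \<le> ennreal (2 * (norm (Y1 s \<omega>))\<^sup>2 + 4 * (norm (Y2 s \<omega>))\<^sup>2 + 4 * (norm (Y3 s \<omega>))\<^sup>2)"
      by (rule ennreal_leI[OF le])
    also have "\<dots> = 2 * f Y1 (\<omega>, s) + 4 * f Y2 (\<omega>, s) + 4 * f Y3 (\<omega>, s)"
      using True by (simp add: f_def ennreal_plus 4)
    finally show ?thesis .
  qed (simp add: f_def)
  have "time_moment P T 2 X \<le> (\<integral>\<^sup>+\<omega>. (\<integral>\<^sup>+s. 2 * f Y1 (\<omega>, s) + 4 * f Y2 (\<omega>, s) + 4 * f Y3 (\<omega>, s) \<partial>lborel) \<partial>P)"
    unfolding tm by (intro nn_integral_mono le')
  also have "\<dots> = (\<integral>\<^sup>+\<omega>. 2 * (\<integral>\<^sup>+s. f Y1 (\<omega>, s) \<partial>lborel) + 4 * (\<integral>\<^sup>+s. f Y2 (\<omega>, s) \<partial>lborel)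
       + 4 * (\<integral>\<^sup>+s. f Y3 (\<omega>, s) \<partial>lborel) \<partial>P)"
    by (intro nn_integral_cong) (simp add: nn_integral_add nn_integral_cmult)
  also have "\<dots> = 2 * time_moment P T 2 Y1 + 4 * time_moment P T 2 Y2 + 4 * time_moment P T 2 Y3"
    unfolding tm by (simp add: nn_integral_add nn_integral_cmult)
  finally show ?thesis .
qed

lemma norm_square_le3:
  fixes x y u v :: "'b::real_normed_vector"
  shows "(norm (x - y))\<^sup>2 \<le> 2 * (norm (u - v))\<^sup>2 + 4 * (norm (u - x))\<^sup>2 + 4 * (norm (v - y))\<^sup>2"
proof -
  have "x - y = (u - v) - ((u - x) - (v - y))" by simp
  then have "norm (x - y) \<le> norm (u - v) + (norm (u - x) + norm (v - y))"
    using norm_triangle_ineq4[of "u - v" "(u - x) - (v - y)"] norm_triangle_ineq4[of "u - x" "v - y"]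
    by simp
  then have "(norm (x - y))\<^sup>2 \<le> (norm (u - v) + (norm (u - x) + norm (v - y)))\<^sup>2"
    by (intro power_mono) auto
  also have "\<dots> \<le> 2 * (norm (u - v))\<^sup>2 + 4 * (norm (u - x))\<^sup>2 + 4 * (norm (v - y))\<^sup>2"
  proof -
    have "(a + (b + c))\<^sup>2 \<le> 2 * a\<^sup>2 + 4 * b\<^sup>2 + 4 * c\<^sup>2" for a b c :: real
    proof -
      have "2 * a\<^sup>2 + 4 * b\<^sup>2 + 4 * c\<^sup>2 - (a + (b + c))\<^sup>2 = (a - (b + c))\<^sup>2 + 2 * (b - c)\<^sup>2"
        by (simp add: power2_eq_square algebra_simps)
      then show ?thesis using zero_le_power2[of "a - (b + c)"] zero_le_power2[of "b - c"] by linarith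
    qed
    then show ?thesis .
  qed
  finally show ?thesis .
qed

text \<open>If \<open>\<phi>\<close> is the difference of two simple processes approximating \<open>Z1\<close> and \<open>Z2\<close>, then
  \<open>|Z1 - Z2|\<^sup>2 \<le> 2 |\<phi>|\<^sup>2 + \<dots>\<close>, the isometry applies to \<open>\<phi>\<close>, and its integral is compared with
  \<open>N1 - N2\<close> by the same inequality. The two factors \<open>2\<close> make up the factor \<open>4\<close>.\<close>

lemma ito_isometry_diff:
  fixes N1 N2 :: "real \<Rightarrow> 'w \<Rightarrow> real"
  assumes ito1: "ito_integral P T F B Z1 N1" and ito2: "ito_integral P T F B Z2 N2"
  shows "time_moment P T 2 (\<lambda>s \<omega>. Z1 s \<omega> - Z2 s \<omega>) \<le> 4 * (\<integral>\<^sup>+\<omega>. ennreal ((N1 T \<omega> - N2 T \<omega>)\<^sup>2) \<partial>P)"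
proof -
  obtain m1 \<tau>1 \<zeta>1 where s1: "\<And>k. simple_integrand T F (m1 k) (\<tau>1 k) (\<zeta>1 k)"
    and z1: "(\<lambda>k. time_moment P T 2 (\<lambda>s \<omega>. simple_process (m1 k) (\<tau>1 k) (\<zeta>1 k) s \<omega> - Z1 s \<omega>)) \<longlonglongrightarrow> 0"
    and n1: "\<And>t. t \<in> {0..T} \<Longrightarrow> (\<lambda>k. \<integral>\<^sup>+\<omega>. ennreal
              ((norm (simple_ito_integral B (m1 k) (\<tau>1 k) (\<zeta>1 k) t \<omega> - N1 t \<omega>))\<^sup>2) \<partial>P) \<longlonglongrightarrow> 0"
    using ito1 unfolding ito_integral_def by blast
  obtain m2 \<tau>2 \<zeta>2 where s2: "\<And>k. simple_integrand T F (m2 k) (\<tau>2 k) (\<zeta>2 k)"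
    and z2: "(\<lambda>k. time_moment P T 2 (\<lambda>s \<omega>. simple_process (m2 k) (\<tau>2 k) (\<zeta>2 k) s \<omega> - Z2 s \<omega>)) \<longlonglongrightarrow> 0"
    and n2: "\<And>t. t \<in> {0..T} \<Longrightarrow> (\<lambda>k. \<integral>\<^sup>+\<omega>. ennreal
              ((norm (simple_ito_integral B (m2 k) (\<tau>2 k) (\<zeta>2 k) t \<omega> - N2 t \<omega>))\<^sup>2) \<partial>P) \<longlonglongrightarrow> 0"
    using ito2 unfolding ito_integral_def by blast
  have T: "T \<in> {0..T}" using T_pos by simp
  define p1 where "p1 k = simple_process (m1 k) (\<tau>1 k) (\<zeta>1 k)" for k
  define p2 where "p2 k = simple_process (m2 k) (\<tau>2 k) (\<zeta>2 k)" for k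
  define J1 where "J1 k \<omega> = simple_ito_integral B (m1 k) (\<tau>1 k) (\<zeta>1 k) T \<omega>" for k \<omega>
  define J2 where "J2 k \<omega> = simple_ito_integral B (m2 k) (\<tau>2 k) (\<zeta>2 k) T \<omega>" for k \<omega>
  have [measurable]: "J1 k \<in> borel_measurable P" "J2 k \<in> borel_measurable P" for k
    unfolding J1_def[abs_def] J2_def[abs_def] using simple_ito_L2[OF s1 T] simple_ito_L2[OF s2 T] by (auto simp: L2_measurable)
  have [measurable]: "N1 T \<in> borel_measurable P" "N2 T \<in> borel_measurable P"
    using ito_integral_martingale(1)[OF ito1 T] ito_integral_martingale(1)[OF ito2 T] by (auto simp: L2_measurable)
  have Z: "jointly_measurable Z1" "jointly_measurable Z2"
    using ito1 ito2 by (auto simp: ito_integral_def intro: progressive_jointly_measurable)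
  have p: "jointly_measurable (p1 k)" "jointly_measurable (p2 k)" for k
    unfolding p1_def p2_def by (intro simple_jointly_measurable s1 s2)+
  have isom: "time_moment P T 2 (\<lambda>s \<omega>. p1 k s \<omega> - p2 k s \<omega>) = (\<integral>\<^sup>+\<omega>. ennreal ((J1 k \<omega> - J2 k \<omega>)\<^sup>2) \<partial>P)" for k
  proof -
    \<comment> \<open>The difference of the two simple processes is one family of possibly overlapping blocks.\<close>
    define I where "I = {..<m1 k} <+> {..<m2 k}"
    define a where "a = case_sum (\<tau>1 k) (\<tau>2 k)"
    define b where "b = case_sum (\<lambda>i. \<tau>1 k (Suc i)) (\<lambda>i. \<tau>2 k (Suc i))"
    define \<zeta> where "\<zeta> = case_sum (\<zeta>1 k) (\<lambda>i \<omega>. - \<zeta>2 k i \<omega>)"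
    have I: "finite I" by (simp add: I_def)
    have z: "bounded_at (a i) (\<zeta> i)" if "i \<in> I" for i
      using that simple_integrand_bounded_at[OF s1[of k]] simple_integrand_bounded_at[OF s2[of k]]
      by (auto simp: I_def a_def \<zeta>_def bounded_at_def)
    have ab: "0 \<le> a i \<and> a i \<le> b i \<and> b i \<le> T" if "i \<in> I" for i
      using that simple_integrand_times[OF s1[of k]] simple_integrand_times[OF s2[of k]]
      by (auto simp: I_def a_def b_def)
    have P: "(\<Sum>i\<in>I. indicator {a i<..b i} s *\<^sub>R \<zeta> i \<omega>) = p1 k s \<omega> - p2 k s \<omega>" for s \<omega>
      unfolding I_def sum.Plus[OF finite_lessThan finite_lessThan] by (simp add: p1_def p2_def a_def b_def \<zeta>_def simple_process_def sum_negf)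
    have min: "min (\<tau>1 k i) T = \<tau>1 k i \<and> min (\<tau>1 k (Suc i)) T = \<tau>1 k (Suc i)" if "i < m1 k" for i
      using simple_integrand_times[OF s1 that] by auto
    have min2: "min (\<tau>2 k i) T = \<tau>2 k i \<and> min (\<tau>2 k (Suc i)) T = \<tau>2 k (Suc i)" if "i < m2 k" for i
      using simple_integrand_times[OF s2 that] by auto
    have "J1 k \<omega> = (\<Sum>i<m1 k. \<zeta>1 k i \<omega> \<bullet> (B (\<tau>1 k (Suc i)) \<omega> - B (\<tau>1 k i) \<omega>))"
      "J2 k \<omega> = (\<Sum>i<m2 k. \<zeta>2 k i \<omega> \<bullet> (B (\<tau>2 k (Suc i)) \<omega> - B (\<tau>2 k i) \<omega>))" for \<omega>
      unfolding J1_def J2_def simple_ito_integral_def columns_times_real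
      by (intro sum.cong refl; simp add: min min2)+
    then have J: "(\<Sum>i\<in>I. \<zeta> i \<omega> \<bullet> (B (b i) \<omega> - B (a i) \<omega>)) = J1 k \<omega> - J2 k \<omega>" for \<omega>
      unfolding I_def sum.Plus[OF finite_lessThan finite_lessThan] by (simp add: a_def b_def \<zeta>_def sum_negf)
    show ?thesis using block_isometry[of I a \<zeta> b, OF I z ab] unfolding P J by simp
  qed
  let ?c = "\<integral>\<^sup>+\<omega>. ennreal ((N1 T \<omega> - N2 T \<omega>)\<^sup>2) \<partial>P"
  define e1 where "e1 k = (\<integral>\<^sup>+\<omega>. ennreal ((J1 k \<omega> - N1 T \<omega>)\<^sup>2) \<partial>P)" for k
  define e2 where "e2 k = (\<integral>\<^sup>+\<omega>. ennreal ((J2 k \<omega> - N2 T \<omega>)\<^sup>2) \<partial>P)" for k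
  define q1 where "q1 k = time_moment P T 2 (\<lambda>s \<omega>. p1 k s \<omega> - Z1 s \<omega>)" for k
  define q2 where "q2 k = time_moment P T 2 (\<lambda>s \<omega>. p2 k s \<omega> - Z2 s \<omega>)" for k
  have 4: "ennreal (4 * x) = 4 * ennreal x" "ennreal (2 * x) = 2 * ennreal x" if "x \<ge> 0" for x
    using that by (simp_all add: ennreal_mult)
  have J: "(\<integral>\<^sup>+\<omega>. ennreal ((J1 k \<omega> - J2 k \<omega>)\<^sup>2) \<partial>P) \<le> 2 * ?c + 4 * e1 k + 4 * e2 k" for k
  proof -
    have "(x - y)\<^sup>2 \<le> 2 * (u - v)\<^sup>2 + 4 * (x - u)\<^sup>2 + 4 * (y - v)\<^sup>2" for x y u v :: real
      using norm_square_le3[of x y u v] by (simp add: power2_commute)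
    then have "(\<integral>\<^sup>+\<omega>. ennreal ((J1 k \<omega> - J2 k \<omega>)\<^sup>2) \<partial>P)
      \<le> (\<integral>\<^sup>+\<omega>. ennreal (2 * (N1 T \<omega> - N2 T \<omega>)\<^sup>2 + 4 * (J1 k \<omega> - N1 T \<omega>)\<^sup>2 + 4 * (J2 k \<omega> - N2 T \<omega>)\<^sup>2) \<partial>P)"
      by (intro nn_integral_mono ennreal_leI)
    also have "\<dots> = 2 * ?c + 4 * e1 k + 4 * e2 k"
      by (simp add: e1_def e2_def ennreal_plus 4 nn_integral_add nn_integral_cmult)
    finally show ?thesis .
  qed
  have "time_moment P T 2 (\<lambda>s \<omega>. Z1 s \<omega> - Z2 s \<omega>)
      \<le> 2 * (2 * ?c + 4 * e1 k + 4 * e2 k) + 4 * q1 k + 4 * q2 k" for k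
  proof -
    have "time_moment P T 2 (\<lambda>s \<omega>. Z1 s \<omega> - Z2 s \<omega>)
      \<le> 2 * time_moment P T 2 (\<lambda>s \<omega>. p1 k s \<omega> - p2 k s \<omega>) + 4 * q1 k + 4 * q2 k"
      unfolding q1_def q2_def
      by (intro time_moment_le3 jointly_measurable_diff Z p norm_square_le3)
    also have "\<dots> \<le> 2 * (2 * ?c + 4 * e1 k + 4 * e2 k) + 4 * q1 k + 4 * q2 k"
      unfolding isom by (intro add_mono mult_left_mono J) auto
    finally show ?thesis .
  qed
  moreover have "(\<lambda>k. 2 * (2 * ?c + 4 * e1 k + 4 * e2 k) + 4 * q1 k + 4 * q2 k)
      \<longlonglongrightarrow> 2 * (2 * ?c + 4 * 0 + 4 * 0) + 4 * 0 + 4 * 0"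
  proof -
    have "e1 \<longlonglongrightarrow> 0" "e2 \<longlonglongrightarrow> 0" "q1 \<longlonglongrightarrow> 0" "q2 \<longlonglongrightarrow> 0"
      using n1[OF T] n2[OF T] z1 z2
      by (simp_all add: e1_def[abs_def] e2_def[abs_def] q1_def[abs_def] q2_def[abs_def]
          p1_def p2_def J1_def J2_def)
    then show ?thesis
      by (intro tendsto_add ennreal_tendsto_cmult tendsto_const) auto
  qed
  ultimately have "time_moment P T 2 (\<lambda>s \<omega>. Z1 s \<omega> - Z2 s \<omega>) \<le> 2 * (2 * ?c + 4 * 0 + 4 * 0) + 4 * 0 + 4 * 0"
    by (intro LIMSEQ_le_const) auto
  also have "\<dots> = 4 * ?c" by (simp add: mult.assoc[symmetric])
  finally show ?thesis .
qed

end

section \<open>The sign of the reflection term\<close>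

locale constraint = prob_space P for P :: "'w measure" +
  fixes T M :: real and H Hy :: "real \<Rightarrow> real measure \<Rightarrow> real" and Hmu :: "real \<Rightarrow> real measure \<Rightarrow> real \<Rightarrow> real"
  assumes T_pos: "T > 0"
    and Hy_cont: "jointly_continuous Hy"
    and Hmu_cont: "jointly_continuous (\<lambda>(y, v) \<mu>. Hmu y \<mu> v)"
    and Hy_bound: "\<And>y \<mu>. \<mu> \<in> P2 \<Longrightarrow> \<bar>Hy y \<mu>\<bar> \<le> M"
    and Hmu_bound: "\<And>y \<mu> v. \<mu> \<in> P2 \<Longrightarrow> \<bar>Hmu y \<mu> v\<bar> \<le> M"
    and concave: "\<And>y1 y2 Y1 Y2. Y1 \<in> L2 P \<Longrightarrow> Y2 \<in> L2 P \<Longrightarrow>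
      H y2 (law P Y2) - H y1 (law P Y1) \<le> Hy y1 (law P Y1) * (y2 - y1)
        + (\<integral>\<omega>. Hmu y1 (law P Y1) (Y1 \<omega>) * (Y2 \<omega> - Y1 \<omega>) \<partial>P)"
begin

lemma M_nonneg: "0 \<le> M"
  using Hy_bound[OF law_in_P2[OF prob_space_axioms L2_const[of 0]]] by (meson abs_ge_zero order_trans)

lemma Hmu_measurable: "\<mu> = law P X \<Longrightarrow> X \<in> L2 P \<Longrightarrow> (\<lambda>p. Hmu (fst p) \<mu> (snd p)) \<in> borel_measurable borel"
proof (rule borel_measurable_continuous_onI)
  assume X: "\<mu> = law P X" "X \<in> L2 P"
  show "continuous_on UNIV (\<lambda>p. Hmu (fst p) \<mu> (snd p))"
    unfolding continuous_on_sequentially comp_def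
  proof (intro ballI allI impI)
    fix x and a :: "real \<times> real"
    assume "(\<forall>n. x n \<in> UNIV) \<and> x \<longlonglongrightarrow> a"
    then have "x \<longlonglongrightarrow> a" by simp
    from jointly_continuousD[OF Hmu_cont this, of "\<lambda>_. \<mu>" \<mu>]
    show "(\<lambda>n. Hmu (fst (x n)) \<mu> (snd (x n))) \<longlonglongrightarrow> Hmu (fst a) \<mu> (snd a)"
      using law_in_P2[OF prob_space_axioms X(2)] W2_law_self[OF prob_space_axioms X(2)] X(1)
      by (simp add: case_prod_unfold)
  qed
qed

text \<open>Concavity bounds an increment of \<open>H\<close> by its first-order expansion at one end. Applied at both
  ends this makes \<open>H\<close> Lipschitz, and hence continuous along the solution.\<close>

lemma H_diff_le:
  assumes Y: "Y1 \<in> L2 P" "Y2 \<in> L2 P"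
  shows "H y2 (law P Y2) - H y1 (law P Y1) \<le> M * \<bar>y2 - y1\<bar> + M * l2norm P (\<lambda>\<omega>. Y2 \<omega> - Y1 \<omega>)"
proof -
  let ?\<mu> = "law P Y1"
  have mu: "?\<mu> \<in> P2" by (rule law_in_P2[OF prob_space_axioms Y(1)])
  let ?D = "\<lambda>\<omega>. Y2 \<omega> - Y1 \<omega>"
  have D: "?D \<in> L2 P" by (rule L2_diff[OF Y(2,1)])
  have [measurable]: "Y1 \<in> borel_measurable P" "Y2 \<in> borel_measurable P" using Y by (auto simp: L2_measurable)
  have hm: "(\<lambda>\<omega>. Hmu y1 ?\<mu> (Y1 \<omega>)) \<in> borel_measurable P"
    using measurable_compose[OF _ Hmu_measurable[OF refl Y(1)], of "\<lambda>\<omega>. (y1, Y1 \<omega>)" P] by simp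
  have h: "(\<lambda>\<omega>. Hmu y1 ?\<mu> (Y1 \<omega>)) \<in> L2 P"
    by (rule L2_dominated[OF hm L2_const[of M]]) (use Hmu_bound[OF mu] M_nonneg in auto)
  have "(\<integral>\<omega>. Hmu y1 ?\<mu> (Y1 \<omega>) * ?D \<omega> \<partial>P) \<le> (\<integral>\<omega>. M * \<bar>?D \<omega>\<bar> \<partial>P)"
  proof (rule integral_mono)
    show "integrable P (\<lambda>\<omega>. Hmu y1 ?\<mu> (Y1 \<omega>) * ?D \<omega>)" by (rule L2_mult_integrable[OF h D])
    show "integrable P (\<lambda>\<omega>. M * \<bar>?D \<omega>\<bar>)" using L2_integrable[OF D] by auto
    show "Hmu y1 ?\<mu> (Y1 \<omega>) * ?D \<omega> \<le> M * \<bar>?D \<omega>\<bar>" for \<omega>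
      using abs_ge_self[of "Hmu y1 ?\<mu> (Y1 \<omega>) * ?D \<omega>"]
        mult_right_mono[OF Hmu_bound[OF mu, of y1 "Y1 \<omega>"], of "\<bar>?D \<omega>\<bar>"] by (simp add: abs_mult)
  qed
  also have "\<dots> \<le> M * l2norm P ?D"
    using mult_left_mono[OF expectation_abs_le_l2norm[OF D] M_nonneg] by simp
  finally have 1: "(\<integral>\<omega>. Hmu y1 ?\<mu> (Y1 \<omega>) * ?D \<omega> \<partial>P) \<le> M * l2norm P ?D" .
  have "Hy y1 ?\<mu> * (y2 - y1) \<le> M * \<bar>y2 - y1\<bar>"
    using abs_ge_self[of "Hy y1 ?\<mu> * (y2 - y1)"]
      mult_right_mono[OF Hy_bound[OF mu, of y1], of "\<bar>y2 - y1\<bar>"] by (simp add: abs_mult)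
  then show ?thesis using concave[OF Y, of y2 y1] 1 by linarith
qed

lemma H_lipschitz:
  assumes Y: "Y1 \<in> L2 P" "Y2 \<in> L2 P"
  shows "\<bar>H y2 (law P Y2) - H y1 (law P Y1)\<bar> \<le> M * \<bar>y2 - y1\<bar> + M * l2norm P (\<lambda>\<omega>. Y2 \<omega> - Y1 \<omega>)"
  using H_diff_le[OF Y, of y2 y1] H_diff_le[OF Y(2,1), of y1 y2]
  by (simp add: l2norm_def power2_commute abs_minus_commute)

end

text \<open>A process with continuous paths dominated by the square-integrable variable \<open>S\<close>. Its laws are then
  continuous in time, so that \<open>Hy\<close>, \<open>Hmu\<close> and \<open>H\<close> are continuous along its paths.\<close>

locale continuous_process = constraint P T M H Hy Hmu
  for P :: "'w measure" and T M :: real and H Hy :: "real \<Rightarrow> real measure \<Rightarrow> real" and Hmu +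
  fixes Y :: "real \<Rightarrow> 'w \<Rightarrow> real" and S :: "'w \<Rightarrow> real"
  assumes Y_measurable: "\<And>t. t \<in> {0..T} \<Longrightarrow> Y t \<in> borel_measurable P"
    and Y_cont: "\<And>\<omega>. \<omega> \<in> space P \<Longrightarrow> continuous_on {0..T} (\<lambda>t. Y t \<omega>)"
    and Y_bound: "\<And>t \<omega>. t \<in> {0..T} \<Longrightarrow> \<omega> \<in> space P \<Longrightarrow> \<bar>Y t \<omega>\<bar> \<le> S \<omega>"
    and S_L2: "S \<in> L2 P"
begin

lemma S_nonneg: "\<omega> \<in> space P \<Longrightarrow> 0 \<le> S \<omega>"
  using Y_bound[of 0 \<omega>] T_pos by auto

lemma Y_L2: "t \<in> {0..T} \<Longrightarrow> Y t \<in> L2 P"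
  by (rule L2_dominated[OF Y_measurable S_L2]) (use Y_bound in \<open>force intro!: AE_I2\<close>)+

lemma law_P2: "t \<in> {0..T} \<Longrightarrow> law P (Y t) \<in> P2"
  by (rule law_in_P2[OF prob_space_axioms Y_L2])

lemma l2norm_Y_tendsto:
  assumes "\<And>n. r n \<in> {0..T}" "t \<in> {0..T}" "r \<longlonglongrightarrow> t"
  shows "(\<lambda>n. l2norm P (\<lambda>\<omega>. Y (r n) \<omega> - Y t \<omega>)) \<longlonglongrightarrow> 0"
  by (rule l2norm_continuous_paths[where T = T and S = S])
    (use assms Y_measurable Y_cont Y_bound S_L2 in \<open>auto simp: L2_real_iff\<close>)

lemma W2_tendsto:
  assumes "\<And>n. r n \<in> {0..T}" "t \<in> {0..T}" "r \<longlonglongrightarrow> t"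
  shows "(\<lambda>n. W2 (law P (Y (r n))) (law P (Y t))) \<longlonglongrightarrow> 0"
proof (rule Lim_null_comparison[OF _ l2norm_Y_tendsto[OF assms]])
  show "\<forall>\<^sub>F n in sequentially. norm (W2 (law P (Y (r n))) (law P (Y t))) \<le> l2norm P (\<lambda>\<omega>. Y (r n) \<omega> - Y t \<omega>)"
    using W2_law_le_l2norm[OF prob_space_axioms Y_L2 Y_L2] assms by (simp add: W2_def)
qed

lemma Y_tendsto:
  assumes "\<And>n. r n \<in> {0..T}" "t \<in> {0..T}" "r \<longlonglongrightarrow> t" "\<omega> \<in> space P"
  shows "(\<lambda>n. Y (r n) \<omega>) \<longlonglongrightarrow> Y t \<omega>"
  using Y_cont[OF assms(4)] assms(1-3) unfolding continuous_on_sequentially comp_def by blast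

lemma Hy_path_continuous: "\<omega> \<in> space P \<Longrightarrow> continuous_on {0..T} (\<lambda>s. Hy (Y s \<omega>) (law P (Y s)))"
  unfolding continuous_on_sequentially comp_def
  by (intro ballI allI impI jointly_continuousD[OF Hy_cont] Y_tendsto W2_tendsto law_P2) auto

lemma Hmu_path_continuous:
  assumes "\<omega> \<in> space P" "\<omega>' \<in> space P"
  shows "continuous_on {0..T} (\<lambda>s. Hmu (Y s \<omega>') (law P (Y s)) (Y s \<omega>))"
  unfolding continuous_on_sequentially comp_def
proof (intro ballI allI impI)
  fix r t assume t: "t \<in> {0..T}" and "(\<forall>n. r n \<in> {0..T}) \<and> r \<longlonglongrightarrow> t"
  then have r: "\<And>n. r n \<in> {0..T}" "r \<longlonglongrightarrow> t" by auto
  have "(\<lambda>n. (Y (r n) \<omega>', Y (r n) \<omega>)) \<longlonglongrightarrow> (Y t \<omega>', Y t \<omega>)"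
    by (intro tendsto_Pair Y_tendsto r t assms)
  from jointly_continuousD[OF Hmu_cont this law_P2[OF r(1)] law_P2[OF t] W2_tendsto[OF r(1) t r(2)]]
  show "(\<lambda>n. Hmu (Y (r n) \<omega>') (law P (Y (r n))) (Y (r n) \<omega>)) \<longlonglongrightarrow> Hmu (Y t \<omega>') (law P (Y t)) (Y t \<omega>)"
    by simp
qed

text \<open>\<open>H\<close> is not assumed jointly continuous; the Lipschitz bound supplies it.\<close>

lemma H_path_continuous:
  assumes w: "\<omega> \<in> space P"
  shows "continuous_on {0..T} (\<lambda>s. H (Y s \<omega>) (law P (Y s)))"
  unfolding continuous_on_sequentially comp_def
proof (intro ballI allI impI)
  fix r t assume t: "t \<in> {0..T}" and "(\<forall>n. r n \<in> {0..T}) \<and> r \<longlonglongrightarrow> t"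
  then have r: "\<And>n. r n \<in> {0..T}" "r \<longlonglongrightarrow> t" by auto
  have "(\<lambda>n. M * \<bar>Y (r n) \<omega> - Y t \<omega>\<bar> + M * l2norm P (\<lambda>\<omega>. Y (r n) \<omega> - Y t \<omega>)) \<longlonglongrightarrow> M * \<bar>Y t \<omega> - Y t \<omega>\<bar> + M * 0"
    by (intro tendsto_intros Y_tendsto l2norm_Y_tendsto r t w)
  then have l: "(\<lambda>n. M * \<bar>Y (r n) \<omega> - Y t \<omega>\<bar> + M * l2norm P (\<lambda>\<omega>. Y (r n) \<omega> - Y t \<omega>)) \<longlonglongrightarrow> 0" by simp
  have "(\<lambda>n. H (Y (r n) \<omega>) (law P (Y (r n))) - H (Y t \<omega>) (law P (Y t))) \<longlonglongrightarrow> 0"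
    by (rule Lim_null_comparison[OF _ l]) (use H_lipschitz[OF Y_L2[OF t] Y_L2[OF r(1)]] in auto)
  then show "(\<lambda>n. H (Y (r n) \<omega>) (law P (Y (r n)))) \<longlonglongrightarrow> H (Y t \<omega>) (law P (Y t))"
    by (rule LIM_zero_cancel)
qed

lemma H_bound:
  assumes "t \<in> {0..T}" "\<omega> \<in> space P"
  shows "\<bar>H (Y t \<omega>) (law P (Y t))\<bar> \<le> \<bar>H 0 (law P (\<lambda>_. 0))\<bar> + M * S \<omega> + M * l2norm P S"
proof -
  have "(l2norm P (\<lambda>\<omega>. Y t \<omega> - 0))\<^sup>2 \<le> (l2norm P S)\<^sup>2"
    unfolding l2norm_power2
  proof (rule integral_mono)
    show "(norm (Y t \<omega> - 0))\<^sup>2 \<le> (norm (S \<omega>))\<^sup>2" if "\<omega> \<in> space P" for \<omega>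
      using Y_bound[OF assms(1) that] by (intro power_mono) auto
  qed (use Y_L2[OF assms(1)] S_L2 in \<open>auto simp: L2_real_iff\<close>)
  then have "l2norm P (\<lambda>\<omega>. Y t \<omega> - 0) \<le> l2norm P S" by (rule power2_le_imp_le) simp
  then have "M * l2norm P (\<lambda>\<omega>. Y t \<omega> - 0) \<le> M * l2norm P S" by (rule mult_left_mono[OF _ M_nonneg])
  moreover have "M * \<bar>Y t \<omega> - 0\<bar> \<le> M * S \<omega>"
    using Y_bound[OF assms] by (intro mult_left_mono[OF _ M_nonneg]) simp
  ultimately show ?thesis
    using H_lipschitz[OF L2_const[of 0] Y_L2[OF assms(1)], of "Y t \<omega>" 0] by linarith
qed

lemma Hy_Y_measurable: "t \<in> {0..T} \<Longrightarrow> (\<lambda>\<omega>. Hy (Y t \<omega>) (law P (Y t))) \<in> borel_measurable P"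
  by (rule measurable_compose[OF Y_measurable
        jointly_continuous_borel_measurable[OF Hy_cont prob_space_axioms Y_L2]])

lemma Hmu_Y_measurable: "t \<in> {0..T} \<Longrightarrow>
    (\<lambda>p. Hmu (Y t (fst p)) (law P (Y t)) (Y t (snd p))) \<in> borel_measurable (P \<Otimes>\<^sub>M P)"
proof -
  assume t: "t \<in> {0..T}"
  have [measurable]: "Y t \<in> borel_measurable P" by (rule Y_measurable[OF t])
  have "(\<lambda>p. (Y t (fst p), Y t (snd p))) \<in> borel_measurable (P \<Otimes>\<^sub>M P)" by measurable
  from measurable_compose[OF this Hmu_measurable[OF refl Y_L2[OF t]]] show ?thesis by simp
qed

lemma H_Y_measurable: "t \<in> {0..T} \<Longrightarrow> (\<lambda>\<omega>. H (Y t \<omega>) (law P (Y t))) \<in> borel_measurable P"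
proof (rule measurable_compose[OF Y_measurable])
  assume t: "t \<in> {0..T}"
  show "(\<lambda>y. H y (law P (Y t))) \<in> borel_measurable borel"
  proof (rule borel_measurable_continuous_onI)
    have "M-lipschitz_on UNIV (\<lambda>y. H y (law P (Y t)))"
    proof (rule lipschitz_onI)
      show "dist (H x (law P (Y t))) (H y (law P (Y t))) \<le> M * dist x y" for x y
        using H_lipschitz[OF Y_L2[OF t] Y_L2[OF t], of x y] by (simp add: dist_real_def l2norm_def)
    qed (rule M_nonneg)
    then show "continuous_on UNIV (\<lambda>y. H y (law P (Y t)))" by (rule lipschitz_on_continuous_on)
  qed
qed

end

locale reflected_process = continuous_process P T M H Hy Hmu Y S
  for P :: "'w measure" and T M :: real and H Hy :: "real \<Rightarrow> real measure \<Rightarrow> real" and Hmu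
    and Y :: "real \<Rightarrow> 'w \<Rightarrow> real" and S :: "'w \<Rightarrow> real" +
  fixes K :: "real \<Rightarrow> 'w \<Rightarrow> real"
  assumes K_measurable: "\<And>t. t \<in> {0..T} \<Longrightarrow> K t \<in> borel_measurable P"
    and K_path: "\<And>\<omega>. \<omega> \<in> space P \<Longrightarrow> increasing_path T (\<lambda>t. K t \<omega>)"
    and K_0: "\<And>\<omega>. \<omega> \<in> space P \<Longrightarrow> K 0 \<omega> = 0"
    and K_L2: "K T \<in> L2 P"
begin

text \<open>The mean-field part of the reflection before the average over the copy \<open>\<omega>'\<close>, which carries
  the measure \<open>dK\<close> and the first argument of \<open>Hmu\<close>. It is kept as a function of two scenarios
  because their roles are exchanged later.\<close>

definition mean_part :: "real \<Rightarrow> real \<Rightarrow> 'w \<Rightarrow> 'w \<Rightarrow> real" where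
  "mean_part a b \<omega>' \<omega> = (LINT s:{a..b}|stieltjes T (\<lambda>t. K t \<omega>'). Hmu (Y s \<omega>') (law P (Y s)) (Y s \<omega>))"

definition own_part :: "real \<Rightarrow> real \<Rightarrow> 'w \<Rightarrow> real" where
  "own_part a b \<omega> = (LINT s:{a..b}|stieltjes T (\<lambda>t. K t \<omega>). Hy (Y s \<omega>) (law P (Y s)))"

abbreviation R :: "real \<Rightarrow> real \<Rightarrow> 'w \<Rightarrow> real" where
  "R \<equiv> reflection P T Hy Hmu Y K"

lemma R_eq: "R a b \<omega> = own_part a b \<omega> + (\<integral>\<omega>'. mean_part a b \<omega>' \<omega> \<partial>P)"
  by (simp add: reflection_def mean_part_def own_part_def)

lemma K_increment:
  assumes "\<omega> \<in> space P" "0 \<le> a" "a \<le> b" "b \<le> T"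
  shows "0 \<le> K b \<omega> - K a \<omega>" "K b \<omega> - K a \<omega> \<le> K T \<omega>" "0 \<le> K a \<omega>" "K a \<omega> \<le> K T \<omega>"
proof -
  have m: "mono_on {0..T} (\<lambda>t. K t \<omega>)" using K_path[OF assms(1)] by (simp add: increasing_path_def)
  show "0 \<le> K b \<omega> - K a \<omega>" "K b \<omega> - K a \<omega> \<le> K T \<omega>" "0 \<le> K a \<omega>" "K a \<omega> \<le> K T \<omega>"
    using mono_onD[OF m, of a b] mono_onD[OF m, of 0 a] mono_onD[OF m, of b T] mono_onD[OF m, of a T] K_0[OF assms(1)] assms
    by auto
qed

lemma K_L2': "t \<in> {0..T} \<Longrightarrow> K t \<in> L2 P"
proof (rule L2_dominated[OF K_measurable K_L2])
  assume t: "t \<in> {0..T}"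
  show "AE \<omega> in P. \<bar>K t \<omega>\<bar> \<le> \<bar>K T \<omega>\<bar>"
  proof (rule AE_I2)
    fix \<omega> assume "\<omega> \<in> space P"
    from K_increment(3,4)[OF this, of t t] t show "\<bar>K t \<omega>\<bar> \<le> \<bar>K T \<omega>\<bar>" by auto
  qed
qed

lemma own_part_measurable:
  assumes ab: "0 \<le> a" "a \<le> b" "b \<le> T"
  shows "own_part a b \<in> borel_measurable P"
proof (rule borel_measurable_LIMSEQ_real)
  show "(\<lambda>m. \<Sum>i<m. Hy (Y (grid a b m i) \<omega>) (law P (Y (grid a b m i)))
      * (K (grid a b m (Suc i)) \<omega> - K (grid a b m i) \<omega>)) \<longlonglongrightarrow> own_part a b \<omega>" if "\<omega> \<in> space P" for \<omega>
    unfolding own_part_def using ab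
    by (intro riemann_stieltjes_tendsto[OF T_pos K_path[OF that] _ _ Hy_path_continuous[OF that]]) auto
  show "(\<lambda>\<omega>. \<Sum>i<m. Hy (Y (grid a b m i) \<omega>) (law P (Y (grid a b m i)))
      * (K (grid a b m (Suc i)) \<omega> - K (grid a b m i) \<omega>)) \<in> borel_measurable P" for m
  proof (intro borel_measurable_sum borel_measurable_times borel_measurable_diff K_measurable Hy_Y_measurable)
  qed (use grid_mem_time[OF ab] in auto)
qed

lemma mean_part_measurable:
  assumes ab: "0 \<le> a" "a \<le> b" "b \<le> T"
  shows "(\<lambda>p. mean_part a b (fst p) (snd p)) \<in> borel_measurable (P \<Otimes>\<^sub>M P)"
proof (rule borel_measurable_LIMSEQ_real)
  show "(\<lambda>m. \<Sum>i<m. Hmu (Y (grid a b m i) (fst p)) (law P (Y (grid a b m i))) (Y (grid a b m i) (snd p))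
      * (K (grid a b m (Suc i)) (fst p) - K (grid a b m i) (fst p))) \<longlonglongrightarrow> mean_part a b (fst p) (snd p)"
    if "p \<in> space (P \<Otimes>\<^sub>M P)" for p
  proof -
    have p: "fst p \<in> space P" "snd p \<in> space P" using that by (auto simp: space_pair_measure)
    show ?thesis
      unfolding mean_part_def using ab
      by (intro riemann_stieltjes_tendsto[OF T_pos K_path[OF p(1)] _ _ Hmu_path_continuous[OF p(2,1)]]) auto
  qed
  show "(\<lambda>p. \<Sum>i<m. Hmu (Y (grid a b m i) (fst p)) (law P (Y (grid a b m i))) (Y (grid a b m i) (snd p))
      * (K (grid a b m (Suc i)) (fst p) - K (grid a b m i) (fst p))) \<in> borel_measurable (P \<Otimes>\<^sub>M P)" for m
  proof (intro borel_measurable_sum borel_measurable_times borel_measurable_diff Hmu_Y_measurable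
      measurable_compose[OF measurable_fst K_measurable])
  qed (use grid_mem_time[OF ab] in auto)
qed

lemma mean_part_measurable_left: "0 \<le> a \<Longrightarrow> a \<le> b \<Longrightarrow> b \<le> T \<Longrightarrow> \<omega> \<in> space P \<Longrightarrow> (\<lambda>\<omega>'. mean_part a b \<omega>' \<omega>) \<in> borel_measurable P"
  using measurable_compose[OF measurable_Pair2'[of \<omega> P P] mean_part_measurable[of a b]]
    measurable_compose[OF measurable_Pair1'[of \<omega> P P] mean_part_measurable[of a b]] by simp

lemma own_part_bound:
  assumes "0 \<le> a" "a \<le> b" "b \<le> T" "\<omega> \<in> space P"
  shows "\<bar>own_part a b \<omega>\<bar> \<le> M * (K b \<omega> - K a \<omega>)"
  unfolding own_part_def
  by (rule stieltjes_integral_bound[OF T_pos K_path[OF assms(4)] _ _ Hy_path_continuous[OF assms(4)]])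
    (use assms Hy_bound law_P2 in auto)

lemma mean_part_bound:
  assumes "0 \<le> a" "a \<le> b" "b \<le> T" "\<omega> \<in> space P" "\<omega>' \<in> space P"
  shows "\<bar>mean_part a b \<omega>' \<omega>\<bar> \<le> M * (K b \<omega>' - K a \<omega>')"
  unfolding mean_part_def
  by (rule stieltjes_integral_bound[OF T_pos K_path[OF assms(5)] _ _ Hmu_path_continuous[OF assms(4,5)]])
    (use assms Hmu_bound law_P2 in auto)

lemma K_increment_integrable:
  assumes "0 \<le> a" "a \<le> b" "b \<le> T"
  shows "integrable P (\<lambda>\<omega>. K b \<omega> - K a \<omega>)"
  using assms by (intro L2_integrable L2_diff K_L2') auto

lemma mean_part_integrable:
  assumes "0 \<le> a" "a \<le> b" "b \<le> T" "\<omega> \<in> space P"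
  shows "integrable P (\<lambda>\<omega>'. mean_part a b \<omega>' \<omega>)"
proof (rule Bochner_Integration.integrable_bound)
  show "integrable P (\<lambda>\<omega>'. M * (K b \<omega>' - K a \<omega>'))" using K_increment_integrable[OF assms(1-3)] by simp
  show "AE \<omega>' in P. norm (mean_part a b \<omega>' \<omega>) \<le> norm (M * (K b \<omega>' - K a \<omega>'))"
  proof (rule AE_I2)
    fix \<omega>' assume "\<omega>' \<in> space P"
    from mean_part_bound[OF assms this] show "norm (mean_part a b \<omega>' \<omega>) \<le> norm (M * (K b \<omega>' - K a \<omega>'))" by simp
  qed
qed (rule mean_part_measurable_left[OF assms])

lemma R_bound:
  assumes "0 \<le> a" "a \<le> b" "b \<le> T" "\<omega> \<in> space P"
  shows "\<bar>R a b \<omega>\<bar> \<le> M * (K b \<omega> - K a \<omega>) + M * expectation (\<lambda>\<omega>'. K b \<omega>' - K a \<omega>')"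
proof -
  have "\<bar>\<integral>\<omega>'. mean_part a b \<omega>' \<omega> \<partial>P\<bar> \<le> (\<integral>\<omega>'. \<bar>mean_part a b \<omega>' \<omega>\<bar> \<partial>P)" by (rule integral_abs_bound)
  also have "\<dots> \<le> (\<integral>\<omega>'. M * (K b \<omega>' - K a \<omega>') \<partial>P)"
    by (intro integral_mono integrable_abs mean_part_integrable[OF assms] integrable_mult_right
        K_increment_integrable[OF assms(1-3)] mean_part_bound[OF assms])
  finally show ?thesis unfolding R_eq using own_part_bound[OF assms] by simp
qed

lemma R_combine:
  assumes "0 \<le> a" "a \<le> b" "b \<le> c" "c \<le> T" "\<omega> \<in> space P"
  shows "R a c \<omega> = R a b \<omega> + R b c \<omega>"
proof -
  have "own_part a c \<omega> = own_part a b \<omega> + own_part b c \<omega>"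
    unfolding own_part_def
    by (rule stieltjes_integral_combine[OF T_pos K_path[OF assms(5)] _ _ _ Hy_path_continuous[OF assms(5)]])
      (use assms in auto)
  moreover have "(\<integral>\<omega>'. mean_part a c \<omega>' \<omega> \<partial>P) = (\<integral>\<omega>'. mean_part a b \<omega>' \<omega> + mean_part b c \<omega>' \<omega> \<partial>P)"
    unfolding mean_part_def
    by (intro Bochner_Integration.integral_cong refl stieltjes_integral_combine[OF T_pos K_path _ _ _ Hmu_path_continuous[OF assms(5)]])
      (use assms in auto)
  moreover have "\<dots> = (\<integral>\<omega>'. mean_part a b \<omega>' \<omega> \<partial>P) + (\<integral>\<omega>'. mean_part b c \<omega>' \<omega> \<partial>P)"
    by (intro Bochner_Integration.integral_add mean_part_integrable) (use assms in auto)
  ultimately show ?thesis by (simp add: R_eq)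
qed

lemma R_measurable:
  assumes "0 \<le> a" "a \<le> b" "b \<le> T"
  shows "R a b \<in> borel_measurable P"
proof -
  have "(\<lambda>p. mean_part a b (snd p) (fst p)) \<in> borel_measurable (P \<Otimes>\<^sub>M P)"
    using measurable_compose[OF measurable_pair_swap' mean_part_measurable[OF assms]] by (simp add: case_prod_unfold)
  then have "(\<lambda>(\<omega>, \<omega>'). mean_part a b \<omega>' \<omega>) \<in> borel_measurable (P \<Otimes>\<^sub>M P)" by (simp add: case_prod_unfold)
  from borel_measurable_lebesgue_integral[OF this]
  have "(\<lambda>\<omega>. \<integral>\<omega>'. mean_part a b \<omega>' \<omega> \<partial>P) \<in> borel_measurable P" by simp
  with own_part_measurable[OF assms] show ?thesis unfolding R_eq[abs_def] by measurable
qed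

lemma R_L2:
  assumes "0 \<le> a" "a \<le> b" "b \<le> T"
  shows "R a b \<in> L2 P"
proof (rule L2_dominated[OF R_measurable[OF assms]])
  show "(\<lambda>\<omega>. M * (K b \<omega> - K a \<omega>) + M * expectation (\<lambda>\<omega>'. K b \<omega>' - K a \<omega>')) \<in> L2 P"
    using assms by (intro L2_add L2_const L2_cmult L2_diff K_L2') auto
  show "AE \<omega> in P. \<bar>R a b \<omega>\<bar> \<le> \<bar>M * (K b \<omega> - K a \<omega>) + M * expectation (\<lambda>\<omega>'. K b \<omega>' - K a \<omega>')\<bar>"
    by (rule AE_I2) (use R_bound[OF assms] in force)
qed

text \<open>The sign of \<open>\<integral> (Y - Y') dR\<close> in expectation, for Riemann sums of the left endpoints. On
  the product of two copies of the probability space, the sums are compared with sums in which the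
  integrands are frozen at the left endpoints. For these, concavity bounds the average over the second
  scenario by \<open>H (Y, \<mu>) dK\<close>, and the sums of that tend to \<open>\<integral> H (Y, \<mu>) dK = 0\<close>.\<close>

lemma reflection_energy:
  assumes Y': "continuous_process P T M H Hy Hmu Y' S'"
    and H': "AE \<omega> in P. \<forall>t\<in>{0..T}. 0 \<le> H (Y' t \<omega>) (law P (Y' t))"
    and H0: "AE \<omega> in P. (\<forall>t\<in>{0..T}. 0 \<le> H (Y t \<omega>) (law P (Y t))) \<and>
        (\<integral>\<^sup>+s\<in>{0..T}. ennreal (H (Y s \<omega>) (law P (Y s))) \<partial>stieltjes T (\<lambda>t. K t \<omega>)) = 0"
    and t: "t \<in> {0..T}" and e: "e > 0"
  shows "\<forall>\<^sub>F m in sequentially.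
    (\<Sum>i<m. expectation (\<lambda>\<omega>. (Y (grid t T m i) \<omega> - Y' (grid t T m i) \<omega>) * R (grid t T m i) (grid t T m (Suc i)) \<omega>)) < e"
proof -
  interpret Y': continuous_process P T M H Hy Hmu Y' S' by fact
  interpret PP: pair_prob_space P P ..
  define U where "U s \<omega> = Y s \<omega> - Y' s \<omega>" for s \<omega>
  define V where "V \<omega> = S \<omega> + S' \<omega>" for \<omega>
  have V: "V \<in> L2 P" unfolding V_def[abs_def] by (rule L2_add[OF S_L2 Y'.S_L2])
  have V0: "0 \<le> V \<omega>" if "\<omega> \<in> space P" for \<omega> using S_nonneg[OF that] Y'.S_nonneg[OF that] by (simp add: V_def)
  have UV: "\<bar>U s \<omega>\<bar> \<le> V \<omega>" if "s \<in> {0..T}" "\<omega> \<in> space P" for s \<omega>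
    using Y_bound[OF that] Y'.Y_bound[OF that] by (simp add: U_def V_def)
  have U_L2: "U s \<in> L2 P" if "s \<in> {0..T}" for s
    unfolding U_def[abs_def] by (rule L2_diff[OF Y_L2[OF that] Y'.Y_L2[OF that]])
  note [measurable] = L2_measurable[OF U_L2] L2_measurable[OF V]
  have KTm [measurable]: "K T \<in> borel_measurable P" by (rule L2_measurable[OF K_L2])
  have tT: "t \<le> T" "0 \<le> t" using t by auto
  define g where "g = (\<lambda>m i. grid t T m i)"
  have g: "g m i \<in> {0..T}" "g m (Suc i) \<in> {0..T}" "0 \<le> g m i" "g m i \<le> g m (Suc i)" "g m (Suc i) \<le> T" if "i < m" for m i
    using grid_mem[OF tT(1), of i m] grid_mem[OF tT(1), of "Suc i" m] grid_Suc_mono[OF tT(1), of m i] that tT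
    by (auto simp: g_def)
  \<comment> \<open>In the pair \<open>p\<close> the first scenario carries \<open>dK\<close>, in both parts of the reflection. For the
    mean-field part this is the copy, so that \<open>U\<close> is evaluated in the second scenario there. The
    terms of \<open>A'\<close> are those of \<open>A\<close> with integrands frozen at the left endpoint.\<close>
  define A where "A m i p = U (g m i) (fst p) * own_part (g m i) (g m (Suc i)) (fst p)
      + U (g m i) (snd p) * mean_part (g m i) (g m (Suc i)) (fst p) (snd p)" for m i p
  define A' where "A' m i p = (U (g m i) (fst p) * Hy (Y (g m i) (fst p)) (law P (Y (g m i)))
      + U (g m i) (snd p) * Hmu (Y (g m i) (fst p)) (law P (Y (g m i))) (Y (g m i) (snd p)))
      * (K (g m (Suc i)) (fst p) - K (g m i) (fst p))" for m i p
  \<comment> \<open>An integrable bound for all the sums.\<close>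
  define W where "W p = M * (V (fst p) + V (snd p)) * K T (fst p)" for p
  have KVi: "integrable (P \<Otimes>\<^sub>M P) (\<lambda>p. V (fst p) * K T (fst p))" "integrable (P \<Otimes>\<^sub>M P) (\<lambda>p. V (snd p) * K T (fst p))"
    using integrable_pair_mult[OF L2_mult_integrable[OF V K_L2] integrable_const[of 1]]
      integrable_pair_mult[OF L2_integrable[OF K_L2] L2_integrable[OF V]] by (simp_all add: mult.commute)
  have W: "integrable (P \<Otimes>\<^sub>M P) W"
  proof -
    have "W = (\<lambda>p. M * (V (fst p) * K T (fst p)) + M * (V (snd p) * K T (fst p)))"
      by (auto simp: W_def fun_eq_iff algebra_simps)
    then show ?thesis using KVi by simp
  qed
  have dK: "0 \<le> K (g m (Suc i)) \<omega> - K (g m i) \<omega>" "K (g m (Suc i)) \<omega> - K (g m i) \<omega> \<le> K T \<omega>"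
    if "i < m" "\<omega> \<in> space P" for m i \<omega>
    using K_increment(1,2)[OF that(2) g(3,4,5)[OF that(1)]] by auto
  have bound: "\<bar>u * d + v * c\<bar> \<le> M * (V (fst p) + V (snd p)) * k"
    if "\<bar>u\<bar> \<le> V (fst p)" "\<bar>v\<bar> \<le> V (snd p)" "\<bar>d\<bar> \<le> M * k" "\<bar>c\<bar> \<le> M * k" for u d v c k p
  proof -
    have "\<bar>u * d\<bar> \<le> V (fst p) * (M * k)" "\<bar>v * c\<bar> \<le> V (snd p) * (M * k)"
      unfolding abs_mult using that by (auto intro!: mult_mono order_trans[OF abs_ge_zero that(1)] order_trans[OF abs_ge_zero that(2)])
    then have "\<bar>u * d + v * c\<bar> \<le> V (fst p) * (M * k) + V (snd p) * (M * k)" by linarith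
    then show ?thesis by (simp add: algebra_simps)
  qed
  have A_bd: "\<bar>A m i p\<bar> \<le> M * (V (fst p) + V (snd p)) * (K (g m (Suc i)) (fst p) - K (g m i) (fst p))"
    if "i < m" "p \<in> space (P \<Otimes>\<^sub>M P)" for m i p
    unfolding A_def using that(2) g[OF that(1)]
    by (intro bound UV own_part_bound mean_part_bound) (auto simp: space_pair_measure)
  have A'_bd: "\<bar>A' m i p\<bar> \<le> M * (V (fst p) + V (snd p)) * (K (g m (Suc i)) (fst p) - K (g m i) (fst p))"
    if "i < m" "p \<in> space (P \<Otimes>\<^sub>M P)" for m i p
  proof -
    have p: "fst p \<in> space P" "snd p \<in> space P" using that(2) by (auto simp: space_pair_measure)
    let ?k = "K (g m (Suc i)) (fst p) - K (g m i) (fst p)"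
    have "\<bar>U (g m i) (fst p) * (Hy (Y (g m i) (fst p)) (law P (Y (g m i))) * ?k)
        + U (g m i) (snd p) * (Hmu (Y (g m i) (fst p)) (law P (Y (g m i))) (Y (g m i) (snd p)) * ?k)\<bar>
      \<le> M * (V (fst p) + V (snd p)) * ?k"
      using dK(1)[OF that(1) p(1)]
      by (intro bound UV p g(1)[OF that(1)])
        (auto simp: abs_mult intro!: mult_right_mono Hy_bound Hmu_bound law_P2 g(1)[OF that(1), unfolded atLeastAtMost_iff])
    then show ?thesis by (simp add: A'_def algebra_simps)
  qed
  have W_bd: "M * (V (fst p) + V (snd p)) * (K (g m (Suc i)) (fst p) - K (g m i) (fst p)) \<le> W p"
    if "i < m" "p \<in> space (P \<Otimes>\<^sub>M P)" for m i p
    unfolding W_def using that(2) dK[OF that(1), of "fst p"] V0[of "fst p"] V0[of "snd p"] M_nonneg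
    by (intro mult_left_mono mult_nonneg_nonneg) (auto simp: space_pair_measure)
  have Am: "A m i \<in> borel_measurable (P \<Otimes>\<^sub>M P)" if "i < m" for m i
    unfolding A_def[abs_def] using g[OF that]
    by (intro borel_measurable_add borel_measurable_times mean_part_measurable
        measurable_compose[OF measurable_fst own_part_measurable] measurable_compose[OF measurable_fst L2_measurable[OF U_L2]]
        measurable_compose[OF measurable_snd L2_measurable[OF U_L2]]) auto
  have A'm: "A' m i \<in> borel_measurable (P \<Otimes>\<^sub>M P)" if "i < m" for m i
    unfolding A'_def[abs_def] using g[OF that]
    by (intro borel_measurable_add borel_measurable_times borel_measurable_diff Hmu_Y_measurable
        measurable_compose[OF measurable_fst Hy_Y_measurable] measurable_compose[OF measurable_fst K_measurable]
        measurable_compose[OF measurable_fst L2_measurable[OF U_L2]]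
        measurable_compose[OF measurable_snd L2_measurable[OF U_L2]]) auto
  have Ai: "integrable (P \<Otimes>\<^sub>M P) (A m i)" and A'i: "integrable (P \<Otimes>\<^sub>M P) (A' m i)" if "i < m" for m i
  proof -
    show "integrable (P \<Otimes>\<^sub>M P) (A m i)"
      by (rule Bochner_Integration.integrable_bound[OF W Am[OF that]])
        (use order_trans[OF A_bd[OF that] W_bd[OF that]] in \<open>force intro!: AE_I2\<close>)
    show "integrable (P \<Otimes>\<^sub>M P) (A' m i)"
      by (rule Bochner_Integration.integrable_bound[OF W A'm[OF that]])
        (use order_trans[OF A'_bd[OF that] W_bd[OF that]] in \<open>force intro!: AE_I2\<close>)
  qed
  \<comment> \<open>Fubini.\<close>
  have EA: "expectation (\<lambda>\<omega>. U (g m i) \<omega> * R (g m i) (g m (Suc i)) \<omega>) = integral\<^sup>L (P \<Otimes>\<^sub>M P) (A m i)" if "i < m" for m i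
  proof -
    let ?a = "g m i" and ?b = "g m (Suc i)"
    have ab: "0 \<le> ?a" "?a \<le> ?b" "?b \<le> T" using g[OF that] by auto
    have UD: "integrable P (\<lambda>\<omega>. U ?a \<omega> * own_part ?a ?b \<omega>)"
    proof (rule L2_mult_integrable[OF U_L2[OF g(1)[OF that]]])
      show "own_part ?a ?b \<in> L2 P"
      proof (rule L2_dominated[OF own_part_measurable[OF ab]])
        show "(\<lambda>\<omega>. M * (K ?b \<omega> - K ?a \<omega>)) \<in> L2 P" by (intro L2_cmult L2_diff K_L2' g(1,2)[OF that])
        show "AE \<omega> in P. \<bar>own_part ?a ?b \<omega>\<bar> \<le> \<bar>M * (K ?b \<omega> - K ?a \<omega>)\<bar>"
          by (rule AE_I2) (use own_part_bound[OF ab] in force)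
      qed
    qed
    have UDp: "integrable (P \<Otimes>\<^sub>M P) (\<lambda>p. U ?a (fst p) * own_part ?a ?b (fst p))"
      using integrable_pair_mult[OF UD integrable_const[of 1]] by simp
    have "integrable (P \<Otimes>\<^sub>M P) (\<lambda>p. A m i p - U ?a (fst p) * own_part ?a ?b (fst p))"
      by (intro Bochner_Integration.integrable_diff Ai[OF that] UDp)
    then have UG: "integrable (P \<Otimes>\<^sub>M P) (\<lambda>p. U ?a (snd p) * mean_part ?a ?b (fst p) (snd p))"
      by (simp add: A_def)
    then have UG': "integrable (P \<Otimes>\<^sub>M P) (case_prod (\<lambda>\<omega>' \<omega>. U ?a \<omega> * mean_part ?a ?b \<omega>' \<omega>))"
      by (simp add: case_prod_unfold)
    have 1: "integral\<^sup>L (P \<Otimes>\<^sub>M P) (\<lambda>p. U ?a (fst p) * own_part ?a ?b (fst p)) = expectation (\<lambda>\<omega>. U ?a \<omega> * own_part ?a ?b \<omega>)"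
      using PP.integral_fst'[OF UDp] by (simp add: prob_space)
    have 2: "integral\<^sup>L (P \<Otimes>\<^sub>M P) (\<lambda>p. U ?a (snd p) * mean_part ?a ?b (fst p) (snd p))
        = expectation (\<lambda>\<omega>. U ?a \<omega> * (\<integral>\<omega>'. mean_part ?a ?b \<omega>' \<omega> \<partial>P))"
      using PP.integral_snd[OF UG'] by (simp add: case_prod_unfold)
    have 3: "integrable P (\<lambda>\<omega>. U ?a \<omega> * (\<integral>\<omega>'. mean_part ?a ?b \<omega>' \<omega> \<partial>P))"
      using PP.integrable_snd[OF UG'] by simp
    have "integral\<^sup>L (P \<Otimes>\<^sub>M P) (A m i) = expectation (\<lambda>\<omega>. U ?a \<omega> * own_part ?a ?b \<omega>) + expectation (\<lambda>\<omega>. U ?a \<omega> * (\<integral>\<omega>'. mean_part ?a ?b \<omega>' \<omega> \<partial>P))"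
      unfolding A_def[abs_def] by (subst Bochner_Integration.integral_add[OF UDp UG]) (simp only: 1 2)
    also have "\<dots> = expectation (\<lambda>\<omega>. U ?a \<omega> * R ?a ?b \<omega>)"
      unfolding R_eq distrib_left by (rule Bochner_Integration.integral_add[symmetric, OF UD 3])
    finally show ?thesis by simp
  qed
  define h where "h s \<omega> = H (Y s \<omega>) (law P (Y s))" for s \<omega>
  define hb where "hb \<omega> = \<bar>H 0 (law P (\<lambda>_. 0))\<bar> + M * S \<omega> + M * l2norm P S" for \<omega>
  have hbL2: "hb \<in> L2 P" unfolding hb_def[abs_def] by (intro L2_add L2_const L2_cmult S_L2)
  have h_bd: "\<bar>h s \<omega>\<bar> \<le> hb \<omega>" if "s \<in> {0..T}" "\<omega> \<in> space P" for s \<omega>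
    unfolding h_def hb_def by (rule H_bound[OF that])
  have h_m: "h s \<in> borel_measurable P" if "s \<in> {0..T}" for s
    unfolding h_def[abs_def] by (rule H_Y_measurable[OF that])
  have h_L2: "h s \<in> L2 P" if "s \<in> {0..T}" for s
    by (rule L2_dominated[OF h_m[OF that] hbL2]) (use h_bd[OF that] in \<open>force intro!: AE_I2\<close>)
  \<comment> \<open>Concavity, with the first scenario fixed; \<open>H\<close> along \<open>Y'\<close> is nonnegative and can be dropped.\<close>
  have EA': "integral\<^sup>L (P \<Otimes>\<^sub>M P) (A' m i) \<le> expectation (\<lambda>\<omega>. h (g m i) \<omega> * (K (g m (Suc i)) \<omega> - K (g m i) \<omega>))"
    if "i < m" for m i
  proof -
    let ?a = "g m i" and ?b = "g m (Suc i)"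
    have a: "?a \<in> {0..T}" by (rule g(1)[OF that])
    have "integral\<^sup>L (P \<Otimes>\<^sub>M P) (A' m i) = (\<integral>\<omega>'. (\<integral>\<omega>. A' m i (\<omega>', \<omega>) \<partial>P) \<partial>P)"
      using PP.integral_fst'[OF A'i[OF that]] by simp
    also have "\<dots> \<le> expectation (\<lambda>\<omega>. h ?a \<omega> * (K ?b \<omega> - K ?a \<omega>))"
    proof (rule integral_mono_AE)
      show "integrable P (\<lambda>\<omega>'. \<integral>\<omega>. A' m i (\<omega>', \<omega>) \<partial>P)" by (rule PP.integrable_fst'[OF A'i[OF that]])
      show "integrable P (\<lambda>\<omega>. h ?a \<omega> * (K ?b \<omega> - K ?a \<omega>))"
        by (intro L2_mult_integrable h_L2 a L2_diff K_L2' g(2)[OF that])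
      show "AE \<omega>' in P. (\<integral>\<omega>. A' m i (\<omega>', \<omega>) \<partial>P) \<le> h ?a \<omega>' * (K ?b \<omega>' - K ?a \<omega>')"
        using H' AE_space
      proof eventually_elim
        case (elim \<omega>')
        let ?k = "K ?b \<omega>' - K ?a \<omega>'"
        let ?hy = "Hy (Y ?a \<omega>') (law P (Y ?a))"
        let ?hm = "\<lambda>\<omega>. Hmu (Y ?a \<omega>') (law P (Y ?a)) (Y ?a \<omega>)"
        have hm: "?hm \<in> L2 P"
        proof (rule L2_dominated[OF _ L2_const[of M]])
          show "?hm \<in> borel_measurable P"
            using measurable_compose[OF measurable_Pair1'[OF elim(2)] Hmu_Y_measurable[OF a]] by simp
        qed (use Hmu_bound[OF law_P2[OF a]] M_nonneg in auto)
        have Um: "integrable P (\<lambda>\<omega>. U ?a \<omega> * ?hm \<omega>)" by (rule L2_mult_integrable[OF U_L2[OF a] hm])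
        have "(\<integral>\<omega>. ?hm \<omega> * (Y' ?a \<omega> - Y ?a \<omega>) \<partial>P) = (\<integral>\<omega>. - (U ?a \<omega> * ?hm \<omega>) \<partial>P)"
          by (intro Bochner_Integration.integral_cong refl) (simp add: U_def algebra_simps)
        also have "\<dots> = - (\<integral>\<omega>. U ?a \<omega> * ?hm \<omega> \<partial>P)" by simp
        finally have "U ?a \<omega>' * ?hy + (\<integral>\<omega>. U ?a \<omega> * ?hm \<omega> \<partial>P) \<le> h ?a \<omega>' - H (Y' ?a \<omega>') (law P (Y' ?a))"
          using concave[OF Y_L2[OF a] Y'.Y_L2[OF a], of "Y' ?a \<omega>'" "Y ?a \<omega>'"]
          by (simp add: h_def U_def algebra_simps)
        also have "\<dots> \<le> h ?a \<omega>'" using elim(1) a by auto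
        finally have le: "U ?a \<omega>' * ?hy + (\<integral>\<omega>. U ?a \<omega> * ?hm \<omega> \<partial>P) \<le> h ?a \<omega>'" .
        have "(\<integral>\<omega>. A' m i (\<omega>', \<omega>) \<partial>P) = (\<integral>\<omega>. U ?a \<omega>' * ?hy + U ?a \<omega> * ?hm \<omega> \<partial>P) * ?k"
          by (simp add: A'_def)
        also have "(\<integral>\<omega>. U ?a \<omega>' * ?hy + U ?a \<omega> * ?hm \<omega> \<partial>P) = U ?a \<omega>' * ?hy + (\<integral>\<omega>. U ?a \<omega> * ?hm \<omega> \<partial>P)"
          by (subst Bochner_Integration.integral_add[OF integrable_const Um]) (simp add: prob_space)
        also have "\<dots> * ?k \<le> h ?a \<omega>' * ?k"
          by (rule mult_right_mono[OF le dK(1)[OF that elim(2)]])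
        finally show ?case .
      qed
    qed
    finally show ?thesis .
  qed
  have lim1: "(\<lambda>m. \<integral>p. (\<Sum>i<m. A m i p - A' m i p) \<partial>(P \<Otimes>\<^sub>M P)) \<longlonglongrightarrow> (\<integral>p. 0 \<partial>(P \<Otimes>\<^sub>M P))"
  proof (rule integral_dominated_convergence[where w = "\<lambda>p. 2 * W p"])
    show "(\<lambda>p. \<Sum>i<m. A m i p - A' m i p) \<in> borel_measurable (P \<Otimes>\<^sub>M P)" for m
      by (intro borel_measurable_sum borel_measurable_diff Am A'm) auto
    show "integrable (P \<Otimes>\<^sub>M P) (\<lambda>p. 2 * W p)" using W by simp
    show "AE p in P \<Otimes>\<^sub>M P. (\<lambda>m. \<Sum>i<m. A m i p - A' m i p) \<longlonglongrightarrow> 0"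
    proof (rule AE_I2)
      fix p assume "p \<in> space (P \<Otimes>\<^sub>M P)"
      then have p: "fst p \<in> space P" "snd p \<in> space P" by (auto simp: space_pair_measure)
      have sub: "{t..T} \<subseteq> {0..T}" using t by auto
      let ?hm = "\<lambda>s. Hmu (Y s (fst p)) (law P (Y s)) (Y s (snd p))"
      let ?hy = "\<lambda>s. Hy (Y s (fst p)) (law P (Y s))"
      let ?dk = "\<lambda>m i. K (g m (Suc i)) (fst p) - K (g m i) (fst p)"
      have "(\<lambda>m. \<Sum>i<m. U (g m i) (fst p) * (own_part (g m i) (g m (Suc i)) (fst p) - ?hy (g m i) * ?dk m i)) \<longlonglongrightarrow> 0"
        unfolding own_part_def g_def
        by (rule riemann_stieltjes_error[OF T_pos K_path[OF p(1)] tT(1) sub Hy_path_continuous[OF p(1)], of _ "V (fst p)"])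
          (use UV p sub in auto)
      moreover have "(\<lambda>m. \<Sum>i<m. U (g m i) (snd p) * (mean_part (g m i) (g m (Suc i)) (fst p) (snd p) - ?hm (g m i) * ?dk m i)) \<longlonglongrightarrow> 0"
        unfolding mean_part_def g_def
        by (rule riemann_stieltjes_error[OF T_pos K_path[OF p(1)] tT(1) sub Hmu_path_continuous[OF p(2,1)], of _ "V (snd p)"])
          (use UV p sub in auto)
      ultimately have "(\<lambda>m. (\<Sum>i<m. U (g m i) (fst p) * (own_part (g m i) (g m (Suc i)) (fst p) - ?hy (g m i) * ?dk m i))
         + (\<Sum>i<m. U (g m i) (snd p) * (mean_part (g m i) (g m (Suc i)) (fst p) (snd p) - ?hm (g m i) * ?dk m i))) \<longlonglongrightarrow> 0 + 0"
        by (rule tendsto_add)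
      then show "(\<lambda>m. \<Sum>i<m. A m i p - A' m i p) \<longlonglongrightarrow> 0"
        unfolding sum.distrib[symmetric] A_def A'_def by (simp add: algebra_simps)
    qed
    show "AE p in P \<Otimes>\<^sub>M P. norm (\<Sum>i<m. A m i p - A' m i p) \<le> 2 * W p" for m
    proof (rule AE_I2)
      fix p assume p: "p \<in> space (P \<Otimes>\<^sub>M P)"
      then have p': "fst p \<in> space P" "snd p \<in> space P" by (auto simp: space_pair_measure)
      let ?c = "M * (V (fst p) + V (snd p))"
      have c: "0 \<le> ?c" using M_nonneg V0[OF p'(1)] V0[OF p'(2)] by simp
      have Wp: "0 \<le> W p"
        unfolding W_def using c K_increment(3)[OF p'(1), of T] T_pos by simp
      show "norm (\<Sum>i<m. A m i p - A' m i p) \<le> 2 * W p"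
      proof (cases "m = 0")
        case False
        then have m: "m > 0" by simp
        have "norm (\<Sum>i<m. A m i p - A' m i p) \<le> (\<Sum>i<m. 2 * (?c * (K (g m (Suc i)) (fst p) - K (g m i) (fst p))))"
        proof (rule sum_norm_le)
          fix i assume "i \<in> {..<m}"
          then have i: "i < m" by simp
          show "norm (A m i p - A' m i p) \<le> 2 * (?c * (K (g m (Suc i)) (fst p) - K (g m i) (fst p)))"
            using A_bd[OF i p] A'_bd[OF i p] unfolding real_norm_def by linarith
        qed
        also have "\<dots> = 2 * (?c * (K T (fst p) - K t (fst p)))"
          unfolding sum_distrib_left[symmetric] g_def
          using sum_increments_grid[OF m, of "\<lambda>s. K s (fst p)" t T] by simp
        also have "\<dots> \<le> 2 * W p"
          unfolding W_def using K_increment(3)[OF p'(1) tT(2) order_refl tT(1)] c by (simp add: mult_left_mono)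
        finally show ?thesis .
      qed (use Wp in simp)
    qed
  qed auto
  \<comment> \<open>\<open>K\<close> grows only where \<open>H\<close> vanishes along \<open>Y\<close>.\<close>
  have lim2: "(\<lambda>m. \<integral>\<omega>. (\<Sum>i<m. h (g m i) \<omega> * (K (g m (Suc i)) \<omega> - K (g m i) \<omega>)) \<partial>P) \<longlonglongrightarrow> (\<integral>\<omega>. 0 \<partial>P)"
  proof (rule integral_dominated_convergence[where w = "\<lambda>\<omega>. hb \<omega> * K T \<omega>"])
    show "(\<lambda>\<omega>. \<Sum>i<m. h (g m i) \<omega> * (K (g m (Suc i)) \<omega> - K (g m i) \<omega>)) \<in> borel_measurable P" for m
      by (intro borel_measurable_sum borel_measurable_times borel_measurable_diff h_m K_measurable) (use g in auto)
    show "integrable P (\<lambda>\<omega>. hb \<omega> * K T \<omega>)" by (rule L2_mult_integrable[OF hbL2 K_L2])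
    show "AE \<omega> in P. (\<lambda>m. \<Sum>i<m. h (g m i) \<omega> * (K (g m (Suc i)) \<omega> - K (g m i) \<omega>)) \<longlonglongrightarrow> 0"
      using H0 AE_space
    proof eventually_elim
      case (elim \<omega>)
      have sub: "{t..T} \<subseteq> {0..T}" using t by auto
      have z: "(LINT s:{g m i..g m (Suc i)}|stieltjes T (\<lambda>t. K t \<omega>). h s \<omega>) = 0" if "i < m" for m i
        unfolding h_def
        by (rule stieltjes_integral_eq_0[OF T_pos K_path[OF elim(2)] _ _ H_path_continuous[OF elim(2)]])
          (use g[OF that] elim(1) in auto)
      have "(\<lambda>m. \<Sum>i<m. 1 * ((LINT s:{g m i..g m (Suc i)}|stieltjes T (\<lambda>t. K t \<omega>). h s \<omega>)
          - h (g m i) \<omega> * (K (g m (Suc i)) \<omega> - K (g m i) \<omega>))) \<longlonglongrightarrow> 0"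
        unfolding h_def g_def
        by (rule riemann_stieltjes_error[OF T_pos K_path[OF elim(2)] tT(1) sub H_path_continuous[OF elim(2)], of "\<lambda>_. 1" 1]) auto
      then have "(\<lambda>m. - (\<Sum>i<m. h (g m i) \<omega> * (K (g m (Suc i)) \<omega> - K (g m i) \<omega>))) \<longlonglongrightarrow> 0"
        by (simp add: z sum_negf)
      from tendsto_minus[OF this] show ?case by simp
    qed
    show "AE \<omega> in P. norm (\<Sum>i<m. h (g m i) \<omega> * (K (g m (Suc i)) \<omega> - K (g m i) \<omega>)) \<le> hb \<omega> * K T \<omega>" for m
    proof (rule AE_I2)
      fix \<omega> assume w: "\<omega> \<in> space P"
      have hb0: "0 \<le> hb \<omega>" using h_bd[OF t w] by linarith
      have KT: "0 \<le> K T \<omega>" using K_increment(3)[OF w, of T] T_pos by simp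
      show "norm (\<Sum>i<m. h (g m i) \<omega> * (K (g m (Suc i)) \<omega> - K (g m i) \<omega>)) \<le> hb \<omega> * K T \<omega>"
      proof (cases "m = 0")
        case False
        then have m: "m > 0" by simp
        have "norm (\<Sum>i<m. h (g m i) \<omega> * (K (g m (Suc i)) \<omega> - K (g m i) \<omega>))
          \<le> (\<Sum>i<m. hb \<omega> * (K (g m (Suc i)) \<omega> - K (g m i) \<omega>))"
        proof (rule sum_norm_le)
          fix i assume "i \<in> {..<m}"
          then have i: "i < m" by simp
          show "norm (h (g m i) \<omega> * (K (g m (Suc i)) \<omega> - K (g m i) \<omega>)) \<le> hb \<omega> * (K (g m (Suc i)) \<omega> - K (g m i) \<omega>)"
            using dK(1)[OF i w] h_bd[OF g(1)[OF i] w] by (simp add: abs_mult mult_right_mono)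
        qed
        also have "\<dots> = hb \<omega> * (K T \<omega> - K t \<omega>)"
          unfolding sum_distrib_left[symmetric] g_def
          using sum_increments_grid[OF m, of "\<lambda>s. K s \<omega>" t T] by simp
        also have "\<dots> \<le> hb \<omega> * K T \<omega>"
          using K_increment(3)[OF w tT(2) order_refl tT(1)] hb0 by (simp add: mult_left_mono)
        finally show ?thesis .
      qed (use hb0 KT in simp)
    qed
  qed auto
  have "\<forall>\<^sub>F m in sequentially. (\<integral>p. (\<Sum>i<m. A m i p - A' m i p) \<partial>(P \<Otimes>\<^sub>M P)) < e / 2"
    using lim1 e by (intro order_tendstoD) auto
  moreover have "\<forall>\<^sub>F m in sequentially. (\<integral>\<omega>. (\<Sum>i<m. h (g m i) \<omega> * (K (g m (Suc i)) \<omega> - K (g m i) \<omega>)) \<partial>P) < e / 2"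
    using lim2 e by (intro order_tendstoD) auto
  ultimately show ?thesis
  proof eventually_elim
    case (elim m)
    have hi: "integrable P (\<lambda>\<omega>. h (g m i) \<omega> * (K (g m (Suc i)) \<omega> - K (g m i) \<omega>))" if "i < m" for i
      by (intro L2_mult_integrable h_L2 L2_diff K_L2' g(1,2)[OF that])
    have "(\<Sum>i<m. expectation (\<lambda>\<omega>. U (g m i) \<omega> * R (g m i) (g m (Suc i)) \<omega>)) = (\<Sum>i<m. integral\<^sup>L (P \<Otimes>\<^sub>M P) (A m i))"
      using EA by (intro sum.cong) auto
    also have "\<dots> = (\<Sum>i<m. (\<integral>p. A m i p - A' m i p \<partial>(P \<Otimes>\<^sub>M P)) + integral\<^sup>L (P \<Otimes>\<^sub>M P) (A' m i))"
      by (intro sum.cong refl) (simp add: Bochner_Integration.integral_diff Ai A'i)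
    also have "\<dots> \<le> (\<Sum>i<m. (\<integral>p. A m i p - A' m i p \<partial>(P \<Otimes>\<^sub>M P))
       + expectation (\<lambda>\<omega>. h (g m i) \<omega> * (K (g m (Suc i)) \<omega> - K (g m i) \<omega>)))"
      by (intro sum_mono add_mono order_refl EA') auto
    also have "\<dots> = (\<integral>p. (\<Sum>i<m. A m i p - A' m i p) \<partial>(P \<Otimes>\<^sub>M P))
       + (\<integral>\<omega>. (\<Sum>i<m. h (g m i) \<omega> * (K (g m (Suc i)) \<omega> - K (g m i) \<omega>)) \<partial>P)"
      using hi by (simp add: sum.distrib Bochner_Integration.integral_sum Ai A'i)
    also have "\<dots> < e" using elim by simp
    finally show ?case by (simp add: U_def g_def)
  qed
qed

end

section \<open>Integrals over time and a backward Gronwall inequality\<close>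

lemma exp_integral:
  fixes c t T :: real
  assumes "c > 0" "t \<le> T"
  shows "set_integrable lborel {t..T} (\<lambda>s. exp (2 * c * (T - s)))"
    and "(LINT s:{t..T}|lborel. exp (2 * c * (T - s))) = (exp (2 * c * (T - t)) - 1) / (2 * c)"
proof -
  have d: "((\<lambda>s. - exp (2 * c * (T - s)) / (2 * c)) has_vector_derivative exp (2 * c * (T - s))) (at s within {t..T})" for s
    by (rule has_vector_derivative_at_within)
      (use assms in \<open>auto intro!: derivative_eq_intros simp: has_real_derivative_iff_has_vector_derivative[symmetric]\<close>)
  have c: "continuous_on {t..T} (\<lambda>s. exp (2 * c * (T - s)))" by (intro continuous_intros)
  show "set_integrable lborel {t..T} (\<lambda>s. exp (2 * c * (T - s)))"
    unfolding set_integrable_def by (rule borel_integrable_compact[OF compact_Icc c])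
  have "(\<integral>s. indicator {t..T} s *\<^sub>R exp (2 * c * (T - s)) \<partial>lborel)
      = - exp (2 * c * (T - T)) / (2 * c) - (- exp (2 * c * (T - t)) / (2 * c))"
    by (rule integral_FTC_atLeastAtMost[OF assms(2) d c])
  then show "(LINT s:{t..T}|lborel. exp (2 * c * (T - s))) = (exp (2 * c * (T - t)) - 1) / (2 * c)"
    by (simp add: set_lebesgue_integral_def diff_divide_distrib)
qed

text \<open>Let \<open>m\<close> be the maximum of \<open>\<phi> s exp (- 2 c (T - s))\<close>. At the maximiser the hypothesis gives
  \<open>m x \<le> a + m (x - 1) / 2\<close> with \<open>x = exp (2 c (T - s)) \<ge> 1\<close>, whence \<open>m (x + 1) \<le> 2 a\<close> and so \<open>m \<le> 2 a\<close>.\<close>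

lemma gronwall_backward:
  fixes \<phi> :: "real \<Rightarrow> real"
  assumes cont: "continuous_on {0..T} \<phi>" and T: "T > 0" and c: "c > 0" and a: "a \<ge> 0"
    and le: "\<And>t. t \<in> {0..T} \<Longrightarrow> \<phi> t \<le> a + c * (LINT s:{t..T}|lborel. \<phi> s)"
    and t: "t \<in> {0..T}"
  shows "\<phi> t \<le> 2 * a * exp (2 * c * T)"
proof -
  define \<psi> where "\<psi> s = \<phi> s * exp (- 2 * c * (T - s))" for s
  have "continuous_on {0..T} \<psi>" unfolding \<psi>_def by (intro continuous_intros cont)
  then obtain t0 where t0: "t0 \<in> {0..T}" "\<And>s. s \<in> {0..T} \<Longrightarrow> \<psi> s \<le> \<psi> t0"
    using continuous_attains_sup[of "{0..T}" \<psi>] T by auto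
  define m where "m = \<psi> t0"
  have phi: "\<phi> s = \<psi> s * exp (2 * c * (T - s))" for s
    by (simp add: \<psi>_def mult.assoc exp_add[symmetric])
  have phi_le: "\<phi> s \<le> m * exp (2 * c * (T - s))" if "s \<in> {0..T}" for s
    unfolding phi m_def using t0(2)[OF that] by simp
  have sub: "{t0..T} \<subseteq> {0..T}" and t0T: "t0 \<le> T" using t0(1) by auto
  have "(LINT s:{t0..T}|lborel. \<phi> s) \<le> (LINT s:{t0..T}|lborel. m * exp (2 * c * (T - s)))"
  proof (rule set_integral_mono)
    show "set_integrable lborel {t0..T} \<phi>"
      unfolding set_integrable_def
      by (rule borel_integrable_compact[OF compact_Icc continuous_on_subset[OF cont sub]])
    show "set_integrable lborel {t0..T} (\<lambda>s. m * exp (2 * c * (T - s)))"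
      using exp_integral(1)[OF c t0T] by (intro set_integrable_mult_right)
  qed (use phi_le sub in auto)
  also have "\<dots> = m * ((exp (2 * c * (T - t0)) - 1) / (2 * c))"
    by (simp add: exp_integral(2)[OF c t0T])
  finally have "c * (LINT s:{t0..T}|lborel. \<phi> s) \<le> c * (m * ((exp (2 * c * (T - t0)) - 1) / (2 * c)))"
    using c by (intro mult_left_mono) auto
  also have "\<dots> = m * (exp (2 * c * (T - t0)) - 1) / 2" using c by simp
  finally have "\<phi> t0 \<le> a + m * (exp (2 * c * (T - t0)) - 1) / 2" using le[OF t0(1)] by linarith
  then have 1: "m * exp (2 * c * (T - t0)) \<le> a + m * (exp (2 * c * (T - t0)) - 1) / 2"
    unfolding phi m_def .
  have m: "m \<le> 2 * a"
  proof (cases "m \<le> 0")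
    case True then show ?thesis using a by simp
  next
    case False
    have "exp (2 * c * (T - t0)) \<ge> 1" using c t0T by simp
    then have "m * 1 \<le> m * exp (2 * c * (T - t0))" using False by (intro mult_left_mono) auto
    moreover have "m * (exp (2 * c * (T - t0)) - 1) = m * exp (2 * c * (T - t0)) - m"
      by (simp add: right_diff_distrib)
    ultimately show ?thesis using 1 False by linarith
  qed
  have "\<phi> t \<le> m * exp (2 * c * (T - t))" by (rule phi_le[OF t])
  also have "\<dots> \<le> 2 * a * exp (2 * c * (T - t))" using m by simp
  also have "\<dots> \<le> 2 * a * exp (2 * c * T)" using a c t by (intro mult_left_mono) auto
  finally show ?thesis .
qed

lemma interval_integral_grid:
  fixes h :: "real \<Rightarrow> real"
  assumes ab: "a \<le> b" and h: "set_integrable lborel {a..b} h" and m: "m > 0"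
  shows "(\<Sum>i<m. LINT s:{grid a b m i..grid a b m (Suc i)}|lborel. h s) = (LINT s:{a..b}|lborel. h s)"
proof -
  have sub: "set_integrable lborel {x..y} h" if "a \<le> x" "y \<le> b" for x y
    by (rule set_integrable_subset[OF h]) (use that in auto)
  have g: "a \<le> grid a b m j" "grid a b m j \<le> b" if "j \<le> m" for j
    using grid_mem[OF ab that m] by auto
  have "(\<Sum>i<j. LINT s:{grid a b m i..grid a b m (Suc i)}|lborel. h s) = (LINT s:{a..grid a b m j}|lborel. h s)" if "j \<le> m" for j
    using that
  proof (induction j)
    case 0
    have "AE s in lborel. s \<notin> {a}" by (intro AE_not_in) auto
    then have "AE s in lborel. indicator {a..a} s *\<^sub>R h s = 0" by eventually_elim auto
    then show ?case by (simp add: set_lebesgue_integral_def integral_eq_zero_AE)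
  next
    case (Suc j)
    have "{a..grid a b m (Suc j)} = {a..grid a b m j} \<union> {grid a b m j..grid a b m (Suc j)}"
      using g[of j] g[of "Suc j"] Suc.prems grid_Suc_mono[OF ab, of m j] by auto
    moreover have "(LINT s:({a..grid a b m j} \<union> {grid a b m j..grid a b m (Suc j)})|lborel. h s)
      = (LINT s:{a..grid a b m j}|lborel. h s) + (LINT s:{grid a b m j..grid a b m (Suc j)}|lborel. h s)"
    proof (rule set_integral_Un_AE)
      have "AE x in lborel. x \<notin> {grid a b m j}" by (intro AE_not_in) auto
      then show "AE x in lborel. \<not> (x \<in> {a..grid a b m j} \<and> x \<in> {grid a b m j..grid a b m (Suc j)})"
        by eventually_elim auto
    qed (use g[of j] g[of "Suc j"] Suc.prems in \<open>auto intro!: sub\<close>)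
    ultimately show ?case using Suc by simp
  qed
  from this[of m] show ?thesis using m by simp
qed

lemma riemann_sum_le:
  fixes \<phi> :: "real \<Rightarrow> real"
  assumes cont: "continuous_on {a..b} \<phi>" and ab: "a \<le> b" and e: "e > 0"
  shows "\<forall>\<^sub>F m in sequentially.
    (\<Sum>i<m. \<phi> (grid a b m i) * (grid a b m (Suc i) - grid a b m i)) \<le> (LINT s:{a..b}|lborel. \<phi> s) + e"
proof -
  define e' where "e' = e / (1 + (b - a))"
  have e': "e' > 0" using e ab by (simp add: e'_def)
  have e'ab: "e' * (b - a) \<le> e"
  proof -
    have "e' * (1 + (b - a)) = e" using ab by (simp add: e'_def)
    then show ?thesis using e' by (simp add: algebra_simps)
  qed
  have int: "set_integrable lborel {a..b} \<phi>"
    unfolding set_integrable_def by (rule borel_integrable_compact[OF compact_Icc cont])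
  from eventually_grid_uniform[OF cont ab e'] show ?thesis
  proof eventually_elim
    case (elim m)
    then have m: "m > 0" by simp
    have "\<phi> (grid a b m i) * (grid a b m (Suc i) - grid a b m i)
       \<le> (LINT s:{grid a b m i..grid a b m (Suc i)}|lborel. \<phi> s) + e' * (grid a b m (Suc i) - grid a b m i)" if i: "i < m" for i
    proof -
      let ?x = "grid a b m i" and ?y = "grid a b m (Suc i)"
      have xy: "?x \<le> ?y" by (rule grid_Suc_mono[OF ab])
      have "a \<le> ?x" "?y \<le> b" using grid_mem[OF ab, of i m] grid_mem[OF ab, of "Suc i" m] i m by auto
      then have sub: "set_integrable lborel {?x..?y} \<phi>" by (intro set_integrable_subset[OF int]) auto
      have k: "set_integrable lborel {?x..?y} (\<lambda>s. c)" for c :: real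
        unfolding set_integrable_def by (rule borel_integrable_compact[OF compact_Icc continuous_on_const])
      have "(LINT s:{?x..?y}|lborel. \<phi> ?x) \<le> (LINT s:{?x..?y}|lborel. \<phi> s + e')"
      proof (rule set_integral_mono)
        show "\<phi> ?x \<le> \<phi> s + e'" if "s \<in> {?x..?y}" for s
        proof -
          have "dist (\<phi> s) (\<phi> ?x) < e'" using elim i that by blast
          then show ?thesis by (simp add: dist_real_def)
        qed
      qed (use sub k in \<open>auto intro!: set_integral_add\<close>)
      also have "\<dots> = (LINT s:{?x..?y}|lborel. \<phi> s) + (LINT s:{?x..?y}|lborel. e')"
        by (rule set_integral_add(2)[OF sub k])
      finally show ?thesis using xy by (simp add: set_lebesgue_integral_def mult.commute)
    qed
    then have "(\<Sum>i<m. \<phi> (grid a b m i) * (grid a b m (Suc i) - grid a b m i))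
      \<le> (\<Sum>i<m. (LINT s:{grid a b m i..grid a b m (Suc i)}|lborel. \<phi> s) + e' * (grid a b m (Suc i) - grid a b m i))"
      by (intro sum_mono) auto
    also have "\<dots> = (LINT s:{a..b}|lborel. \<phi> s) + e' * (b - a)"
      unfolding sum.distrib sum_distrib_left[symmetric] interval_integral_grid[OF ab int m]
      using sum_increments_grid[OF m, of "\<lambda>s. s" a b] by simp
    finally show ?case using e'ab by linarith
  qed
qed

lemma continuous_indefinite_integral:
  fixes h :: "real \<Rightarrow> real"
  assumes h: "set_integrable lborel {a..b} h" and ab: "a \<le> b"
  shows "continuous_on {a..b} (\<lambda>t. LINT s:{a..t}|lborel. h s)"
proof -
  have i: "set_integrable lborel {a..t} h" if "t \<in> {a..b}" for t
    by (rule set_integrable_subset[OF h]) (use that in auto)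
  have "continuous_on {a..b} (\<lambda>t. integral {a..t} h)"
    using set_borel_integral_eq_integral(1)[OF h] by (rule indefinite_integral_continuous_1)
  then show ?thesis
    by (rule continuous_on_eq) (use set_borel_integral_eq_integral(2)[OF i] in auto)
qed

lemma set_integral_combine_Icc:
  fixes h :: "real \<Rightarrow> real"
  assumes h: "set_integrable lborel {a..c} h" and "a \<le> b" "b \<le> c"
  shows "(LINT s:{a..c}|lborel. h s) = (LINT s:{a..b}|lborel. h s) + (LINT s:{b..c}|lborel. h s)"
proof -
  have "{a..c} = {a..b} \<union> {b..c}" using assms by auto
  moreover have "(LINT s:({a..b} \<union> {b..c})|lborel. h s) = (LINT s:{a..b}|lborel. h s) + (LINT s:{b..c}|lborel. h s)"
  proof (rule set_integral_Un_AE)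
    have "AE x in lborel. x \<notin> {b}" by (intro AE_not_in) auto
    then show "AE x in lborel. \<not> (x \<in> {a..b} \<and> x \<in> {b..c})" by eventually_elim auto
  qed (use assms in \<open>auto intro!: set_integrable_subset[OF h]\<close>)
  ultimately show ?thesis by simp
qed

lemma set_integral_abs_bound: "\<bar>LINT s:A|M'. h s\<bar> \<le> (LINT s:A|M'. \<bar>h s\<bar>)" for h :: "'z \<Rightarrow> real"
proof -
  have "(\<lambda>s. \<bar>indicator A s *\<^sub>R h s\<bar>) = (\<lambda>s. indicator A s *\<^sub>R \<bar>h s\<bar>)" by (auto simp: fun_eq_iff indicator_def)
  then show ?thesis
    using integral_abs_bound[of M' "\<lambda>s. indicator A s *\<^sub>R h s"] by (simp add: set_lebesgue_integral_def)
qed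

text \<open>Cauchy-Schwarz against the constant \<open>1\<close>.\<close>

lemma set_integral_square_le:
  fixes h :: "real \<Rightarrow> real"
  assumes h: "set_integrable lborel {a..b} (\<lambda>s. (h s)\<^sup>2)" and m: "set_borel_measurable lborel {a..b} h" and ab: "a \<le> b"
  shows "(LINT s:{a..b}|lborel. \<bar>h s\<bar>)\<^sup>2 \<le> (b - a) * (LINT s:{a..b}|lborel. (h s)\<^sup>2)"
proof -
  let ?X = "\<lambda>s. indicator {a..b} s :: real" and ?Y = "\<lambda>s. indicator {a..b} s * h s"
  have sq: "(?X s)\<^sup>2 = indicator {a..b} s" "(?Y s)\<^sup>2 = indicator {a..b} s * (h s)\<^sup>2" for s
    by (auto simp: indicator_def)
  have X: "?X \<in> L2 lborel"
    using borel_integrable_compact[OF compact_Icc[of a b] continuous_on_const[of _ "1::real"]]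
    by (simp add: L2_real_iff sq)
  have Y: "?Y \<in> L2 lborel" using h m by (simp add: L2_real_iff sq set_integrable_def set_borel_measurable_def)
  have "(\<integral>s. \<bar>?X s * ?Y s\<bar> \<partial>lborel) \<le> l2norm lborel ?X * l2norm lborel ?Y"
    by (rule L2_Cauchy_Schwarz_abs[OF X Y])
  moreover have "(\<integral>s. \<bar>?X s * ?Y s\<bar> \<partial>lborel) = (LINT s:{a..b}|lborel. \<bar>h s\<bar>)"
    unfolding set_lebesgue_integral_def by (intro Bochner_Integration.integral_cong refl) (auto simp: indicator_def)
  moreover have "0 \<le> (LINT s:{a..b}|lborel. \<bar>h s\<bar>)"
    unfolding set_lebesgue_integral_def by (intro Bochner_Integration.integral_nonneg) (auto simp: indicator_def)
  ultimately have "(LINT s:{a..b}|lborel. \<bar>h s\<bar>)\<^sup>2 \<le> (l2norm lborel ?X * l2norm lborel ?Y)\<^sup>2"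
    by (intro power_mono) auto
  also have "\<dots> = (b - a) * (LINT s:{a..b}|lborel. (h s)\<^sup>2)"
    unfolding power_mult_distrib l2norm_power2 using ab by (simp add: sq set_lebesgue_integral_def)
  finally show ?thesis .
qed

context brownian
begin

definition time_integrable :: "(real \<Rightarrow> 'w \<Rightarrow> real) \<Rightarrow> bool" where
  "time_integrable X \<longleftrightarrow> integrable (P \<Otimes>\<^sub>M lborel) (\<lambda>(\<omega>, s). indicator {0..T} s *\<^sub>R X s \<omega>)"

text \<open>Fubini on \<open>P\<close> times Lebesgue measure, over subintervals of the horizon.\<close>

lemma
  assumes X: "time_integrable X" and ab: "0 \<le> a" "b \<le> T"
  shows time_integrable_AE: "AE \<omega> in P. set_integrable lborel {a..b} (\<lambda>s. X s \<omega>)"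
    and time_integrable_integral: "integrable P (\<lambda>\<omega>. LINT s:{a..b}|lborel. X s \<omega>)"
    and time_integrable_Fubini: "expectation (\<lambda>\<omega>. LINT s:{a..b}|lborel. X s \<omega>) = (LINT s:{a..b}|lborel. expectation (X s))"
proof -
  interpret PL: pair_sigma_finite P "lborel :: real measure" ..
  have "integrable (P \<Otimes>\<^sub>M lborel) (\<lambda>p. indicator (UNIV \<times> {a..b}) p *\<^sub>R (case p of (\<omega>, s) \<Rightarrow> indicator {0..T} s *\<^sub>R X s \<omega>))"
  proof -
    have "(space P \<times> {a..b}) \<in> sets (P \<Otimes>\<^sub>M lborel)" by simp
    from integrable_mult_indicator[OF this X[unfolded time_integrable_def]]
    show ?thesis
      by (rule Bochner_Integration.integrable_cong[THEN iffD1, rotated 2])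
        (auto simp: space_pair_measure indicator_def)
  qed
  also have "(\<lambda>p. indicator (UNIV \<times> {a..b}) p *\<^sub>R (case p of (\<omega>, s) \<Rightarrow> indicator {0..T} s *\<^sub>R X s \<omega>))
    = (\<lambda>(\<omega>, s). indicator {a..b} s *\<^sub>R X s \<omega>)"
    using ab by (auto simp: fun_eq_iff indicator_def)
  finally have I: "integrable (P \<Otimes>\<^sub>M lborel) (\<lambda>(\<omega>, s). indicator {a..b} s *\<^sub>R X s \<omega>)" .
  show "AE \<omega> in P. set_integrable lborel {a..b} (\<lambda>s. X s \<omega>)"
    using PL.AE_integrable_fst'[OF I] by (simp add: set_integrable_def)
  show "integrable P (\<lambda>\<omega>. LINT s:{a..b}|lborel. X s \<omega>)"
    using PL.integrable_fst'[OF I] by (simp add: set_lebesgue_integral_def)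
  have "expectation (\<lambda>\<omega>. LINT s:{a..b}|lborel. X s \<omega>) = (\<integral>s. (\<integral>\<omega>. indicator {a..b} s *\<^sub>R X s \<omega> \<partial>P) \<partial>lborel)"
    using PL.Fubini_integral[OF I] by (simp add: set_lebesgue_integral_def)
  then show "expectation (\<lambda>\<omega>. LINT s:{a..b}|lborel. X s \<omega>) = (LINT s:{a..b}|lborel. expectation (X s))"
    by (simp add: set_lebesgue_integral_def)
qed

lemma time_integrable_bounded:
  assumes X: "jointly_measurable X" and Y: "time_integrable Y"
    and le: "AE p in P \<Otimes>\<^sub>M lborel. snd p \<in> {0..T} \<longrightarrow> \<bar>X (snd p) (fst p)\<bar> \<le> Y (snd p) (fst p)"
  shows "time_integrable X"
  unfolding time_integrable_def
proof (rule Bochner_Integration.integrable_bound[OF Y[unfolded time_integrable_def]])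
  show "(\<lambda>(\<omega>, s). indicator {0..T} s *\<^sub>R X s \<omega>) \<in> borel_measurable (P \<Otimes>\<^sub>M lborel)"
    using X by (simp add: jointly_measurable_def)
  show "AE p in P \<Otimes>\<^sub>M lborel. norm (case p of (\<omega>, s) \<Rightarrow> indicator {0..T} s *\<^sub>R X s \<omega>)
      \<le> norm (case p of (\<omega>, s) \<Rightarrow> indicator {0..T} s *\<^sub>R Y s \<omega>)"
    using le by eventually_elim (auto simp: indicator_def split: prod.splits)
qed

lemma time_integrable_add: "time_integrable X \<Longrightarrow> time_integrable Y \<Longrightarrow> time_integrable (\<lambda>s \<omega>. X s \<omega> + Y s \<omega>)"
  unfolding time_integrable_def
  by (drule (1) Bochner_Integration.integrable_add) (simp add: case_prod_unfold algebra_simps)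

lemma time_integrable_cmult: "time_integrable X \<Longrightarrow> time_integrable (\<lambda>s \<omega>. c * X s \<omega>)"
  using integrable_mult_right[of c "P \<Otimes>\<^sub>M lborel" "\<lambda>(\<omega>, s). indicator {0..T} s *\<^sub>R X s \<omega>"]
  by (simp add: time_integrable_def case_prod_unfold algebra_simps)

lemma time_integrable_product:
  assumes g: "set_integrable lborel {0..T} g" and V: "integrable P V"
  shows "time_integrable (\<lambda>s \<omega>. V \<omega> * g s)"
proof -
  interpret PL: pair_sigma_finite P "lborel :: real measure" ..
  let ?g = "\<lambda>s. indicator {0..T} s * g s"
  have gi: "integrable lborel ?g" using g by (simp add: set_integrable_def)
  have "integrable (P \<Otimes>\<^sub>M lborel) (\<lambda>p. V (fst p) * ?g (snd p))"
  proof (rule PL.Fubini_integrable)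
    have [measurable]: "V \<in> borel_measurable P" "?g \<in> borel_measurable lborel" using gi V by auto
    show "(\<lambda>p. V (fst p) * ?g (snd p)) \<in> borel_measurable (P \<Otimes>\<^sub>M lborel)" by measurable
    show "integrable P (\<lambda>x. \<integral>y. norm (V (fst (x, y)) * ?g (snd (x, y))) \<partial>lborel)"
      using V by (simp add: abs_mult)
  qed (use gi in auto)
  then show ?thesis
    unfolding time_integrable_def
    by (rule Bochner_Integration.integrable_cong[THEN iffD1, rotated 2]) (auto simp: split_beta)
qed

end

section \<open>Energy estimate for the difference of two regular solutions\<close>

text \<open>The Gronwall factor for the rate \<open>1 + 4 L\<close>. The constants below bound, in terms of the squared size
  of the perturbation, the increment of \<open>N\<close> (\<open>N_const\<close>), and in terms of the size itself, the difference of the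
  reflections (\<open>R_const\<close>).\<close>

definition growth :: "real \<Rightarrow> real \<Rightarrow> real" where
  "growth T L = 2 * exp (2 * (1 + 4 * L) * T)"

definition N_const :: "real \<Rightarrow> real \<Rightarrow> real" where
  "N_const T L = 2 * (1 + (1 + 4 * L) * T * growth T L)"

definition R_const :: "real \<Rightarrow> real \<Rightarrow> real" where
  "R_const T L = 2 * sqrt (growth T L) + sqrt (3 * T * (1 + 2 * L\<^sup>2 * T * growth T L)) + sqrt (N_const T L)"

definition stability_const :: "real \<Rightarrow> real \<Rightarrow> real" where
  "stability_const T L = growth T L + 4 * N_const T L + R_const T L"

lemma square_sum3: "(x + L * (y + z))\<^sup>2 \<le> 3 * x\<^sup>2 + 3 * L\<^sup>2 * y\<^sup>2 + 3 * L\<^sup>2 * z\<^sup>2" for x y z L :: real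
proof -
  have "3 * x\<^sup>2 + 3 * L\<^sup>2 * y\<^sup>2 + 3 * L\<^sup>2 * z\<^sup>2 - (x + L * (y + z))\<^sup>2 = (x - L * y)\<^sup>2 + (x - L * z)\<^sup>2 + (L * y - L * z)\<^sup>2"
    by (simp add: power2_eq_square algebra_simps)
  also have "\<dots> \<ge> 0" by simp
  finally show ?thesis by linarith
qed

text \<open>Two regular reflected processes for the same constraint, whose difference \<open>U\<close> has driver \<open>f\<close> and
  martingale part \<open>N\<close>. The process \<open>\<delta>\<close> stands for the part of \<open>f\<close> that is due to the perturbation of
  the data.\<close>

locale reflected_pair = brownian W T B P F +
  r1: reflected_process P T M H Hy Hmu Y1 S1 K1 + r2: reflected_process P T M H Hy Hmu Y2 S2 K2
  for W :: "'w measure" and T :: real and B :: "real \<Rightarrow> 'w \<Rightarrow> real ^ 'd::finite" and P F M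
    and H Hy :: "real \<Rightarrow> real measure \<Rightarrow> real" and Hmu Y1 S1 K1 Y2 S2 K2 +
  fixes U N f \<delta> :: "real \<Rightarrow> 'w \<Rightarrow> real" and L :: real
  assumes L_pos: "L > 0"
    and U_def: "U = (\<lambda>t \<omega>. Y1 t \<omega> - Y2 t \<omega>)"
    and U_adapted: "\<And>t. t \<in> {0..T} \<Longrightarrow> U t \<in> borel_measurable (F t)"
    and U_jointly: "jointly_measurable U"
    and N_adapted: "\<And>t. t \<in> {0..T} \<Longrightarrow> N t \<in> borel_measurable (F t)"
    and N_L2: "\<And>t. t \<in> {0..T} \<Longrightarrow> N t \<in> L2 P"
    and N_martingale: "\<And>a b V. 0 \<le> a \<Longrightarrow> a \<le> b \<Longrightarrow> b \<le> T \<Longrightarrow> V \<in> borel_measurable (F a) \<Longrightarrow> V \<in> L2 P \<Longrightarrow>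
      expectation (\<lambda>\<omega>. V \<omega> * (N b \<omega> - N a \<omega>)) = 0"
    and f_jointly: "jointly_measurable f"
    and \<delta>_L2: "time_integrable (\<lambda>s \<omega>. (\<delta> s \<omega>)\<^sup>2)"
    and f_bound: "AE p in P \<Otimes>\<^sub>M lborel. snd p \<in> {0..T} \<longrightarrow>
      \<bar>f (snd p) (fst p)\<bar> \<le> \<delta> (snd p) (fst p) + L * (\<bar>U (snd p) (fst p)\<bar> + l2norm P (U (snd p)))"
    and dynamics: "AE \<omega> in P. \<forall>a b. 0 \<le> a \<and> a \<le> b \<and> b \<le> T \<longrightarrow>
      U a \<omega> - U b \<omega> = (LINT s:{a..b}|lborel. f s \<omega>) - (N b \<omega> - N a \<omega>)
        + (reflection P T Hy Hmu Y1 K1 a b \<omega> - reflection P T Hy Hmu Y2 K2 a b \<omega>)"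
    and flat1: "AE \<omega> in P. (\<forall>t\<in>{0..T}. 0 \<le> H (Y1 t \<omega>) (law P (Y1 t))) \<and>
        (\<integral>\<^sup>+s\<in>{0..T}. ennreal (H (Y1 s \<omega>) (law P (Y1 s))) \<partial>stieltjes T (\<lambda>t. K1 t \<omega>)) = 0"
    and flat2: "AE \<omega> in P. (\<forall>t\<in>{0..T}. 0 \<le> H (Y2 t \<omega>) (law P (Y2 t))) \<and>
        (\<integral>\<^sup>+s\<in>{0..T}. ennreal (H (Y2 s \<omega>) (law P (Y2 s))) \<partial>stieltjes T (\<lambda>t. K2 t \<omega>)) = 0"
begin

definition \<phi> :: "real \<Rightarrow> real" where "\<phi> s = expectation (\<lambda>\<omega>. (U s \<omega>)\<^sup>2)"

text \<open>The squared size of the perturbation, with \<open>U T\<close> in place of the terminal values.\<close>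

definition data_sq :: real where "data_sq = \<phi> T + expectation (\<lambda>\<omega>. LINT s:{0..T}|lborel. (\<delta> s \<omega>)\<^sup>2)"

definition U_sup :: "'w \<Rightarrow> real" where "U_sup \<omega> = S1 \<omega> + S2 \<omega>"

lemma U_sup_L2: "U_sup \<in> L2 P"
  unfolding U_sup_def[abs_def] by (rule L2_add[OF r1.S_L2 r2.S_L2])

lemma U_bound: "t \<in> {0..T} \<Longrightarrow> \<omega> \<in> space P \<Longrightarrow> \<bar>U t \<omega>\<bar> \<le> U_sup \<omega>"
  using r1.Y_bound[of t \<omega>] r2.Y_bound[of t \<omega>] by (auto simp: U_def U_sup_def)

lemma U_L2: "t \<in> {0..T} \<Longrightarrow> U t \<in> L2 P"
  unfolding U_def by (rule L2_diff[OF r1.Y_L2 r2.Y_L2])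

lemma \<phi>_eq: "\<phi> s = (l2norm P (U s))\<^sup>2"
  by (simp add: \<phi>_def l2norm_power2)

lemma \<phi>_nonneg: "0 \<le> \<phi> s" by (simp add: \<phi>_eq)

lemma \<phi>_continuous: "continuous_on {0..T} \<phi>"
  unfolding continuous_on_sequentially comp_def
proof (intro ballI allI impI)
  fix r t assume t: "t \<in> {0..T}" and "(\<forall>n. r n \<in> {0..T}) \<and> r \<longlonglongrightarrow> t"
  then have r: "\<And>n. r n \<in> {0..T}" "r \<longlonglongrightarrow> t" by auto
  show "(\<lambda>n. \<phi> (r n)) \<longlonglongrightarrow> \<phi> t"
    unfolding \<phi>_def
  proof (rule integral_dominated_convergence[where w = "\<lambda>\<omega>. (U_sup \<omega>)\<^sup>2"])
    show "AE \<omega> in P. (\<lambda>n. (U (r n) \<omega>)\<^sup>2) \<longlonglongrightarrow> (U t \<omega>)\<^sup>2"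
      unfolding U_def by (intro AE_I2 tendsto_intros r1.Y_tendsto r2.Y_tendsto r t)
    show "AE \<omega> in P. norm ((U (r n) \<omega>)\<^sup>2) \<le> (U_sup \<omega>)\<^sup>2" for n
    proof (rule AE_I2)
      fix \<omega> assume "\<omega> \<in> space P"
      from power_mono[OF U_bound[OF r(1) this, of n], of 2] show "norm ((U (r n) \<omega>)\<^sup>2) \<le> (U_sup \<omega>)\<^sup>2" by simp
    qed
  qed (use U_L2 r t U_sup_L2 in \<open>auto simp: L2_real_iff\<close>)
qed

lemma \<phi>_integrable: "0 \<le> a \<Longrightarrow> b \<le> T \<Longrightarrow> set_integrable lborel {a..b} \<phi>"
  unfolding set_integrable_def
  by (rule borel_integrable_compact[OF compact_Icc continuous_on_subset[OF \<phi>_continuous]]) auto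

lemma U2_time_integrable: "time_integrable (\<lambda>s \<omega>. (U s \<omega>)\<^sup>2)"
proof (rule time_integrable_bounded)
  have "(\<lambda>p. (case p of (\<omega>, s) \<Rightarrow> indicator {0..T} s *\<^sub>R U s \<omega>)\<^sup>2) \<in> borel_measurable (P \<Otimes>\<^sub>M lborel)"
    using U_jointly unfolding jointly_measurable_def by measurable
  also have "(\<lambda>p. (case p of (\<omega>, s) \<Rightarrow> indicator {0..T} s *\<^sub>R U s \<omega>)\<^sup>2) = (\<lambda>(\<omega>, s). indicator {0..T} s *\<^sub>R (U s \<omega>)\<^sup>2)"
    by (auto simp: fun_eq_iff indicator_def)
  finally show "jointly_measurable (\<lambda>s \<omega>. (U s \<omega>)\<^sup>2)" by (simp add: jointly_measurable_def)
  have "set_integrable lborel {0..T} (\<lambda>_. 1::real)"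
    unfolding set_integrable_def by (rule borel_integrable_compact[OF compact_Icc continuous_on_const])
  then show "time_integrable (\<lambda>s \<omega>. (U_sup \<omega>)\<^sup>2 * 1)"
    using U_sup_L2 by (intro time_integrable_product) (auto simp: L2_real_iff)
  show "AE p in P \<Otimes>\<^sub>M lborel. snd p \<in> {0..T} \<longrightarrow> \<bar>(U (snd p) (fst p))\<^sup>2\<bar> \<le> (U_sup (fst p))\<^sup>2 * 1"
  proof (rule AE_I2, intro impI)
    fix p assume "p \<in> space (P \<Otimes>\<^sub>M lborel)" "snd p \<in> {0..T}"
    then have "\<bar>U (snd p) (fst p)\<bar> \<le> U_sup (fst p)" by (intro U_bound) (auto simp: space_pair_measure)
    from power_mono[OF this, of 2] show "\<bar>(U (snd p) (fst p))\<^sup>2\<bar> \<le> (U_sup (fst p))\<^sup>2 * 1" by simp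
  qed
qed

lemma \<phi>_time_integrable: "time_integrable (\<lambda>s \<omega>. \<phi> s)"
  using time_integrable_product[OF \<phi>_integrable integrable_const[of 1]] by simp

lemma f2_time_integrable: "time_integrable (\<lambda>s \<omega>. (f s \<omega>)\<^sup>2)"
proof (rule time_integrable_bounded)
  have "(\<lambda>p. (case p of (\<omega>, s) \<Rightarrow> indicator {0..T} s *\<^sub>R f s \<omega>)\<^sup>2) \<in> borel_measurable (P \<Otimes>\<^sub>M lborel)"
    using f_jointly unfolding jointly_measurable_def by measurable
  also have "(\<lambda>p. (case p of (\<omega>, s) \<Rightarrow> indicator {0..T} s *\<^sub>R f s \<omega>)\<^sup>2) = (\<lambda>(\<omega>, s). indicator {0..T} s *\<^sub>R (f s \<omega>)\<^sup>2)"
    by (auto simp: fun_eq_iff indicator_def)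
  finally show "jointly_measurable (\<lambda>s \<omega>. (f s \<omega>)\<^sup>2)" by (simp add: jointly_measurable_def)
  show "time_integrable (\<lambda>s \<omega>. 3 * (\<delta> s \<omega>)\<^sup>2 + 3 * L\<^sup>2 * (U s \<omega>)\<^sup>2 + 3 * L\<^sup>2 * \<phi> s)"
    by (intro time_integrable_add time_integrable_cmult \<delta>_L2 U2_time_integrable \<phi>_time_integrable)
  show "AE p in P \<Otimes>\<^sub>M lborel. snd p \<in> {0..T} \<longrightarrow> \<bar>(f (snd p) (fst p))\<^sup>2\<bar>
      \<le> 3 * (\<delta> (snd p) (fst p))\<^sup>2 + 3 * L\<^sup>2 * (U (snd p) (fst p))\<^sup>2 + 3 * L\<^sup>2 * \<phi> (snd p)"
    using f_bound
  proof eventually_elim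
    case (elim p)
    show ?case
    proof
      assume "snd p \<in> {0..T}"
      then have "\<bar>f (snd p) (fst p)\<bar> \<le> \<delta> (snd p) (fst p) + L * (\<bar>U (snd p) (fst p)\<bar> + l2norm P (U (snd p)))" using elim by blast
      from power_mono[OF this, of 2] square_sum3[of "\<delta> (snd p) (fst p)" L "\<bar>U (snd p) (fst p)\<bar>" "l2norm P (U (snd p))"]
      show "\<bar>(f (snd p) (fst p))\<^sup>2\<bar> \<le> 3 * (\<delta> (snd p) (fst p))\<^sup>2 + 3 * L\<^sup>2 * (U (snd p) (fst p))\<^sup>2 + 3 * L\<^sup>2 * \<phi> (snd p)"
        by (simp add: \<phi>_eq)
    qed
  qed
qed

lemma f_time_integrable: "time_integrable f"
proof (rule time_integrable_bounded[OF f_jointly])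
  have "set_integrable lborel {0..T} (\<lambda>_. 1::real)"
    unfolding set_integrable_def by (rule borel_integrable_compact[OF compact_Icc continuous_on_const])
  from time_integrable_product[OF this integrable_const[of 1]]
  show "time_integrable (\<lambda>s \<omega>. 1 * 1 + (f s \<omega>)\<^sup>2)" by (intro time_integrable_add f2_time_integrable)
  have "\<bar>x\<bar> \<le> 1 * 1 + x\<^sup>2" for x :: real
  proof -
    have "0 \<le> (\<bar>x\<bar> - 1)\<^sup>2" by simp
    then have "2 * \<bar>x\<bar> \<le> 1 + x\<^sup>2" by (simp add: power2_diff)
    then show ?thesis using abs_ge_zero[of x] by linarith
  qed
  then show "AE p in P \<Otimes>\<^sub>M lborel. snd p \<in> {0..T} \<longrightarrow> \<bar>f (snd p) (fst p)\<bar> \<le> 1 * 1 + (f (snd p) (fst p))\<^sup>2"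
    by auto
qed

text \<open>The scenarios in which every almost sure property of the pair holds.\<close>

definition regular :: "'w \<Rightarrow> bool" where
  "regular \<omega> \<longleftrightarrow> \<omega> \<in> space P \<and> set_integrable lborel {0..T} (\<lambda>s. f s \<omega>) \<and> set_integrable lborel {0..T} (\<lambda>s. (f s \<omega>)\<^sup>2)
    \<and> set_integrable lborel {0..T} (\<lambda>s. (U s \<omega>)\<^sup>2) \<and> set_integrable lborel {0..T} (\<lambda>s. (\<delta> s \<omega>)\<^sup>2)
    \<and> (AE s in lborel. s \<in> {0..T} \<longrightarrow> \<bar>f s \<omega>\<bar> \<le> \<delta> s \<omega> + L * (\<bar>U s \<omega>\<bar> + l2norm P (U s)))
    \<and> (\<forall>a b. 0 \<le> a \<and> a \<le> b \<and> b \<le> T \<longrightarrow>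
      U a \<omega> - U b \<omega> = (LINT s:{a..b}|lborel. f s \<omega>) - (N b \<omega> - N a \<omega>) + (r1.R a b \<omega> - r2.R a b \<omega>))"

lemma AE_regular: "AE \<omega> in P. regular \<omega>"
proof -
  interpret PL: pair_sigma_finite P "lborel :: real measure" ..
  have "AE \<omega> in P. AE s in lborel. s \<in> {0..T} \<longrightarrow> \<bar>f s \<omega>\<bar> \<le> \<delta> s \<omega> + L * (\<bar>U s \<omega>\<bar> + l2norm P (U s))"
    using PL.AE_pair[OF f_bound] by simp
  moreover note time_integrable_AE[OF f_time_integrable order_refl order_refl]
    time_integrable_AE[OF f2_time_integrable order_refl order_refl]
    time_integrable_AE[OF U2_time_integrable order_refl order_refl]
    time_integrable_AE[OF \<delta>_L2 order_refl order_refl] dynamics AE_space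
  ultimately show ?thesis
    by eventually_elim (unfold regular_def, intro conjI, assumption+)
qed

definition driver_int :: "real \<Rightarrow> real \<Rightarrow> 'w \<Rightarrow> real" where "driver_int a b \<omega> = (LINT s:{a..b}|lborel. f s \<omega>)"

definition driver_var :: "'w \<Rightarrow> real" where "driver_var \<omega> = (LINT s:{0..T}|lborel. \<bar>f s \<omega>\<bar>)"

lemma abs_f_time_integrable: "time_integrable (\<lambda>s \<omega>. \<bar>f s \<omega>\<bar>)"
  using integrable_abs[OF f_time_integrable[unfolded time_integrable_def]]
  by (simp add: time_integrable_def case_prod_unfold abs_mult)

lemma driver_var_square:
  assumes "regular \<omega>" shows "(driver_var \<omega>)\<^sup>2 \<le> T * (LINT s:{0..T}|lborel. (f s \<omega>)\<^sup>2)"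
proof -
  have "set_borel_measurable lborel {0..T} (\<lambda>s. f s \<omega>)"
    using assms by (auto simp: regular_def set_integrable_def set_borel_measurable_def)
  then show ?thesis
    using set_integral_square_le[of 0 T "\<lambda>s. f s \<omega>"] assms T_pos by (auto simp: regular_def driver_var_def)
qed

lemma driver_var_L2: "driver_var \<in> L2 P"
proof -
  have m: "driver_var \<in> borel_measurable P"
    unfolding driver_var_def[abs_def] using time_integrable_integral[OF abs_f_time_integrable order_refl order_refl] by simp
  have "integrable P (\<lambda>\<omega>. (driver_var \<omega>)\<^sup>2)"
  proof (rule Bochner_Integration.integrable_bound)
    show "integrable P (\<lambda>\<omega>. T * (LINT s:{0..T}|lborel. (f s \<omega>)\<^sup>2))"
      using time_integrable_integral[OF f2_time_integrable order_refl order_refl] by simp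
    show "AE \<omega> in P. norm ((driver_var \<omega>)\<^sup>2) \<le> norm (T * (LINT s:{0..T}|lborel. (f s \<omega>)\<^sup>2))"
      using AE_regular by eventually_elim (use driver_var_square in force)
  qed (use m in measurable)
  then show ?thesis using m by (simp add: L2_real_iff)
qed

lemma regular_subinterval:
  assumes "regular \<omega>" "0 \<le> a" "b \<le> T"
  shows "set_integrable lborel {a..b} (\<lambda>s. f s \<omega>)" "set_integrable lborel {a..b} (\<lambda>s. (U s \<omega>)\<^sup>2)"
    "set_integrable lborel {a..b} (\<lambda>s. (\<delta> s \<omega>)\<^sup>2)" "set_integrable lborel {a..b} (\<lambda>s. \<bar>f s \<omega>\<bar>)"
proof -
  have sub: "{a..b} \<subseteq> {0..T}" using assms by auto
  show "set_integrable lborel {a..b} (\<lambda>s. f s \<omega>)" "set_integrable lborel {a..b} (\<lambda>s. (U s \<omega>)\<^sup>2)"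
    "set_integrable lborel {a..b} (\<lambda>s. (\<delta> s \<omega>)\<^sup>2)"
    using assms(1) unfolding regular_def by (auto intro!: set_integrable_subset[OF _ _ sub])
  then show "set_integrable lborel {a..b} (\<lambda>s. \<bar>f s \<omega>\<bar>)" by (intro set_integrable_abs)
qed

lemma driver_int_bound:
  assumes "regular \<omega>" "0 \<le> a" "a \<le> b" "b \<le> T"
  shows "\<bar>driver_int a b \<omega>\<bar> \<le> (LINT s:{a..b}|lborel. \<bar>f s \<omega>\<bar>)" "\<bar>driver_int a b \<omega>\<bar> \<le> driver_var \<omega>"
proof -
  show 1: "\<bar>driver_int a b \<omega>\<bar> \<le> (LINT s:{a..b}|lborel. \<bar>f s \<omega>\<bar>)"
    unfolding driver_int_def by (rule set_integral_abs_bound)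
  have "(LINT s:{a..b}|lborel. \<bar>f s \<omega>\<bar>) \<le> driver_var \<omega>"
    using regular_subinterval(4)[OF assms(1,2,4)] regular_subinterval(4)[OF assms(1) order_refl order_refl]
    unfolding driver_var_def set_lebesgue_integral_def set_integrable_def
    by (rule integral_mono) (use assms in \<open>auto simp: indicator_def\<close>)
  with 1 show "\<bar>driver_int a b \<omega>\<bar> \<le> driver_var \<omega>" by linarith
qed

lemma driver_int_L2: "0 \<le> a \<Longrightarrow> a \<le> b \<Longrightarrow> b \<le> T \<Longrightarrow> driver_int a b \<in> L2 P"
proof (rule L2_dominated[OF _ driver_var_L2])
  assume ab: "0 \<le> a" "a \<le> b" "b \<le> T"
  show "driver_int a b \<in> borel_measurable P"
    unfolding driver_int_def[abs_def] using time_integrable_integral[OF f_time_integrable ab(1,3)] by simp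
  show "AE \<omega> in P. \<bar>driver_int a b \<omega>\<bar> \<le> \<bar>driver_var \<omega>\<bar>"
    using AE_regular by eventually_elim (use driver_int_bound(2)[OF _ ab] in force)
qed

text \<open>The inequality \<open>2 x y \<le> x\<^sup>2 + y\<^sup>2\<close> is applied to each of the three products of \<open>|U a|\<close> with \<open>\<delta> s\<close>,
  \<open>|U s|\<close> and the norm of \<open>U s\<close>.\<close>

lemma driver_step:
  assumes ab: "0 \<le> a" "a \<le> b" "b \<le> T"
  shows "2 * expectation (\<lambda>\<omega>. U a \<omega> * driver_int a b \<omega>)
    \<le> (1 + 2 * L) * (\<phi> a * (b - a)) + expectation (\<lambda>\<omega>. LINT s:{a..b}|lborel. (\<delta> s \<omega>)\<^sup>2)
      + 2 * L * (LINT s:{a..b}|lborel. \<phi> s)"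
proof -
  have a: "a \<in> {0..T}" using ab by auto
  let ?X = "\<lambda>\<omega>. (1 + 2 * L) * (b - a) * (U a \<omega>)\<^sup>2 + (LINT s:{a..b}|lborel. (\<delta> s \<omega>)\<^sup>2)
      + (L * (LINT s:{a..b}|lborel. (U s \<omega>)\<^sup>2) + L * (LINT s:{a..b}|lborel. \<phi> s))"
  have iU: "integrable P (\<lambda>\<omega>. (U a \<omega>)\<^sup>2)" using U_L2[OF a] by (simp add: L2_real_iff)
  note ii = time_integrable_integral[OF \<delta>_L2 ab(1,3)] time_integrable_integral[OF U2_time_integrable ab(1,3)]
  have i0: "set_integrable lborel {a..b} (\<lambda>s. c)" for c :: real
    unfolding set_integrable_def by (rule borel_integrable_compact[OF compact_Icc continuous_on_const])
  have pw: "AE \<omega> in P. 2 * (U a \<omega> * driver_int a b \<omega>) \<le> ?X \<omega>"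
    using AE_regular
  proof eventually_elim
    case (elim \<omega>)
    note g = regular_subinterval[OF elim ab(1,3)] and gp = \<phi>_integrable[OF ab(1,3)]
    let ?u = "\<bar>U a \<omega>\<bar>"
    have "2 * (U a \<omega> * driver_int a b \<omega>) \<le> 2 * ?u * \<bar>driver_int a b \<omega>\<bar>"
      using abs_ge_self[of "U a \<omega> * driver_int a b \<omega>"] by (simp add: abs_mult)
    also have "\<dots> \<le> 2 * ?u * (LINT s:{a..b}|lborel. \<bar>f s \<omega>\<bar>)"
      by (intro mult_left_mono driver_int_bound(1)[OF elim ab]) auto
    also have "\<dots> = (LINT s:{a..b}|lborel. 2 * ?u * \<bar>f s \<omega>\<bar>)" by simp
    also have "\<dots> \<le> (LINT s:{a..b}|lborel. ((1 + 2 * L) * (U a \<omega>)\<^sup>2 + (\<delta> s \<omega>)\<^sup>2) + (L * (U s \<omega>)\<^sup>2 + L * \<phi> s))"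
    proof (rule set_integral_mono_AE)
      show "set_integrable lborel {a..b} (\<lambda>s. 2 * ?u * \<bar>f s \<omega>\<bar>)" using g(4) by (intro set_integrable_mult_right)
      show "set_integrable lborel {a..b} (\<lambda>s. ((1 + 2 * L) * (U a \<omega>)\<^sup>2 + (\<delta> s \<omega>)\<^sup>2) + (L * (U s \<omega>)\<^sup>2 + L * \<phi> s))"
        by (intro set_integral_add set_integrable_mult_right i0 g gp)
      have "AE s in lborel. s \<in> {0..T} \<longrightarrow> \<bar>f s \<omega>\<bar> \<le> \<delta> s \<omega> + L * (\<bar>U s \<omega>\<bar> + l2norm P (U s))"
        using elim by (simp add: regular_def)
      then show "AE s\<in>{a..b} in lborel. 2 * ?u * \<bar>f s \<omega>\<bar> \<le> ((1 + 2 * L) * (U a \<omega>)\<^sup>2 + (\<delta> s \<omega>)\<^sup>2) + (L * (U s \<omega>)\<^sup>2 + L * \<phi> s)"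
      proof eventually_elim
        case (elim s)
        show ?case
        proof
          assume "s \<in> {a..b}"
          then have "\<bar>f s \<omega>\<bar> \<le> \<delta> s \<omega> + L * (\<bar>U s \<omega>\<bar> + l2norm P (U s))" using elim ab by auto
          then have "2 * ?u * \<bar>f s \<omega>\<bar> \<le> 2 * ?u * (\<delta> s \<omega> + L * (\<bar>U s \<omega>\<bar> + l2norm P (U s)))"
            by (intro mult_left_mono) auto
          also have "\<dots> = 2 * ?u * \<delta> s \<omega> + L * (2 * ?u * \<bar>U s \<omega>\<bar>) + L * (2 * ?u * l2norm P (U s))"
            by (simp add: algebra_simps)
          also have "\<dots> \<le> (?u\<^sup>2 + (\<delta> s \<omega>)\<^sup>2) + L * (?u\<^sup>2 + \<bar>U s \<omega>\<bar>\<^sup>2) + L * (?u\<^sup>2 + (l2norm P (U s))\<^sup>2)"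
            using L_pos by (intro add_mono mult_left_mono sum_squares_bound) auto
          also have "\<dots> = ((1 + 2 * L) * (U a \<omega>)\<^sup>2 + (\<delta> s \<omega>)\<^sup>2) + (L * (U s \<omega>)\<^sup>2 + L * \<phi> s)"
            by (simp add: \<phi>_eq algebra_simps)
          finally show "2 * ?u * \<bar>f s \<omega>\<bar> \<le> ((1 + 2 * L) * (U a \<omega>)\<^sup>2 + (\<delta> s \<omega>)\<^sup>2) + (L * (U s \<omega>)\<^sup>2 + L * \<phi> s)" .
        qed
      qed
    qed
    also have "\<dots> = (LINT s:{a..b}|lborel. (1 + 2 * L) * (U a \<omega>)\<^sup>2) + (LINT s:{a..b}|lborel. (\<delta> s \<omega>)\<^sup>2)
       + ((LINT s:{a..b}|lborel. L * (U s \<omega>)\<^sup>2) + (LINT s:{a..b}|lborel. L * \<phi> s))"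
      by (simp only: set_integral_add set_integrable_mult_right i0 g gp)
    also have "(LINT s:{a..b}|lborel. (1 + 2 * L) * (U a \<omega>)\<^sup>2) = (1 + 2 * L) * (b - a) * (U a \<omega>)\<^sup>2"
      using ab by (simp add: set_lebesgue_integral_def)
    finally show ?case by simp
  qed
  have "expectation (\<lambda>\<omega>. 2 * (U a \<omega> * driver_int a b \<omega>)) \<le> expectation ?X"
    by (rule integral_mono_AE[OF _ _ pw])
      (intro integrable_mult_right L2_mult_integrable U_L2 a driver_int_L2 ab Bochner_Integration.integrable_add iU ii integrable_const)+
  also have "expectation ?X = (1 + 2 * L) * (b - a) * \<phi> a + expectation (\<lambda>\<omega>. LINT s:{a..b}|lborel. (\<delta> s \<omega>)\<^sup>2)
     + (L * expectation (\<lambda>\<omega>. LINT s:{a..b}|lborel. (U s \<omega>)\<^sup>2) + L * (LINT s:{a..b}|lborel. \<phi> s))"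
    using iU ii by (simp add: \<phi>_def prob_space)
  also have "expectation (\<lambda>\<omega>. LINT s:{a..b}|lborel. (U s \<omega>)\<^sup>2) = (LINT s:{a..b}|lborel. \<phi> s)"
    unfolding \<phi>_def by (rule time_integrable_Fubini[OF U2_time_integrable ab(1,3)])
  finally show ?thesis by (simp add: algebra_simps)
qed

text \<open>By the dynamics of \<open>U\<close> this is the increment of the finite-variation part (\<open>drift_eq\<close>). Defined by
  this formula, it satisfies the discrete equation in every scenario.\<close>

definition drift :: "real \<Rightarrow> real \<Rightarrow> 'w \<Rightarrow> real" where
  "drift a b \<omega> = (U a \<omega> - U b \<omega>) + (N b \<omega> - N a \<omega>)"

lemma drift_L2: "a \<in> {0..T} \<Longrightarrow> b \<in> {0..T} \<Longrightarrow> drift a b \<in> L2 P"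
  unfolding drift_def[abs_def] by (intro L2_add L2_diff U_L2 N_L2)

lemma drift_eq: "regular \<omega> \<Longrightarrow> 0 \<le> a \<Longrightarrow> a \<le> b \<Longrightarrow> b \<le> T \<Longrightarrow> drift a b \<omega> = driver_int a b \<omega> + (r1.R a b \<omega> - r2.R a b \<omega>)"
  by (auto simp: regular_def drift_def driver_int_def)

text \<open>A continuous increasing path whose increments dominate those of the drift; its last term is the
  average of the mean-field part.\<close>

definition drift_var :: "'w \<Rightarrow> real \<Rightarrow> real" where
  "drift_var \<omega> t = (LINT s:{0..t}|lborel. \<bar>f s \<omega>\<bar>) + M * (K1 t \<omega> + K2 t \<omega>)
    + M * (expectation (K1 t) + expectation (K2 t))"

lemma drift_le_drift_var:
  assumes "regular \<omega>" "0 \<le> a" "a \<le> b" "b \<le> T"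
  shows "\<bar>drift a b \<omega>\<bar> \<le> drift_var \<omega> b - drift_var \<omega> a"
proof -
  have w: "\<omega> \<in> space P" using assms(1) by (simp add: regular_def)
  have e: "expectation (\<lambda>\<omega>. K1 b \<omega> - K1 a \<omega>) = expectation (K1 b) - expectation (K1 a)"
    "expectation (\<lambda>\<omega>. K2 b \<omega> - K2 a \<omega>) = expectation (K2 b) - expectation (K2 a)"
    using assms by (auto intro!: Bochner_Integration.integral_diff L2_integrable r1.K_L2' r2.K_L2')
  have "(LINT s:{0..b}|lborel. \<bar>f s \<omega>\<bar>) = (LINT s:{0..a}|lborel. \<bar>f s \<omega>\<bar>) + (LINT s:{a..b}|lborel. \<bar>f s \<omega>\<bar>)"
    by (rule set_integral_combine_Icc[OF regular_subinterval(4)[OF assms(1)]]) (use assms in auto)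
  then show ?thesis
    using driver_int_bound(1)[OF assms] r1.R_bound[OF assms(2-4) w] r2.R_bound[OF assms(2-4) w]
    unfolding drift_eq[OF assms] drift_var_def e by (simp add: algebra_simps)
qed

lemma K_expectation_continuous:
  "continuous_on {0..T} (\<lambda>t. expectation (K1 t))" "continuous_on {0..T} (\<lambda>t. expectation (K2 t))"
proof -
  have gen: "continuous_on {0..T} (\<lambda>t. expectation (K t))"
    if "\<And>t. t \<in> {0..T} \<Longrightarrow> K t \<in> borel_measurable P" "integrable P (K T)"
      "\<And>t \<omega>. t \<in> {0..T} \<Longrightarrow> \<omega> \<in> space P \<Longrightarrow> 0 \<le> K t \<omega> \<and> K t \<omega> \<le> K T \<omega>"
      "\<And>\<omega>. \<omega> \<in> space P \<Longrightarrow> increasing_path T (\<lambda>t. K t \<omega>)" for K :: "real \<Rightarrow> 'w \<Rightarrow> real"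
    unfolding continuous_on_sequentially comp_def
  proof (intro ballI allI impI)
    fix r t assume t: "t \<in> {0..T}" and "(\<forall>n. r n \<in> {0..T}) \<and> r \<longlonglongrightarrow> t"
    then have r: "\<And>n. r n \<in> {0..T}" "r \<longlonglongrightarrow> t" by auto
    show "(\<lambda>n. expectation (K (r n))) \<longlonglongrightarrow> expectation (K t)"
    proof (rule integral_dominated_convergence[where w = "K T"])
      show "AE \<omega> in P. (\<lambda>n. K (r n) \<omega>) \<longlonglongrightarrow> K t \<omega>"
      proof (rule AE_I2)
        fix \<omega> assume "\<omega> \<in> space P"
        then have "continuous_on {0..T} (\<lambda>t. K t \<omega>)" using that(4) by (simp add: increasing_path_def)
        then show "(\<lambda>n. K (r n) \<omega>) \<longlonglongrightarrow> K t \<omega>"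
          using r t unfolding continuous_on_sequentially comp_def by blast
      qed
      show "AE \<omega> in P. norm (K (r n) \<omega>) \<le> K T \<omega>" for n
        by (rule AE_I2) (use that(3)[OF r(1)] in force)
    qed (use that(1,2) r t in auto)
  qed
  show "continuous_on {0..T} (\<lambda>t. expectation (K1 t))"
  proof (rule gen[OF r1.K_measurable L2_integrable[OF r1.K_L2] _ r1.K_path])
    fix t \<omega> assume "t \<in> {0..T}" "\<omega> \<in> space P"
    then show "0 \<le> K1 t \<omega> \<and> K1 t \<omega> \<le> K1 T \<omega>" using r1.K_increment(3,4)[of \<omega> t t] by auto
  qed
  show "continuous_on {0..T} (\<lambda>t. expectation (K2 t))"
  proof (rule gen[OF r2.K_measurable L2_integrable[OF r2.K_L2] _ r2.K_path])
    fix t \<omega> assume "t \<in> {0..T}" "\<omega> \<in> space P"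
    then show "0 \<le> K2 t \<omega> \<and> K2 t \<omega> \<le> K2 T \<omega>" using r2.K_increment(3,4)[of \<omega> t t] by auto
  qed
qed

lemma drift_var_path:
  assumes "regular \<omega>"
  shows "continuous_on {0..T} (drift_var \<omega>)" "mono_on {0..T} (drift_var \<omega>)" "0 \<le> drift_var \<omega> 0"
proof -
  have w: "\<omega> \<in> space P" using assms by (simp add: regular_def)
  have "continuous_on {0..T} (\<lambda>t. LINT s:{0..t}|lborel. \<bar>f s \<omega>\<bar>)"
    using regular_subinterval(4)[OF assms order_refl order_refl] T_pos by (intro continuous_indefinite_integral) auto
  moreover have "continuous_on {0..T} (\<lambda>t. K1 t \<omega>)" "continuous_on {0..T} (\<lambda>t. K2 t \<omega>)"
    using r1.K_path[OF w] r2.K_path[OF w] by (auto simp: increasing_path_def)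
  ultimately show "continuous_on {0..T} (drift_var \<omega>)"
    unfolding drift_var_def by (intro continuous_intros K_expectation_continuous)
  show "mono_on {0..T} (drift_var \<omega>)"
  proof (rule mono_onI)
    fix a b assume "a \<in> {0..T}" "b \<in> {0..T}" "a \<le> b"
    then have "\<bar>drift a b \<omega>\<bar> \<le> drift_var \<omega> b - drift_var \<omega> a" by (intro drift_le_drift_var[OF assms]) auto
    then show "drift_var \<omega> a \<le> drift_var \<omega> b" using abs_ge_zero[of "drift a b \<omega>"] by linarith
  qed
  have "0 \<le> (LINT s:{0..0}|lborel. \<bar>f s \<omega>\<bar>)"
    unfolding set_lebesgue_integral_def by (intro Bochner_Integration.integral_nonneg) (auto simp: indicator_def)
  moreover have "0 \<le> expectation (K1 0)" "0 \<le> expectation (K2 0)"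
    using r1.K_0 r2.K_0 by (auto intro!: Bochner_Integration.integral_nonneg_AE AE_I2)
  ultimately show "0 \<le> drift_var \<omega> 0"
    unfolding drift_var_def using r1.K_0[OF w] r2.K_0[OF w] r1.M_nonneg by simp
qed

lemma drift_var_L2: "(\<lambda>\<omega>. drift_var \<omega> T) \<in> L2 P"
  unfolding drift_var_def driver_var_def[symmetric]
  by (intro L2_add L2_cmult L2_const driver_var_L2 r1.K_L2 r2.K_L2)

lemma sum_drift_square_tendsto_0:
  assumes t: "t \<in> {0..T}"
  shows "(\<lambda>m. \<Sum>i<m. expectation (\<lambda>\<omega>. (drift (grid t T m i) (grid t T m (Suc i)) \<omega>)\<^sup>2)) \<longlonglongrightarrow> 0"
proof -
  define g where "g = (\<lambda>m i. grid t T m i)"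
  have tT: "t \<le> T" "0 \<le> t" using t by auto
  have g: "g m i \<in> {0..T}" "g m (Suc i) \<in> {0..T}" "0 \<le> g m i" "g m i \<le> g m (Suc i)" "g m (Suc i) \<le> T" if "i < m" for m i
    using grid_mem_time[OF tT(2,1) order_refl that] grid_Suc_mono[OF tT(1), of m i] by (auto simp: g_def)
  have AL: "drift (g m i) (g m (Suc i)) \<in> L2 P" if "i < m" for m i by (intro drift_L2 g that)
  have le: "(\<Sum>i<m. (drift (g m i) (g m (Suc i)) \<omega>)\<^sup>2) \<le> (\<Sum>i<m. (drift_var \<omega> (g m (Suc i)) - drift_var \<omega> (g m i))\<^sup>2)" if "regular \<omega>" for m \<omega>
  proof (rule sum_mono)
    fix i assume "i \<in> {..<m}"
    then have i: "i < m" by simp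
    from power_mono[OF drift_le_drift_var[OF that g(3,4,5)[OF i]], of 2]
    show "(drift (g m i) (g m (Suc i)) \<omega>)\<^sup>2 \<le> (drift_var \<omega> (g m (Suc i)) - drift_var \<omega> (g m i))\<^sup>2" by simp
  qed
  have sub: "{t..T} \<subseteq> {0..T}" using t by auto
  have "(\<lambda>m. expectation (\<lambda>\<omega>. \<Sum>i<m. (drift (g m i) (g m (Suc i)) \<omega>)\<^sup>2)) \<longlonglongrightarrow> expectation (\<lambda>_. 0)"
  proof (rule integral_dominated_convergence[where w = "\<lambda>\<omega>. (drift_var \<omega> T)\<^sup>2"])
    show "(\<lambda>\<omega>. \<Sum>i<m. (drift (g m i) (g m (Suc i)) \<omega>)\<^sup>2) \<in> borel_measurable P" for m
      by (intro borel_measurable_sum borel_measurable_power L2_measurable AL) auto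
    show "integrable P (\<lambda>\<omega>. (drift_var \<omega> T)\<^sup>2)" using drift_var_L2 by (simp add: L2_real_iff)
    show "AE \<omega> in P. (\<lambda>m. \<Sum>i<m. (drift (g m i) (g m (Suc i)) \<omega>)\<^sup>2) \<longlonglongrightarrow> 0"
      using AE_regular
    proof eventually_elim
      case (elim \<omega>)
      have "(\<lambda>m. \<Sum>i<m. (drift_var \<omega> (g m (Suc i)) - drift_var \<omega> (g m i))\<^sup>2) \<longlonglongrightarrow> 0"
        unfolding g_def
        by (rule sum_squares_increments_tendsto_0[OF mono_on_subset[OF drift_var_path(2)[OF elim] sub]
              continuous_on_subset[OF drift_var_path(1)[OF elim] sub] tT(1)])
      then show ?case
        by (rule tendsto_sandwich[OF _ _ tendsto_const, rotated 2])
          (use le[OF elim] in \<open>auto intro!: always_eventually sum_nonneg\<close>)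
    qed
    show "AE \<omega> in P. norm (\<Sum>i<m. (drift (g m i) (g m (Suc i)) \<omega>)\<^sup>2) \<le> (drift_var \<omega> T)\<^sup>2" for m
      using AE_regular
    proof eventually_elim
      case (elim \<omega>)
      have vt: "0 \<le> drift_var \<omega> t" "drift_var \<omega> t \<le> drift_var \<omega> T"
        using drift_var_path(3)[OF elim] mono_onD[OF drift_var_path(2)[OF elim], of 0 t] mono_onD[OF drift_var_path(2)[OF elim], of t T] t by auto
      show ?case
      proof (cases "m = 0")
        case False
        then have m: "m > 0" by simp
        have "norm (\<Sum>i<m. (drift (g m i) (g m (Suc i)) \<omega>)\<^sup>2) = (\<Sum>i<m. (drift (g m i) (g m (Suc i)) \<omega>)\<^sup>2)"
          by (simp add: sum_nonneg)
        also have "\<dots> \<le> (\<Sum>i<m. (drift_var \<omega> (g m (Suc i)) - drift_var \<omega> (g m i))\<^sup>2)" by (rule le[OF elim])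
        also have "\<dots> \<le> (drift_var \<omega> T - drift_var \<omega> t)\<^sup>2"
          unfolding g_def by (rule sum_squares_increments_le[OF mono_on_subset[OF drift_var_path(2)[OF elim] sub] tT(1) m])
        also have "\<dots> \<le> (drift_var \<omega> T)\<^sup>2" using vt by (intro power_mono) auto
        finally show ?thesis .
      qed simp
    qed
  qed auto
  moreover have "expectation (\<lambda>\<omega>. \<Sum>i<m. (drift (g m i) (g m (Suc i)) \<omega>)\<^sup>2)
      = (\<Sum>i<m. expectation (\<lambda>\<omega>. (drift (g m i) (g m (Suc i)) \<omega>)\<^sup>2))" for m
    by (rule Bochner_Integration.integral_sum) (use AL in \<open>auto simp: L2_real_iff\<close>)
  ultimately show ?thesis by (simp add: g_def)
qed

text \<open>Orthogonality of martingale increments.\<close>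

lemma N_increments:
  assumes t: "t \<in> {0..T}" and m: "m > 0"
  shows "expectation (\<lambda>\<omega>. (N T \<omega> - N t \<omega>)\<^sup>2)
    = (\<Sum>i<m. expectation (\<lambda>\<omega>. (N (grid t T m (Suc i)) \<omega> - N (grid t T m i) \<omega>)\<^sup>2))"
proof -
  define g where "g = grid t T m"
  have tT: "t \<le> T" "0 \<le> t" using t by auto
  have g: "g i \<in> {t..T}" if "i \<le> m" for i using grid_mem[OF tT(1) that m] by (simp add: g_def)
  have "expectation (\<lambda>\<omega>. (N (g j) \<omega> - N t \<omega>)\<^sup>2) = (\<Sum>i<j. expectation (\<lambda>\<omega>. (N (g (Suc i)) \<omega> - N (g i) \<omega>)\<^sup>2))"
    if "j \<le> m" for j
    using that
  proof (induction j)
    case 0 then show ?case by (simp add: g_def)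
  next
    case (Suc j)
    have gj: "t \<le> g j" "g j \<le> g (Suc j)" "g (Suc j) \<le> T" "0 \<le> g j"
      using g[of j] g[of "Suc j"] Suc.prems grid_Suc_mono[OF tT(1), of m j] tT by (auto simp: g_def)
    let ?V = "\<lambda>\<omega>. N (g j) \<omega> - N t \<omega>" and ?n = "\<lambda>\<omega>. N (g (Suc j)) \<omega> - N (g j) \<omega>"
    have "N t \<in> borel_measurable (F (g j))" by (rule F_measurable_mono[OF N_adapted[OF t] gj(1)])
    moreover have "N (g j) \<in> borel_measurable (F (g j))" using gj by (intro N_adapted) auto
    ultimately have VF: "?V \<in> borel_measurable (F (g j))" by (rule borel_measurable_diff[rotated])
    have U_sup: "?V \<in> L2 P" and n: "?n \<in> L2 P" using gj tT by (auto intro!: L2_diff N_L2)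
    have orth: "expectation (\<lambda>\<omega>. ?V \<omega> * ?n \<omega>) = 0" by (rule N_martingale[OF gj(4,2,3) VF U_sup])
    have "(\<lambda>\<omega>. (N (g (Suc j)) \<omega> - N t \<omega>)\<^sup>2) = (\<lambda>\<omega>. (?V \<omega>)\<^sup>2 + (?n \<omega>)\<^sup>2 + 2 * (?V \<omega> * ?n \<omega>))"
      by (auto simp: fun_eq_iff power2_eq_square algebra_simps)
    then have "expectation (\<lambda>\<omega>. (N (g (Suc j)) \<omega> - N t \<omega>)\<^sup>2)
        = expectation (\<lambda>\<omega>. (?V \<omega>)\<^sup>2) + expectation (\<lambda>\<omega>. (?n \<omega>)\<^sup>2) + 2 * expectation (\<lambda>\<omega>. ?V \<omega> * ?n \<omega>)"
      using U_sup n L2_mult_integrable[OF U_sup n] unfolding L2_real_iff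
      by (simp del: Bochner_Integration.integral_diff)
    then show ?case using Suc orth by simp
  qed
  from this[of m] show ?thesis using m by (simp add: g_def)
qed

text \<open>The discrete form of Ito's formula for \<open>U\<^sup>2\<close>. With \<open>x = U a - U b\<close> one has
  \<open>U b\<^sup>2 = U a\<^sup>2 - 2 U a x + x\<^sup>2\<close>, and \<open>x\<close> differs from the drift by a martingale increment, which is
  orthogonal to \<open>U a\<close>.\<close>

lemma energy_identity:
  assumes t: "t \<in> {0..T}" and m: "m > 0"
  defines "g \<equiv> grid t T m"
  shows "\<phi> t + (\<Sum>i<m. expectation (\<lambda>\<omega>. (U (g i) \<omega> - U (g (Suc i)) \<omega>)\<^sup>2))
    = \<phi> T + 2 * (\<Sum>i<m. expectation (\<lambda>\<omega>. U (g i) \<omega> * drift (g i) (g (Suc i)) \<omega>))"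
proof -
  have tT: "t \<le> T" "0 \<le> t" using t by auto
  have step: "\<phi> (g i) + expectation (\<lambda>\<omega>. (U (g i) \<omega> - U (g (Suc i)) \<omega>)\<^sup>2)
      = \<phi> (g (Suc i)) + 2 * expectation (\<lambda>\<omega>. U (g i) \<omega> * drift (g i) (g (Suc i)) \<omega>)" if i: "i < m" for i
  proof -
    let ?a = "g i" and ?b = "g (Suc i)"
    have ab: "?a \<in> {0..T}" "?b \<in> {0..T}" "0 \<le> ?a" "?a \<le> ?b" "?b \<le> T"
      using grid_mem_time[OF tT(2,1) order_refl i] grid_Suc_mono[OF tT(1), of m i] by (auto simp: g_def)
    let ?x = "\<lambda>\<omega>. U ?a \<omega> - U ?b \<omega>" and ?n = "\<lambda>\<omega>. N ?b \<omega> - N ?a \<omega>"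
    note L = U_L2[OF ab(1)] L2_diff[OF U_L2[OF ab(1)] U_L2[OF ab(2)]] L2_diff[OF N_L2[OF ab(2)] N_L2[OF ab(1)]]
    have orth: "expectation (\<lambda>\<omega>. U ?a \<omega> * ?n \<omega>) = 0"
      by (rule N_martingale[OF ab(3,4,5) U_adapted[OF ab(1)] L(1)])
    have "expectation (\<lambda>\<omega>. U ?a \<omega> * drift ?a ?b \<omega>) = expectation (\<lambda>\<omega>. U ?a \<omega> * ?x \<omega> + U ?a \<omega> * ?n \<omega>)"
      by (simp add: drift_def distrib_left)
    also have "\<dots> = expectation (\<lambda>\<omega>. U ?a \<omega> * ?x \<omega>)"
      by (subst Bochner_Integration.integral_add[OF L2_mult_integrable[OF L(1,2)] L2_mult_integrable[OF L(1,3)]]) (simp only: orth add_0_right)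
    finally have 1: "expectation (\<lambda>\<omega>. U ?a \<omega> * drift ?a ?b \<omega>) = expectation (\<lambda>\<omega>. U ?a \<omega> * ?x \<omega>)" .
    have "\<phi> ?b = expectation (\<lambda>\<omega>. (U ?a \<omega>)\<^sup>2 + (?x \<omega>)\<^sup>2 - 2 * (U ?a \<omega> * ?x \<omega>))"
      unfolding \<phi>_def by (intro Bochner_Integration.integral_cong refl) (simp add: power2_eq_square algebra_simps)
    also have "\<dots> = \<phi> ?a + expectation (\<lambda>\<omega>. (?x \<omega>)\<^sup>2) - 2 * expectation (\<lambda>\<omega>. U ?a \<omega> * ?x \<omega>)"
    proof -
      have i: "integrable P (\<lambda>\<omega>. (U ?a \<omega>)\<^sup>2)" "integrable P (\<lambda>\<omega>. (?x \<omega>)\<^sup>2)" "integrable P (\<lambda>\<omega>. 2 * (U ?a \<omega> * ?x \<omega>))"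
        using L(1,2) integrable_mult_right[OF L2_mult_integrable[OF L(1,2)]] by (auto simp: L2_real_iff)
      show ?thesis
        unfolding \<phi>_def
        by (subst Bochner_Integration.integral_diff[OF Bochner_Integration.integrable_add[OF i(1,2)] i(3)],
            subst Bochner_Integration.integral_add[OF i(1,2)]) simp
    qed
    finally show ?thesis using 1 by simp
  qed
  have "(\<Sum>i<m. \<phi> (g (Suc i)) - \<phi> (g i)) = \<phi> T - \<phi> t"
    unfolding g_def by (rule sum_increments_grid[OF m])
  moreover have "(\<Sum>i<m. \<phi> (g i) + expectation (\<lambda>\<omega>. (U (g i) \<omega> - U (g (Suc i)) \<omega>)\<^sup>2))
      = (\<Sum>i<m. \<phi> (g (Suc i)) + 2 * expectation (\<lambda>\<omega>. U (g i) \<omega> * drift (g i) (g (Suc i)) \<omega>))"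
    using step by (intro sum.cong) auto
  ultimately show ?thesis by (simp add: sum.distrib sum_subtractf sum_distrib_left)
qed

text \<open>The drift splits into the driver, bounded cell by cell, and the two reflections, whose
  contributions are asymptotically nonpositive.\<close>

lemma cross_terms:
  assumes t: "t \<in> {0..T}" and e: "e > 0"
  shows "\<forall>\<^sub>F m in sequentially. m > 0 \<and> \<phi> T
      + 2 * (\<Sum>i<m. expectation (\<lambda>\<omega>. U (grid t T m i) \<omega> * drift (grid t T m i) (grid t T m (Suc i)) \<omega>))
    \<le> data_sq + (1 + 4 * L) * (LINT s:{t..T}|lborel. \<phi> s) + e"
proof -
  have tT: "t \<le> T" "0 \<le> t" using t by auto
  \<comment> \<open>The error is incurred \<open>1 + 2 L\<close> times from the Riemann sum of \<open>\<phi>\<close> and twice from each of the two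
    reflections.\<close>
  define \<epsilon> where "\<epsilon> = e / (5 + 2 * L)"
  have \<epsilon>: "\<epsilon> > 0" using e L_pos by (simp add: \<epsilon>_def)
  have \<epsilon>e: "(5 + 2 * L) * \<epsilon> = e" using L_pos by (simp add: \<epsilon>_def)
  have cont: "continuous_on {t..T} \<phi>" by (rule continuous_on_subset[OF \<phi>_continuous]) (use t in auto)
  have H2: "AE \<omega> in P. \<forall>t\<in>{0..T}. 0 \<le> H (Y2 t \<omega>) (law P (Y2 t))" using flat2 by eventually_elim auto
  have H1: "AE \<omega> in P. \<forall>t\<in>{0..T}. 0 \<le> H (Y1 t \<omega>) (law P (Y1 t))" using flat1 by eventually_elim auto
  note ev1 = r1.reflection_energy[OF r2.continuous_process_axioms H2 flat1 t \<epsilon>]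
  note ev2 = r2.reflection_energy[OF r1.continuous_process_axioms H1 flat2 t \<epsilon>]
  note ev3 = riemann_sum_le[OF cont tT(1) \<epsilon>]
  show ?thesis
    using ev1 ev2 ev3 eventually_gt_at_top[of 0]
  proof eventually_elim
    case (elim m)
    define g where "g = grid t T m"
    have m: "m > 0" by fact
    have g: "g i \<in> {0..T}" "g (Suc i) \<in> {0..T}" "0 \<le> g i" "g i \<le> g (Suc i)" "g (Suc i) \<le> T" if "i < m" for i
      using grid_mem_time[OF tT(2,1) order_refl that] grid_Suc_mono[OF tT(1), of m i] by (auto simp: g_def)
    have split: "expectation (\<lambda>\<omega>. U (g i) \<omega> * drift (g i) (g (Suc i)) \<omega>)
      = expectation (\<lambda>\<omega>. U (g i) \<omega> * driver_int (g i) (g (Suc i)) \<omega>)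
        + expectation (\<lambda>\<omega>. (Y1 (g i) \<omega> - Y2 (g i) \<omega>) * r1.R (g i) (g (Suc i)) \<omega>)
        + expectation (\<lambda>\<omega>. (Y2 (g i) \<omega> - Y1 (g i) \<omega>) * r2.R (g i) (g (Suc i)) \<omega>)" if i: "i < m" for i
    proof -
      have Y21: "(\<lambda>\<omega>. Y2 (g i) \<omega> - Y1 (g i) \<omega>) \<in> L2 P" "(\<lambda>\<omega>. Y1 (g i) \<omega> - Y2 (g i) \<omega>) \<in> L2 P"
        by (intro L2_diff r1.Y_L2 r2.Y_L2 g(1)[OF i])+
      have i1: "integrable P (\<lambda>\<omega>. U (g i) \<omega> * driver_int (g i) (g (Suc i)) \<omega>)"
        by (intro L2_mult_integrable U_L2 driver_int_L2 g[OF i])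
      have i2: "integrable P (\<lambda>\<omega>. (Y1 (g i) \<omega> - Y2 (g i) \<omega>) * r1.R (g i) (g (Suc i)) \<omega>)"
        by (intro L2_mult_integrable Y21 r1.R_L2 g[OF i])
      have i3: "integrable P (\<lambda>\<omega>. (Y2 (g i) \<omega> - Y1 (g i) \<omega>) * r2.R (g i) (g (Suc i)) \<omega>)"
        by (intro L2_mult_integrable Y21 r2.R_L2 g[OF i])
      have "expectation (\<lambda>\<omega>. U (g i) \<omega> * drift (g i) (g (Suc i)) \<omega>) = expectation (\<lambda>\<omega>. U (g i) \<omega> * driver_int (g i) (g (Suc i)) \<omega>
          + (Y1 (g i) \<omega> - Y2 (g i) \<omega>) * r1.R (g i) (g (Suc i)) \<omega> + (Y2 (g i) \<omega> - Y1 (g i) \<omega>) * r2.R (g i) (g (Suc i)) \<omega>)"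
      proof (rule integral_cong_AE)
        show "(\<lambda>\<omega>. U (g i) \<omega> * drift (g i) (g (Suc i)) \<omega>) \<in> borel_measurable P"
          by (intro borel_measurable_times L2_measurable U_L2 drift_L2 g[OF i])
        show "(\<lambda>\<omega>. U (g i) \<omega> * driver_int (g i) (g (Suc i)) \<omega> + (Y1 (g i) \<omega> - Y2 (g i) \<omega>) * r1.R (g i) (g (Suc i)) \<omega>
            + (Y2 (g i) \<omega> - Y1 (g i) \<omega>) * r2.R (g i) (g (Suc i)) \<omega>) \<in> borel_measurable P"
          using i1 i2 i3 by (intro borel_measurable_add borel_measurable_integrable)
        show "AE \<omega> in P. U (g i) \<omega> * drift (g i) (g (Suc i)) \<omega> = U (g i) \<omega> * driver_int (g i) (g (Suc i)) \<omega>
            + (Y1 (g i) \<omega> - Y2 (g i) \<omega>) * r1.R (g i) (g (Suc i)) \<omega> + (Y2 (g i) \<omega> - Y1 (g i) \<omega>) * r2.R (g i) (g (Suc i)) \<omega>"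
          using AE_regular
        proof eventually_elim
          case (elim \<omega>)
          have U: "U (g i) \<omega> = Y1 (g i) \<omega> - Y2 (g i) \<omega>" by (simp add: U_def)
          show ?case unfolding drift_eq[OF elim g(3,4,5)[OF i]] U by (simp add: algebra_simps)
        qed
      qed
      also have "\<dots> = expectation (\<lambda>\<omega>. U (g i) \<omega> * driver_int (g i) (g (Suc i)) \<omega>)
        + expectation (\<lambda>\<omega>. (Y1 (g i) \<omega> - Y2 (g i) \<omega>) * r1.R (g i) (g (Suc i)) \<omega>)
        + expectation (\<lambda>\<omega>. (Y2 (g i) \<omega> - Y1 (g i) \<omega>) * r2.R (g i) (g (Suc i)) \<omega>)"
        by (subst Bochner_Integration.integral_add[OF Bochner_Integration.integrable_add[OF i1 i2] i3],
            subst Bochner_Integration.integral_add[OF i1 i2]) simp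
      finally show ?thesis .
    qed
    have d2: "integrable P (\<lambda>\<omega>. LINT s:{a..b}|lborel. (\<delta> s \<omega>)\<^sup>2)" if "0 \<le> a" "b \<le> T" for a b
      by (rule time_integrable_integral[OF \<delta>_L2 that])
    have dsum: "(\<Sum>i<m. expectation (\<lambda>\<omega>. LINT s:{g i..g (Suc i)}|lborel. (\<delta> s \<omega>)\<^sup>2))
        = expectation (\<lambda>\<omega>. LINT s:{t..T}|lborel. (\<delta> s \<omega>)\<^sup>2)"
    proof -
      have "(\<Sum>i<m. expectation (\<lambda>\<omega>. LINT s:{g i..g (Suc i)}|lborel. (\<delta> s \<omega>)\<^sup>2))
        = expectation (\<lambda>\<omega>. \<Sum>i<m. LINT s:{g i..g (Suc i)}|lborel. (\<delta> s \<omega>)\<^sup>2)"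
        by (rule Bochner_Integration.integral_sum[symmetric]) (use d2 g in auto)
      also have "\<dots> = expectation (\<lambda>\<omega>. LINT s:{t..T}|lborel. (\<delta> s \<omega>)\<^sup>2)"
      proof (rule integral_cong_AE)
        show "(\<lambda>\<omega>. \<Sum>i<m. LINT s:{g i..g (Suc i)}|lborel. (\<delta> s \<omega>)\<^sup>2) \<in> borel_measurable P"
          by (intro borel_measurable_sum borel_measurable_integrable d2) (use g in auto)
        show "(\<lambda>\<omega>. LINT s:{t..T}|lborel. (\<delta> s \<omega>)\<^sup>2) \<in> borel_measurable P"
          by (intro borel_measurable_integrable d2 tT order_refl)
        show "AE \<omega> in P. (\<Sum>i<m. LINT s:{g i..g (Suc i)}|lborel. (\<delta> s \<omega>)\<^sup>2) = (LINT s:{t..T}|lborel. (\<delta> s \<omega>)\<^sup>2)"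
          using AE_regular unfolding g_def
          by eventually_elim (rule interval_integral_grid[OF tT(1) regular_subinterval(3)[OF _ tT(2) order_refl] m])
      qed
      finally show ?thesis .
    qed
    have dle: "expectation (\<lambda>\<omega>. LINT s:{t..T}|lborel. (\<delta> s \<omega>)\<^sup>2) \<le> expectation (\<lambda>\<omega>. LINT s:{0..T}|lborel. (\<delta> s \<omega>)\<^sup>2)"
    proof (rule integral_mono_AE[OF d2[OF tT(2) order_refl] d2[OF order_refl order_refl]])
      show "AE \<omega> in P. (LINT s:{t..T}|lborel. (\<delta> s \<omega>)\<^sup>2) \<le> (LINT s:{0..T}|lborel. (\<delta> s \<omega>)\<^sup>2)"
        using AE_regular
      proof eventually_elim
        case (elim \<omega>)
        show ?case
          using regular_subinterval(3)[OF elim tT(2) order_refl] regular_subinterval(3)[OF elim order_refl order_refl]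
          unfolding set_lebesgue_integral_def set_integrable_def
          by (rule integral_mono) (use tT in \<open>auto simp: indicator_def\<close>)
      qed
    qed
    have "2 * (\<Sum>i<m. expectation (\<lambda>\<omega>. U (g i) \<omega> * driver_int (g i) (g (Suc i)) \<omega>))
       = (\<Sum>i<m. 2 * expectation (\<lambda>\<omega>. U (g i) \<omega> * driver_int (g i) (g (Suc i)) \<omega>))" by (rule sum_distrib_left)
    also have "\<dots> \<le> (\<Sum>i<m. (1 + 2 * L) * (\<phi> (g i) * (g (Suc i) - g i))
        + expectation (\<lambda>\<omega>. LINT s:{g i..g (Suc i)}|lborel. (\<delta> s \<omega>)\<^sup>2)
        + 2 * L * (LINT s:{g i..g (Suc i)}|lborel. \<phi> s))"
      by (intro sum_mono driver_step) (use g in auto)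
    also have "\<dots> = (1 + 2 * L) * (\<Sum>i<m. \<phi> (g i) * (g (Suc i) - g i))
        + expectation (\<lambda>\<omega>. LINT s:{t..T}|lborel. (\<delta> s \<omega>)\<^sup>2) + 2 * L * (LINT s:{t..T}|lborel. \<phi> s)"
      unfolding sum.distrib sum_distrib_left[symmetric] dsum
      using interval_integral_grid[OF tT(1) \<phi>_integrable[OF tT(2) order_refl] m] by (simp add: g_def)
    also have "\<dots> \<le> (1 + 2 * L) * ((LINT s:{t..T}|lborel. \<phi> s) + \<epsilon>)
        + expectation (\<lambda>\<omega>. LINT s:{0..T}|lborel. (\<delta> s \<omega>)\<^sup>2) + 2 * L * (LINT s:{t..T}|lborel. \<phi> s)"
      using elim(3) L_pos dle by (intro add_mono mult_left_mono) (auto simp: g_def)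
    finally have F: "2 * (\<Sum>i<m. expectation (\<lambda>\<omega>. U (g i) \<omega> * driver_int (g i) (g (Suc i)) \<omega>))
      \<le> (1 + 2 * L) * ((LINT s:{t..T}|lborel. \<phi> s) + \<epsilon>)
        + expectation (\<lambda>\<omega>. LINT s:{0..T}|lborel. (\<delta> s \<omega>)\<^sup>2) + 2 * L * (LINT s:{t..T}|lborel. \<phi> s)" .
    define sF where "sF = (\<Sum>i<m. expectation (\<lambda>\<omega>. U (g i) \<omega> * driver_int (g i) (g (Suc i)) \<omega>))"
    define s1 where "s1 = (\<Sum>i<m. expectation (\<lambda>\<omega>. (Y1 (g i) \<omega> - Y2 (g i) \<omega>) * r1.R (g i) (g (Suc i)) \<omega>))"
    define s2 where "s2 = (\<Sum>i<m. expectation (\<lambda>\<omega>. (Y2 (g i) \<omega> - Y1 (g i) \<omega>) * r2.R (g i) (g (Suc i)) \<omega>))"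
    define J where "J = (LINT s:{t..T}|lborel. \<phi> s)"
    define dd where "dd = expectation (\<lambda>\<omega>. LINT s:{0..T}|lborel. (\<delta> s \<omega>)\<^sup>2)"
    have sum: "(\<Sum>i<m. expectation (\<lambda>\<omega>. U (g i) \<omega> * drift (g i) (g (Suc i)) \<omega>)) = sF + s1 + s2"
      unfolding sF_def s1_def s2_def sum.distrib[symmetric] by (intro sum.cong refl split) auto
    define X where "X = (1 + 2 * L) * (J + \<epsilon>) + dd + 2 * L * J"
    have F': "2 * sF \<le> X"
      using F unfolding X_def sF_def J_def dd_def .
    have s12: "s1 < \<epsilon>" "s2 < \<epsilon>" using elim(1,2) unfolding s1_def s2_def g_def .
    have "\<phi> T + X + 4 * \<epsilon> = data_sq + (1 + 4 * L) * J + (5 + 2 * L) * \<epsilon>"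
      unfolding X_def data_sq_def dd_def by (simp add: algebra_simps)
    also have "(5 + 2 * L) * \<epsilon> = e" by (rule \<epsilon>e)
    finally have "data_sq + (1 + 4 * L) * J + e = \<phi> T + X + 4 * \<epsilon>" by (rule sym)
    moreover have "\<phi> T + 2 * (sF + s1 + s2) \<le> \<phi> T + X + 4 * \<epsilon>"
      using F' s12 unfolding distrib_left by linarith
    ultimately have "\<phi> T + 2 * (sF + s1 + s2) \<le> data_sq + (1 + 4 * L) * J + e" by (simp only:)
    then show ?case using m sum unfolding J_def g_def by simp
  qed
qed

text \<open>The squares on the left of the energy identity are dropped.\<close>

lemma energy_U:
  assumes t: "t \<in> {0..T}"
  shows "\<phi> t \<le> data_sq + (1 + 4 * L) * (LINT s:{t..T}|lborel. \<phi> s)"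
proof (rule field_le_epsilon)
  fix e :: real assume "e > 0"
  from eventually_happens'[OF sequentially_bot cross_terms[OF t this]] obtain m where m: "m > 0" and
    le: "\<phi> T + 2 * (\<Sum>i<m. expectation (\<lambda>\<omega>. U (grid t T m i) \<omega> * drift (grid t T m i) (grid t T m (Suc i)) \<omega>))
      \<le> data_sq + (1 + 4 * L) * (LINT s:{t..T}|lborel. \<phi> s) + e"
    by blast
  have "0 \<le> (\<Sum>i<m. expectation (\<lambda>\<omega>. (U (grid t T m i) \<omega> - U (grid t T m (Suc i)) \<omega>)\<^sup>2))"
    by (intro sum_nonneg Bochner_Integration.integral_nonneg) auto
  then show "\<phi> t \<le> data_sq + (1 + 4 * L) * (LINT s:{t..T}|lborel. \<phi> s) + e"
    using energy_identity[OF t m] le by linarith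
qed

text \<open>A martingale increment differs from the increment of \<open>U\<close> by the drift, and the squares of the drift
  are negligible on fine grids. So the squares that were dropped for \<open>U\<close> control \<open>N\<close>.\<close>

lemma energy_N:
  "expectation (\<lambda>\<omega>. (N T \<omega> - N 0 \<omega>)\<^sup>2) \<le> 2 * (data_sq + (1 + 4 * L) * (LINT s:{0..T}|lborel. \<phi> s))"
proof (rule field_le_epsilon)
  fix e :: real assume e: "e > 0"
  have t: "0 \<in> {0..T}" using T_pos by simp
  have "\<forall>\<^sub>F m in sequentially. (\<Sum>i<m. expectation (\<lambda>\<omega>. (drift (grid 0 T m i) (grid 0 T m (Suc i)) \<omega>)\<^sup>2)) < e / 4"
    using sum_drift_square_tendsto_0[OF t] e by (intro order_tendstoD) auto
  moreover have "e / 4 > 0" using e by simp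
  note cross_terms[OF t this]
  ultimately have "\<forall>\<^sub>F m in sequentially. expectation (\<lambda>\<omega>. (N T \<omega> - N 0 \<omega>)\<^sup>2)
      \<le> 2 * (data_sq + (1 + 4 * L) * (LINT s:{0..T}|lborel. \<phi> s)) + e"
  proof eventually_elim
    case (elim m)
    define g where "g = grid 0 T m"
    have m: "m > 0" using elim by simp
    have g: "g i \<in> {0..T}" "g (Suc i) \<in> {0..T}" if "i < m" for i
      using grid_mem_time[OF order_refl _ order_refl that] T_pos by (auto simp: g_def)
    have "expectation (\<lambda>\<omega>. (N T \<omega> - N 0 \<omega>)\<^sup>2) = (\<Sum>i<m. expectation (\<lambda>\<omega>. (N (g (Suc i)) \<omega> - N (g i) \<omega>)\<^sup>2))"
      unfolding g_def by (rule N_increments[OF t m])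
    also have "\<dots> \<le> (\<Sum>i<m. 2 * expectation (\<lambda>\<omega>. (U (g i) \<omega> - U (g (Suc i)) \<omega>)\<^sup>2) + 2 * expectation (\<lambda>\<omega>. (drift (g i) (g (Suc i)) \<omega>)\<^sup>2))"
    proof (rule sum_mono)
      fix i assume "i \<in> {..<m}"
      then have i: "i < m" by simp
      have x: "integrable P (\<lambda>\<omega>. (U (g i) \<omega> - U (g (Suc i)) \<omega>)\<^sup>2)" "integrable P (\<lambda>\<omega>. (drift (g i) (g (Suc i)) \<omega>)\<^sup>2)"
        "integrable P (\<lambda>\<omega>. (N (g (Suc i)) \<omega> - N (g i) \<omega>)\<^sup>2)"
        using L2_diff[OF U_L2[OF g(1)[OF i]] U_L2[OF g(2)[OF i]]] drift_L2[OF g[OF i]]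
          L2_diff[OF N_L2[OF g(2)[OF i]] N_L2[OF g(1)[OF i]]] by (simp_all add: L2_real_iff)
      have "expectation (\<lambda>\<omega>. (N (g (Suc i)) \<omega> - N (g i) \<omega>)\<^sup>2)
        \<le> expectation (\<lambda>\<omega>. 2 * (U (g i) \<omega> - U (g (Suc i)) \<omega>)\<^sup>2 + 2 * (drift (g i) (g (Suc i)) \<omega>)\<^sup>2)"
      proof (rule integral_mono)
        fix \<omega>
        have "(y - x)\<^sup>2 \<le> 2 * x\<^sup>2 + 2 * y\<^sup>2" for x y :: real
        proof -
          have "2 * x\<^sup>2 + 2 * y\<^sup>2 - (y - x)\<^sup>2 = (x + y)\<^sup>2" by (simp add: power2_eq_square algebra_simps)
          then show ?thesis using zero_le_power2[of "x + y"] by linarith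
        qed
        from this[of "drift (g i) (g (Suc i)) \<omega>" "U (g i) \<omega> - U (g (Suc i)) \<omega>"]
        show "(N (g (Suc i)) \<omega> - N (g i) \<omega>)\<^sup>2 \<le> 2 * (U (g i) \<omega> - U (g (Suc i)) \<omega>)\<^sup>2 + 2 * (drift (g i) (g (Suc i)) \<omega>)\<^sup>2"
          by (simp add: drift_def)
      qed (use x in auto)
      also have "\<dots> = 2 * expectation (\<lambda>\<omega>. (U (g i) \<omega> - U (g (Suc i)) \<omega>)\<^sup>2) + 2 * expectation (\<lambda>\<omega>. (drift (g i) (g (Suc i)) \<omega>)\<^sup>2)"
        using x(1,2) by simp
      finally show "expectation (\<lambda>\<omega>. (N (g (Suc i)) \<omega> - N (g i) \<omega>)\<^sup>2)
        \<le> 2 * expectation (\<lambda>\<omega>. (U (g i) \<omega> - U (g (Suc i)) \<omega>)\<^sup>2) + 2 * expectation (\<lambda>\<omega>. (drift (g i) (g (Suc i)) \<omega>)\<^sup>2)" .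
    qed
    also have "\<dots> = 2 * (\<Sum>i<m. expectation (\<lambda>\<omega>. (U (g i) \<omega> - U (g (Suc i)) \<omega>)\<^sup>2))
        + 2 * (\<Sum>i<m. expectation (\<lambda>\<omega>. (drift (g i) (g (Suc i)) \<omega>)\<^sup>2))"
      by (simp add: sum.distrib sum_distrib_left)
    also have "\<dots> \<le> 2 * (data_sq + (1 + 4 * L) * (LINT s:{0..T}|lborel. \<phi> s)) + e"
    proof -
      define Z where "Z = data_sq + (1 + 4 * L) * (LINT s:{0..T}|lborel. \<phi> s)"
      have "(\<Sum>i<m. expectation (\<lambda>\<omega>. (U (g i) \<omega> - U (g (Suc i)) \<omega>)\<^sup>2)) \<le> Z + e / 4"
        using energy_identity[OF t m] conjunct2[OF elim(2)] \<phi>_nonneg[of 0] unfolding Z_def[symmetric] g_def by linarith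
      moreover have "(\<Sum>i<m. expectation (\<lambda>\<omega>. (drift (g i) (g (Suc i)) \<omega>)\<^sup>2)) < e / 4"
        using elim(1) unfolding g_def .
      ultimately show ?thesis unfolding Z_def[symmetric] using e by linarith
    qed
    finally show ?case .
  qed
  then show "expectation (\<lambda>\<omega>. (N T \<omega> - N 0 \<omega>)\<^sup>2) \<le> 2 * (data_sq + (1 + 4 * L) * (LINT s:{0..T}|lborel. \<phi> s)) + e"
    by (auto simp: eventually_sequentially)
qed

lemma data_sq_nonneg: "0 \<le> data_sq"
  unfolding data_sq_def set_lebesgue_integral_def
  by (intro add_nonneg_nonneg \<phi>_nonneg Bochner_Integration.integral_nonneg) (auto simp: indicator_def)

lemma \<phi>_bound: "t \<in> {0..T} \<Longrightarrow> \<phi> t \<le> growth T L * data_sq"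
  using gronwall_backward[OF \<phi>_continuous T_pos _ data_sq_nonneg energy_U, of t] L_pos by (simp add: growth_def mult_ac)

lemma \<phi>_integral_bound: "(LINT s:{0..T}|lborel. \<phi> s) \<le> T * (growth T L * data_sq)"
proof -
  have "(LINT s:{0..T}|lborel. \<phi> s) \<le> (LINT s:{0..T}|lborel. growth T L * data_sq)"
  proof (rule set_integral_mono)
    show "set_integrable lborel {0..T} (\<lambda>s. growth T L * data_sq)"
      unfolding set_integrable_def by (rule borel_integrable_compact[OF compact_Icc continuous_on_const])
  qed (use \<phi>_integrable \<phi>_bound in auto)
  then show ?thesis using T_pos by (simp add: set_lebesgue_integral_def mult_ac)
qed

lemma N_bound: "expectation (\<lambda>\<omega>. (N T \<omega> - N 0 \<omega>)\<^sup>2)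
    \<le> N_const T L * data_sq"
proof -
  have "(1 + 4 * L) * (LINT s:{0..T}|lborel. \<phi> s) \<le> (1 + 4 * L) * (T * (growth T L * data_sq))"
    using \<phi>_integral_bound L_pos by (intro mult_left_mono) auto
  then show ?thesis using energy_N by (simp add: N_const_def algebra_simps)
qed

lemma driver_var_bound: "(l2norm P driver_var)\<^sup>2 \<le> 3 * T * (1 + 2 * L\<^sup>2 * T * growth T L) * data_sq"
proof -
  note i = time_integrable_integral[OF f2_time_integrable order_refl order_refl]
    time_integrable_integral[OF \<delta>_L2 order_refl order_refl]
    time_integrable_integral[OF U2_time_integrable order_refl order_refl]
  have "(l2norm P driver_var)\<^sup>2 \<le> expectation (\<lambda>\<omega>. 3 * T * (LINT s:{0..T}|lborel. (\<delta> s \<omega>)\<^sup>2)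
      + (3 * T * L\<^sup>2 * (LINT s:{0..T}|lborel. (U s \<omega>)\<^sup>2) + 3 * T * L\<^sup>2 * (LINT s:{0..T}|lborel. \<phi> s)))"
    unfolding l2norm_power2
  proof (rule integral_mono_AE)
    show "integrable P (\<lambda>\<omega>. (norm (driver_var \<omega>))\<^sup>2)" using driver_var_L2 by (simp add: L2_real_iff)
    show "AE \<omega> in P. (norm (driver_var \<omega>))\<^sup>2 \<le> 3 * T * (LINT s:{0..T}|lborel. (\<delta> s \<omega>)\<^sup>2)
      + (3 * T * L\<^sup>2 * (LINT s:{0..T}|lborel. (U s \<omega>)\<^sup>2) + 3 * T * L\<^sup>2 * (LINT s:{0..T}|lborel. \<phi> s))"
      using AE_regular
    proof eventually_elim
      case (elim \<omega>)
      note g = regular_subinterval[OF elim order_refl order_refl] and gp = \<phi>_integrable[OF order_refl order_refl]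
      have "(LINT s:{0..T}|lborel. (f s \<omega>)\<^sup>2)
        \<le> (LINT s:{0..T}|lborel. 3 * (\<delta> s \<omega>)\<^sup>2 + (3 * L\<^sup>2 * (U s \<omega>)\<^sup>2 + 3 * L\<^sup>2 * \<phi> s))"
      proof (rule set_integral_mono_AE)
        show "set_integrable lborel {0..T} (\<lambda>s. (f s \<omega>)\<^sup>2)" using elim by (simp add: regular_def)
        show "set_integrable lborel {0..T} (\<lambda>s. 3 * (\<delta> s \<omega>)\<^sup>2 + (3 * L\<^sup>2 * (U s \<omega>)\<^sup>2 + 3 * L\<^sup>2 * \<phi> s))"
          by (intro set_integral_add set_integrable_mult_right g gp)
        have "AE s in lborel. s \<in> {0..T} \<longrightarrow> \<bar>f s \<omega>\<bar> \<le> \<delta> s \<omega> + L * (\<bar>U s \<omega>\<bar> + l2norm P (U s))"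
          using elim by (simp add: regular_def)
        then show "AE s\<in>{0..T} in lborel. (f s \<omega>)\<^sup>2 \<le> 3 * (\<delta> s \<omega>)\<^sup>2 + (3 * L\<^sup>2 * (U s \<omega>)\<^sup>2 + 3 * L\<^sup>2 * \<phi> s)"
        proof eventually_elim
          case (elim s)
          show ?case
          proof
            assume "s \<in> {0..T}"
            then have "\<bar>f s \<omega>\<bar> \<le> \<delta> s \<omega> + L * (\<bar>U s \<omega>\<bar> + l2norm P (U s))" using elim by blast
            from power_mono[OF this, of 2] square_sum3[of "\<delta> s \<omega>" L "\<bar>U s \<omega>\<bar>" "l2norm P (U s)"]
            show "(f s \<omega>)\<^sup>2 \<le> 3 * (\<delta> s \<omega>)\<^sup>2 + (3 * L\<^sup>2 * (U s \<omega>)\<^sup>2 + 3 * L\<^sup>2 * \<phi> s)" by (simp add: \<phi>_eq)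
          qed
        qed
      qed
      also have "\<dots> = (LINT s:{0..T}|lborel. 3 * (\<delta> s \<omega>)\<^sup>2)
         + ((LINT s:{0..T}|lborel. 3 * L\<^sup>2 * (U s \<omega>)\<^sup>2) + (LINT s:{0..T}|lborel. 3 * L\<^sup>2 * \<phi> s))"
        by (simp only: set_integral_add set_integrable_mult_right g gp)
      finally have "T * (LINT s:{0..T}|lborel. (f s \<omega>)\<^sup>2) \<le> T * (3 * (LINT s:{0..T}|lborel. (\<delta> s \<omega>)\<^sup>2)
         + (3 * L\<^sup>2 * (LINT s:{0..T}|lborel. (U s \<omega>)\<^sup>2) + 3 * L\<^sup>2 * (LINT s:{0..T}|lborel. \<phi> s)))"
        using T_pos by (intro mult_left_mono) auto
      then show ?case using driver_var_square[OF elim] by (simp add: algebra_simps)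
    qed
  qed (intro Bochner_Integration.integrable_add integrable_mult_right i integrable_const)
  also have "\<dots> = 3 * T * expectation (\<lambda>\<omega>. LINT s:{0..T}|lborel. (\<delta> s \<omega>)\<^sup>2)
      + (3 * T * L\<^sup>2 * expectation (\<lambda>\<omega>. LINT s:{0..T}|lborel. (U s \<omega>)\<^sup>2) + 3 * T * L\<^sup>2 * (LINT s:{0..T}|lborel. \<phi> s))"
    using i(2,3) by (simp add: prob_space)
  also have "expectation (\<lambda>\<omega>. LINT s:{0..T}|lborel. (U s \<omega>)\<^sup>2) = (LINT s:{0..T}|lborel. \<phi> s)"
    unfolding \<phi>_def by (rule time_integrable_Fubini[OF U2_time_integrable order_refl order_refl])
  also have "3 * T * expectation (\<lambda>\<omega>. LINT s:{0..T}|lborel. (\<delta> s \<omega>)\<^sup>2)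
      + (3 * T * L\<^sup>2 * (LINT s:{0..T}|lborel. \<phi> s) + 3 * T * L\<^sup>2 * (LINT s:{0..T}|lborel. \<phi> s))
    = 3 * T * (expectation (\<lambda>\<omega>. LINT s:{0..T}|lborel. (\<delta> s \<omega>)\<^sup>2) + 2 * L\<^sup>2 * (LINT s:{0..T}|lborel. \<phi> s))"
    by (simp add: algebra_simps)
  also have "\<dots> \<le> 3 * T * (data_sq + 2 * L\<^sup>2 * (T * (growth T L * data_sq)))"
    using T_pos \<phi>_nonneg[of T] \<phi>_integral_bound unfolding data_sq_def
    by (intro mult_left_mono add_mono) auto
  finally show ?thesis by (simp add: algebra_simps)
qed

lemma N_increment_bound:
  assumes t: "t \<in> {0..T}"
  shows "expectation (\<lambda>\<omega>. (N t \<omega> - N 0 \<omega>)\<^sup>2) \<le> expectation (\<lambda>\<omega>. (N T \<omega> - N 0 \<omega>)\<^sup>2)"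
proof -
  have t0: "0 \<in> {0..T}" "T \<in> {0..T}" "0 \<le> t" "t \<le> T" using t by auto
  let ?V = "\<lambda>\<omega>. N t \<omega> - N 0 \<omega>" and ?n = "\<lambda>\<omega>. N T \<omega> - N t \<omega>"
  have "N 0 \<in> borel_measurable (F t)" by (rule F_measurable_mono[OF N_adapted[OF t0(1)] t0(3)])
  then have VF: "?V \<in> borel_measurable (F t)" using N_adapted[OF t] by (rule borel_measurable_diff[rotated])
  have U_sup: "?V \<in> L2 P" and n: "?n \<in> L2 P" using t t0 by (auto intro!: L2_diff N_L2)
  have orth: "expectation (\<lambda>\<omega>. ?V \<omega> * ?n \<omega>) = 0" by (rule N_martingale[OF t0(3,4) order_refl VF U_sup])
  have i: "integrable P (\<lambda>\<omega>. (?V \<omega>)\<^sup>2)" "integrable P (\<lambda>\<omega>. (?n \<omega>)\<^sup>2)" "integrable P (\<lambda>\<omega>. 2 * (?V \<omega> * ?n \<omega>))"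
    using U_sup n integrable_mult_right[OF L2_mult_integrable[OF U_sup n]] by (auto simp: L2_real_iff)
  have "expectation (\<lambda>\<omega>. (N T \<omega> - N 0 \<omega>)\<^sup>2) = expectation (\<lambda>\<omega>. (?V \<omega>)\<^sup>2 + (?n \<omega>)\<^sup>2 + 2 * (?V \<omega> * ?n \<omega>))"
    by (intro Bochner_Integration.integral_cong refl) (simp add: power2_eq_square algebra_simps)
  also have "\<dots> = expectation (\<lambda>\<omega>. (?V \<omega>)\<^sup>2) + expectation (\<lambda>\<omega>. (?n \<omega>)\<^sup>2)"
    by (subst Bochner_Integration.integral_add[OF Bochner_Integration.integrable_add[OF i(1,2)] i(3)],
        subst Bochner_Integration.integral_add[OF i(1,2)]) (simp add: orth)
  also have "\<dots> \<ge> expectation (\<lambda>\<omega>. (?V \<omega>)\<^sup>2)"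
    by (simp add: Bochner_Integration.integral_nonneg)
  finally show ?thesis .
qed

text \<open>In the dynamics of \<open>U\<close> over \<open>[0, t]\<close> everything except the reflections is bounded in mean square.\<close>

lemma R_difference:
  assumes t: "t \<in> {0..T}"
  shows "expectation (\<lambda>\<omega>. \<bar>r1.R 0 t \<omega> - r2.R 0 t \<omega>\<bar>)
    \<le> R_const T L * sqrt data_sq"
proof -
  have t0: "0 \<in> {0..T}" "0 \<le> t" "t \<le> T" using t by auto
  have NL: "(\<lambda>\<omega>. N t \<omega> - N 0 \<omega>) \<in> L2 P" by (intro L2_diff N_L2 t t0)
  have "expectation (\<lambda>\<omega>. \<bar>r1.R 0 t \<omega> - r2.R 0 t \<omega>\<bar>)
      \<le> expectation (\<lambda>\<omega>. \<bar>U 0 \<omega>\<bar> + \<bar>U t \<omega>\<bar> + (\<bar>driver_var \<omega>\<bar> + \<bar>N t \<omega> - N 0 \<omega>\<bar>))"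
  proof (rule integral_mono_AE)
    show "integrable P (\<lambda>\<omega>. \<bar>r1.R 0 t \<omega> - r2.R 0 t \<omega>\<bar>)"
      using t0 by (intro integrable_abs L2_integrable L2_diff r1.R_L2 r2.R_L2) auto
    show "integrable P (\<lambda>\<omega>. \<bar>U 0 \<omega>\<bar> + \<bar>U t \<omega>\<bar> + (\<bar>driver_var \<omega>\<bar> + \<bar>N t \<omega> - N 0 \<omega>\<bar>))"
      by (intro Bochner_Integration.integrable_add integrable_abs L2_integrable U_L2 driver_var_L2 NL t t0)
    show "AE \<omega> in P. \<bar>r1.R 0 t \<omega> - r2.R 0 t \<omega>\<bar> \<le> \<bar>U 0 \<omega>\<bar> + \<bar>U t \<omega>\<bar> + (\<bar>driver_var \<omega>\<bar> + \<bar>N t \<omega> - N 0 \<omega>\<bar>)"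
      using AE_regular
    proof eventually_elim
      case (elim \<omega>)
      have "drift 0 t \<omega> = driver_int 0 t \<omega> + (r1.R 0 t \<omega> - r2.R 0 t \<omega>)" by (rule drift_eq[OF elim order_refl t0(2,3)])
      moreover have "\<bar>driver_int 0 t \<omega>\<bar> \<le> \<bar>driver_var \<omega>\<bar>" using driver_int_bound(2)[OF elim order_refl t0(2,3)] by linarith
      ultimately show ?case unfolding drift_def by linarith
    qed
  qed
  also have "\<dots> = expectation (\<lambda>\<omega>. \<bar>U 0 \<omega>\<bar>) + expectation (\<lambda>\<omega>. \<bar>U t \<omega>\<bar>)
      + (expectation (\<lambda>\<omega>. \<bar>driver_var \<omega>\<bar>) + expectation (\<lambda>\<omega>. \<bar>N t \<omega> - N 0 \<omega>\<bar>))"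
    using L2_integrable[OF U_L2[OF t]] L2_integrable[OF U_L2[OF t0(1)]] L2_integrable[OF driver_var_L2] L2_integrable[OF NL]
    by simp
  also have "\<dots> \<le> l2norm P (U 0) + l2norm P (U t) + (l2norm P driver_var + l2norm P (\<lambda>\<omega>. N t \<omega> - N 0 \<omega>))"
    by (intro add_mono expectation_abs_le_l2norm U_L2 driver_var_L2 NL t t0)
  also have "\<dots> \<le> sqrt (growth T L * data_sq) + sqrt (growth T L * data_sq)
      + (sqrt (3 * T * (1 + 2 * L\<^sup>2 * T * growth T L) * data_sq)
      + sqrt (N_const T L * data_sq))"
  proof (intro add_mono real_le_rsqrt)
    show "(l2norm P (U 0))\<^sup>2 \<le> growth T L * data_sq" "(l2norm P (U t))\<^sup>2 \<le> growth T L * data_sq"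
      using \<phi>_bound[OF t0(1)] \<phi>_bound[OF t] by (simp_all add: \<phi>_eq)
    show "(l2norm P driver_var)\<^sup>2 \<le> 3 * T * (1 + 2 * L\<^sup>2 * T * growth T L) * data_sq" by (rule driver_var_bound)
    show "(l2norm P (\<lambda>\<omega>. N t \<omega> - N 0 \<omega>))\<^sup>2 \<le> N_const T L * data_sq"
      using N_increment_bound[OF t] N_bound by (simp add: l2norm_power2)
  qed
  also have "sqrt (a * data_sq) + sqrt (a * data_sq) + (sqrt (b * data_sq) + sqrt (c * data_sq)) = (2 * sqrt a + sqrt b + sqrt c) * sqrt data_sq"
    for a b c by (simp add: real_sqrt_mult algebra_simps)
  finally show ?thesis by (simp only: R_const_def)
qed

end

section \<open>Regular versions of solutions\<close>

text \<open>The reflection of a solution is defined by an integral whose integrand is measurable only up to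
  null sets; completeness repairs this.\<close>

lemma (in complete_measure) measurable_cong_AE_complete:
  fixes f g :: "'a \<Rightarrow> 'b::topological_space"
  assumes g: "g \<in> borel_measurable M" and eq: "AE x in M. f x = g x"
  shows "f \<in> borel_measurable M"
proof (rule measurableI)
  fix A :: "'b set" assume "A \<in> sets borel"
  then have s: "g -` A \<inter> space M \<in> sets M" by (rule measurable_sets[OF g])
  have "AE x in M. x \<in> g -` A \<inter> space M \<longleftrightarrow> x \<in> f -` A \<inter> space M" using eq by eventually_elim auto
  from in_sets_AE[OF this s] show "f -` A \<inter> space M \<in> sets M" by simp
qed simp

text \<open>The restriction of a process to an event of full probability on which its paths are regular. All its
  paths are then regular, and it stays adapted because the filtration contains the null sets.\<close>

definition on_event :: "'w set \<Rightarrow> (real \<Rightarrow> 'w \<Rightarrow> real) \<Rightarrow> real \<Rightarrow> 'w \<Rightarrow> real" where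
  "on_event \<Omega> X t \<omega> = (if \<omega> \<in> \<Omega> then X t \<omega> else 0)"

lemma on_event_in [simp]: "\<omega> \<in> \<Omega> \<Longrightarrow> on_event \<Omega> X t \<omega> = X t \<omega>"
  by (simp add: on_event_def)

lemma continuous_le_rational:
  fixes y :: "real \<Rightarrow> real"
  assumes "T > 0" "continuous_on {0..T} y" and le: "\<And>q. q \<in> \<rat> \<Longrightarrow> y (max 0 (min T q)) \<le> c" and t: "t \<in> {0..T}"
  shows "y t \<le> c"
proof -
  have "continuous_on UNIV (\<lambda>s. y (max 0 (min T s)))"
    by (rule continuous_on_compose2[OF assms(2)]) (use assms(1) in \<open>auto intro!: continuous_intros\<close>)
  then have "closed {s. y (max 0 (min T s)) \<le> c}"
    by (intro closed_Collect_le continuous_on_const) 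
  moreover have "\<rat> \<subseteq> {s. y (max 0 (min T s)) \<le> c}" using le by auto
  ultimately have "closure \<rat> \<subseteq> {s. y (max 0 (min T s)) \<le> c}" by (rule closure_minimal[rotated])
  then have "y (max 0 (min T t)) \<le> c" unfolding Rats_closure_real by blast
  then show ?thesis using t by simp
qed

context brownian
begin

sublocale complete_measure P
  unfolding P_def by (rule completion.complete_measure_axioms)

lemma S2_L2:
  fixes X :: "real \<Rightarrow> 'w \<Rightarrow> 'b::euclidean_space"
  assumes "X \<in> S2 P T F" "t \<in> {0..T}"
  shows "X t \<in> L2 P"
proof -
  have m: "X t \<in> borel_measurable P"
    using assms F_measurable_P[of "X t" t borel] by (auto simp: S2_def adapted_def)
  have "(\<integral>\<^sup>+\<omega>. ennreal ((norm (X t \<omega>))\<^sup>2) \<partial>P) \<le> (\<integral>\<^sup>+\<omega>. (SUP t\<in>{0..T}. ennreal ((norm (X t \<omega>))\<^sup>2)) \<partial>P)"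
    by (intro nn_integral_mono SUP_upper assms(2))
  also have "\<dots> < \<infinity>" using assms(1) by (simp add: S2_def)
  finally show ?thesis using m by (auto simp: L2_def intro!: integrableI_bounded)
qed

text \<open>The supremum over rational times is measurable and, for continuous paths, bounds all times.\<close>

lemma S2_dominating:
  fixes X :: "real \<Rightarrow> 'w \<Rightarrow> real"
  assumes "X \<in> S2 P T F"
  obtains S where "S \<in> L2 P" "AE \<omega> in P. \<forall>t\<in>{0..T}. \<bar>X t \<omega>\<bar> \<le> S \<omega>" "\<And>\<omega>. 0 \<le> S \<omega>"
proof -
  define q where "q \<omega> = (SUP r\<in>\<rat>. ennreal ((X (max 0 (min T r)) \<omega>)\<^sup>2))" for \<omega>
  have clamp: "max 0 (min T r) \<in> {0..T}" for r using T_pos by auto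
  have [measurable]: "X (max 0 (min T r)) \<in> borel_measurable P" for r
    using S2_L2[OF assms clamp] by (rule L2_measurable)
  have qm [measurable]: "q \<in> borel_measurable P"
    unfolding q_def by (intro borel_measurable_SUP countable_rat) measurable
  have "(\<integral>\<^sup>+\<omega>. q \<omega> \<partial>P) \<le> (\<integral>\<^sup>+\<omega>. (SUP t\<in>{0..T}. ennreal ((norm (X t \<omega>))\<^sup>2)) \<partial>P)"
    unfolding q_def using clamp by (intro nn_integral_mono SUP_mono) force
  also have "\<dots> < \<infinity>" using assms by (simp add: S2_def)
  finally have fin: "(\<integral>\<^sup>+\<omega>. q \<omega> \<partial>P) < \<infinity>" .
  define S where "S \<omega> = sqrt (enn2real (q \<omega>))" for \<omega>
  have AEfin: "AE \<omega> in P. q \<omega> \<noteq> \<infinity>" using fin by (intro nn_integral_PInf_AE qm) auto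
  have "(\<integral>\<^sup>+\<omega>. ennreal ((S \<omega>)\<^sup>2) \<partial>P) = (\<integral>\<^sup>+\<omega>. q \<omega> \<partial>P)"
    using AEfin by (intro nn_integral_cong_AE) (auto simp: S_def less_top elim!: eventually_mono)
  then have "S \<in> L2 P" using fin by (intro L2_of_nn_integral_finite) (auto simp: S_def[abs_def])
  moreover have "AE \<omega> in P. continuous_on {0..T} (\<lambda>t. X t \<omega>)" using assms by (simp add: S2_def)
  with AEfin have "AE \<omega> in P. \<forall>t\<in>{0..T}. \<bar>X t \<omega>\<bar> \<le> S \<omega>"
  proof eventually_elim
    case (elim \<omega>)
    show ?case
    proof
      fix t assume t: "t \<in> {0..T}"
      have "\<bar>X t \<omega>\<bar> \<le> S \<omega>"
      proof (rule continuous_le_rational[OF T_pos _ _ t])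
        show "continuous_on {0..T} (\<lambda>t. \<bar>X t \<omega>\<bar>)" by (intro continuous_intros elim)
        fix r :: real assume "r \<in> \<rat>"
        then have "ennreal ((X (max 0 (min T r)) \<omega>)\<^sup>2) \<le> q \<omega>" unfolding q_def by (rule SUP_upper)
        then have "ennreal ((X (max 0 (min T r)) \<omega>)\<^sup>2) \<le> ennreal (enn2real (q \<omega>))"
          using elim(1) by (simp add: less_top)
        then have "(X (max 0 (min T r)) \<omega>)\<^sup>2 \<le> enn2real (q \<omega>)" by simp
        from real_sqrt_le_mono[OF this] show "\<bar>X (max 0 (min T r)) \<omega>\<bar> \<le> S \<omega>" by (simp add: S_def)
      qed
      then show "\<bar>X t \<omega>\<bar> \<le> S \<omega>" .
    qed
  qed
  moreover have "0 \<le> S \<omega>" for \<omega> by (simp add: S_def)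
  ultimately show ?thesis using that by blast
qed

lemma on_event_measurable:
  assumes "\<Omega> \<in> sets P" "AE \<omega> in P. \<omega> \<in> \<Omega>" "X t \<in> borel_measurable (F t)"
  shows "on_event \<Omega> X t \<in> borel_measurable (F t)"
proof -
  have "space P - \<Omega> \<in> null_sets P"
    using assms(1,2) by (subst null_sets_iff_AE) (auto elim!: eventually_mono)
  then have "space P - \<Omega> \<in> sets (F t)" by (rule null_in_F)
  from sets.Diff[OF sets.top[of "F t"] this] have "space (F t) - (space P - \<Omega>) \<in> sets (F t)" .
  moreover have "space (F t) - (space P - \<Omega>) = \<Omega>" using sets.sets_into_space[OF assms(1)] by auto
  ultimately have "\<Omega> \<in> sets (F t)" by simp
  then have "(\<lambda>\<omega>. if \<omega> \<in> \<Omega> then X t \<omega> else 0) \<in> borel_measurable (F t)"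
    using assms(3) sets.sets_into_space[OF assms(1)]
    by (intro measurable_If_set) (auto simp: Int_absorb2)
  then show ?thesis by (simp add: on_event_def[abs_def])
qed

lemma regular_version:
  assumes c: "constraint P T M H Hy Hmu" and Y: "Y \<in> S2 P T F" and K: "K \<in> A2 P T F"
  obtains \<Omega> S where "\<Omega> \<in> sets P" "AE \<omega> in P. \<omega> \<in> \<Omega>"
    "reflected_process P T M H Hy Hmu (on_event \<Omega> Y) S (on_event \<Omega> K)"
proof -
  interpret constraint P T M H Hy Hmu by fact
  obtain S where S: "S \<in> L2 P" "AE \<omega> in P. \<forall>t\<in>{0..T}. \<bar>Y t \<omega>\<bar> \<le> S \<omega>" "\<And>\<omega>. 0 \<le> S \<omega>"
    using S2_dominating[OF Y] by blast
  have KS: "K \<in> S2 P T F" using K by (simp add: A2_def)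
  have "AE \<omega> in P. continuous_on {0..T} (\<lambda>t. Y t \<omega>)" "AE \<omega> in P. continuous_on {0..T} (\<lambda>t. K t \<omega>)"
    "AE \<omega> in P. mono_on {0..T} (\<lambda>t. K t \<omega>) \<and> K 0 \<omega> = 0"
    using Y KS K by (auto simp: S2_def A2_def)
  with S(2) have "AE \<omega> in P. (\<forall>t\<in>{0..T}. \<bar>Y t \<omega>\<bar> \<le> S \<omega>) \<and> continuous_on {0..T} (\<lambda>t. Y t \<omega>)
      \<and> increasing_path T (\<lambda>t. K t \<omega>) \<and> K 0 \<omega> = 0" (is "AE \<omega> in P. ?Q \<omega>")
    by eventually_elim (simp add: increasing_path_def)
  then obtain N where N: "{\<omega>\<in>space P. \<not> ?Q \<omega>} \<subseteq> N" "emeasure P N = 0" "N \<in> sets P"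
    by (rule AE_E)
  define \<Omega> where "\<Omega> = space P - N"
  have \<Omega>: "\<Omega> \<in> sets P" using N by (auto simp: \<Omega>_def)
  have "N \<in> null_sets P" using N by auto
  from AE_not_in[OF this] have AE\<Omega>: "AE \<omega> in P. \<omega> \<in> \<Omega>"
    using AE_space by eventually_elim (simp add: \<Omega>_def)
  have Q: "?Q \<omega>" if "\<omega> \<in> \<Omega>" for \<omega> using that N(1) by (auto simp: \<Omega>_def)
  have m: "on_event \<Omega> X t \<in> borel_measurable P" if "X \<in> S2 P T F" "t \<in> {0..T}" for X t
  proof -
    have "X t \<in> borel_measurable (F t)" using that by (simp add: S2_def adapted_def)
    from on_event_measurable[of \<Omega> X t, OF \<Omega> AE\<Omega> this] show ?thesis
      by (rule F_measurable_P) (use that in auto)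
  qed
  have "reflected_process P T M H Hy Hmu (on_event \<Omega> Y) S (on_event \<Omega> K)"
  proof
    show "on_event \<Omega> Y t \<in> borel_measurable P" "on_event \<Omega> K t \<in> borel_measurable P" if "t \<in> {0..T}" for t
      using m[OF Y that] m[OF KS that] by auto
    show "continuous_on {0..T} (\<lambda>t. on_event \<Omega> Y t \<omega>)" for \<omega>
      using Q[of \<omega>] by (cases "\<omega> \<in> \<Omega>") (auto simp: on_event_def)
    show "\<bar>on_event \<Omega> Y t \<omega>\<bar> \<le> S \<omega>" if "t \<in> {0..T}" for t \<omega>
      using Q[of \<omega>] S(3)[of \<omega>] that by (cases "\<omega> \<in> \<Omega>") (auto simp: on_event_def)
    show "S \<in> L2 P" by (rule S(1))
    show "increasing_path T (\<lambda>t. on_event \<Omega> K t \<omega>)" for \<omega>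
      using Q[of \<omega>] by (cases "\<omega> \<in> \<Omega>") (auto simp: on_event_def increasing_path_def mono_on_def)
    show "on_event \<Omega> K 0 \<omega> = 0" for \<omega>
      using Q[of \<omega>] by (cases "\<omega> \<in> \<Omega>") (auto simp: on_event_def)
    have T: "T \<in> {0..T}" using T_pos by simp
    show "on_event \<Omega> K T \<in> L2 P"
      by (rule L2_dominated[OF m[OF KS T] S2_L2[OF KS T]]) (auto simp: on_event_def)
  qed
  then show ?thesis using that \<Omega> AE\<Omega> by blast
qed

text \<open>The reflection depends on the process through its paths, on the event, and through its laws.\<close>

lemma reflection_on_event:
  assumes "reflected_process P T M H Hy Hmu (on_event \<Omega> Y) S (on_event \<Omega> K)"
    and \<Omega>: "\<Omega> \<in> sets P" "AE \<omega> in P. \<omega> \<in> \<Omega>" and Y: "\<And>t. t \<in> {0..T} \<Longrightarrow> Y t \<in> borel_measurable P"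
    and ab: "0 \<le> a" "a \<le> b" "b \<le> T" and w: "\<omega> \<in> \<Omega>"
  shows "reflection P T Hy Hmu Y K a b \<omega> = reflection P T Hy Hmu (on_event \<Omega> Y) (on_event \<Omega> K) a b \<omega>"
proof -
  interpret r: reflected_process P T M H Hy Hmu "on_event \<Omega> Y" S "on_event \<Omega> K" by fact
  have wP: "\<omega> \<in> space P" using w sets.sets_into_space[OF \<Omega>(1)] by auto
  have law: "law P (Y t) = law P (on_event \<Omega> Y t)" if "t \<in> {0..T}" for t
    by (rule distr_cong_AE) (use \<Omega>(2) Y[OF that] r.Y_measurable[OF that] in \<open>auto elim!: eventually_mono\<close>)
  have st: "stieltjes T (\<lambda>t. K t \<omega>') = stieltjes T (\<lambda>t. on_event \<Omega> K t \<omega>')" if "\<omega>' \<in> \<Omega>" for \<omega>'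
    using that by simp
  have 1: "(LINT s:{a..b}|stieltjes T (\<lambda>t. K t \<omega>). Hy (Y s \<omega>) (law P (Y s))) = r.own_part a b \<omega>"
    unfolding r.own_part_def st[OF w] set_lebesgue_integral_def
    by (intro Bochner_Integration.integral_cong refl) (use w ab in \<open>auto simp: indicator_def law\<close>)
  have 2: "(LINT s:{a..b}|stieltjes T (\<lambda>t. K t \<omega>'). Hmu (Y s \<omega>') (law P (Y s)) (Y s \<omega>)) = r.mean_part a b \<omega>' \<omega>" if "\<omega>' \<in> \<Omega>" for \<omega>'
    unfolding r.mean_part_def st[OF that] set_lebesgue_integral_def
    by (intro Bochner_Integration.integral_cong refl) (use w that ab in \<open>auto simp: indicator_def law\<close>)
  have "AE \<omega>' in P. (LINT s:{a..b}|stieltjes T (\<lambda>t. K t \<omega>'). Hmu (Y s \<omega>') (law P (Y s)) (Y s \<omega>)) = r.mean_part a b \<omega>' \<omega>"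
    using \<Omega>(2) by eventually_elim (rule 2)
  note ae = this
  have m: "(\<lambda>\<omega>'. r.mean_part a b \<omega>' \<omega>) \<in> borel_measurable P" by (rule r.mean_part_measurable_left[OF ab wP])
  have "(\<integral>\<omega>'. (LINT s:{a..b}|stieltjes T (\<lambda>t. K t \<omega>'). Hmu (Y s \<omega>') (law P (Y s)) (Y s \<omega>)) \<partial>P) = (\<integral>\<omega>'. r.mean_part a b \<omega>' \<omega> \<partial>P)"
    by (rule integral_cong_AE[OF measurable_cong_AE_complete[OF m ae] m ae])
  then show ?thesis unfolding r.R_eq 1[symmetric] by (simp add: reflection_def)
qed

lemma jointly_measurable_section:
  fixes X :: "real \<Rightarrow> 'w \<Rightarrow> 'b::euclidean_space"
  assumes "jointly_measurable X" "t \<in> {0..T}"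
  shows "X t \<in> borel_measurable P"
proof -
  have "(\<lambda>\<omega>. (case (\<omega>, t) of (\<omega>, s) \<Rightarrow> indicator {0..T} s *\<^sub>R X s \<omega>)) \<in> borel_measurable P"
    by (rule measurable_compose[OF measurable_Pair2'[of t lborel] assms(1)[unfolded jointly_measurable_def]]) simp
  then show ?thesis using assms(2) by simp
qed

text \<open>By Tonelli \<open>E |Z s|\<^sup>2\<close> is finite for almost every \<open>s\<close>.\<close>

lemma AE_law_in_P2:
  fixes Y :: "real \<Rightarrow> 'w \<Rightarrow> real" and Z :: "real \<Rightarrow> 'w \<Rightarrow> real ^ 'd"
  assumes Y: "Y \<in> S2 P T F" and Z: "jointly_measurable Z" "time_moment P T 2 Z < \<infinity>"
  shows "AE s in lborel. s \<in> {0..T} \<longrightarrow> law P (\<lambda>\<omega>. (Y s \<omega>, Z s \<omega>)) \<in> P2"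
proof -
  interpret PL: pair_sigma_finite P "lborel :: real measure" ..
  define f where "f = (\<lambda>(\<omega>, s). ennreal ((norm (indicator {0..T} s *\<^sub>R Z s \<omega>))\<^sup>2))"
  have [measurable]: "f \<in> borel_measurable (P \<Otimes>\<^sub>M lborel)"
    using Z(1) unfolding f_def jointly_measurable_def case_prod_beta by measurable
  have "(\<integral>\<^sup>+s. (\<integral>\<^sup>+\<omega>. f (\<omega>, s) \<partial>P) \<partial>lborel) = (\<integral>\<^sup>+\<omega>. (\<integral>\<^sup>+s. f (\<omega>, s) \<partial>lborel) \<partial>P)"
    by (rule PL.Fubini) measurable
  also have "\<dots> = time_moment P T 2 Z"
    unfolding time_moment_def f_def by (intro nn_integral_cong) (auto simp: indicator_def)
  finally have fin: "(\<integral>\<^sup>+s. (\<integral>\<^sup>+\<omega>. f (\<omega>, s) \<partial>P) \<partial>lborel) \<noteq> \<infinity>" using Z(2) by simp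
  have "(\<lambda>s. \<integral>\<^sup>+\<omega>. f (\<omega>, s) \<partial>P) \<in> borel_measurable lborel" by measurable
  from nn_integral_PInf_AE[OF this fin] have "AE s in lborel. (\<integral>\<^sup>+\<omega>. f (\<omega>, s) \<partial>P) \<noteq> \<infinity>" .
  then show ?thesis
  proof eventually_elim
    case (elim s)
    show ?case
    proof
      assume s: "s \<in> {0..T}"
      then have zf: "(\<integral>\<^sup>+\<omega>. ennreal ((norm (Z s \<omega>))\<^sup>2) \<partial>P) < \<infinity>"
        using elim by (simp add: less_top f_def)
      have [measurable]: "Z s \<in> borel_measurable P" by (rule jointly_measurable_section[OF Z(1) s])
      have YL: "Y s \<in> L2 P" by (rule S2_L2[OF Y s])
      then have [measurable]: "Y s \<in> borel_measurable P" by (rule L2_measurable)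
      have "integrable P (\<lambda>\<omega>. (norm (Z s \<omega>))\<^sup>2)" using zf by (intro integrableI_bounded) auto
      moreover have "integrable P (\<lambda>\<omega>. (Y s \<omega>)\<^sup>2)" using YL by (simp add: L2_real_iff)
      moreover have "(norm (Y s \<omega>, Z s \<omega>))\<^sup>2 = (Y s \<omega>)\<^sup>2 + (norm (Z s \<omega>))\<^sup>2" for \<omega>
        by (simp add: norm_Pair)
      ultimately have "(\<lambda>\<omega>. (Y s \<omega>, Z s \<omega>)) \<in> L2 P"
        by (simp add: L2_def)
      then show "law P (\<lambda>\<omega>. (Y s \<omega>, Z s \<omega>)) \<in> P2" by (rule law_in_P2[OF prob_space_axioms])
    qed
  qed
qed

lemma law_fst:
  fixes Z :: "real \<Rightarrow> 'w \<Rightarrow> 'b::euclidean_space" and Y :: "real \<Rightarrow> 'w \<Rightarrow> real"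
  assumes [measurable]: "Y s \<in> borel_measurable P" "Z s \<in> borel_measurable P"
  shows "distr (law P (\<lambda>\<omega>. (Y s \<omega>, Z s \<omega>))) borel fst = law P (Y s)"
proof -
  have [measurable]: "fst \<in> borel_measurable (borel :: (real \<times> 'b) measure)"
    by (intro borel_measurable_continuous_onI continuous_intros)
  show ?thesis by (subst distr_distr) (auto simp: comp_def)
qed

text \<open>In the Markovian form both evaluations share the forward process and its law, and the law of \<open>(Y, Z)\<close>
  enters through its first marginal, whose distance is at most the norm of \<open>Y1 - Y2\<close>.\<close>

lemma driver_lipschitz:
  fixes Y1 Y2 :: "real \<Rightarrow> 'w \<Rightarrow> real" and Z1 Z2 :: "real \<Rightarrow> 'w \<Rightarrow> real ^ 'd"
    and b :: "real \<Rightarrow> 'w \<Rightarrow> real ^ 'l::finite \<Rightarrow> real ^ 'l"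
  assumes sde: "assumption_SDE P T F B L b \<sigma> x0 X h g f \<xi>"
    and Y: "Y1 \<in> S2 P T F" "Y2 \<in> S2 P T F" and Z: "jointly_measurable Z1" "jointly_measurable Z2"
  shows "AE \<omega> in P. \<forall>s\<in>{0..T}. law P (\<lambda>\<omega>. (Y1 s \<omega>, Z1 s \<omega>)) \<in> P2 \<longrightarrow> law P (\<lambda>\<omega>. (Y2 s \<omega>, Z2 s \<omega>)) \<in> P2 \<longrightarrow>
    \<bar>driver_along P f Y1 Z1 s \<omega> - driver_along P f Y2 Z2 s \<omega>\<bar>
      \<le> L * (\<bar>Y1 s \<omega> - Y2 s \<omega>\<bar> + l2norm P (\<lambda>\<omega>. Y1 s \<omega> - Y2 s \<omega>))"
proof -
  have XS: "X \<in> S2 P T F" and L: "0 < L" using sde by (auto simp: assumption_SDE_def sde_solution_def)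
  have f: "AE \<omega> in P. (\<forall>t\<in>{0..T}. \<forall>y z. \<forall>\<nu>\<in>P2.
        f t \<omega> y z \<nu> = h t (X t \<omega>) y (law P (X t)) (distr \<nu> borel fst))"
    and lip: "\<And>t x1 x2 y1 y2 \<rho>1 \<rho>2 \<mu>1 \<mu>2. t \<in> {0..T} \<Longrightarrow> \<rho>1 \<in> P2 \<Longrightarrow> \<rho>2 \<in> P2 \<Longrightarrow> \<mu>1 \<in> P2 \<Longrightarrow> \<mu>2 \<in> P2 \<Longrightarrow>
        \<bar>h t x1 y1 \<rho>1 \<mu>1 - h t x2 y2 \<rho>2 \<mu>2\<bar> \<le> L * (norm (x1 - x2) + \<bar>y1 - y2\<bar> + W2 \<rho>1 \<rho>2 + W2 \<mu>1 \<mu>2)"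
    using sde by (auto simp: assumption_SDE_def)
  show ?thesis
    using f
  proof eventually_elim
    case (elim \<omega>)
    show ?case
    proof (intro ballI impI)
      fix s assume s: "s \<in> {0..T}" and \<nu>: "law P (\<lambda>\<omega>. (Y1 s \<omega>, Z1 s \<omega>)) \<in> P2" "law P (\<lambda>\<omega>. (Y2 s \<omega>, Z2 s \<omega>)) \<in> P2"
      have YL: "Y1 s \<in> L2 P" "Y2 s \<in> L2 P" by (intro S2_L2 Y s)+
      have XL: "X s \<in> L2 P" by (rule S2_L2[OF XS s])
      have fst1: "distr (law P (\<lambda>\<omega>. (Y1 s \<omega>, Z1 s \<omega>))) borel fst = law P (Y1 s)"
        by (intro law_fst L2_measurable YL jointly_measurable_section[OF Z(1) s])
      have fst2: "distr (law P (\<lambda>\<omega>. (Y2 s \<omega>, Z2 s \<omega>))) borel fst = law P (Y2 s)"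
        by (intro law_fst L2_measurable YL jointly_measurable_section[OF Z(2) s])
      have "\<bar>driver_along P f Y1 Z1 s \<omega> - driver_along P f Y2 Z2 s \<omega>\<bar>
        = \<bar>h s (X s \<omega>) (Y1 s \<omega>) (law P (X s)) (law P (Y1 s)) - h s (X s \<omega>) (Y2 s \<omega>) (law P (X s)) (law P (Y2 s))\<bar>"
        using elim s \<nu> by (simp add: driver_along_def Let_def fst1 fst2)
      also have "\<dots> \<le> L * (norm (X s \<omega> - X s \<omega>) + \<bar>Y1 s \<omega> - Y2 s \<omega>\<bar> + W2 (law P (X s)) (law P (X s)) + W2 (law P (Y1 s)) (law P (Y2 s)))"
        by (intro lip s law_in_P2[OF prob_space_axioms] XL YL)
      also have "\<dots> \<le> L * (\<bar>Y1 s \<omega> - Y2 s \<omega>\<bar> + l2norm P (\<lambda>\<omega>. Y1 s \<omega> - Y2 s \<omega>))"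
        using W2_law_self[OF prob_space_axioms XL] W2_law_le_l2norm[OF prob_space_axioms YL] L
        by (intro mult_left_mono) auto
      finally show "\<bar>driver_along P f Y1 Z1 s \<omega> - driver_along P f Y2 Z2 s \<omega>\<bar>
        \<le> L * (\<bar>Y1 s \<omega> - Y2 s \<omega>\<bar> + l2norm P (\<lambda>\<omega>. Y1 s \<omega> - Y2 s \<omega>))" .
    qed
  qed
qed

end

context brownian
begin

lemma jointly_measurable_on_event:
  assumes X: "jointly_measurable X" and \<Omega>: "\<Omega> \<in> sets P"
  shows "jointly_measurable (on_event \<Omega> X)"
proof -
  have [measurable]: "(\<lambda>(\<omega>, s). indicator {0..T} s *\<^sub>R X s \<omega>) \<in> borel_measurable (P \<Otimes>\<^sub>M lborel)"
    using X by (simp add: jointly_measurable_def)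
  have "(\<lambda>p. indicator \<Omega> (fst p) * (case p of (\<omega>, s) \<Rightarrow> indicator {0..T} s *\<^sub>R X s \<omega>)) \<in> borel_measurable (P \<Otimes>\<^sub>M lborel)"
    using \<Omega> by measurable
  also have "(\<lambda>p. indicator \<Omega> (fst p) * (case p of (\<omega>, s) \<Rightarrow> indicator {0..T} s *\<^sub>R X s \<omega>))
      = (\<lambda>(\<omega>, s). indicator {0..T} s *\<^sub>R on_event \<Omega> X s \<omega>)"
    by (auto simp: fun_eq_iff on_event_def)
  finally show ?thesis by (simp add: jointly_measurable_def)
qed

lemma jointly_measurable_l2norm:
  fixes X :: "real \<Rightarrow> 'w \<Rightarrow> real"
  assumes X: "jointly_measurable X"
  shows "jointly_measurable (\<lambda>s \<omega>. l2norm P (X s))"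
proof -
  have X': "(\<lambda>p. case p of (\<omega>, s) \<Rightarrow> indicator {0..T} s *\<^sub>R X s \<omega>) \<in> borel_measurable (P \<Otimes>\<^sub>M lborel)"
    using X by (simp add: jointly_measurable_def)
  have "(\<lambda>p. indicator {0..T} (fst p) * X (fst p) (snd p)) \<in> borel_measurable (lborel \<Otimes>\<^sub>M P)"
    using measurable_compose[OF measurable_pair_swap' X'] by (simp add: case_prod_unfold)
  then have "(\<lambda>p. (indicator {0..T} (fst p) * X (fst p) (snd p))\<^sup>2) \<in> borel_measurable (lborel \<Otimes>\<^sub>M P)" by measurable
  then have "(\<lambda>(s, \<omega>). (indicator {0..T} s * X s \<omega>)\<^sup>2) \<in> borel_measurable (lborel \<Otimes>\<^sub>M P)" by (simp add: case_prod_unfold)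
  from borel_measurable_lebesgue_integral[OF this]
  have [measurable]: "(\<lambda>s. \<integral>\<omega>. (indicator {0..T} s * X s \<omega>)\<^sup>2 \<partial>P) \<in> borel_measurable lborel" by simp
  have "(\<lambda>p. sqrt (\<integral>\<omega>. (indicator {0..T} (snd p) * X (snd p) \<omega>)\<^sup>2 \<partial>P)) \<in> borel_measurable (P \<Otimes>\<^sub>M lborel)" by measurable
  also have "(\<lambda>p. sqrt (\<integral>\<omega>. (indicator {0..T} (snd p) * X (snd p) \<omega>)\<^sup>2 \<partial>P))
      = (\<lambda>(\<omega>, s). indicator {0..T} s *\<^sub>R l2norm P (X s))"
    by (auto simp: fun_eq_iff l2norm_def indicator_def)
  finally show ?thesis by (simp add: jointly_measurable_def)
qed

lemma
  fixes X :: "real \<Rightarrow> 'w \<Rightarrow> real"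
  assumes X: "jointly_measurable X" and nonneg: "\<And>s \<omega>. 0 \<le> X s \<omega>"
    and fin: "(\<integral>\<^sup>+\<omega>. (\<integral>\<^sup>+s\<in>{0..T}. ennreal (X s \<omega>) \<partial>lborel) \<partial>P) < \<infinity>"
  shows time_integrable_nonneg: "time_integrable X"
    and time_integral_nonneg: "ennreal (expectation (\<lambda>\<omega>. LINT s:{0..T}|lborel. X s \<omega>))
      = (\<integral>\<^sup>+\<omega>. (\<integral>\<^sup>+s\<in>{0..T}. ennreal (X s \<omega>) \<partial>lborel) \<partial>P)"
    and time_inner_measurable: "(\<lambda>\<omega>. \<integral>\<^sup>+s\<in>{0..T}. ennreal (X s \<omega>) \<partial>lborel) \<in> borel_measurable P"
proof -
  interpret PL: pair_sigma_finite P "lborel :: real measure" ..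
  let ?X = "\<lambda>(\<omega>, s). indicator {0..T} s *\<^sub>R X s \<omega>"
  have [measurable]: "?X \<in> borel_measurable (P \<Otimes>\<^sub>M lborel)" using X by (simp add: jointly_measurable_def)
  have inner: "(\<integral>\<^sup>+s. ennreal (?X (\<omega>, s)) \<partial>lborel) = (\<integral>\<^sup>+s\<in>{0..T}. ennreal (X s \<omega>) \<partial>lborel)" for \<omega>
    by (intro nn_integral_cong) (auto simp: indicator_def)
  have m: "(\<lambda>p. ennreal (?X p)) \<in> borel_measurable (P \<Otimes>\<^sub>M lborel)" by measurable
  have eq: "(\<integral>\<^sup>+p. ennreal (?X p) \<partial>(P \<Otimes>\<^sub>M lborel)) = (\<integral>\<^sup>+\<omega>. (\<integral>\<^sup>+s\<in>{0..T}. ennreal (X s \<omega>) \<partial>lborel) \<partial>P)"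
    using lborel.nn_integral_fst[OF m] by (simp only: inner)
  have I: "integrable (P \<Otimes>\<^sub>M lborel) ?X"
  proof (rule integrableI_nonneg)
    show "?X \<in> borel_measurable (P \<Otimes>\<^sub>M lborel)" by measurable
    show "AE p in P \<Otimes>\<^sub>M lborel. 0 \<le> ?X p" using nonneg by (auto simp: indicator_def)
    show "(\<integral>\<^sup>+p. ennreal (?X p) \<partial>(P \<Otimes>\<^sub>M lborel)) < \<infinity>" unfolding eq by (rule fin)
  qed
  then show "time_integrable X" by (simp add: time_integrable_def)
  have "ennreal (integral\<^sup>L (P \<Otimes>\<^sub>M lborel) ?X) = (\<integral>\<^sup>+p. ennreal (?X p) \<partial>(P \<Otimes>\<^sub>M lborel))"
    by (rule nn_integral_eq_integral[OF I, symmetric]) (use nonneg in \<open>auto simp: indicator_def\<close>)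
  moreover have "integral\<^sup>L (P \<Otimes>\<^sub>M lborel) ?X = expectation (\<lambda>\<omega>. LINT s:{0..T}|lborel. X s \<omega>)"
    using PL.integral_fst'[OF I] by (simp add: set_lebesgue_integral_def)
  ultimately show "ennreal (expectation (\<lambda>\<omega>. LINT s:{0..T}|lborel. X s \<omega>))
      = (\<integral>\<^sup>+\<omega>. (\<integral>\<^sup>+s\<in>{0..T}. ennreal (X s \<omega>) \<partial>lborel) \<partial>P)"
    using eq by simp
  show "(\<lambda>\<omega>. \<integral>\<^sup>+s\<in>{0..T}. ennreal (X s \<omega>) \<partial>lborel) \<in> borel_measurable P"
    using lborel.borel_measurable_nn_integral_fst[OF m] by (simp only: inner)
qed

end

lemma constraint_of_assumption:
  assumes P: "prob_space P" and T: "T > 0" and A: "constraint_assumption P L \<beta> M H Hy Hmu"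
  shows "constraint P T M H Hy Hmu"
proof -
  interpret prob_space P by fact
  show ?thesis
    using A unfolding constraint_assumption_def
  proof (elim conjE exE)
    fix Hyy :: "real \<Rightarrow> real measure \<Rightarrow> real \<Rightarrow>\<^sub>L real" and Hvmu :: "real \<Rightarrow> real measure \<Rightarrow> real \<Rightarrow> real \<Rightarrow>\<^sub>L real"
    assume c: "jointly_continuous Hy" "jointly_continuous (\<lambda>(y, v) \<mu>. Hmu y \<mu> v)"
      and b: "\<forall>y v. \<forall>\<mu>\<in>P2. \<beta> \<le> norm (Hy y \<mu>) \<and>
          norm (Hy y \<mu>) + norm (Hyy y \<mu>) + norm (Hmu y \<mu> v) + norm (Hvmu y \<mu> v) \<le> M"
      and g: "\<forall>y1 y2. \<forall>Y1\<in>L2 P. \<forall>Y2\<in>L2 P.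
        H y2 (law P Y2) - H y1 (law P Y1)
          \<le> Hy y1 (law P Y1) \<bullet> (y2 - y1)
             + (\<integral>\<omega>. Hmu y1 (law P Y1) (Y1 \<omega>) \<bullet> (Y2 \<omega> - Y1 \<omega>) \<partial>P)"
    show "constraint P T M H Hy Hmu"
    proof
      fix y v :: real and \<mu> :: "real measure" assume "\<mu> \<in> P2"
      then have "norm (Hy y \<mu>) + norm (Hyy y \<mu>) + norm (Hmu y \<mu> v) + norm (Hvmu y \<mu> v) \<le> M" using b by blast
      then show "\<bar>Hy y \<mu>\<bar> \<le> M" "\<bar>Hmu y \<mu> v\<bar> \<le> M"
        using norm_ge_zero[of "Hy y \<mu>"] norm_ge_zero[of "Hyy y \<mu>"] norm_ge_zero[of "Hmu y \<mu> v"]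
          norm_ge_zero[of "Hvmu y \<mu> v"] unfolding real_norm_def by linarith+
    qed (use T c g in auto)
  qed
qed

section \<open>The stability estimate\<close>

context brownian
begin

lemma stability:
  fixes f1 f2 :: "real \<Rightarrow> 'w \<Rightarrow> real \<Rightarrow> real ^ 'd \<Rightarrow> (real \<times> (real ^ 'd)) measure \<Rightarrow> real"
    and b :: "real \<Rightarrow> 'w \<Rightarrow> real ^ 'l::finite \<Rightarrow> real ^ 'l"
  assumes con: "constraint P T M H Hy Hmu"
    and sde: "assumption_SDE P T F B L b \<sigma> x0 X h g f2 \<xi>2"
    and Y: "Y1 \<in> S2 P T F" "Y2 \<in> S2 P T F" and Z: "Z1 \<in> H2 P T F" "Z2 \<in> H2 P T F"
    and K: "K1 \<in> A2 P T F" "K2 \<in> A2 P T F"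
    and sol1: "mf_rbsde_solution P T F B H Hy Hmu f1 \<xi>1 Y1 Z1 K1"
    and sol2: "mf_rbsde_solution P T F B H Hy Hmu f2 \<xi>2 Y2 Z2 K2"
    and fin: "I_delta P T f1 f2 \<xi>1 \<xi>2 Y1 Z1 \<noteq> \<infinity>"
  shows "(SUP t\<in>{0..T}. \<integral>\<^sup>+\<omega>. ennreal ((norm (Y1 t \<omega> - Y2 t \<omega>))\<^sup>2) \<partial>P)
        + time_moment P T 2 (\<lambda>s \<omega>. Z1 s \<omega> - Z2 s \<omega>)
      \<le> ennreal (stability_const T L) * (I_delta P T f1 f2 \<xi>1 \<xi>2 Y1 Z1)\<^sup>2"
    and "(SUP t\<in>{0..T}. \<integral>\<^sup>+\<omega>. ennreal (norm
        (reflection P T Hy Hmu Y1 K1 0 t \<omega> - reflection P T Hy Hmu Y2 K2 0 t \<omega>)) \<partial>P)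
      \<le> ennreal (stability_const T L) * I_delta P T f1 f2 \<xi>1 \<xi>2 Y1 Z1"
proof -
  have L: "L > 0" using sde by (simp add: assumption_SDE_def)
  define d1 where "d1 = driver_along P f1 Y1 Z1"
  define d2 where "d2 = driver_along P f2 Y2 Z2"
  define d12 where "d12 = driver_along P f2 Y1 Z1"
  define Q where "Q = (\<integral>\<^sup>+\<omega>. (ennreal ((norm (\<xi>1 \<omega> - \<xi>2 \<omega>))\<^sup>2) +
       (\<integral>\<^sup>+s\<in>{0..T}. ennreal ((norm (d1 s \<omega> - d12 s \<omega>))\<^sup>2) \<partial>lborel)) \<partial>P)"
  have IQ: "I_delta P T f1 f2 \<xi>1 \<xi>2 Y1 Z1 = ennreal_sqrt Q"
    by (simp add: I_delta_def Q_def d1_def d12_def)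
  have Qfin: "Q \<noteq> \<infinity>" using fin unfolding IQ ennreal_sqrt_def by auto
  define q where "q = enn2real Q"
  have q: "q \<ge> 0" "Q = ennreal q" using Qfin by (auto simp: q_def less_top)
  have Iq: "I_delta P T f1 f2 \<xi>1 \<xi>2 Y1 Z1 = ennreal (sqrt q)"
    unfolding IQ ennreal_sqrt_def using Qfin by (simp add: q_def)
  obtain \<Omega>1 S1 where \<Omega>1: "\<Omega>1 \<in> sets P" "AE \<omega> in P. \<omega> \<in> \<Omega>1"
    and r1: "reflected_process P T M H Hy Hmu (on_event \<Omega>1 Y1) S1 (on_event \<Omega>1 K1)"
    by (rule regular_version[OF con Y(1) K(1)])
  obtain \<Omega>2 S2 where \<Omega>2: "\<Omega>2 \<in> sets P" "AE \<omega> in P. \<omega> \<in> \<Omega>2"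
    and r2: "reflected_process P T M H Hy Hmu (on_event \<Omega>2 Y2) S2 (on_event \<Omega>2 K2)"
    by (rule regular_version[OF con Y(2) K(2)])
  interpret r1: reflected_process P T M H Hy Hmu "on_event \<Omega>1 Y1" S1 "on_event \<Omega>1 K1" by (rule r1)
  interpret r2: reflected_process P T M H Hy Hmu "on_event \<Omega>2 Y2" S2 "on_event \<Omega>2 K2" by (rule r2)
  have YL: "Y1 t \<in> L2 P" "Y2 t \<in> L2 P" if "t \<in> {0..T}" for t
    using S2_L2[OF Y(1) that] S2_L2[OF Y(2) that] .
  have prog: "progressive T F Y1" "progressive T F Z1" "progressive T F d1"
    "progressive T F Y2" "progressive T F Z2" "progressive T F d2"
    using sol1 sol2 by (auto simp: mf_rbsde_solution_def d1_def d2_def)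
  note jm = prog[THEN progressive_jointly_measurable]
  obtain N1 where ito1: "ito_integral P T F B Z1 N1" and
    eq1: "AE \<omega> in P. \<forall>t\<in>{0..T}. Y1 t \<omega> = \<xi>1 \<omega> + (LINT s:{t..T}|lborel. d1 s \<omega>)
                   - (N1 T \<omega> - N1 t \<omega>) + reflection P T Hy Hmu Y1 K1 t T \<omega>"
    using sol1 unfolding mf_rbsde_solution_def d1_def by blast
  obtain N2 where ito2: "ito_integral P T F B Z2 N2" and
    eq2: "AE \<omega> in P. \<forall>t\<in>{0..T}. Y2 t \<omega> = \<xi>2 \<omega> + (LINT s:{t..T}|lborel. d2 s \<omega>)
                   - (N2 T \<omega> - N2 t \<omega>) + reflection P T Hy Hmu Y2 K2 t T \<omega>"
    using sol2 unfolding mf_rbsde_solution_def d2_def by blast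
  have dint: "AE \<omega> in P. set_integrable lborel {0..T} (\<lambda>s. d1 s \<omega>)" "AE \<omega> in P. set_integrable lborel {0..T} (\<lambda>s. d2 s \<omega>)"
    using sol1 sol2 unfolding mf_rbsde_solution_def d1_def d2_def by blast+
  have flat1: "AE \<omega> in P. (\<forall>t\<in>{0..T}. 0 \<le> H (Y1 t \<omega>) (law P (Y1 t))) \<and>
        (\<integral>\<^sup>+s\<in>{0..T}. ennreal (H (Y1 s \<omega>) (law P (Y1 s))) \<partial>stieltjes T (\<lambda>t. K1 t \<omega>)) = 0"
    and flat2: "AE \<omega> in P. (\<forall>t\<in>{0..T}. 0 \<le> H (Y2 t \<omega>) (law P (Y2 t))) \<and>
        (\<integral>\<^sup>+s\<in>{0..T}. ennreal (H (Y2 s \<omega>) (law P (Y2 s))) \<partial>stieltjes T (\<lambda>t. K2 t \<omega>)) = 0"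
    using sol1 sol2 unfolding mf_rbsde_solution_def by blast+
  define U where "U = (\<lambda>t \<omega>. on_event \<Omega>1 Y1 t \<omega> - on_event \<Omega>2 Y2 t \<omega>)"
  define N where "N = (\<lambda>t \<omega>. N1 t \<omega> - N2 t \<omega>)"
  define f where "f = (\<lambda>s \<omega>. d1 s \<omega> - d2 s \<omega>)"
  \<comment> \<open>A measurable lower bound for the difference \<open>d1 - d12\<close> of the drivers along the first solution,
    which itself need not be measurable.\<close>
  define \<delta> where "\<delta> = (\<lambda>s \<omega>. max 0 (\<bar>f s \<omega>\<bar> - L * (\<bar>U s \<omega>\<bar> + l2norm P (U s))))"
  have UY: "AE \<omega> in P. \<forall>t. U t \<omega> = Y1 t \<omega> - Y2 t \<omega>"
    using \<Omega>1(2) \<Omega>2(2) by eventually_elim (simp add: U_def)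
  have law_eq: "law P (on_event \<Omega>1 Y1 t) = law P (Y1 t)" "law P (on_event \<Omega>2 Y2 t) = law P (Y2 t)" if "t \<in> {0..T}" for t
  proof -
    have "AE \<omega> in P. on_event \<Omega>1 Y1 t \<omega> = Y1 t \<omega>" using \<Omega>1(2) by eventually_elim simp
    moreover have "AE \<omega> in P. on_event \<Omega>2 Y2 t \<omega> = Y2 t \<omega>" using \<Omega>2(2) by eventually_elim simp
    ultimately show "law P (on_event \<Omega>1 Y1 t) = law P (Y1 t)" "law P (on_event \<Omega>2 Y2 t) = law P (Y2 t)"
      using YL[OF that, THEN L2_measurable] r1.Y_measurable[OF that] r2.Y_measurable[OF that]
      by (intro distr_cong_AE refl; simp)+
  qed
  have Um: "U t \<in> borel_measurable P" if "t \<in> {0..T}" for t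
    unfolding U_def using r1.Y_measurable[OF that] r2.Y_measurable[OF that] by measurable
  have l2U: "l2norm P (\<lambda>\<omega>. Y1 s \<omega> - Y2 s \<omega>) = l2norm P (U s)" if "s \<in> {0..T}" for s
  proof -
    have [measurable]: "Y1 s \<in> borel_measurable P" "Y2 s \<in> borel_measurable P" "U s \<in> borel_measurable P"
      using YL[OF that] Um[OF that] by (auto simp: L2_measurable)
    have "(\<integral>\<omega>. (norm (Y1 s \<omega> - Y2 s \<omega>))\<^sup>2 \<partial>P) = (\<integral>\<omega>. (norm (U s \<omega>))\<^sup>2 \<partial>P)"
      using UY by (intro integral_cong_AE) (auto elim!: eventually_mono)
    then show ?thesis by (simp add: l2norm_def)
  qed
  have U_jm: "jointly_measurable U"
    unfolding U_def by (intro jointly_measurable_diff jointly_measurable_on_event jm \<Omega>1 \<Omega>2)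
  have f_jm: "jointly_measurable f" unfolding f_def by (intro jointly_measurable_diff jm)
  have \<delta>_jm: "jointly_measurable (\<lambda>s \<omega>. (\<delta> s \<omega>)\<^sup>2)"
  proof -
    define J where "J X = (\<lambda>(\<omega>, s). indicator {0..T} s *\<^sub>R X s \<omega>)" for X :: "real \<Rightarrow> 'w \<Rightarrow> real"
    have J: "J X \<in> borel_measurable (P \<Otimes>\<^sub>M lborel)" if "jointly_measurable X" for X
      using that unfolding J_def jointly_measurable_def .
    note [measurable] = J[OF f_jm] J[OF U_jm] J[OF jointly_measurable_l2norm[OF U_jm]]
    have "(\<lambda>p. (max 0 (\<bar>J f p\<bar> - L * (\<bar>J U p\<bar> + J (\<lambda>s \<omega>. l2norm P (U s)) p)))\<^sup>2) \<in> borel_measurable (P \<Otimes>\<^sub>M lborel)"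
      by measurable
    also have "(\<lambda>p. (max 0 (\<bar>J f p\<bar> - L * (\<bar>J U p\<bar> + J (\<lambda>s \<omega>. l2norm P (U s)) p)))\<^sup>2) = J (\<lambda>s \<omega>. (\<delta> s \<omega>)\<^sup>2)"
      by (auto simp: fun_eq_iff J_def \<delta>_def indicator_def)
    finally show ?thesis by (simp add: jointly_measurable_def J_def)
  qed
  have Zm: "time_moment P T 2 Z1 < \<infinity>" "time_moment P T 2 Z2 < \<infinity>" using Z by (auto simp: H2_def)
  have \<nu>: "AE s in lborel. s \<in> {0..T} \<longrightarrow> law P (\<lambda>\<omega>. (Y1 s \<omega>, Z1 s \<omega>)) \<in> P2 \<and> law P (\<lambda>\<omega>. (Y2 s \<omega>, Z2 s \<omega>)) \<in> P2"
    using AE_law_in_P2[OF Y(1) jm(2) Zm(1)] AE_law_in_P2[OF Y(2) jm(5) Zm(2)] by eventually_elim auto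
  have \<delta>_le: "AE \<omega> in P. (\<integral>\<^sup>+s\<in>{0..T}. ennreal ((\<delta> s \<omega>)\<^sup>2) \<partial>lborel)
      \<le> (\<integral>\<^sup>+s\<in>{0..T}. ennreal ((norm (d1 s \<omega> - d12 s \<omega>))\<^sup>2) \<partial>lborel)"
    using driver_lipschitz[OF sde Y jm(2,5)] UY
  proof eventually_elim
    case (elim \<omega>)
    show ?case
    proof (rule nn_integral_mono_AE)
      show "AE s in lborel. ennreal ((\<delta> s \<omega>)\<^sup>2) * indicator {0..T} s \<le> ennreal ((norm (d1 s \<omega> - d12 s \<omega>))\<^sup>2) * indicator {0..T} s"
        using \<nu>
      proof eventually_elim
        case (elim s)
        note e = \<open>\<forall>s\<in>{0..T}. _ s\<close>
        show ?case
        proof (cases "s \<in> {0..T}")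
          case True
          then have "\<bar>d12 s \<omega> - d2 s \<omega>\<bar> \<le> L * (\<bar>U s \<omega>\<bar> + l2norm P (U s))"
            using e elim \<open>\<forall>t. U t \<omega> = Y1 t \<omega> - Y2 t \<omega>\<close> l2U[OF True] unfolding d12_def d2_def by auto
          then have "\<bar>f s \<omega>\<bar> - L * (\<bar>U s \<omega>\<bar> + l2norm P (U s)) \<le> norm (d1 s \<omega> - d12 s \<omega>)"
            unfolding f_def real_norm_def by linarith
          then have "0 \<le> \<delta> s \<omega>" "\<delta> s \<omega> \<le> norm (d1 s \<omega> - d12 s \<omega>)" by (auto simp: \<delta>_def)
          then have "(\<delta> s \<omega>)\<^sup>2 \<le> (norm (d1 s \<omega> - d12 s \<omega>))\<^sup>2" by (intro power_mono)
          from ennreal_leI[OF this] show ?thesis using True by simp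
        qed simp
      qed
    qed
  qed
  have \<delta>fin: "(\<integral>\<^sup>+\<omega>. (\<integral>\<^sup>+s\<in>{0..T}. ennreal ((\<delta> s \<omega>)\<^sup>2) \<partial>lborel) \<partial>P) < \<infinity>"
  proof -
    have "(\<integral>\<^sup>+\<omega>. (\<integral>\<^sup>+s\<in>{0..T}. ennreal ((\<delta> s \<omega>)\<^sup>2) \<partial>lborel) \<partial>P) \<le> Q"
      unfolding Q_def
    proof (rule nn_integral_mono_AE)
      show "AE \<omega> in P. (\<integral>\<^sup>+s\<in>{0..T}. ennreal ((\<delta> s \<omega>)\<^sup>2) \<partial>lborel) \<le> ennreal ((norm (\<xi>1 \<omega> - \<xi>2 \<omega>))\<^sup>2) +
       (\<integral>\<^sup>+s\<in>{0..T}. ennreal ((norm (d1 s \<omega> - d12 s \<omega>))\<^sup>2) \<partial>lborel)"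
        using \<delta>_le by eventually_elim (rule add_increasing, auto)
    qed
    then show ?thesis using Qfin by (auto simp: less_top[symmetric] top_unique)
  qed
  note \<delta>T = time_integrable_nonneg[OF \<delta>_jm zero_le_power2 \<delta>fin]
  have ref1: "reflection P T Hy Hmu Y1 K1 a b \<omega> = r1.R a b \<omega>" if "\<omega> \<in> \<Omega>1" "0 \<le> a" "a \<le> b" "b \<le> T" for a b \<omega>
    by (rule reflection_on_event[OF r1 \<Omega>1 L2_measurable[OF YL(1)] that(2-4) that(1)])
  have ref2: "reflection P T Hy Hmu Y2 K2 a b \<omega> = r2.R a b \<omega>" if "\<omega> \<in> \<Omega>2" "0 \<le> a" "a \<le> b" "b \<le> T" for a b \<omega>
    by (rule reflection_on_event[OF r2 \<Omega>2 L2_measurable[OF YL(2)] that(2-4) that(1)])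
  \<comment> \<open>The equation of a solution, written backwards from \<open>T\<close>, between two times.\<close>
  have dyn: "y a - y b = (LINT s:{a..b}|lborel. d s) - (n b - n a) + (R' a T - R' b T)"
    if "\<forall>t\<in>{0..T}. y t = x + (LINT s:{t..T}|lborel. d s) - (n T - n t) + R' t T"
      "set_integrable lborel {0..T} d" "0 \<le> a" "a \<le> b" "b \<le> T" for y d n :: "real \<Rightarrow> real" and R' :: "real \<Rightarrow> real \<Rightarrow> real" and x a b
  proof -
    have "a \<in> {0..T}" "b \<in> {0..T}" using that by auto
    moreover have "(LINT s:{a..T}|lborel. d s) = (LINT s:{a..b}|lborel. d s) + (LINT s:{b..T}|lborel. d s)"
      by (rule set_integral_combine_Icc[OF set_integrable_subset[OF that(2)]]) (use that in auto)
    ultimately show ?thesis using that(1) by simp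
  qed
  have dynamics: "AE \<omega> in P. \<forall>a b. 0 \<le> a \<and> a \<le> b \<and> b \<le> T \<longrightarrow>
      U a \<omega> - U b \<omega> = (LINT s:{a..b}|lborel. f s \<omega>) - (N b \<omega> - N a \<omega>) + (r1.R a b \<omega> - r2.R a b \<omega>)"
    using eq1 eq2 dint UY \<Omega>1(2) \<Omega>2(2)
  proof eventually_elim
    case (elim \<omega>)
    show ?case
    proof (intro allI impI)
      fix a b assume "0 \<le> a \<and> a \<le> b \<and> b \<le> T"
      then have ab: "0 \<le> a" "a \<le> b" "b \<le> T" and b0: "0 \<le> b" and aT: "a \<le> T" by auto
      have w: "\<omega> \<in> space P" using elim(6) sets.sets_into_space[OF \<Omega>1(1)] by auto
      have "Y1 a \<omega> - Y1 b \<omega> = (LINT s:{a..b}|lborel. d1 s \<omega>) - (N1 b \<omega> - N1 a \<omega>)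
          + (reflection P T Hy Hmu Y1 K1 a T \<omega> - reflection P T Hy Hmu Y1 K1 b T \<omega>)"
        using dyn[of "\<lambda>t. Y1 t \<omega>" "\<xi>1 \<omega>" "\<lambda>s. d1 s \<omega>" "\<lambda>t. N1 t \<omega>" "\<lambda>s t. reflection P T Hy Hmu Y1 K1 s t \<omega>" a b,
            OF elim(1,3) ab] .
      also have "reflection P T Hy Hmu Y1 K1 a T \<omega> - reflection P T Hy Hmu Y1 K1 b T \<omega> = r1.R a b \<omega>"
        using r1.R_combine[OF ab order_refl w] by (simp add: ref1[OF elim(6)] ab b0 aT)
      finally have 1: "Y1 a \<omega> - Y1 b \<omega> = (LINT s:{a..b}|lborel. d1 s \<omega>) - (N1 b \<omega> - N1 a \<omega>) + r1.R a b \<omega>" .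
      have "Y2 a \<omega> - Y2 b \<omega> = (LINT s:{a..b}|lborel. d2 s \<omega>) - (N2 b \<omega> - N2 a \<omega>)
          + (reflection P T Hy Hmu Y2 K2 a T \<omega> - reflection P T Hy Hmu Y2 K2 b T \<omega>)"
        using dyn[of "\<lambda>t. Y2 t \<omega>" "\<xi>2 \<omega>" "\<lambda>s. d2 s \<omega>" "\<lambda>t. N2 t \<omega>" "\<lambda>s t. reflection P T Hy Hmu Y2 K2 s t \<omega>" a b,
            OF elim(2,4) ab] .
      also have "reflection P T Hy Hmu Y2 K2 a T \<omega> - reflection P T Hy Hmu Y2 K2 b T \<omega> = r2.R a b \<omega>"
        using r2.R_combine[OF ab order_refl w] by (simp add: ref2[OF elim(7)] ab b0 aT)
      finally have 2: "Y2 a \<omega> - Y2 b \<omega> = (LINT s:{a..b}|lborel. d2 s \<omega>) - (N2 b \<omega> - N2 a \<omega>) + r2.R a b \<omega>" .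
      have "(LINT s:{a..b}|lborel. f s \<omega>) = (LINT s:{a..b}|lborel. d1 s \<omega>) - (LINT s:{a..b}|lborel. d2 s \<omega>)"
        unfolding f_def
        by (rule set_integral_diff(2)[OF set_integrable_subset[OF elim(3)] set_integrable_subset[OF elim(4)]])
          (use ab in auto)
      then show "U a \<omega> - U b \<omega> = (LINT s:{a..b}|lborel. f s \<omega>) - (N b \<omega> - N a \<omega>) + (r1.R a b \<omega> - r2.R a b \<omega>)"
        using 1 2 elim(5) by (simp add: N_def)
    qed
  qed
  note mart1 = ito_integral_martingale[OF ito1] and mart2 = ito_integral_martingale[OF ito2]
  interpret reflected_pair W T B P F M H Hy Hmu "on_event \<Omega>1 Y1" S1 "on_event \<Omega>1 K1" "on_event \<Omega>2 Y2" S2 "on_event \<Omega>2 K2"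
    U N f \<delta> L
  proof
    show "L > 0" by (rule L)
    show "U = (\<lambda>t \<omega>. on_event \<Omega>1 Y1 t \<omega> - on_event \<Omega>2 Y2 t \<omega>)" by (rule U_def)
    show "U t \<in> borel_measurable (F t)" if "t \<in> {0..T}" for t
    proof -
      have "Y1 t \<in> borel_measurable (F t)" "Y2 t \<in> borel_measurable (F t)" using Y that by (auto simp: S2_def adapted_def)
      then show ?thesis unfolding U_def by (intro borel_measurable_diff on_event_measurable \<Omega>1 \<Omega>2)
    qed
    show "jointly_measurable U" by (rule U_jm)
    show "N t \<in> borel_measurable (F t)" if "t \<in> {0..T}" for t
      using ito1 ito2 that unfolding N_def by (intro borel_measurable_diff) (auto simp: ito_integral_def adapted_def)
    show "N t \<in> L2 P" if "t \<in> {0..T}" for t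
      unfolding N_def by (intro L2_diff mart1(1) mart2(1) that)
    show "expectation (\<lambda>\<omega>. V \<omega> * (N b \<omega> - N a \<omega>)) = 0"
      if "0 \<le> a" "a \<le> b" "b \<le> T" "V \<in> borel_measurable (F a)" "V \<in> L2 P" for a b V
    proof -
      have i: "integrable P (\<lambda>\<omega>. V \<omega> * (N1 b \<omega> - N1 a \<omega>))" "integrable P (\<lambda>\<omega>. V \<omega> * (N2 b \<omega> - N2 a \<omega>))"
        using that by (auto intro!: L2_mult_integrable L2_diff mart1(1) mart2(1))
      have "(\<lambda>\<omega>. V \<omega> * (N b \<omega> - N a \<omega>)) = (\<lambda>\<omega>. V \<omega> * (N1 b \<omega> - N1 a \<omega>) - V \<omega> * (N2 b \<omega> - N2 a \<omega>))"
        by (auto simp: N_def fun_eq_iff algebra_simps)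
      then show ?thesis
        using Bochner_Integration.integral_diff[OF i] mart1(3)[OF that] mart2(3)[OF that] by simp
    qed
    show "jointly_measurable f" by (rule f_jm)
    show "time_integrable (\<lambda>s \<omega>. (\<delta> s \<omega>)\<^sup>2)" by (rule \<delta>T)
    show "AE p in P \<Otimes>\<^sub>M lborel. snd p \<in> {0..T} \<longrightarrow>
      \<bar>f (snd p) (fst p)\<bar> \<le> \<delta> (snd p) (fst p) + L * (\<bar>U (snd p) (fst p)\<bar> + l2norm P (U (snd p)))"
      by (auto simp: \<delta>_def)
    show "AE \<omega> in P. (\<forall>t\<in>{0..T}. 0 \<le> H (on_event \<Omega>1 Y1 t \<omega>) (law P (on_event \<Omega>1 Y1 t))) \<and>
        (\<integral>\<^sup>+s\<in>{0..T}. ennreal (H (on_event \<Omega>1 Y1 s \<omega>) (law P (on_event \<Omega>1 Y1 s))) \<partial>stieltjes T (\<lambda>t. on_event \<Omega>1 K1 t \<omega>)) = 0"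
      using flat1 \<Omega>1(2)
    proof eventually_elim
      case (elim \<omega>)
      have "(\<integral>\<^sup>+s\<in>{0..T}. ennreal (H (on_event \<Omega>1 Y1 s \<omega>) (law P (on_event \<Omega>1 Y1 s))) \<partial>stieltjes T (\<lambda>t. on_event \<Omega>1 K1 t \<omega>))
        = (\<integral>\<^sup>+s\<in>{0..T}. ennreal (H (Y1 s \<omega>) (law P (Y1 s))) \<partial>stieltjes T (\<lambda>t. K1 t \<omega>))"
        using elim(2) by (simp only: on_event_in) (intro nn_integral_cong, auto simp: indicator_def law_eq)
      then show ?case using elim by (simp add: law_eq)
    qed
    show "AE \<omega> in P. (\<forall>t\<in>{0..T}. 0 \<le> H (on_event \<Omega>2 Y2 t \<omega>) (law P (on_event \<Omega>2 Y2 t))) \<and>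
        (\<integral>\<^sup>+s\<in>{0..T}. ennreal (H (on_event \<Omega>2 Y2 s \<omega>) (law P (on_event \<Omega>2 Y2 s))) \<partial>stieltjes T (\<lambda>t. on_event \<Omega>2 K2 t \<omega>)) = 0"
      using flat2 \<Omega>2(2)
    proof eventually_elim
      case (elim \<omega>)
      have "(\<integral>\<^sup>+s\<in>{0..T}. ennreal (H (on_event \<Omega>2 Y2 s \<omega>) (law P (on_event \<Omega>2 Y2 s))) \<partial>stieltjes T (\<lambda>t. on_event \<Omega>2 K2 t \<omega>))
        = (\<integral>\<^sup>+s\<in>{0..T}. ennreal (H (Y2 s \<omega>) (law P (Y2 s))) \<partial>stieltjes T (\<lambda>t. K2 t \<omega>))"
        using elim(2) by (simp only: on_event_in) (intro nn_integral_cong, auto simp: indicator_def law_eq)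
      then show ?case using elim by (simp add: law_eq)
    qed
  qed (rule dynamics)
  have T: "T \<in> {0..T}" "0 \<le> T" using T_pos by auto
  have terminal: "AE \<omega> in P. U T \<omega> = \<xi>1 \<omega> - \<xi>2 \<omega>"
    using eq1 eq2 UY \<Omega>1(2) \<Omega>2(2)
  proof eventually_elim
    case (elim \<omega>)
    have w: "\<omega> \<in> space P" using elim(4) sets.sets_into_space[OF \<Omega>1(1)] by auto
    have "r1.R T T \<omega> = 0" "r2.R T T \<omega> = 0"
      using r1.R_combine[of T T T \<omega>] r2.R_combine[of T T T \<omega>] w T by auto
    moreover have "(LINT s:{T..T}|lborel. d s) = 0" for d :: "real \<Rightarrow> real"
    proof -
      have "AE s in lborel. s \<notin> {T}" by (intro AE_not_in) auto
      then have "AE s in lborel. indicator {T..T} s *\<^sub>R d s = 0" by eventually_elim auto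
      then show ?thesis by (simp add: set_lebesgue_integral_def integral_eq_zero_AE)
    qed
    moreover have "Y1 T \<omega> = \<xi>1 \<omega> + (LINT s:{T..T}|lborel. d1 s \<omega>) - (N1 T \<omega> - N1 T \<omega>) + r1.R T T \<omega>"
      using elim(1) T ref1[OF elim(4) T(2) order_refl order_refl] by auto
    moreover have "Y2 T \<omega> = \<xi>2 \<omega> + (LINT s:{T..T}|lborel. d2 s \<omega>) - (N2 T \<omega> - N2 T \<omega>) + r2.R T T \<omega>"
      using elim(2) T ref2[OF elim(5) T(2) order_refl order_refl] by auto
    ultimately show ?case using elim(3) by simp
  qed
  have nnU: "(\<integral>\<^sup>+\<omega>. ennreal ((U t \<omega>)\<^sup>2) \<partial>P) = ennreal (\<phi> t)" if "t \<in> {0..T}" for t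
    using L2_nn_integral[OF U_L2[OF that]] by (simp add: \<phi>_eq)
  have I2q: "data_sq \<le> q"
  proof -
    have [measurable]: "U T \<in> borel_measurable P" by (rule Um[OF T(1)])
    note [measurable] = time_inner_measurable[OF \<delta>_jm zero_le_power2 \<delta>fin]
    have e0: "0 \<le> expectation (\<lambda>\<omega>. LINT s:{0..T}|lborel. (\<delta> s \<omega>)\<^sup>2)"
      unfolding set_lebesgue_integral_def by (intro Bochner_Integration.integral_nonneg) (auto simp: indicator_def)
    have "ennreal data_sq = ennreal (\<phi> T) + ennreal (expectation (\<lambda>\<omega>. LINT s:{0..T}|lborel. (\<delta> s \<omega>)\<^sup>2))"
      unfolding data_sq_def by (rule ennreal_plus[OF \<phi>_nonneg e0])
    also have "\<dots> = (\<integral>\<^sup>+\<omega>. ennreal ((U T \<omega>)\<^sup>2) + (\<integral>\<^sup>+s\<in>{0..T}. ennreal ((\<delta> s \<omega>)\<^sup>2) \<partial>lborel) \<partial>P)"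
      unfolding nnU[OF T(1), symmetric] time_integral_nonneg[OF \<delta>_jm zero_le_power2 \<delta>fin]
      by (rule nn_integral_add[symmetric]) measurable
    also have "\<dots> \<le> Q"
      unfolding Q_def
    proof (rule nn_integral_mono_AE)
      show "AE \<omega> in P. ennreal ((U T \<omega>)\<^sup>2) + (\<integral>\<^sup>+s\<in>{0..T}. ennreal ((\<delta> s \<omega>)\<^sup>2) \<partial>lborel)
        \<le> ennreal ((norm (\<xi>1 \<omega> - \<xi>2 \<omega>))\<^sup>2) + (\<integral>\<^sup>+s\<in>{0..T}. ennreal ((norm (d1 s \<omega> - d12 s \<omega>))\<^sup>2) \<partial>lborel)"
        using terminal \<delta>_le by eventually_elim (intro add_mono, auto)
    qed
    finally show ?thesis using q by simp
  qed
  have g0: "0 \<le> growth T L" by (simp add: growth_def)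
  have n0: "0 \<le> N_const T L" using g0 L T_pos by (simp add: N_const_def)
  have R0: "0 \<le> R_const T L" using g0 n0 L T_pos by (simp add: R_const_def)
  have supU: "(SUP t\<in>{0..T}. \<integral>\<^sup>+\<omega>. ennreal ((norm (Y1 t \<omega> - Y2 t \<omega>))\<^sup>2) \<partial>P) \<le> ennreal (growth T L * data_sq)"
  proof (rule SUP_least)
    fix t assume t: "t \<in> {0..T}"
    have "(\<integral>\<^sup>+\<omega>. ennreal ((norm (Y1 t \<omega> - Y2 t \<omega>))\<^sup>2) \<partial>P) = (\<integral>\<^sup>+\<omega>. ennreal ((U t \<omega>)\<^sup>2) \<partial>P)"
      using UY by (intro nn_integral_cong_AE) (auto elim!: eventually_mono)
    also have "\<dots> \<le> ennreal (growth T L * data_sq)"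
      unfolding nnU[OF t] by (rule ennreal_leI[OF \<phi>_bound[OF t]])
    finally show "(\<integral>\<^sup>+\<omega>. ennreal ((norm (Y1 t \<omega> - Y2 t \<omega>))\<^sup>2) \<partial>P) \<le> ennreal (growth T L * data_sq)" .
  qed
  have ZN: "time_moment P T 2 (\<lambda>s \<omega>. Z1 s \<omega> - Z2 s \<omega>) \<le> ennreal (4 * N_const T L * data_sq)"
  proof -
    have "time_moment P T 2 (\<lambda>s \<omega>. Z1 s \<omega> - Z2 s \<omega>) \<le> 4 * (\<integral>\<^sup>+\<omega>. ennreal ((N1 T \<omega> - N2 T \<omega>)\<^sup>2) \<partial>P)"
      by (rule ito_isometry_diff[OF ito1 ito2])
    also have "(\<integral>\<^sup>+\<omega>. ennreal ((N1 T \<omega> - N2 T \<omega>)\<^sup>2) \<partial>P) = (\<integral>\<^sup>+\<omega>. ennreal ((N T \<omega> - N 0 \<omega>)\<^sup>2) \<partial>P)"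
      using mart1(2) mart2(2) by (intro nn_integral_cong_AE, eventually_elim) (simp add: N_def)
    also have "\<dots> = ennreal (expectation (\<lambda>\<omega>. (N T \<omega> - N 0 \<omega>)\<^sup>2))"
      using L2_diff[OF N_L2[OF T(1)] N_L2[of 0]] T by (intro nn_integral_eq_integral) (auto simp: L2_real_iff)
    also have "4 * \<dots> \<le> 4 * ennreal (N_const T L * data_sq)"
      using N_bound by (intro mult_left_mono ennreal_leI) auto
    also have "\<dots> = ennreal (4 * N_const T L * data_sq)"
      using n0 data_sq_nonneg by (simp add: ennreal_mult mult.assoc)
    finally show ?thesis .
  qed
  have "(SUP t\<in>{0..T}. \<integral>\<^sup>+\<omega>. ennreal ((norm (Y1 t \<omega> - Y2 t \<omega>))\<^sup>2) \<partial>P)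
        + time_moment P T 2 (\<lambda>s \<omega>. Z1 s \<omega> - Z2 s \<omega>)
      \<le> ennreal (growth T L * data_sq) + ennreal (4 * N_const T L * data_sq)" by (rule add_mono[OF supU ZN])
  also have "\<dots> = ennreal ((growth T L + 4 * N_const T L) * data_sq)"
    using g0 n0 data_sq_nonneg by (simp add: ennreal_plus[symmetric] distrib_right del: ennreal_plus)
  also have "\<dots> \<le> ennreal (stability_const T L * q)"
    using g0 n0 R0 data_sq_nonneg I2q by (intro ennreal_leI mult_mono) (auto simp: stability_const_def)
  also have "\<dots> = ennreal (stability_const T L) * (I_delta P T f1 f2 \<xi>1 \<xi>2 Y1 Z1)\<^sup>2"
    using g0 n0 R0 q(1) unfolding Iq by (simp add: ennreal_power ennreal_mult stability_const_def)
  finally show "(SUP t\<in>{0..T}. \<integral>\<^sup>+\<omega>. ennreal ((norm (Y1 t \<omega> - Y2 t \<omega>))\<^sup>2) \<partial>P)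
        + time_moment P T 2 (\<lambda>s \<omega>. Z1 s \<omega> - Z2 s \<omega>)
      \<le> ennreal (stability_const T L) * (I_delta P T f1 f2 \<xi>1 \<xi>2 Y1 Z1)\<^sup>2" .
  show "(SUP t\<in>{0..T}. \<integral>\<^sup>+\<omega>. ennreal (norm
        (reflection P T Hy Hmu Y1 K1 0 t \<omega> - reflection P T Hy Hmu Y2 K2 0 t \<omega>)) \<partial>P)
      \<le> ennreal (stability_const T L) * I_delta P T f1 f2 \<xi>1 \<xi>2 Y1 Z1"
  proof (rule SUP_least)
    fix t assume t: "t \<in> {0..T}"
    then have t0: "0 \<le> t" "t \<le> T" by auto
    have i: "integrable P (\<lambda>\<omega>. \<bar>r1.R 0 t \<omega> - r2.R 0 t \<omega>\<bar>)"
      using t0 by (intro integrable_abs L2_integrable L2_diff r1.R_L2 r2.R_L2) auto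
    have "(\<integral>\<^sup>+\<omega>. ennreal (norm (reflection P T Hy Hmu Y1 K1 0 t \<omega> - reflection P T Hy Hmu Y2 K2 0 t \<omega>)) \<partial>P)
      = (\<integral>\<^sup>+\<omega>. ennreal \<bar>r1.R 0 t \<omega> - r2.R 0 t \<omega>\<bar> \<partial>P)"
      using \<Omega>1(2) \<Omega>2(2)
      by (intro nn_integral_cong_AE, eventually_elim) (simp add: ref1 ref2 t0)
    also have "\<dots> = ennreal (expectation (\<lambda>\<omega>. \<bar>r1.R 0 t \<omega> - r2.R 0 t \<omega>\<bar>))"
      by (rule nn_integral_eq_integral[OF i]) simp
    also have "\<dots> \<le> ennreal (R_const T L * sqrt data_sq)"
      by (rule ennreal_leI[OF R_difference[OF t]])
    also have "\<dots> \<le> ennreal (stability_const T L * sqrt q)"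
      using g0 n0 R0 data_sq_nonneg I2q by (intro ennreal_leI mult_mono) (auto simp: stability_const_def)
    also have "\<dots> = ennreal (stability_const T L) * I_delta P T f1 f2 \<xi>1 \<xi>2 Y1 Z1"
      using g0 n0 R0 q(1) unfolding Iq by (simp add: ennreal_mult stability_const_def)
    finally show "(\<integral>\<^sup>+\<omega>. ennreal (norm (reflection P T Hy Hmu Y1 K1 0 t \<omega> - reflection P T Hy Hmu Y2 K2 0 t \<omega>)) \<partial>P)
      \<le> ennreal (stability_const T L) * I_delta P T f1 f2 \<xi>1 \<xi>2 Y1 Z1" .
  qed
qed

end

theorem proposition3p1:
  fixes T L :: real
  assumes "T > 0"
  shows "\<exists>C>0. \<forall>(W :: (real \<Rightarrow> real ^ 'd::finite) measure) P Fil \<beta> M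
      H Hy Hmu
      (b1 :: real \<Rightarrow> (real \<Rightarrow> real ^ 'd) \<Rightarrow> real ^ 'l::finite \<Rightarrow> real ^ 'l) \<sigma>1 x1 X1 h1 g1
      (b2 :: real \<Rightarrow> (real \<Rightarrow> real ^ 'd) \<Rightarrow> real ^ 'l \<Rightarrow> real ^ 'l) \<sigma>2 x2 X2 h2 g2
      f1 \<xi>1 f2 \<xi>2 Y1 Z1 K1 Y2 Z2 K2.
    wiener_measure T W \<and>
    P = completion W \<and>
    Fil = brownian_filtration P coordinate \<and>
    assumption_A P T Fil L \<beta> M H Hy Hmu f1 \<xi>1 \<and>
    assumption_A P T Fil L \<beta> M H Hy Hmu f2 \<xi>2 \<and>
    assumption_SDE P T Fil coordinate L b1 \<sigma>1 x1 X1 h1 g1 f1 \<xi>1 \<and>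
    assumption_SDE P T Fil coordinate L b2 \<sigma>2 x2 X2 h2 g2 f2 \<xi>2 \<and>
    condition_U Hy Hmu \<and>
    Y1 \<in> S2 P T Fil \<and> Z1 \<in> H2 P T Fil \<and> K1 \<in> A2 P T Fil \<and>
    Y2 \<in> S2 P T Fil \<and> Z2 \<in> H2 P T Fil \<and> K2 \<in> A2 P T Fil \<and>
    mf_rbsde_solution P T Fil coordinate H Hy Hmu f1 \<xi>1 Y1 Z1 K1 \<and>
    mf_rbsde_solution P T Fil coordinate H Hy Hmu f2 \<xi>2 Y2 Z2 K2
    \<longrightarrow>
    (SUP t\<in>{0..T}. \<integral>\<^sup>+\<omega>. ennreal ((norm (Y1 t \<omega> - Y2 t \<omega>))\<^sup>2) \<partial>P)
        + time_moment P T 2 (\<lambda>s \<omega>. Z1 s \<omega> - Z2 s \<omega>)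
      \<le> ennreal C * (I_delta P T f1 f2 \<xi>1 \<xi>2 Y1 Z1)\<^sup>2 \<and>
    (SUP t\<in>{0..T}. \<integral>\<^sup>+\<omega>. ennreal (norm
        (reflection P T Hy Hmu Y1 K1 0 t \<omega> - reflection P T Hy Hmu Y2 K2 0 t \<omega>)) \<partial>P)
      \<le> ennreal C * I_delta P T f1 f2 \<xi>1 \<xi>2 Y1 Z1"
\<comment> \<open>The Markovian assumption includes \<open>L > 0\<close>, so that for \<open>L \<le> 0\<close> there are no solutions to compare.\<close>
proof (cases "L > 0")
  case False
  then show ?thesis by (intro exI[of _ 1]) (auto simp: assumption_SDE_def)
next
  case L: True
  have C: "stability_const T L > 0"
  proof -
    have "0 < growth T L" by (simp add: growth_def)
    then show ?thesis
      using L assms by (simp add: stability_const_def N_const_def R_const_def add_pos_nonneg)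
  qed
  show ?thesis
  proof (intro exI[of _ "stability_const T L"] conjI allI impI C; elim conjE)
    fix W :: "(real \<Rightarrow> real ^ 'd) measure" and P Fil \<beta> M H Hy Hmu
      and b1 :: "real \<Rightarrow> (real \<Rightarrow> real ^ 'd) \<Rightarrow> real ^ 'l \<Rightarrow> real ^ 'l" and \<sigma>1 x1 X1 h1 g1
      and b2 :: "real \<Rightarrow> (real \<Rightarrow> real ^ 'd) \<Rightarrow> real ^ 'l \<Rightarrow> real ^ 'l" and \<sigma>2 x2 X2 h2 g2
      f1 \<xi>1 f2 \<xi>2 Y1 Z1 K1 Y2 Z2 K2
    assume W: "wiener_measure T W" and P: "P = completion W" and Fil: "Fil = brownian_filtration P coordinate"
      and A: "assumption_A P T Fil L \<beta> M H Hy Hmu f1 \<xi>1"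
      and sde: "assumption_SDE P T Fil coordinate L b2 \<sigma>2 x2 X2 h2 g2 f2 \<xi>2"
      and Y: "Y1 \<in> S2 P T Fil" "Y2 \<in> S2 P T Fil" and Z: "Z1 \<in> H2 P T Fil" "Z2 \<in> H2 P T Fil"
      and K: "K1 \<in> A2 P T Fil" "K2 \<in> A2 P T Fil"
      and sol: "mf_rbsde_solution P T Fil coordinate H Hy Hmu f1 \<xi>1 Y1 Z1 K1"
        "mf_rbsde_solution P T Fil coordinate H Hy Hmu f2 \<xi>2 Y2 Z2 K2"
    interpret brownian W T coordinate P Fil
      using W P Fil assms by (auto simp: wiener_measure_def brownian_def)
    have con: "constraint P T M H Hy Hmu"
      using A by (intro constraint_of_assumption[OF prob_space_axioms assms]) (auto simp: assumption_A_def)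
    let ?I = "I_delta P T f1 f2 \<xi>1 \<xi>2 Y1 Z1"
    \<comment> \<open>For data at infinite distance both bounds are trivial.\<close>
    have top: "ennreal (stability_const T L) * \<infinity> = \<infinity>" using C by (simp add: ennreal_mult_top)
    show "(SUP t\<in>{0..T}. \<integral>\<^sup>+\<omega>. ennreal ((norm (Y1 t \<omega> - Y2 t \<omega>))\<^sup>2) \<partial>P)
        + time_moment P T 2 (\<lambda>s \<omega>. Z1 s \<omega> - Z2 s \<omega>) \<le> ennreal (stability_const T L) * ?I\<^sup>2"
    proof (cases "?I = \<infinity>")
      case True
      then show ?thesis using top by (simp add: power2_eq_square)
    qed (rule stability(1)[OF con sde Y Z K sol])
    show "(SUP t\<in>{0..T}. \<integral>\<^sup>+\<omega>. ennreal (norm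
        (reflection P T Hy Hmu Y1 K1 0 t \<omega> - reflection P T Hy Hmu Y2 K2 0 t \<omega>)) \<partial>P)
      \<le> ennreal (stability_const T L) * ?I"
    proof (cases "?I = \<infinity>")
      case True
      then show ?thesis using top by simp
    qed (rule stability(2)[OF con sde Y Z K sol])
  qed
qed

end
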